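(* Let $(M,\nabla)$ be a connected smooth manifold with an affine connection $\nabla$ on $TM$ whose curvature $R$ and torsion $T$ are both parallel, i.e. $\nabla R=0$ and $\nabla T=0$. For $p\in M$ let $\mathrm{Hol}_p\subseteq \mathrm{GL}(T_pM)$ be the holonomy group of $\nabla$ at $p$, with Lie algebra $\mathfrak{hol}_p\subseteq \mathrm{End}(T_pM)$, and let $\mathfrak{hol}\subseteq T^*M\otimes TM$ be the sub-vector bundle of endomorphisms of $TM$ whose fiber at $p$ is $\mathfrak{hol}_p$. Let $\mathfrak{X}_M=\Gamma(TM)$ be the space of smooth vector fields on $M$ and let $\mathfrak{Hol}_M=\Gamma(\mathfrak{hol})$ be the space of smooth sections of $\mathfrak{hol}$. On $\hat{\mathfrak{X}}_M:=\mathfrak{X}_M\oplus\mathfrak{Hol}_M$ define $\mathbb{R}$-bilinear operations $[\cdot,\cdot]$ (skew-symmetric) and $\rhd$ such that for all $x,y\in\mathfrak{X}_M$ and $E,E_1,E_2\in\mathfrak{Hol}_M$, \begin{align*} x\rhd y&=\nabla_x y, & [x,y]&=-T(x,y)+R(x,y),\\ x\rhd E&=\nabla_x E, & [E,x]&=-Ex,\\ E\rhd y&=Ey, & [E_1,E_2]&=-E_1E_2+E_2E_1,\\ E_1\rhd E_2&=E_1E_2-E_2E_1. && \end{align*} Then $(\hat{\mathfrak{X}}_M,[\cdot,\cdot],\rhd)$ is a post-Lie algebra.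
   Context: A post-Lie algebra is a triple $(\mathfrak{A},[\cdot,\cdot],\rhd)$, where $(\mathfrak{A},[\cdot,\cdot])$ is a (real) Lie algebra and $\rhd:\mathfrak{A}\otimes\mathfrak{A}\to\mathfrak{A}$ is a binary (bilinear) product such that, writing $a_\rhd(x,y,z)=x\rhd(y\rhd z)-(x\rhd y)\rhd z$, for all $x,y,z\in\mathfrak{A}$: $$x\rhd[y,z]=[x\rhd y,z]+[y,x\rhd z],\qquad [x,y]\rhd z=a_\rhd(x,y,z)-a_\rhd(y,x,z).$$ Conventions: $[x,y]_J$ denotes the usual Jacobi (Lie) bracket of vector fields, which is not the bracket $[\cdot,\cdot]$ of the claim. Torsion: $T(x,y)=\nabla_xy-\nabla_yx-[x,y]_J$. Curvature: $R(x,y)=\nabla_x\nabla_y-\nabla_y\nabla_x-\nabla_{[x,y]_J}$, so that $R(x,y)$ is a section of the endomorphism bundle of $TM$; in the formula for $[x,y]$, the term $-T(x,y)$ is the $\mathfrak{X}_M$-component and $R(x,y)$ is the $\mathfrak{Hol}_M$-component. The holonomy group $\mathrm{Hol}_p$ is the group of all parallel transport maps $T_pM\to T_pM$ along loops based at $p$. For an endomorphism field $E$, $(\nabla_xE)y=\nabla_x(Ey)-E\nabla_xy$; $Ex$ is the pointwise application of $E$ to $x$, and $E_1E_2$ is pointwise composition. *)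

theory Defs
  imports "HOL-Analysis.Analysis" "HOL-Library.Function_Algebras"
begin

section \<open>Post-Lie algebras\<close>

text \<open>Algebras live on a linear subspace \<open>V\<close> of a real vector space type; all axioms are
  relativised to \<open>V\<close>.\<close>

definition bilinear_on :: "'v::real_vector set \<Rightarrow> ('v \<Rightarrow> 'v \<Rightarrow> 'v) \<Rightarrow> bool" where
  "bilinear_on V f \<longleftrightarrow>
     (\<forall>x\<in>V. \<forall>y\<in>V. f x y \<in> V) \<and>
     (\<forall>x\<in>V. \<forall>y\<in>V. \<forall>z\<in>V. f (x + y) z = f x z + f y z \<and> f z (x + y) = f z x + f z y) \<and>
     (\<forall>x\<in>V. \<forall>y\<in>V. \<forall>a. f (a *\<^sub>R x) y = a *\<^sub>R f x y \<and> f x (a *\<^sub>R y) = a *\<^sub>R f x y)"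

locale lie_algebra =
  fixes V :: "'v::real_vector set" and br :: "'v \<Rightarrow> 'v \<Rightarrow> 'v"
  assumes subspace: "subspace V"
    and br_bilinear: "bilinear_on V br"
    and br_alternating: "\<And>x. x \<in> V \<Longrightarrow> br x x = 0"
    and jacobi: "\<And>x y z. x \<in> V \<Longrightarrow> y \<in> V \<Longrightarrow> z \<in> V \<Longrightarrow>
      br x (br y z) + br y (br z x) + br z (br x y) = 0"

definition associator :: "('v::real_vector \<Rightarrow> 'v \<Rightarrow> 'v) \<Rightarrow> 'v \<Rightarrow> 'v \<Rightarrow> 'v \<Rightarrow> 'v" where
  "associator tr x y z = tr x (tr y z) - tr (tr x y) z"

locale post_lie_algebra = lie_algebra V br
  for V :: "'v::real_vector set" and br :: "'v \<Rightarrow> 'v \<Rightarrow> 'v" +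
  fixes tr :: "'v \<Rightarrow> 'v \<Rightarrow> 'v"
  assumes tr_bilinear: "bilinear_on V tr"
    and tr_derivation: "\<And>x y z. x \<in> V \<Longrightarrow> y \<in> V \<Longrightarrow> z \<in> V \<Longrightarrow>
      tr x (br y z) = br (tr x y) z + br y (tr x z)"
    and br_tr: "\<And>x y z. x \<in> V \<Longrightarrow> y \<in> V \<Longrightarrow> z \<in> V \<Longrightarrow>
      tr (br x y) z = associator tr x y z - associator tr y x z"

text \<open>Functions form a vector space pointwise; \<open>Function_Algebras\<close> only provides the group
  structure.\<close>

instantiation "fun" :: (type, real_vector) real_vector
begin

definition scaleR_fun :: "real \<Rightarrow> ('a \<Rightarrow> 'b) \<Rightarrow> 'a \<Rightarrow> 'b" where
  "scaleR_fun a f = (\<lambda>x. a *\<^sub>R f x)"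

instance
  by standard (auto simp: scaleR_fun_def fun_eq_iff scaleR_add_right scaleR_add_left)

end


section \<open>Smooth functions on open subsets of a Euclidean space\<close>

primrec Ck_on :: "nat \<Rightarrow> 'a::euclidean_space set \<Rightarrow> ('a \<Rightarrow> 'b::real_normed_vector) \<Rightarrow> bool" where
  "Ck_on 0 S f \<longleftrightarrow> continuous_on S f"
| "Ck_on (Suc k) S f \<longleftrightarrow> (\<forall>x\<in>S. f differentiable (at x)) \<and>
     (\<forall>v. Ck_on k S (\<lambda>x. frechet_derivative f (at x) v))"

definition smooth_on :: "'a::euclidean_space set \<Rightarrow> ('a \<Rightarrow> 'b::real_normed_vector) \<Rightarrow> bool" where
  "smooth_on S f \<longleftrightarrow> (\<forall>k. Ck_on k S f)"


section \<open>Smooth manifolds\<close>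

text \<open>The underlying space is a type \<open>'m\<close>; a chart is a pair of its (open) domain and the
  coordinate map into the model space \<open>'e\<close>, the latter being relevant on the domain only.\<close>

type_synonym ('m, 'e) chart = "'m set \<times> ('m \<Rightarrow> 'e)"

abbreviation chart_dom :: "('m, 'e) chart \<Rightarrow> 'm set" where
  "chart_dom c \<equiv> fst c"

abbreviation chart_map :: "('m, 'e) chart \<Rightarrow> 'm \<Rightarrow> 'e" where
  "chart_map c \<equiv> snd c"

abbreviation chart_image :: "('m, 'e) chart \<Rightarrow> 'e set" where
  "chart_image c \<equiv> chart_map c ` chart_dom c"

abbreviation chart_inv :: "('m, 'e) chart \<Rightarrow> 'e \<Rightarrow> 'm" where
  "chart_inv c \<equiv> inv_into (chart_dom c) (chart_map c)"

locale smooth_manifold =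
  fixes A :: "('m::{t2_space, second_countable_topology}, 'e::euclidean_space) chart set"
  assumes open_dom: "c \<in> A \<Longrightarrow> open (chart_dom c)"
    and open_image: "c \<in> A \<Longrightarrow> open (chart_image c)"
    and homeo: "c \<in> A \<Longrightarrow> homeomorphism (chart_dom c) (chart_image c) (chart_map c) (chart_inv c)"
    and cover: "(\<Union>c\<in>A. chart_dom c) = UNIV"
    and compatible: "c \<in> A \<Longrightarrow> d \<in> A \<Longrightarrow>
      smooth_on (chart_map c ` (chart_dom c \<inter> chart_dom d)) (chart_map d \<circ> chart_inv c)"

text \<open>Every point \<open>p\<close> gets a preferred chart, and the tangent space at \<open>p\<close> is represented by \<open>'e\<close>
  through that chart. A vector field thus has type \<open>'m \<Rightarrow> 'e\<close> and a field of endomorphisms of the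
  tangent bundle has type \<open>'m \<Rightarrow> 'e \<Rightarrow>\<^sub>L 'e\<close>. Since the preferred chart jumps from point to point,
  smoothness is always tested after conversion to one fixed chart.\<close>

definition chart_at :: "('m, 'e) chart set \<Rightarrow> 'm \<Rightarrow> ('m, 'e) chart" where
  "chart_at A p = (SOME c. c \<in> A \<and> p \<in> chart_dom c)"

definition coord_change :: "('m, 'e::euclidean_space) chart \<Rightarrow> ('m, 'e) chart \<Rightarrow> 'm \<Rightarrow> 'e \<Rightarrow> 'e" where
  "coord_change c d p = frechet_derivative (chart_map d \<circ> chart_inv c) (at (chart_map c p))"

definition to_chart :: "('m, 'e::euclidean_space) chart set \<Rightarrow> ('m, 'e) chart \<Rightarrow> 'm \<Rightarrow> 'e \<Rightarrow> 'e" where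
  "to_chart A c p = coord_change (chart_at A p) c p"

definition from_chart :: "('m, 'e::euclidean_space) chart set \<Rightarrow> ('m, 'e) chart \<Rightarrow> 'm \<Rightarrow> 'e \<Rightarrow> 'e" where
  "from_chart A c p = coord_change c (chart_at A p) p"

definition smooth_funs :: "('m, 'e::euclidean_space) chart set \<Rightarrow> ('m \<Rightarrow> real) set" where
  "smooth_funs A = {f. \<forall>c\<in>A. smooth_on (chart_image c) (f \<circ> chart_inv c)}"

definition vf_rep :: "('m, 'e::euclidean_space) chart set \<Rightarrow> ('m, 'e) chart \<Rightarrow> ('m \<Rightarrow> 'e) \<Rightarrow> 'e \<Rightarrow> 'e" where
  "vf_rep A c X = (\<lambda>u. let p = chart_inv c u in to_chart A c p (X p))"

definition vector_fields :: "('m, 'e::euclidean_space) chart set \<Rightarrow> ('m \<Rightarrow> 'e) set" where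
  "vector_fields A = {X. \<forall>c\<in>A. smooth_on (chart_image c) (vf_rep A c X)}"

definition endo_fields :: "('m, 'e::euclidean_space) chart set \<Rightarrow> ('m \<Rightarrow> 'e \<Rightarrow>\<^sub>L 'e) set" where
  "endo_fields A = {E. \<forall>c\<in>A. \<forall>v. smooth_on (chart_image c)
     (\<lambda>u. let p = chart_inv c u in to_chart A c p (blinfun_apply (E p) (from_chart A c p v)))}"

definition dir_deriv :: "('m, 'e::euclidean_space) chart set \<Rightarrow> ('m \<Rightarrow> 'e) \<Rightarrow> ('m \<Rightarrow> real) \<Rightarrow> 'm \<Rightarrow> real" where
  "dir_deriv A X f p = (let c = chart_at A p in
     frechet_derivative (f \<circ> chart_inv c) (at (chart_map c p)) (X p))"

text \<open>Jacobi bracket, in coordinates \<open>[X,Y]\<^sup>j = X\<^sup>i \<partial>\<^sub>i Y\<^sup>j - Y\<^sup>i \<partial>\<^sub>i X\<^sup>j\<close>.\<close>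

definition jacobi_bracket ::
    "('m, 'e::euclidean_space) chart set \<Rightarrow> ('m \<Rightarrow> 'e) \<Rightarrow> ('m \<Rightarrow> 'e) \<Rightarrow> 'm \<Rightarrow> 'e" where
  "jacobi_bracket A X Y p = (let c = chart_at A p; u = chart_map c p in
     frechet_derivative (vf_rep A c Y) (at u) (X p) - frechet_derivative (vf_rep A c X) (at u) (Y p))"


section \<open>Affine connections, torsion and curvature\<close>

locale affine_connection = smooth_manifold A
  for A :: "('m::{t2_space, second_countable_topology}, 'e::euclidean_space) chart set" +
  fixes D :: "('m \<Rightarrow> 'e) \<Rightarrow> ('m \<Rightarrow> 'e) \<Rightarrow> 'm \<Rightarrow> 'e"
  assumes D_closed: "X \<in> vector_fields A \<Longrightarrow> Y \<in> vector_fields A \<Longrightarrow> D X Y \<in> vector_fields A"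
    and D_add_left: "X \<in> vector_fields A \<Longrightarrow> X' \<in> vector_fields A \<Longrightarrow> Y \<in> vector_fields A \<Longrightarrow>
      D (X + X') Y = D X Y + D X' Y"
    and D_add_right: "X \<in> vector_fields A \<Longrightarrow> Y \<in> vector_fields A \<Longrightarrow> Y' \<in> vector_fields A \<Longrightarrow>
      D X (Y + Y') = D X Y + D X Y'"
    and D_mult_left: "f \<in> smooth_funs A \<Longrightarrow> X \<in> vector_fields A \<Longrightarrow> Y \<in> vector_fields A \<Longrightarrow>
      D (\<lambda>p. f p *\<^sub>R X p) Y = (\<lambda>p. f p *\<^sub>R D X Y p)"
    and D_leibniz: "f \<in> smooth_funs A \<Longrightarrow> X \<in> vector_fields A \<Longrightarrow> Y \<in> vector_fields A \<Longrightarrow>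
      D X (\<lambda>p. f p *\<^sub>R Y p) = (\<lambda>p. dir_deriv A X f p *\<^sub>R Y p + f p *\<^sub>R D X Y p)"

text \<open>The field of endomorphisms induced by a \<open>C\<^sup>\<infinity>\<close>-linear operator on vector fields.\<close>

definition induced_endo ::
    "('m, 'e::euclidean_space) chart set \<Rightarrow> (('m \<Rightarrow> 'e) \<Rightarrow> 'm \<Rightarrow> 'e) \<Rightarrow> 'm \<Rightarrow> 'e \<Rightarrow>\<^sub>L 'e" where
  "induced_endo A Q p = (THE F. \<forall>Y\<in>vector_fields A. blinfun_apply F (Y p) = Q Y p)"

definition endo_app :: "('m \<Rightarrow> 'e::euclidean_space \<Rightarrow>\<^sub>L 'e) \<Rightarrow> ('m \<Rightarrow> 'e) \<Rightarrow> 'm \<Rightarrow> 'e" where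
  "endo_app E X = (\<lambda>p. blinfun_apply (E p) (X p))"

definition endo_comp ::
    "('m \<Rightarrow> 'e::euclidean_space \<Rightarrow>\<^sub>L 'e) \<Rightarrow> ('m \<Rightarrow> 'e \<Rightarrow>\<^sub>L 'e) \<Rightarrow> 'm \<Rightarrow> 'e \<Rightarrow>\<^sub>L 'e" where
  "endo_comp E F = (\<lambda>p. E p o\<^sub>L F p)"

definition torsion where
  "torsion A D X Y = D X Y - D Y X - jacobi_bracket A X Y"

definition curvature_op where
  "curvature_op A D X Y Z = D X (D Y Z) - D Y (D X Z) - D (jacobi_bracket A X Y) Z"

definition curvature where
  "curvature A D X Y = induced_endo A (curvature_op A D X Y)"

definition cov_deriv_endo where
  "cov_deriv_endo A D X E = induced_endo A (\<lambda>Y. D X (endo_app E Y) - endo_app E (D X Y))"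

definition torsion_parallel where
  "torsion_parallel A D \<longleftrightarrow> (\<forall>W\<in>vector_fields A. \<forall>X\<in>vector_fields A. \<forall>Y\<in>vector_fields A.
     D W (torsion A D X Y) - torsion A D (D W X) Y - torsion A D X (D W Y) = 0)"

definition curvature_parallel where
  "curvature_parallel A D \<longleftrightarrow>
     (\<forall>W\<in>vector_fields A. \<forall>X\<in>vector_fields A. \<forall>Y\<in>vector_fields A.
        cov_deriv_endo A D W (curvature A D X Y)
          - curvature A D (D W X) Y - curvature A D X (D W Y) = 0)"


section \<open>Parallel transport and holonomy\<close>

definition smooth_curve ::
    "('m::topological_space, 'e::euclidean_space) chart set \<Rightarrow> real set \<Rightarrow> (real \<Rightarrow> 'm) \<Rightarrow> bool" where
  "smooth_curve A S \<gamma> \<longleftrightarrow> continuous_on S \<gamma> \<and>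
     (\<forall>c\<in>A. smooth_on {t\<in>S. \<gamma> t \<in> chart_dom c} (chart_map c \<circ> \<gamma>))"

definition velocity :: "('m, 'e::euclidean_space) chart set \<Rightarrow> (real \<Rightarrow> 'm) \<Rightarrow> real \<Rightarrow> 'e" where
  "velocity A \<gamma> t = vector_derivative (chart_map (chart_at A (\<gamma> t)) \<circ> \<gamma>) (at t)"

text \<open>\<open>W\<close> is the covariant derivative at time \<open>t\<close> of the vector field \<open>V\<close> along the curve \<open>\<gamma>\<close>: one
  writes \<open>V = \<Sum>\<^sub>i f\<^sub>i \<cdot> (Y\<^sub>i \<circ> \<gamma>)\<close> near \<open>t\<close> and applies the Leibniz rule; \<open>X\<close> is any vector field
  extending the velocity of \<open>\<gamma>\<close> at \<open>t\<close>.\<close>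

definition has_cov_deriv_along ::
    "('m, 'e::euclidean_space) chart set \<Rightarrow> (('m \<Rightarrow> 'e) \<Rightarrow> ('m \<Rightarrow> 'e) \<Rightarrow> 'm \<Rightarrow> 'e) \<Rightarrow>
     (real \<Rightarrow> 'm) \<Rightarrow> (real \<Rightarrow> 'e) \<Rightarrow> 'e \<Rightarrow> real \<Rightarrow> bool" where
  "has_cov_deriv_along A D \<gamma> V W t \<longleftrightarrow>
     (\<exists>(n::nat) f f' Y X. X \<in> vector_fields A \<and> X (\<gamma> t) = velocity A \<gamma> t \<and>
        (\<forall>i<n. Y i \<in> vector_fields A \<and> (f i has_real_derivative f' i) (at t)) \<and>
        (\<forall>\<^sub>F s in nhds t. V s = (\<Sum>i<n. f i s *\<^sub>R Y i (\<gamma> s))) \<and>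
        W = (\<Sum>i<n. f' i *\<^sub>R Y i (\<gamma> t) + f i t *\<^sub>R D X (Y i) (\<gamma> t)))"

definition parallel_along where
  "parallel_along A D S \<gamma> V \<longleftrightarrow> (\<forall>t\<in>S. has_cov_deriv_along A D \<gamma> V 0 t)"

text \<open>\<open>L\<close> is the parallel transport from time 0 to time 1 along a curve \<open>\<gamma>\<close> that is smooth on the
  open set \<open>S \<supseteq> {0..1}\<close>.\<close>

definition is_transport_along ::
    "('m, 'e::euclidean_space) chart set \<Rightarrow> (('m \<Rightarrow> 'e) \<Rightarrow> ('m \<Rightarrow> 'e) \<Rightarrow> 'm \<Rightarrow> 'e) \<Rightarrow>
     real set \<Rightarrow> (real \<Rightarrow> 'm) \<Rightarrow> ('e \<Rightarrow>\<^sub>L 'e) \<Rightarrow> bool" where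
  "is_transport_along A D S \<gamma> L \<longleftrightarrow>
     (\<forall>v. \<exists>V. parallel_along A D S \<gamma> V \<and> V 0 = v \<and> V 1 = blinfun_apply L v)"

text \<open>Parallel transport along piecewise smooth curves: these are the finite concatenations of
  smooth curves, and the transport along a concatenation is the composition of the transports.\<close>

inductive parallel_transport ::
    "('m::topological_space, 'e::euclidean_space) chart set \<Rightarrow>
     (('m \<Rightarrow> 'e) \<Rightarrow> ('m \<Rightarrow> 'e) \<Rightarrow> 'm \<Rightarrow> 'e) \<Rightarrow> 'm \<Rightarrow> 'm \<Rightarrow> ('e \<Rightarrow>\<^sub>L 'e) \<Rightarrow> bool"
  for A D p where
  const: "parallel_transport A D p p id_blinfun"
| concat: "parallel_transport A D p q L \<Longrightarrow> open S \<Longrightarrow> {0..1} \<subseteq> S \<Longrightarrow> smooth_curve A S \<gamma> \<Longrightarrow>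
    \<gamma> 0 = q \<Longrightarrow> \<gamma> 1 = r \<Longrightarrow> is_transport_along A D S \<gamma> K \<Longrightarrow>
    parallel_transport A D p r (K o\<^sub>L L)"

definition holonomy_group where
  "holonomy_group A D p = {L. parallel_transport A D p p L}"

text \<open>The Lie algebra of the (not necessarily closed) Lie subgroup \<open>holonomy_group A D p\<close>: the
  velocities at the identity of the smooth curves in \<open>GL(T\<^sub>pM)\<close> that stay in the group.\<close>

definition holonomy_algebra ::
    "('m::topological_space, 'e::euclidean_space) chart set \<Rightarrow>
     (('m \<Rightarrow> 'e) \<Rightarrow> ('m \<Rightarrow> 'e) \<Rightarrow> 'm \<Rightarrow> 'e) \<Rightarrow> 'm \<Rightarrow> ('e \<Rightarrow>\<^sub>L 'e) set" where
  "holonomy_algebra A D p = {B. \<exists>g :: real \<Rightarrow> 'e \<Rightarrow>\<^sub>L 'e. smooth_on UNIV g \<and> g 0 = id_blinfun \<and>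
     (\<forall>t. g t \<in> holonomy_group A D p) \<and> (g has_vector_derivative B) (at 0)}"

definition holonomy_fields where
  "holonomy_fields A D = {E \<in> endo_fields A. \<forall>p. E p \<in> holonomy_algebra A D p}"


section \<open>The extended algebra of vector fields\<close>

definition ext_fields where
  "ext_fields A D = vector_fields A \<times> holonomy_fields A D"

definition ext_bracket ::
    "('m, 'e::euclidean_space) chart set \<Rightarrow> (('m \<Rightarrow> 'e) \<Rightarrow> ('m \<Rightarrow> 'e) \<Rightarrow> 'm \<Rightarrow> 'e) \<Rightarrow>
     ('m \<Rightarrow> 'e) \<times> ('m \<Rightarrow> 'e \<Rightarrow>\<^sub>L 'e) \<Rightarrow> ('m \<Rightarrow> 'e) \<times> ('m \<Rightarrow> 'e \<Rightarrow>\<^sub>L 'e) \<Rightarrow>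
     ('m \<Rightarrow> 'e) \<times> ('m \<Rightarrow> 'e \<Rightarrow>\<^sub>L 'e)" where
  "ext_bracket A D = (\<lambda>(x, E) (y, F).
     (- torsion A D x y - endo_app E y + endo_app F x,
      curvature A D x y - endo_comp E F + endo_comp F E))"

definition ext_prod ::
    "('m, 'e::euclidean_space) chart set \<Rightarrow> (('m \<Rightarrow> 'e) \<Rightarrow> ('m \<Rightarrow> 'e) \<Rightarrow> 'm \<Rightarrow> 'e) \<Rightarrow>
     ('m \<Rightarrow> 'e) \<times> ('m \<Rightarrow> 'e \<Rightarrow>\<^sub>L 'e) \<Rightarrow> ('m \<Rightarrow> 'e) \<times> ('m \<Rightarrow> 'e \<Rightarrow>\<^sub>L 'e) \<Rightarrow>
     ('m \<Rightarrow> 'e) \<times> ('m \<Rightarrow> 'e \<Rightarrow>\<^sub>L 'e)" where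
  "ext_prod A D = (\<lambda>(x, E) (y, F).
     (D x y + endo_app E y,
      cov_deriv_endo A D x F + endo_comp E F - endo_comp F E))"

end

theory Submission
  imports Defs "HOL-Computational_Algebra.Polynomial"
begin

text \<open>Written out on pairs \<open>(x, E)\<close> and expanded by multilinearity, the axioms
  of a post-Lie algebra turn into identities between vector fields and between fields of
  endomorphisms, and each of them has one geometric reason. The Jacobi identity for three vector
  fields is the pair of Bianchi identities, which for \<open>\<nabla>T = 0\<close> and
  \<open>\<nabla>R = 0\<close> read \<open>\<Sum> R(x,y)z = \<Sum> T(T(x,y),z)\<close> and
  \<open>\<Sum> R(T(x,y),z) = 0\<close> with cyclic sums (\<open>first_bianchi\<close>,
  \<open>second_bianchi\<close>). For an endomorphism field \<open>E\<close> and two vector fields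
  it says that \<open>E\<close> acts as a derivation of \<open>T\<close> and \<open>R\<close>,
  which also makes \<open>E \<rhd> _\<close> a derivation of the bracket; that
  \<open>x \<rhd> _\<close> is one expresses \<open>\<nabla>T = 0\<close> and \<open>\<nabla>R = 0\<close>. The
  second axiom of a post-Lie algebra comes down to the definitions of torsion and curvature.

  So everything depends on the holonomy algebra \<open>hol\<^sub>p\<close>, about which four facts
  are established: it is closed under commutators (\<open>holonomy_algebra_commutator\<close>), it
  contains the values of the curvature (\<open>curvature_in_holonomy_algebra\<close>), the bundle
  of these algebras is stable under covariant derivatives
  (\<open>cov_deriv_in_holonomy_algebra\<close>), and its elements act as derivations of
  \<open>T\<^sub>p\<close> and \<open>R\<^sub>p\<close> (\<open>holonomy_algebra_torsion\<close>,
  \<open>holonomy_algebra_curvature\<close>). As \<open>hol\<^sub>p\<close> consists of the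
  velocities at the identity of smooth curves in the holonomy group, all four are obtained by
  differentiating curves, together with two principles. Being a linear subspace of a
  finite-dimensional space, \<open>hol\<^sub>p\<close> contains the derivative of every curve
  inside it; and conjugation with a parallel transport from \<open>p\<close> to \<open>q\<close>
  maps \<open>hol\<^sub>q\<close> to \<open>hol\<^sub>p\<close>. Conjugating an element of
  \<open>hol\<^sub>p\<close> with a curve in the group and differentiating gives commutators;
  conjugating \<open>E\<close> with the transport along a curve of velocity \<open>x\<close> gives
  \<open>\<nabla>\<^sub>x E\<close>. The holonomy of a coordinate parallelogram with sides
  \<open>s\<close> and \<open>t\<close> is, for fixed \<open>s\<close>, a curve in
  \<open>t\<close> through the identity, so its derivative at \<open>t = 0\<close> lies in
  \<open>hol\<^sub>p\<close> for each \<open>s\<close>, and hence so does the derivative of that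
  in \<open>s\<close>, which is the curvature up to sign. Finally, parallel tensors are invariant
  under transport, in particular under the holonomy group, and the derivative of this invariance
  at the identity is the derivation property.

  Two pieces of analysis support these arguments. The parallelogram requires that parallel transport
  depends smoothly on a parameter; for linear differential equations this follows from the formula
  of variation of constants (\<open>solution_param_difference\<close>,
  \<open>solution_param_Ck\<close>). And a connection is given as an operator on global vector
  fields, whereas parallel transport, \<open>T\<^sub>p\<close> and \<open>R\<^sub>p\<close> are
  pointwise notions: smooth cut-off functions show that operators linear over the smooth functions
  are given by tensors (\<open>tensorial_expansion\<close>) and that the connection has
  Christoffel symbols in every chart (\<open>vf_rep_D\<close>).\<close>

section \<open>Calculus of \<open>C\<^sup>k\<close> functions on open sets\<close>

lemma Ck_on_cong:
  assumes "open S" "\<And>x. x \<in> S \<Longrightarrow> f x = g x"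
  shows "Ck_on k S f \<longleftrightarrow> Ck_on k S g"
proof -
  have "Ck_on k S f \<Longrightarrow> Ck_on k S g" if "\<And>x. x \<in> S \<Longrightarrow> f x = g x" for f g :: "'a \<Rightarrow> 'b"
    using that
  proof (induction k arbitrary: f g)
    case 0
    then show ?case by (metis Ck_on.simps(1) continuous_on_cong)
  next
    case (Suc k)
    have d: "(g has_derivative frechet_derivative f (at x)) (at x)" if "x \<in> S" for x
      using Suc.prems that \<open>open S\<close> has_derivative_transform_within_open
      by (metis Ck_on.simps(2) frechet_derivative_works)
    have "Ck_on k S (\<lambda>x. frechet_derivative g (at x) v)" for v
    proof (rule Suc.IH)
      show "Ck_on k S (\<lambda>x. frechet_derivative f (at x) v)" using Suc.prems(1) by simp
      show "frechet_derivative f (at x) v = frechet_derivative g (at x) v" if "x \<in> S" for x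
        using frechet_derivative_at[OF d[OF that]] by simp
    qed
    then show ?case using d by (auto simp: differentiable_def)
  qed
  with assms(2) show ?thesis by metis
qed

text \<open>On an open set the derivative at a point is unique, so any pointwise derivative may
  stand for the one selected by \<open>frechet_derivative\<close>.\<close>

lemma Ck_on_SucI:
  assumes "open S" "\<And>x. x \<in> S \<Longrightarrow> (f has_derivative f' x) (at x)"
    and "\<And>v. Ck_on k S (\<lambda>x. f' x v)"
  shows "Ck_on (Suc k) S f"
proof -
  have "Ck_on k S (\<lambda>x. frechet_derivative f (at x) v)" for v
    using Ck_on_cong[OF assms(1), of "\<lambda>x. frechet_derivative f (at x) v" "\<lambda>x. f' x v"]
      assms(2,3) frechet_derivative_at by (metis)
  then show ?thesis using assms(2) by (auto simp: differentiable_def)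
qed

lemma Ck_on_SucD:
  assumes "Ck_on (Suc k) S f"
  shows "x \<in> S \<Longrightarrow> (f has_derivative frechet_derivative f (at x)) (at x)"
    and "Ck_on k S (\<lambda>x. frechet_derivative f (at x) v)"
  using assms frechet_derivative_works by auto

lemma Ck_on_Suc_imp: "Ck_on (Suc k) S f \<Longrightarrow> Ck_on k S f"
proof (induction k arbitrary: f)
  case 0
  then show ?case
    by (auto intro!: continuous_at_imp_continuous_on differentiable_imp_continuous_within)
next
  case (Suc k)
  then show ?case by (metis Ck_on.simps(2))
qed

lemma Ck_on_subset: "Ck_on k S f \<Longrightarrow> U \<subseteq> S \<Longrightarrow> Ck_on k U f"
  by (induction k arbitrary: f) (auto intro: continuous_on_subset)

lemma Ck_on_local:
  assumes "open S" "\<And>x. x \<in> S \<Longrightarrow> \<exists>U. open U \<and> x \<in> U \<and> Ck_on k U f"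
  shows "Ck_on k S f"
  using assms(2)
proof (induction k arbitrary: f)
  case 0
  have "continuous (at x) f" if "x \<in> S" for x
    using 0[OF that] by (metis Ck_on.simps(1) continuous_on_eq_continuous_at)
  then show ?case by (simp add: continuous_at_imp_continuous_on)
next
  case (Suc k)
  have "f differentiable (at x)" if "x \<in> S" for x
    using Suc.prems[OF that] by auto
  moreover have "Ck_on k S (\<lambda>x. frechet_derivative f (at x) v)" for v
    using Suc.prems by (intro Suc.IH) (metis Ck_on_SucD(2))
  ultimately show ?case by simp
qed

lemma Ck_on_const: "open S \<Longrightarrow> Ck_on k S (\<lambda>x. c)"
proof (induction k arbitrary: c)
  case (Suc k)
  show ?case
    by (rule Ck_on_SucI[where f' = "\<lambda>x v. 0"]) (use Suc in \<open>auto\<close>)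
qed auto

lemma Ck_on_add: "open S \<Longrightarrow> Ck_on k S f \<Longrightarrow> Ck_on k S g \<Longrightarrow> Ck_on k S (\<lambda>x. f x + g x)"
proof (induction k arbitrary: f g)
  case (Suc k)
  show ?case
  proof (rule Ck_on_SucI[where f' = "\<lambda>x v. frechet_derivative f (at x) v + frechet_derivative g (at x) v"])
    show "((\<lambda>x. f x + g x) has_derivative
        (\<lambda>v. frechet_derivative f (at x) v + frechet_derivative g (at x) v)) (at x)" if "x \<in> S" for x
      using Suc.prems that by (intro has_derivative_add Ck_on_SucD(1))
    show "Ck_on k S (\<lambda>x. frechet_derivative f (at x) v + frechet_derivative g (at x) v)" for v
      using Suc.prems by (intro Suc.IH Ck_on_SucD(2))
  qed (use Suc in auto)
qed (auto intro: continuous_intros)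

lemma Ck_on_bounded_linear:
  assumes "bounded_linear h"
  shows "open S \<Longrightarrow> Ck_on k S f \<Longrightarrow> Ck_on k S (\<lambda>x. h (f x))"
proof (induction k arbitrary: f)
  case 0
  then show ?case using assms by (auto intro: bounded_linear.continuous_on)
next
  case (Suc k)
  show ?case
    by (rule Ck_on_SucI[where f' = "\<lambda>x v. h (frechet_derivative f (at x) v)"])
      (use Suc Ck_on_SucD in \<open>auto intro!: bounded_linear.has_derivative[OF assms] simp: frechet_derivative_works[symmetric]\<close>)
qed

lemma Ck_on_bilinear:
  assumes "bounded_bilinear h"
  shows "open S \<Longrightarrow> Ck_on k S f \<Longrightarrow> Ck_on k S g \<Longrightarrow> Ck_on k S (\<lambda>x. h (f x) (g x))"
proof (induction k arbitrary: f g)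
  case 0
  then show ?case using assms by (auto intro: bounded_bilinear.continuous_on)
next
  case (Suc k)
  show ?case
  proof (rule Ck_on_SucI[where f' = "\<lambda>x v. h (f x) (frechet_derivative g (at x) v) + h (frechet_derivative f (at x) v) (g x)"])
    show "((\<lambda>x. h (f x) (g x)) has_derivative
        (\<lambda>v. h (f x) (frechet_derivative g (at x) v) + h (frechet_derivative f (at x) v) (g x))) (at x)"
      if "x \<in> S" for x
      using Suc.prems that by (intro bounded_bilinear.FDERIV[OF assms] Ck_on_SucD(1))
    note f = Suc.prems(2) and g = Suc.prems(3)
    show "Ck_on k S (\<lambda>x. h (f x) (frechet_derivative g (at x) v) + h (frechet_derivative f (at x) v) (g x))" for v
      using Suc.prems(1) f[THEN Ck_on_Suc_imp] g[THEN Ck_on_Suc_imp] f[THEN Ck_on_SucD(2)] g[THEN Ck_on_SucD(2)]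
      by (intro Ck_on_add Suc.IH)
  qed (use Suc in auto)
qed

lemma Ck_on_sum:
  "open S \<Longrightarrow> (\<And>i. i \<in> I \<Longrightarrow> Ck_on k S (f i)) \<Longrightarrow> Ck_on k S (\<lambda>x. \<Sum>i\<in>I. f i x)"
  by (induction I rule: infinite_finite_induct) (auto intro: Ck_on_const Ck_on_add)

text \<open>Smoothness of a family of linear maps is reduced to smoothness of its values on the
  basis through this expansion.\<close>

lemma linear_basis_expansion:
  fixes f :: "'a::euclidean_space \<Rightarrow> 'b::real_vector"
  assumes "linear f"
  shows "f v = (\<Sum>b\<in>Basis. (v \<bullet> b) *\<^sub>R f b)"
proof -
  have "f v = f (\<Sum>b\<in>Basis. (v \<bullet> b) *\<^sub>R b)" by (simp add: euclidean_representation)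
  then show ?thesis using assms by (simp add: linear_sum linear_cmul)
qed

text \<open>In the chain rule the derivative of \<open>g\<close> is applied to a vector that
  depends on \<open>x\<close>. Expanding this vector in the basis leaves sums of products to which
  the induction hypothesis applies.\<close>

lemma Ck_on_compose:
  fixes f :: "'a::euclidean_space \<Rightarrow> 'b::euclidean_space" and g :: "'b \<Rightarrow> 'c::real_normed_vector"
  assumes "open S" "open U" "f ` S \<subseteq> U"
  shows "Ck_on k S f \<Longrightarrow> Ck_on k U g \<Longrightarrow> Ck_on k S (\<lambda>x. g (f x))"
proof (induction k arbitrary: g)
  case 0
  then show ?case using assms by (auto intro: continuous_on_compose2)
next
  case (Suc k)
  let ?D = "\<lambda>x v. frechet_derivative g (at (f x)) (frechet_derivative f (at x) v)"
  have dg: "x \<in> S \<Longrightarrow> (g has_derivative frechet_derivative g (at (f x))) (at (f x))" for x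
    using Suc.prems assms(3) by (auto intro!: Ck_on_SucD(1))
  show ?case
  proof (rule Ck_on_SucI[where f' = ?D])
    show "((\<lambda>x. g (f x)) has_derivative ?D x) (at x)" if "x \<in> S" for x
      using has_derivative_compose[OF Ck_on_SucD(1)[OF Suc.prems(1) that] dg[OF that]] .
    have "Ck_on k S (\<lambda>x. \<Sum>b\<in>Basis. (frechet_derivative f (at x) v \<bullet> b) *\<^sub>R frechet_derivative g (at (f x)) b)" for v
      using Suc.prems Ck_on_Suc_imp assms(1)
      by (intro Ck_on_sum Ck_on_bilinear[OF bounded_bilinear_scaleR]
            Ck_on_bounded_linear[OF bounded_linear_inner_left] Suc.IH Ck_on_SucD(2)) auto
    moreover have "?D x v = (\<Sum>b\<in>Basis. (frechet_derivative f (at x) v \<bullet> b) *\<^sub>R frechet_derivative g (at (f x)) b)"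
      if "x \<in> S" for x v
      using linear_basis_expansion dg[OF that] has_derivative_linear by blast
    ultimately show "Ck_on k S (\<lambda>x. ?D x v)" for v
      using Ck_on_cong[OF assms(1)] by (metis (no_types, lifting))
  qed (use assms in auto)
qed

lemma smooth_on_cong:
  "open S \<Longrightarrow> (\<And>x. x \<in> S \<Longrightarrow> f x = g x) \<Longrightarrow> smooth_on S f \<longleftrightarrow> smooth_on S g"
  using Ck_on_cong unfolding smooth_on_def by blast

lemma smooth_on_subset: "smooth_on S f \<Longrightarrow> U \<subseteq> S \<Longrightarrow> smooth_on U f"
  unfolding smooth_on_def using Ck_on_subset by blast

lemma smooth_on_local:
  "open S \<Longrightarrow> (\<And>x. x \<in> S \<Longrightarrow> \<exists>U. open U \<and> x \<in> U \<and> smooth_on U f) \<Longrightarrow> smooth_on S f"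
  unfolding smooth_on_def using Ck_on_local by metis

lemma smooth_on_const: "open S \<Longrightarrow> smooth_on S (\<lambda>x. c)"
  unfolding smooth_on_def using Ck_on_const by blast

lemma smooth_on_add: "open S \<Longrightarrow> smooth_on S f \<Longrightarrow> smooth_on S g \<Longrightarrow> smooth_on S (\<lambda>x. f x + g x)"
  unfolding smooth_on_def using Ck_on_add by blast

lemma smooth_on_bounded_linear:
  "bounded_linear h \<Longrightarrow> open S \<Longrightarrow> smooth_on S f \<Longrightarrow> smooth_on S (\<lambda>x. h (f x))"
  unfolding smooth_on_def using Ck_on_bounded_linear by blast

lemma smooth_on_bilinear:
  "bounded_bilinear h \<Longrightarrow> open S \<Longrightarrow> smooth_on S f \<Longrightarrow> smooth_on S g \<Longrightarrow> smooth_on S (\<lambda>x. h (f x) (g x))"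
  unfolding smooth_on_def using Ck_on_bilinear by blast

lemma smooth_on_sum:
  "open S \<Longrightarrow> (\<And>i. i \<in> I \<Longrightarrow> smooth_on S (f i)) \<Longrightarrow> smooth_on S (\<lambda>x. \<Sum>i\<in>I. f i x)"
  unfolding smooth_on_def using Ck_on_sum by metis

lemma smooth_on_compose:
  fixes f :: "'a::euclidean_space \<Rightarrow> 'b::euclidean_space" and g :: "'b \<Rightarrow> 'c::real_normed_vector"
  shows "open S \<Longrightarrow> open U \<Longrightarrow> f ` S \<subseteq> U \<Longrightarrow> smooth_on S f \<Longrightarrow> smooth_on U g \<Longrightarrow> smooth_on S (\<lambda>x. g (f x))"
  unfolding smooth_on_def using Ck_on_compose by blast

lemma smooth_on_id: "open S \<Longrightarrow> smooth_on S (\<lambda>x. x)"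
proof -
  have "Ck_on k S (\<lambda>x. x)" if "open S" for k
  proof (cases k)
    case (Suc n)
    then show ?thesis using that Ck_on_const
      by (auto intro!: Ck_on_SucI[where f' = "\<lambda>x v. v"])
  qed auto
  then show "open S \<Longrightarrow> ?thesis" by (simp add: smooth_on_def)
qed

lemma smooth_on_linear: "bounded_linear h \<Longrightarrow> open S \<Longrightarrow> smooth_on S h"
  using smooth_on_bounded_linear smooth_on_id by blast

lemma smooth_on_diff: "open S \<Longrightarrow> smooth_on S f \<Longrightarrow> smooth_on S g \<Longrightarrow> smooth_on S (\<lambda>x. f x - g x)"
  using smooth_on_add[of S f "\<lambda>x. - g x"] smooth_on_bounded_linear[of uminus S g]
  by (simp add: bounded_linear_minus bounded_linear_ident)

lemmas smooth_on_scaleR = smooth_on_bilinear[OF bounded_bilinear_scaleR]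
lemmas smooth_on_mult = smooth_on_bilinear[OF bounded_bilinear_mult]
lemmas smooth_on_inner_left = smooth_on_bounded_linear[OF bounded_linear_inner_left]

lemma smooth_on_has_derivative:
  "smooth_on S f \<Longrightarrow> x \<in> S \<Longrightarrow> (f has_derivative frechet_derivative f (at x)) (at x)"
  unfolding smooth_on_def using Ck_on_SucD(1) by blast

lemma smooth_on_linear_deriv:
  "smooth_on S f \<Longrightarrow> x \<in> S \<Longrightarrow> linear (frechet_derivative f (at x))"
  using smooth_on_has_derivative has_derivative_linear by blast

lemma smooth_on_deriv: "smooth_on S f \<Longrightarrow> smooth_on S (\<lambda>x. frechet_derivative f (at x) v)"
  unfolding smooth_on_def using Ck_on_SucD(2) by blast

lemma smooth_on_continuous: "smooth_on S f \<Longrightarrow> continuous_on S f"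
  unfolding smooth_on_def by (metis Ck_on.simps(1))

lemma smooth_on_linear_family:
  fixes L :: "'a::euclidean_space \<Rightarrow> 'b::euclidean_space \<Rightarrow> 'c::real_normed_vector"
  assumes "open S" "\<And>x. x \<in> S \<Longrightarrow> linear (L x)" "\<And>b. b \<in> Basis \<Longrightarrow> smooth_on S (\<lambda>x. L x b)" "smooth_on S w"
  shows "smooth_on S (\<lambda>x. L x (w x))"
proof -
  have "smooth_on S (\<lambda>x. \<Sum>b\<in>Basis. (w x \<bullet> b) *\<^sub>R L x b)"
    by (intro smooth_on_sum smooth_on_scaleR smooth_on_inner_left assms)
  moreover have "L x (w x) = (\<Sum>b\<in>Basis. (w x \<bullet> b) *\<^sub>R L x b)" if "x \<in> S" for x
    by (rule linear_basis_expansion[OF assms(2)[OF that]])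
  ultimately show ?thesis
    using smooth_on_cong[OF assms(1), of "\<lambda>x. L x (w x)"] by simp
qed

lemma smooth_on_deriv_apply:
  "open S \<Longrightarrow> smooth_on S f \<Longrightarrow> smooth_on S w \<Longrightarrow> smooth_on S (\<lambda>x. frechet_derivative f (at x) (w x))"
  by (rule smooth_on_linear_family) (auto intro: smooth_on_linear_deriv smooth_on_deriv)

lemma blinfun_basis_expansion:
  fixes F :: "'a::euclidean_space \<Rightarrow>\<^sub>L 'b::real_normed_vector"
  shows "F = (\<Sum>b\<in>Basis. blinfun_scaleR_left (F b) o\<^sub>L blinfun_inner_left b)"
  by (rule blinfun_eqI)
    (simp add: blinfun.sum_left blinfun_inner_left.rep_eq linear_basis_expansion[of F]
      bounded_linear.linear[OF blinfun.bounded_linear_right] inner_commute)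

text \<open>An operator is the sum of the rank-one operators \<open>v \<mapsto> (v \<bullet> b)
  F(b)\<close> over the basis, and each of them depends linearly on the vector
  \<open>F(b)\<close>; so smoothness at fixed vectors gives smoothness for the operator
  norm.\<close>

lemma smooth_on_blinfunI:
  fixes F :: "'a::euclidean_space \<Rightarrow> 'b::euclidean_space \<Rightarrow>\<^sub>L 'c::real_normed_vector"
  assumes "open S" "\<And>v. smooth_on S (\<lambda>x. F x v)"
  shows "smooth_on S F"
proof -
  have "smooth_on S (\<lambda>x. \<Sum>b\<in>Basis. blinfun_scaleR_left (F x b) o\<^sub>L blinfun_inner_left b)"
    by (intro smooth_on_sum smooth_on_bilinear[OF bounded_bilinear_blinfun_compose] assms smooth_on_const
        smooth_on_bounded_linear[OF bounded_linear_blinfun_scaleR_left])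
  then show ?thesis by (subst (asm) blinfun_basis_expansion[symmetric])
qed

lemma smooth_on_real_SucI:
  fixes f :: "real \<Rightarrow> 'b::real_normed_vector"
  assumes "open S" "\<And>x. x \<in> S \<Longrightarrow> (f has_vector_derivative f' x) (at x)" "Ck_on k S f'"
  shows "Ck_on (Suc k) S f"
proof (rule Ck_on_SucI[where f' = "\<lambda>x v. v *\<^sub>R f' x"])
  show "(f has_derivative (\<lambda>v. v *\<^sub>R f' x)) (at x)" if "x \<in> S" for x
    using assms(2)[OF that] by (simp add: has_vector_derivative_def)
  show "Ck_on k S (\<lambda>x. v *\<^sub>R f' x)" for v
    by (rule Ck_on_bounded_linear[OF bounded_linear_scaleR_right assms(1,3)])
qed (rule assms)

subsection \<open>Symmetry of second derivatives\<close>

text \<open>The mean value theorem in the direction \<open>a\<close>, and then in the direction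
  \<open>b\<close>. The left side is symmetric in \<open>a\<close> and \<open>b\<close> while the
  right side differentiates first along \<open>a\<close>.\<close>

lemma second_difference:
  fixes f :: "'a::euclidean_space \<Rightarrow> real"
  assumes "smooth_on (ball u r) f" "\<And>s t. s \<in> {0..h} \<Longrightarrow> t \<in> {0..h} \<Longrightarrow> u + s *\<^sub>R a + t *\<^sub>R b \<in> ball u r"
    and "h > 0"
  shows "\<exists>s\<in>{0..h}. \<exists>t\<in>{0..h}. f (u + h *\<^sub>R a + h *\<^sub>R b) - f (u + h *\<^sub>R a) - f (u + h *\<^sub>R b) + f u =
    h * h * frechet_derivative (\<lambda>x. frechet_derivative f (at x) a) (at (u + s *\<^sub>R a + t *\<^sub>R b)) b"
proof -
  let ?fa = "\<lambda>x. frechet_derivative f (at x) a"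
  let ?p = "\<lambda>s t. u + s *\<^sub>R a + t *\<^sub>R b"
  have da: "((\<lambda>s. f (?p s t)) has_real_derivative ?fa (?p s t)) (at s)"
    if "s \<in> {0..h}" "t \<in> {0..h}" for s t
  proof -
    have "((\<lambda>s. f (?p s t)) has_derivative (\<lambda>k. frechet_derivative f (at (?p s t)) (k *\<^sub>R a))) (at s)"
      by (rule has_derivative_compose[where f = "\<lambda>s. ?p s t" and g = f and f' = "\<lambda>k. k *\<^sub>R a",
            OF _ smooth_on_has_derivative[OF assms(1) assms(2)[OF that]]])
        (auto intro!: derivative_eq_intros)
    then show ?thesis
      using smooth_on_linear_deriv[OF assms(1) assms(2)[OF that]]
      by (simp add: has_real_derivative_iff_has_vector_derivative has_vector_derivative_def linear_cmul)
  qed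
  have db: "((\<lambda>t. ?fa (?p s t)) has_real_derivative frechet_derivative ?fa (at (?p s t)) b) (at t)"
    if "s \<in> {0..h}" "t \<in> {0..h}" for s t
  proof -
    have "((\<lambda>t. ?fa (?p s t)) has_derivative (\<lambda>k. frechet_derivative ?fa (at (?p s t)) (k *\<^sub>R b))) (at t)"
      by (rule has_derivative_compose[where f = "\<lambda>t. ?p s t" and g = ?fa and f' = "\<lambda>k. k *\<^sub>R b",
            OF _ smooth_on_has_derivative[OF smooth_on_deriv[OF assms(1)] assms(2)[OF that]]])
        (auto intro!: derivative_eq_intros)
    then show ?thesis
      using smooth_on_linear_deriv[OF smooth_on_deriv[OF assms(1)] assms(2)[OF that]]
      by (simp add: has_real_derivative_iff_has_vector_derivative has_vector_derivative_def linear_cmul)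
  qed
  have "((\<lambda>s. f (?p s h) - f (?p s 0)) has_real_derivative ?fa (?p s h) - ?fa (?p s 0)) (at s)"
    if "0 \<le> s" "s \<le> h" for s
    by (intro DERIV_diff da) (use that in auto)
  from MVT2[OF \<open>h > 0\<close> this] obtain s where s: "0 < s" "s < h"
    "(f (?p h h) - f (?p h 0)) - (f (?p 0 h) - f (?p 0 0)) = (h - 0) * (?fa (?p s h) - ?fa (?p s 0))"
    by blast
  have "((\<lambda>t. ?fa (?p s t)) has_real_derivative frechet_derivative ?fa (at (?p s t)) b) (at t)"
    if "0 \<le> t" "t \<le> h" for t
    by (intro db) (use that s in auto)
  from MVT2[OF \<open>h > 0\<close> this] obtain t where t: "0 < t" "t < h"
    "?fa (?p s h) - ?fa (?p s 0) = (h - 0) * frechet_derivative ?fa (at (?p s t)) b"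
    by blast
  show ?thesis
    using s t by (intro bexI[of _ s] bexI[of _ t]) auto
qed

text \<open>The second difference over a small parallelogram is both mixed derivatives at two
  nearby points; continuity of the second derivatives closes the gap.\<close>

lemma second_derivative_symmetric_real:
  fixes f :: "'a::euclidean_space \<Rightarrow> real"
  assumes "smooth_on S f" "open S" "u \<in> S"
  shows "frechet_derivative (\<lambda>x. frechet_derivative f (at x) a) (at u) b =
    frechet_derivative (\<lambda>x. frechet_derivative f (at x) b) (at u) a"
proof -
  define F where "F a b x = frechet_derivative (\<lambda>x. frechet_derivative f (at x) a) (at x) b" for a b x
  obtain r where r: "r > 0" "ball u r \<subseteq> S" using assms(2,3) openE by blast
  have sm: "smooth_on (ball u r) f" using assms(1) r(2) smooth_on_subset by blast
  have cont: "isCont (F a b) u" for a b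
    using smooth_on_continuous[OF smooth_on_deriv[OF smooth_on_deriv[OF assms(1)]]] assms(2,3)
    unfolding F_def by (metis continuous_on_eq_continuous_at)
  have "\<bar>F a b u - F b a u\<bar> \<le> e" if "e > 0" for e
  proof -
    obtain d1 where d1: "d1 > 0" "\<And>x. dist x u < d1 \<Longrightarrow> \<bar>F a b x - F a b u\<bar> < e/2"
      using cont[of a b] \<open>e > 0\<close> unfolding continuous_at_eps_delta dist_real_def by (metis half_gt_zero)
    obtain d2 where d2: "d2 > 0" "\<And>x. dist x u < d2 \<Longrightarrow> \<bar>F b a x - F b a u\<bar> < e/2"
      using cont[of b a] \<open>e > 0\<close> unfolding continuous_at_eps_delta dist_real_def by (metis half_gt_zero)
    define d where "d = min r (min d1 d2)"
    define h where "h = d / (2 * (norm a + norm b + 1))"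
    have N: "norm a + norm b + 1 > 0" by (simp add: add_nonneg_pos)
    have "d > 0" using r d1 d2 by (simp add: d_def)
    then have "h > 0" using N by (simp add: h_def)
    have close: "norm (s *\<^sub>R a + t *\<^sub>R b) < d" if "s \<in> {0..h}" "t \<in> {0..h}" for s t
    proof -
      have "norm (s *\<^sub>R a + t *\<^sub>R b) \<le> h * norm a + h * norm b"
        using that by (intro norm_triangle_le) (auto intro!: add_mono mult_right_mono)
      also have "\<dots> \<le> h * (norm a + norm b + 1)" using \<open>h > 0\<close> by (simp add: algebra_simps)
      also have "\<dots> = d / 2" using N by (simp only: h_def times_divide_eq_left) (simp add: field_simps)
      finally show ?thesis using \<open>d > 0\<close> by linarith
    qed
    have inb: "u + s *\<^sub>R a + t *\<^sub>R b \<in> ball u r" "dist (u + s *\<^sub>R a + t *\<^sub>R b) u < d1" "dist (u + s *\<^sub>R a + t *\<^sub>R b) u < d2"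
      if "s \<in> {0..h}" "t \<in> {0..h}" for s t
    proof -
      have "dist (u + s *\<^sub>R a + t *\<^sub>R b) u < d"
        using close[OF that] by (simp add: dist_norm add.assoc)
      then show "u + s *\<^sub>R a + t *\<^sub>R b \<in> ball u r" "dist (u + s *\<^sub>R a + t *\<^sub>R b) u < d1"
        "dist (u + s *\<^sub>R a + t *\<^sub>R b) u < d2"
        by (simp_all add: d_def dist_commute)
    qed
    have inb': "u + s *\<^sub>R b + t *\<^sub>R a \<in> ball u r" if "s \<in> {0..h}" "t \<in> {0..h}" for s t
      using inb(1)[OF that(2,1)] by (simp add: algebra_simps)
    obtain s t where st: "s \<in> {0..h}" "t \<in> {0..h}"
      "f (u + h *\<^sub>R a + h *\<^sub>R b) - f (u + h *\<^sub>R a) - f (u + h *\<^sub>R b) + f u = h * h * F a b (u + s *\<^sub>R a + t *\<^sub>R b)"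
      using second_difference[OF sm inb(1) \<open>h > 0\<close>] unfolding F_def by blast
    obtain s' t' where st': "s' \<in> {0..h}" "t' \<in> {0..h}"
      "f (u + h *\<^sub>R b + h *\<^sub>R a) - f (u + h *\<^sub>R b) - f (u + h *\<^sub>R a) + f u = h * h * F b a (u + s' *\<^sub>R b + t' *\<^sub>R a)"
      using second_difference[OF sm inb' \<open>h > 0\<close>] unfolding F_def by blast
    have "h * h * F a b (u + s *\<^sub>R a + t *\<^sub>R b) = h * h * F b a (u + t' *\<^sub>R a + s' *\<^sub>R b)"
      using st(3) st'(3) by (simp add: algebra_simps)
    then have "F a b (u + s *\<^sub>R a + t *\<^sub>R b) = F b a (u + t' *\<^sub>R a + s' *\<^sub>R b)" using \<open>h > 0\<close> by simp
    then show ?thesis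
      using d1(2)[OF inb(2)[OF st(1,2)]] d2(2)[OF inb(3)[OF st'(2,1)]] by argo
  qed
  then have "F a b u = F b a u" by (metis abs_le_zero_iff dense_ge eq_iff_diff_eq_0)
  then show ?thesis by (simp add: F_def)
qed

text \<open>A product rule for the evaluation of a family of linear maps that is known only
  through its values on fixed vectors.\<close>

lemma has_derivative_linear_family:
  fixes L :: "'a::euclidean_space \<Rightarrow> 'b::euclidean_space \<Rightarrow> 'c::real_normed_vector"
  assumes "open S" "x0 \<in> S" "\<And>x. x \<in> S \<Longrightarrow> linear (L x)" "\<And>b. b \<in> Basis \<Longrightarrow> smooth_on S (\<lambda>x. L x b)"
    and w: "(w has_derivative w') (at x0)"
  shows "((\<lambda>x. L x (w x)) has_derivative
    (\<lambda>k. frechet_derivative (\<lambda>x. L x (w x0)) (at x0) k + L x0 (w' k))) (at x0)"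
proof -
  have exp: "L x v = (\<Sum>b\<in>Basis. (v \<bullet> b) *\<^sub>R L x b)" if "x \<in> S" for x v
    by (rule linear_basis_expansion[OF assms(3)[OF that]])
  define D where "D b = frechet_derivative (\<lambda>x. L x b) (at x0)" for b
  have D: "((\<lambda>x. L x b) has_derivative D b) (at x0)" if "b \<in> Basis" for b
    unfolding D_def using smooth_on_has_derivative[OF assms(4)[OF that] assms(2)] .
  have "((\<lambda>x. \<Sum>b\<in>Basis. (w x0 \<bullet> b) *\<^sub>R L x b) has_derivative (\<lambda>k. \<Sum>b\<in>Basis. (w x0 \<bullet> b) *\<^sub>R D b k)) (at x0)"
    by (intro has_derivative_sum has_derivative_scaleR_right D)
  then have "((\<lambda>x. L x (w x0)) has_derivative (\<lambda>k. \<Sum>b\<in>Basis. (w x0 \<bullet> b) *\<^sub>R D b k)) (at x0)"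
    by (rule has_derivative_transform_within_open[OF _ assms(1,2)]) (simp add: exp[symmetric])
  then have 1: "frechet_derivative (\<lambda>x. L x (w x0)) (at x0) = (\<lambda>k. \<Sum>b\<in>Basis. (w x0 \<bullet> b) *\<^sub>R D b k)"
    by (rule frechet_derivative_at[symmetric])
  have "((\<lambda>x. \<Sum>b\<in>Basis. (w x \<bullet> b) *\<^sub>R L x b) has_derivative
      (\<lambda>k. \<Sum>b\<in>Basis. (w x0 \<bullet> b) *\<^sub>R D b k + (w' k \<bullet> b) *\<^sub>R L x0 b)) (at x0)"
    by (intro has_derivative_sum has_derivative_scaleR has_derivative_inner_left w D)
  then have "((\<lambda>x. L x (w x)) has_derivative
      (\<lambda>k. \<Sum>b\<in>Basis. (w x0 \<bullet> b) *\<^sub>R D b k + (w' k \<bullet> b) *\<^sub>R L x0 b)) (at x0)"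
    by (rule has_derivative_transform_within_open[OF _ assms(1,2)]) (simp add: exp[symmetric])
  then show ?thesis
    unfolding 1 by (rule has_derivative_eq_rhs) (simp add: fun_eq_iff sum.distrib exp[OF assms(2), symmetric])
qed

section \<open>Smooth bump functions\<close>

text \<open>These functions form a family that is closed under differentiation, which yields the
  smoothness of all of them in one induction.\<close>

definition flat_exp :: "real poly \<Rightarrow> real \<Rightarrow> real" where
  "flat_exp p x = (if x > 0 then poly p (1 / x) * exp (- (1 / x)) else 0)"

lemma poly_times_exp_tendsto_0: "((\<lambda>y::real. poly p y * exp (- y)) \<longlongrightarrow> 0) at_top"
proof -
  have "((\<lambda>y::real. \<Sum>i\<le>degree p. coeff p i * (y ^ i / exp y)) \<longlongrightarrow> (\<Sum>i\<le>degree p. coeff p i * 0)) at_top"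
    by (intro tendsto_intros tendsto_power_div_exp_0)
  then show ?thesis
    by (simp add: poly_altdef exp_minus field_simps sum_divide_distrib)
qed

lemma flat_exp_tendsto_0: "((\<lambda>x. flat_exp p x) \<longlongrightarrow> 0) (at 0)"
proof -
  have "((\<lambda>x::real. poly p (inverse x) * exp (- inverse x)) \<longlongrightarrow> 0) (at_right 0)"
    by (rule filterlim_compose[OF poly_times_exp_tendsto_0 filterlim_inverse_at_top_right])
  then have "(flat_exp p \<longlongrightarrow> 0) (at_right 0)"
    by (rule Lim_transform_eventually)
      (auto simp: flat_exp_def inverse_eq_divide eventually_at_right_field intro: exI[of _ 1])
  moreover have "(flat_exp p \<longlongrightarrow> 0) (at_left 0)"
    by (rule Lim_transform_eventually[OF tendsto_const])
      (auto simp: flat_exp_def eventually_at_left_field intro: exI[of _ "-1"])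
  ultimately show ?thesis by (simp add: filterlim_at_split)
qed

lemma flat_exp_derivative:
  "(flat_exp p has_real_derivative flat_exp ([:0, 0, 1:] * (p - pderiv p)) x) (at x)"
proof -
  consider "x > 0" | "x < 0" | "x = 0" by linarith
  then show ?thesis
  proof cases
    case 1
    have "((\<lambda>x. poly p (1 / x) * exp (- (1 / x))) has_real_derivative
        flat_exp ([:0, 0, 1:] * (p - pderiv p)) x) (at x)"
      using 1 by (auto intro!: derivative_eq_intros simp: flat_exp_def field_simps power2_eq_square)
    then show ?thesis
      by (rule has_field_derivative_transform_within_open[of _ _ _ "{0<..}"]) (use 1 in \<open>auto simp: flat_exp_def\<close>)
  next
    case 2
    have "((\<lambda>x. 0) has_real_derivative flat_exp ([:0, 0, 1:] * (p - pderiv p)) x) (at x)"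
      using 2 by (simp add: flat_exp_def)
    then show ?thesis
      by (rule has_field_derivative_transform_within_open[of _ _ _ "{..<0}"]) (use 2 in \<open>auto simp: flat_exp_def\<close>)
  next
    case 3
    \<comment> \<open>The difference quotient at 0 is the member of the family for \<open>p\<close>
      times the variable.\<close>
    have "((\<lambda>h. flat_exp (pCons 0 p) h) \<longlongrightarrow> 0) (at 0)" by (rule flat_exp_tendsto_0)
    moreover have "flat_exp (pCons 0 p) h = (flat_exp p (0 + h) - flat_exp p 0) / h" for h
      by (simp add: flat_exp_def)
    ultimately show ?thesis using 3 by (simp add: DERIV_def flat_exp_def)
  qed
qed

lemma smooth_on_flat_exp: "smooth_on UNIV (flat_exp p)"
proof -
  have "Ck_on k UNIV (flat_exp p)" for k
  proof (induction k arbitrary: p)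
    case 0
    then show ?case
      using flat_exp_derivative by (auto intro!: continuous_at_imp_continuous_on DERIV_isCont)
  next
    case (Suc k)
    show ?case
      by (rule smooth_on_real_SucI[OF _ _ Suc.IH])
        (auto intro: flat_exp_derivative[unfolded has_real_derivative_iff_has_vector_derivative])
  qed
  then show ?thesis by (simp add: smooth_on_def)
qed

text \<open>\<open>f (c - f x) / f c\<close> turns the flat function \<open>f\<close> into a plateau without any division by a
  non-constant function: it is 1 where \<open>f\<close> vanishes and 0 where \<open>f \<ge> c\<close>.\<close>

lemma smooth_bump_exists:
  fixes u0 :: "'e::euclidean_space"
  assumes "r > 0"
  obtains \<beta> :: "'e \<Rightarrow> real" where "smooth_on UNIV \<beta>" "\<And>u. u \<in> ball u0 (r/2) \<Longrightarrow> \<beta> u = 1"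
    "\<And>u. u \<notin> ball u0 r \<Longrightarrow> \<beta> u = 0"
proof -
  define f where "f = flat_exp [:1:]"
  define c where "c = f (r\<^sup>2 / 2)"
  define \<beta> :: "'e \<Rightarrow> real" where "\<beta> u = f (c - f ((u - u0) \<bullet> (u - u0) - r\<^sup>2 / 4)) / f c" for u
  have f0: "f x = 0" if "x \<le> 0" for x using that by (simp add: f_def flat_exp_def)
  have f1: "f x > 0" if "x > 0" for x using that by (simp add: f_def flat_exp_def)
  have f2: "f x \<le> f y" if "0 < x" "x \<le> y" for x y
    using that by (simp add: f_def flat_exp_def frac_le)
  have sf: "smooth_on UNIV f" unfolding f_def by (rule smooth_on_flat_exp)
  have sq: "smooth_on UNIV (\<lambda>u::'e. (u - u0) \<bullet> (u - u0) - r\<^sup>2 / 4)"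
    by (intro smooth_on_diff smooth_on_bilinear[OF bounded_bilinear_inner] smooth_on_id smooth_on_const) auto
  have "smooth_on UNIV (\<lambda>u. c - f ((u - u0) \<bullet> (u - u0) - r\<^sup>2 / 4))"
    by (intro smooth_on_diff smooth_on_const smooth_on_compose[OF _ _ _ sq sf]) auto
  then have "smooth_on UNIV (\<lambda>u. f (c - f ((u - u0) \<bullet> (u - u0) - r\<^sup>2 / 4)))"
    by (intro smooth_on_compose[OF _ _ _ _ sf]) auto
  then have "smooth_on UNIV \<beta>"
    unfolding \<beta>_def by (intro smooth_on_bounded_linear[OF bounded_linear_divide]) auto
  moreover have "c > 0" unfolding c_def using assms by (intro f1) simp
  have nrm: "(u - u0) \<bullet> (u - u0) = (dist u0 u)\<^sup>2" for u
    by (metis dist_commute dist_norm power2_norm_eq_inner)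
  have "\<beta> u = 1" if "u \<in> ball u0 (r/2)" for u
  proof -
    have "(dist u0 u)\<^sup>2 \<le> (r/2)\<^sup>2" using that by (intro power_mono) auto
    then have "f ((u - u0) \<bullet> (u - u0) - r\<^sup>2 / 4) = 0"
      unfolding nrm by (intro f0) (simp add: power_divide)
    then show ?thesis using f1[OF \<open>c > 0\<close>] by (simp add: \<beta>_def)
  qed
  moreover have "\<beta> u = 0" if "u \<notin> ball u0 r" for u
  proof -
    have "r\<^sup>2 \<le> (dist u0 u)\<^sup>2" using that assms by (intro power_mono) auto
    then have "c \<le> f ((u - u0) \<bullet> (u - u0) - r\<^sup>2 / 4)"
      unfolding nrm c_def using zero_less_power[OF assms, of 2] by (intro f2; linarith)
    then show ?thesis by (simp add: \<beta>_def f0)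
  qed
  ultimately show ?thesis using that by blast
qed

section \<open>Charts and changes of coordinates\<close>

definition endo_rep :: "('m, 'e::euclidean_space) chart set \<Rightarrow> ('m, 'e) chart \<Rightarrow> ('m \<Rightarrow> 'e \<Rightarrow>\<^sub>L 'e) \<Rightarrow> 'e \<Rightarrow> 'e \<Rightarrow> 'e" where
  "endo_rep A c E u v = (let p = chart_inv c u in to_chart A c p (E p (from_chart A c p v)))"

context smooth_manifold
begin

lemma chart_at: "chart_at A p \<in> A" "p \<in> chart_dom (chart_at A p)"
proof -
  have "\<exists>c. c \<in> A \<and> p \<in> chart_dom c" using cover by blast
  from someI_ex[OF this] show "chart_at A p \<in> A" "p \<in> chart_dom (chart_at A p)"
    unfolding chart_at_def by auto
qed

lemma chart_inv_map [simp]: "c \<in> A \<Longrightarrow> p \<in> chart_dom c \<Longrightarrow> chart_inv c (chart_map c p) = p"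
  using homeo homeomorphism_apply1 by blast

lemma chart_map_inv [simp]: "u \<in> chart_image c \<Longrightarrow> chart_map c (chart_inv c u) = u"
  by (rule f_inv_into_f)

lemma chart_inv_dom [simp]: "u \<in> chart_image c \<Longrightarrow> chart_inv c u \<in> chart_dom c"
  by (rule inv_into_into)

lemma open_chart_map_image:
  assumes "c \<in> A" "open V" shows "open (chart_map c ` (chart_dom c \<inter> V))"
proof -
  have "openin (top_of_set (chart_image c)) (chart_map c ` (chart_dom c \<inter> V))"
    using homeomorphism_imp_open_map[OF homeo[OF assms(1)]] assms(2) by blast
  then show ?thesis using open_image[OF assms(1)] openin_open_eq by blast
qed

lemma open_chart_preimage:
  assumes "c \<in> A" "open W" shows "open {p \<in> chart_dom c. chart_map c p \<in> W}"
proof -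
  have "continuous_on (chart_dom c) (chart_map c)"
    using homeo[OF assms(1)] by (auto simp: homeomorphism_def)
  then have "open (chart_map c -` W \<inter> chart_dom c)"
    using continuous_on_open_vimage[OF open_dom[OF assms(1)]] assms(2) by blast
  then show ?thesis by (simp add: vimage_def Int_def conj_commute)
qed

lemma continuous_on_chart_inv: "c \<in> A \<Longrightarrow> continuous_on (chart_image c) (chart_inv c)"
  using homeo by (auto simp: homeomorphism_def)

lemma coord_change_has_derivative:
  assumes "c \<in> A" "d \<in> A" "p \<in> chart_dom c" "p \<in> chart_dom d"
  shows "((\<lambda>u. chart_map d (chart_inv c u)) has_derivative coord_change c d p) (at (chart_map c p))"
proof -
  have "chart_map c p \<in> chart_map c ` (chart_dom c \<inter> chart_dom d)" using assms by blast
  from smooth_on_has_derivative[OF compatible[OF assms(1,2)] this]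
  show ?thesis by (simp add: coord_change_def comp_def)
qed

lemma linear_coord_change:
  "c \<in> A \<Longrightarrow> d \<in> A \<Longrightarrow> p \<in> chart_dom c \<Longrightarrow> p \<in> chart_dom d \<Longrightarrow> linear (coord_change c d p)"
  using coord_change_has_derivative has_derivative_linear by blast

lemma coord_change_self:
  assumes "c \<in> A" "p \<in> chart_dom c" shows "coord_change c c p v = v"
proof -
  have "((\<lambda>u. chart_map c (chart_inv c u)) has_derivative (\<lambda>v. v)) (at (chart_map c p))"
    by (rule has_derivative_transform_within_open[of "\<lambda>u. u" _ _ _ "chart_image c"])
      (use assms open_image in \<open>auto\<close>)
  then show ?thesis
    using coord_change_has_derivative[OF assms(1,1) assms(2,2)] has_derivative_unique by metis
qed

lemma coord_change_compose:
  assumes "c \<in> A" "d \<in> A" "e \<in> A" "p \<in> chart_dom c" "p \<in> chart_dom d" "p \<in> chart_dom e"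
  shows "coord_change d e p (coord_change c d p v) = coord_change c e p v"
proof -
  have p: "chart_map d (chart_inv c (chart_map c p)) = chart_map d p" using assms by simp
  have "((\<lambda>u. chart_map e (chart_inv d (chart_map d (chart_inv c u)))) has_derivative
      (\<lambda>v. coord_change d e p (coord_change c d p v))) (at (chart_map c p))"
    by (rule has_derivative_compose[OF coord_change_has_derivative, of c d p "\<lambda>u. chart_map e (chart_inv d u)"])
      (use assms in \<open>auto intro!: coord_change_has_derivative\<close>)
  then have "((\<lambda>u. chart_map e (chart_inv c u)) has_derivative
      (\<lambda>v. coord_change d e p (coord_change c d p v))) (at (chart_map c p))"
    by (rule has_derivative_transform_within_open[OF _ open_chart_map_image[OF assms(1) open_dom[OF assms(2)]]])
      (use assms in auto)
  then show ?thesis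
    using coord_change_has_derivative[OF assms(1,3) assms(4,6)] has_derivative_unique by metis
qed

lemma smooth_on_coord_change:
  assumes "c \<in> A" "d \<in> A"
  shows "smooth_on (chart_map c ` (chart_dom c \<inter> chart_dom d)) (\<lambda>u. coord_change c d (chart_inv c u) v)"
proof -
  have "smooth_on (chart_map c ` (chart_dom c \<inter> chart_dom d))
      (\<lambda>u. frechet_derivative (chart_map d \<circ> chart_inv c) (at u) v)"
    using smooth_on_deriv[OF compatible[OF assms]] .
  then show ?thesis
    by (subst smooth_on_cong[OF open_chart_map_image[OF assms(1) open_dom[OF assms(2)]],
          where g = "\<lambda>u. frechet_derivative (chart_map d \<circ> chart_inv c) (at u) v"])
      (use assms(1) in \<open>auto simp: coord_change_def\<close>)
qed

lemma linear_to_chart: "c \<in> A \<Longrightarrow> p \<in> chart_dom c \<Longrightarrow> linear (to_chart A c p)"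
  unfolding to_chart_def by (simp add: linear_coord_change chart_at)

lemma linear_from_chart: "c \<in> A \<Longrightarrow> p \<in> chart_dom c \<Longrightarrow> linear (from_chart A c p)"
  unfolding from_chart_def by (simp add: linear_coord_change chart_at)

lemma from_to_chart [simp]: "c \<in> A \<Longrightarrow> p \<in> chart_dom c \<Longrightarrow> from_chart A c p (to_chart A c p v) = v"
  unfolding to_chart_def from_chart_def by (simp add: coord_change_compose coord_change_self chart_at)

lemma to_from_chart [simp]: "c \<in> A \<Longrightarrow> p \<in> chart_dom c \<Longrightarrow> to_chart A c p (from_chart A c p v) = v"
  unfolding to_chart_def from_chart_def by (simp add: coord_change_compose coord_change_self chart_at)

lemma to_chart_at [simp]: "to_chart A (chart_at A p) p v = v"
  unfolding to_chart_def by (simp add: coord_change_self chart_at)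

lemma from_chart_at [simp]: "from_chart A (chart_at A p) p v = v"
  unfolding from_chart_def by (simp add: coord_change_self chart_at)

lemma to_chart_change:
  assumes "c \<in> A" "d \<in> A" "p \<in> chart_dom c" "p \<in> chart_dom d"
  shows "coord_change c d p (to_chart A c p v) = to_chart A d p v"
  unfolding to_chart_def using assms by (simp add: coord_change_compose chart_at)

lemma from_chart_change:
  assumes "c \<in> A" "d \<in> A" "p \<in> chart_dom c" "p \<in> chart_dom d"
  shows "from_chart A d p (coord_change c d p v) = from_chart A c p v"
  unfolding from_chart_def using assms by (simp add: coord_change_compose chart_at)

lemma vf_rep_at: "c \<in> A \<Longrightarrow> p \<in> chart_dom c \<Longrightarrow> vf_rep A c X (chart_map c p) = to_chart A c p (X p)"
  by (simp add: vf_rep_def)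

lemma vf_rep_chart_at [simp]: "vf_rep A (chart_at A p) X (chart_map (chart_at A p) p) = X p"
  by (simp add: vf_rep_at chart_at)

lemma from_chart_vf_rep: "c \<in> A \<Longrightarrow> p \<in> chart_dom c \<Longrightarrow> from_chart A c p (vf_rep A c X (chart_map c p)) = X p"
  by (simp add: vf_rep_at)

lemma vf_rep_add: "c \<in> A \<Longrightarrow> u \<in> chart_image c \<Longrightarrow> vf_rep A c (X + Y) u = vf_rep A c X u + vf_rep A c Y u"
  by (simp add: vf_rep_def Let_def linear_add[OF linear_to_chart])

lemma vf_rep_scaleR: "c \<in> A \<Longrightarrow> u \<in> chart_image c \<Longrightarrow>
    vf_rep A c (\<lambda>p. f p *\<^sub>R X p) u = f (chart_inv c u) *\<^sub>R vf_rep A c X u"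
  by (simp add: vf_rep_def Let_def linear_cmul[OF linear_to_chart])

section \<open>Smoothness can be tested in one chart around each point\<close>

text \<open>A local representative over \<open>W\<close> in the chart \<open>c\<close> is pulled back to the chart \<open>d\<close> along the
  change of coordinates; this is the set where that makes sense.\<close>

lemma overlap_open:
  assumes "c \<in> A" "d \<in> A" "open W"
  shows "open (chart_map d ` (chart_dom d \<inter> {q \<in> chart_dom c. chart_map c q \<in> W}))"
  using open_chart_map_image[OF assms(2) open_chart_preimage[OF assms(1,3)]] .

lemma smooth_on_transition:
  assumes "c \<in> A" "d \<in> A"
  shows "smooth_on (chart_map d ` (chart_dom d \<inter> {q \<in> chart_dom c. chart_map c q \<in> W}))
    (\<lambda>u. chart_map c (chart_inv d u))"
  using smooth_on_subset[OF compatible[OF assms(2,1)],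
      of "chart_map d ` (chart_dom d \<inter> {q \<in> chart_dom c. chart_map c q \<in> W})"]
  by (auto simp: comp_def)

lemma smooth_on_pullback:
  fixes g :: "'e \<Rightarrow> 'f::real_normed_vector"
  assumes "c \<in> A" "d \<in> A" "open W" "smooth_on W g"
  shows "smooth_on (chart_map d ` (chart_dom d \<inter> {q \<in> chart_dom c. chart_map c q \<in> W}))
    (\<lambda>u. g (chart_map c (chart_inv d u)))"
  by (rule smooth_on_compose[OF overlap_open[OF assms(1-3)] assms(3) _ _ assms(4)])
    (use assms smooth_on_transition in auto)

text \<open>Smoothness of a field means smoothness of its representatives \<open>g d\<close> in
  all charts \<open>d\<close> of the atlas. It suffices to have it near every point on the overlap
  with one chart \<open>c\<close> of one's choice, to which the representative in \<open>c\<close>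
  can be carried by the change of coordinates.\<close>

lemma smooth_on_by_charts:
  fixes g :: "('m, 'e) chart \<Rightarrow> 'e \<Rightarrow> 'f::real_normed_vector"
  assumes d: "d \<in> A"
    and loc: "\<And>p. p \<in> chart_dom d \<Longrightarrow> \<exists>c W. c \<in> A \<and> open W \<and> p \<in> chart_dom c \<and> chart_map c p \<in> W \<and>
       smooth_on (chart_map d ` (chart_dom d \<inter> {q \<in> chart_dom c. chart_map c q \<in> W})) (g d)"
  shows "smooth_on (chart_image d) (g d)"
proof (rule smooth_on_local[OF open_image[OF d]])
  fix u assume "u \<in> chart_image d"
  then obtain p where p: "p \<in> chart_dom d" "u = chart_map d p" by blast
  obtain c W where "c \<in> A" "open W" "p \<in> chart_dom c" "chart_map c p \<in> W"
    "smooth_on (chart_map d ` (chart_dom d \<inter> {q \<in> chart_dom c. chart_map c q \<in> W})) (g d)"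
    using loc[OF p(1)] by blast
  then show "\<exists>U. open U \<and> u \<in> U \<and> smooth_on U (g d)"
    using overlap_open[of c d W] d p by blast
qed

lemma smooth_funsI:
  assumes "\<And>p. \<exists>c W. c \<in> A \<and> open W \<and> p \<in> chart_dom c \<and> chart_map c p \<in> W \<and> smooth_on W (\<lambda>u. f (chart_inv c u))"
  shows "f \<in> smooth_funs A"
proof -
  have "smooth_on (chart_image d) (\<lambda>u. f (chart_inv d u))" if d: "d \<in> A" for d
  proof (rule smooth_on_by_charts[OF d])
    fix p assume "p \<in> chart_dom d"
    obtain c W where c: "c \<in> A" "open W" "p \<in> chart_dom c" "chart_map c p \<in> W" "smooth_on W (\<lambda>u. f (chart_inv c u))"
      using assms by blast
    have "smooth_on (chart_map d ` (chart_dom d \<inter> {q \<in> chart_dom c. chart_map c q \<in> W})) (\<lambda>u. f (chart_inv d u))"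
      using smooth_on_pullback[OF c(1) d c(2,5)] c(1) d
      by (subst smooth_on_cong[OF overlap_open[OF c(1) d c(2)], where g = "\<lambda>u. f (chart_inv c (chart_map c (chart_inv d u)))"]) auto
    with c show "\<exists>c W. c \<in> A \<and> open W \<and> p \<in> chart_dom c \<and> chart_map c p \<in> W \<and>
       smooth_on (chart_map d ` (chart_dom d \<inter> {q \<in> chart_dom c. chart_map c q \<in> W})) (\<lambda>u. f (chart_inv d u))"
      by blast
  qed
  then show ?thesis by (simp add: smooth_funs_def comp_def)
qed

lemma vf_rep_change:
  assumes "c \<in> A" "d \<in> A" "q \<in> chart_dom c" "q \<in> chart_dom d"
  shows "vf_rep A d X (chart_map d q) = coord_change c d q (vf_rep A c X (chart_map c q))"
  using assms by (simp add: vf_rep_at to_chart_change)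

lemma smooth_on_coord_change_pullback:
  assumes "c \<in> A" "d \<in> A" "open W"
  shows "smooth_on (chart_map d ` (chart_dom d \<inter> {q \<in> chart_dom c. chart_map c q \<in> W}))
    (\<lambda>u. coord_change c d (chart_inv d u) v)"
proof -
  let ?N = "chart_map d ` (chart_dom d \<inter> {q \<in> chart_dom c. chart_map c q \<in> W})"
  have "smooth_on ?N (\<lambda>u. coord_change c d (chart_inv c (chart_map c (chart_inv d u))) v)"
    by (rule smooth_on_compose[OF overlap_open[OF assms] open_chart_map_image[OF assms(1) open_dom[OF assms(2)]] _ _
          smooth_on_coord_change[OF assms(1,2)]])
      (use assms smooth_on_transition in auto)
  then show ?thesis
    by (subst smooth_on_cong[OF overlap_open[OF assms], where g = "\<lambda>u. coord_change c d (chart_inv c (chart_map c (chart_inv d u))) v"])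
      (use assms in auto)
qed

lemma vector_fieldsI:
  assumes "\<And>p. \<exists>c W. c \<in> A \<and> open W \<and> p \<in> chart_dom c \<and> chart_map c p \<in> W \<and> smooth_on W (vf_rep A c X)"
  shows "X \<in> vector_fields A"
proof -
  have "smooth_on (chart_image d) (vf_rep A d X)" if d: "d \<in> A" for d
  proof (rule smooth_on_by_charts[OF d])
    fix p assume "p \<in> chart_dom d"
    obtain c W where c: "c \<in> A" "open W" "p \<in> chart_dom c" "chart_map c p \<in> W" "smooth_on W (vf_rep A c X)"
      using assms by blast
    let ?N = "chart_map d ` (chart_dom d \<inter> {q \<in> chart_dom c. chart_map c q \<in> W})"
    have "smooth_on ?N (\<lambda>u. coord_change c d (chart_inv d u) (vf_rep A c X (chart_map c (chart_inv d u))))"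
      by (rule smooth_on_linear_family[OF overlap_open[OF c(1) d c(2)] _ smooth_on_coord_change_pullback[OF c(1) d c(2)]
            smooth_on_pullback[OF c(1) d c(2,5)]])
        (use c d in \<open>auto intro!: linear_coord_change\<close>)
    then have "smooth_on ?N (vf_rep A d X)"
      by (subst smooth_on_cong[OF overlap_open[OF c(1) d c(2)], where g = "\<lambda>u. coord_change c d (chart_inv d u) (vf_rep A c X (chart_map c (chart_inv d u)))"])
        (use c d in \<open>auto simp: vf_rep_change[of c d]\<close>)
    with c show "\<exists>c W. c \<in> A \<and> open W \<and> p \<in> chart_dom c \<and> chart_map c p \<in> W \<and>
       smooth_on (chart_map d ` (chart_dom d \<inter> {q \<in> chart_dom c. chart_map c q \<in> W})) (vf_rep A d X)"
      by blast
  qed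
  then show ?thesis by (simp add: vector_fields_def)
qed

lemma endo_rep_at: "c \<in> A \<Longrightarrow> p \<in> chart_dom c \<Longrightarrow>
    endo_rep A c E (chart_map c p) v = to_chart A c p (E p (from_chart A c p v))"
  by (simp add: endo_rep_def)

lemma endo_rep_change:
  assumes "c \<in> A" "d \<in> A" "q \<in> chart_dom c" "q \<in> chart_dom d"
  shows "endo_rep A d E (chart_map d q) v =
    coord_change c d q (endo_rep A c E (chart_map c q) (coord_change d c q v))"
  using assms by (simp add: endo_rep_at to_chart_change from_chart_change)

lemma linear_endo_rep: "c \<in> A \<Longrightarrow> u \<in> chart_image c \<Longrightarrow> linear (endo_rep A c E u)"
  unfolding endo_rep_def Let_def
  by (intro linear_compose[unfolded comp_def, OF linear_compose[unfolded comp_def, OF linear_from_chart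
        bounded_linear.linear[OF blinfun.bounded_linear_right]] linear_to_chart]) auto

lemma endo_fields_iff: "E \<in> endo_fields A \<longleftrightarrow> (\<forall>c\<in>A. \<forall>v. smooth_on (chart_image c) (\<lambda>u. endo_rep A c E u v))"
  by (simp add: endo_fields_def endo_rep_def)

lemma endo_fieldsI:
  assumes "\<And>p. \<exists>c W. c \<in> A \<and> open W \<and> p \<in> chart_dom c \<and> chart_map c p \<in> W \<and> (\<forall>v. smooth_on W (\<lambda>u. endo_rep A c E u v))"
  shows "E \<in> endo_fields A"
proof -
  have "smooth_on (chart_image d) (\<lambda>u. endo_rep A d E u v)" if d: "d \<in> A" for d v
  proof (rule smooth_on_by_charts[OF d])
    fix p assume "p \<in> chart_dom d"
    obtain c W where c: "c \<in> A" "open W" "p \<in> chart_dom c" "chart_map c p \<in> W" "\<And>v. smooth_on W (\<lambda>u. endo_rep A c E u v)"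
      using assms by metis
    let ?N = "chart_map d ` (chart_dom d \<inter> {q \<in> chart_dom c. chart_map c q \<in> W})"
    note N = overlap_open[OF c(1) d c(2)]
    have "?N \<subseteq> chart_map d ` (chart_dom d \<inter> chart_dom c)" by blast
    then have "smooth_on ?N (\<lambda>u. coord_change d c (chart_inv d u) v)"
      using smooth_on_coord_change[OF d c(1)] smooth_on_subset by blast
    then have "smooth_on ?N (\<lambda>u. endo_rep A c E (chart_map c (chart_inv d u)) (coord_change d c (chart_inv d u) v))"
      by (intro smooth_on_linear_family[OF N _ smooth_on_pullback[OF c(1) d c(2,5)]])
        (use c d in \<open>auto intro!: linear_endo_rep\<close>)
    then have "smooth_on ?N (\<lambda>u. coord_change c d (chart_inv d u) (endo_rep A c E (chart_map c (chart_inv d u)) (coord_change d c (chart_inv d u) v)))"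
      by (intro smooth_on_linear_family[OF N _ smooth_on_coord_change_pullback[OF c(1) d c(2)]])
        (use c d in \<open>auto intro!: linear_coord_change\<close>)
    then have "smooth_on ?N (\<lambda>u. endo_rep A d E u v)"
      by (subst smooth_on_cong[OF N, where g = "\<lambda>u. coord_change c d (chart_inv d u) (endo_rep A c E (chart_map c (chart_inv d u)) (coord_change d c (chart_inv d u) v))"])
        (use c d in \<open>auto simp: endo_rep_change[of c d]\<close>)
    with c show "\<exists>c W. c \<in> A \<and> open W \<and> p \<in> chart_dom c \<and> chart_map c p \<in> W \<and>
       smooth_on (chart_map d ` (chart_dom d \<inter> {q \<in> chart_dom c. chart_map c q \<in> W})) (\<lambda>u. endo_rep A d E u v)"
      by blast
  qed
  then show ?thesis by (simp add: endo_fields_iff)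
qed

lemma vf_smooth: "X \<in> vector_fields A \<Longrightarrow> c \<in> A \<Longrightarrow> smooth_on (chart_image c) (vf_rep A c X)"
  by (simp add: vector_fields_def)

lemma fun_smooth: "f \<in> smooth_funs A \<Longrightarrow> c \<in> A \<Longrightarrow> smooth_on (chart_image c) (\<lambda>u. f (chart_inv c u))"
  by (simp add: smooth_funs_def comp_def)

lemma endo_smooth: "E \<in> endo_fields A \<Longrightarrow> c \<in> A \<Longrightarrow> smooth_on (chart_image c) (\<lambda>u. endo_rep A c E u v)"
  by (simp add: endo_fields_iff)

lemma smooth_funs_const: "(\<lambda>_. a) \<in> smooth_funs A"
  by (simp add: smooth_funs_def comp_def smooth_on_const open_image)

lemma smooth_funs_mult: "f \<in> smooth_funs A \<Longrightarrow> g \<in> smooth_funs A \<Longrightarrow> (\<lambda>p. f p * g p) \<in> smooth_funs A"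
  by (simp add: smooth_funs_def comp_def smooth_on_mult open_image)

lemma vector_fields_by_rep:
  assumes g: "\<And>c. c \<in> A \<Longrightarrow> smooth_on (chart_image c) (g c)"
    and eq: "\<And>c u. c \<in> A \<Longrightarrow> u \<in> chart_image c \<Longrightarrow> vf_rep A c X u = g c u"
  shows "X \<in> vector_fields A"
proof -
  have "smooth_on (chart_image c) (vf_rep A c X)" if "c \<in> A" for c
    by (subst smooth_on_cong[OF open_image[OF that] eq[OF that]]) (auto intro: g that)
  then show ?thesis by (simp add: vector_fields_def)
qed

lemma vf_add: assumes "X \<in> vector_fields A" "Y \<in> vector_fields A" shows "X + Y \<in> vector_fields A"
  by (rule vector_fields_by_rep[where g = "\<lambda>c u. vf_rep A c X u + vf_rep A c Y u"])
    (auto intro!: smooth_on_add open_image vf_smooth assms vf_rep_add)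

lemma vf_scale: assumes "f \<in> smooth_funs A" "X \<in> vector_fields A" shows "(\<lambda>p. f p *\<^sub>R X p) \<in> vector_fields A"
  by (rule vector_fields_by_rep[where g = "\<lambda>c u. f (chart_inv c u) *\<^sub>R vf_rep A c X u"])
    (auto intro!: smooth_on_scaleR open_image vf_smooth fun_smooth assms vf_rep_scaleR)

lemma vf_zero: "0 \<in> vector_fields A"
  by (rule vector_fields_by_rep[where g = "\<lambda>c u. 0"])
    (auto simp: vf_rep_def Let_def linear_0[OF linear_to_chart] intro: smooth_on_const open_image)

lemma vf_cmul: "X \<in> vector_fields A \<Longrightarrow> a *\<^sub>R X \<in> vector_fields A"
  using vf_scale[OF smooth_funs_const[of a]] by (simp add: scaleR_fun_def)

lemma vf_minus: "X \<in> vector_fields A \<Longrightarrow> - X \<in> vector_fields A"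
  using vf_cmul[of X "-1"] by simp

lemma vf_diff: "X \<in> vector_fields A \<Longrightarrow> Y \<in> vector_fields A \<Longrightarrow> X - Y \<in> vector_fields A"
  using vf_add[OF _ vf_minus] by fastforce

lemma vf_sum: "(\<And>i. i \<in> I \<Longrightarrow> X i \<in> vector_fields A) \<Longrightarrow> (\<Sum>i\<in>I. X i) \<in> vector_fields A"
  by (induction I rule: infinite_finite_induct) (auto intro: vf_zero vf_add)

lemma subspace_vector_fields: "subspace (vector_fields A)"
  by (simp add: subspace_def vf_zero vf_add vf_cmul)

end

section \<open>Cut-off functions, frames and tensoriality\<close>

lemma fun_sum_apply: "(\<Sum>i\<in>I. f i) x = (\<Sum>i\<in>I. f i x)"
  by (induction I rule: infinite_finite_induct) auto

text \<open>The support is enclosed in a subset of the chart domain that is closed in the whole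
  manifold: this is what makes a product of \<open>\<rho>\<close> with a local field smooth after
  extension by zero.\<close>

definition chart_cutoff :: "('m::topological_space, 'e::euclidean_space) chart set \<Rightarrow> ('m, 'e) chart \<Rightarrow> 'e set \<Rightarrow> ('m \<Rightarrow> real) \<Rightarrow> bool" where
  "chart_cutoff A c W \<rho> \<longleftrightarrow> c \<in> A \<and> open W \<and> W \<subseteq> chart_image c \<and> \<rho> \<in> smooth_funs A \<and>
     (\<forall>u\<in>W. \<rho> (chart_inv c u) = 1) \<and> (\<exists>K. closed K \<and> K \<subseteq> chart_dom c \<and> (\<forall>q. q \<notin> K \<longrightarrow> \<rho> q = 0))"

text \<open>The field with constant coordinates \<open>v\<close>, cut off to a global vector
  field; over \<open>W\<close> these fields form the coordinate frame.\<close>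

definition chart_frame :: "('m, 'e::euclidean_space) chart set \<Rightarrow> ('m, 'e) chart \<Rightarrow> ('m \<Rightarrow> real) \<Rightarrow> 'e \<Rightarrow> 'm \<Rightarrow> 'e" where
  "chart_frame A c \<rho> v = (\<lambda>q. \<rho> q *\<^sub>R from_chart A c q v)"

definition tensorial :: "('m, 'e::euclidean_space) chart set \<Rightarrow> (('m \<Rightarrow> 'e) \<Rightarrow> 'm \<Rightarrow> 'f::real_vector) \<Rightarrow> bool" where
  "tensorial A Q \<longleftrightarrow>
     (\<forall>X\<in>vector_fields A. \<forall>Y\<in>vector_fields A. Q (X + Y) = Q X + Q Y) \<and>
     (\<forall>f\<in>smooth_funs A. \<forall>X\<in>vector_fields A. Q (\<lambda>p. f p *\<^sub>R X p) = (\<lambda>p. f p *\<^sub>R Q X p))"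

context smooth_manifold
begin

text \<open>Around a point outside the chart domain, the complement of the closed set
  \<open>K\<close> is a neighbourhood on which the function vanishes.\<close>

lemma smooth_funs_extend_zero:
  assumes c: "c \<in> A" and K: "closed K" "K \<subseteq> chart_dom c" "\<And>q. q \<notin> K \<Longrightarrow> f q = 0"
    and f: "smooth_on (chart_image c) (\<lambda>u. f (chart_inv c u))"
  shows "f \<in> smooth_funs A"
proof (rule smooth_funsI)
  fix p
  show "\<exists>c W. c \<in> A \<and> open W \<and> p \<in> chart_dom c \<and> chart_map c p \<in> W \<and> smooth_on W (\<lambda>u. f (chart_inv c u))"
  proof (cases "p \<in> chart_dom c")
    case True
    then show ?thesis using c f open_image by blast
  next
    case False
    let ?d = "chart_at A p" let ?W = "chart_map ?d ` (chart_dom ?d \<inter> (- K))"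
    have W: "open ?W" using open_chart_map_image[OF chart_at(1)] K(1) by blast
    have "smooth_on ?W (\<lambda>u. f (chart_inv ?d u))"
      by (subst smooth_on_cong[OF W, where g = "\<lambda>_. 0"]) (auto simp: chart_at K(3) intro: smooth_on_const W)
    then show ?thesis using W chart_at[of p] False K(2) by blast
  qed
qed

lemma vector_fields_extend_zero:
  assumes c: "c \<in> A" and K: "closed K" "K \<subseteq> chart_dom c" "\<And>q. q \<notin> K \<Longrightarrow> X q = 0"
    and X: "smooth_on (chart_image c) (vf_rep A c X)"
  shows "X \<in> vector_fields A"
proof (rule vector_fieldsI)
  fix p
  show "\<exists>c W. c \<in> A \<and> open W \<and> p \<in> chart_dom c \<and> chart_map c p \<in> W \<and> smooth_on W (vf_rep A c X)"
  proof (cases "p \<in> chart_dom c")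
    case True
    then show ?thesis using c X open_image by blast
  next
    case False
    let ?d = "chart_at A p" let ?W = "chart_map ?d ` (chart_dom ?d \<inter> (- K))"
    have W: "open ?W" using open_chart_map_image[OF chart_at(1)] K(1) by blast
    have "smooth_on ?W (vf_rep A ?d X)"
      by (subst smooth_on_cong[OF W, where g = "\<lambda>_. 0"])
        (auto simp: chart_at K(3) vf_rep_at linear_0[OF linear_to_chart] intro: smooth_on_const W)
    then show ?thesis using W chart_at[of p] False K(2) by blast
  qed
qed

text \<open>The support lies in the image of a compact coordinate ball, which is compact and
  therefore closed, as the manifold is Hausdorff.\<close>

lemma chart_cutoff_exists:
  assumes c: "c \<in> A" and p: "p \<in> chart_dom c"
  obtains W \<rho> where "chart_cutoff A c W \<rho>" "chart_map c p \<in> W"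
proof -
  have "chart_map c p \<in> chart_image c" using p by blast
  then obtain r where r: "r > 0" "cball (chart_map c p) r \<subseteq> chart_image c"
    using open_contains_cball open_image[OF c] by blast
  obtain \<beta> :: "'e \<Rightarrow> real" where \<beta>: "smooth_on UNIV \<beta>" "\<And>u. u \<in> ball (chart_map c p) (r/2) \<Longrightarrow> \<beta> u = 1"
    "\<And>u. u \<notin> ball (chart_map c p) r \<Longrightarrow> \<beta> u = 0"
    using smooth_bump_exists[OF r(1)] by blast
  define K where "K = chart_inv c ` cball (chart_map c p) r"
  define \<rho> where "\<rho> q = (if q \<in> chart_dom c then \<beta> (chart_map c q) else 0)" for q
  have "compact K" unfolding K_def
    using r continuous_on_subset[OF continuous_on_chart_inv[OF c]] by (intro compact_continuous_image) auto
  then have K: "closed K" "K \<subseteq> chart_dom c"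
    using r(2) compact_imp_closed by (auto simp: K_def intro!: chart_inv_dom)
  have K0: "\<rho> q = 0" if "q \<notin> K" for q
  proof (cases "q \<in> chart_dom c")
    case True
    have "chart_map c q \<notin> ball (chart_map c p) r"
    proof
      assume "chart_map c q \<in> ball (chart_map c p) r"
      then have "chart_inv c (chart_map c q) \<in> K" unfolding K_def by (intro imageI) auto
      then show False using True c that by simp
    qed
    then show ?thesis by (simp add: \<rho>_def \<beta>(3))
  qed (simp add: \<rho>_def)
  have "smooth_on (chart_image c) (\<lambda>u. \<rho> (chart_inv c u))"
    by (subst smooth_on_cong[OF open_image[OF c], where g = \<beta>])
      (use c smooth_on_subset[OF \<beta>(1)] in \<open>auto simp: \<rho>_def\<close>)
  then have "\<rho> \<in> smooth_funs A" using smooth_funs_extend_zero[of c K \<rho>] c K K0 by blast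
  moreover have "\<rho> (chart_inv c u) = 1" if "u \<in> ball (chart_map c p) (r/2)" for u
  proof -
    have "u \<in> chart_image c" using that r by (auto simp: subset_iff)
    then show ?thesis using \<beta>(2)[OF that] by (simp add: \<rho>_def)
  qed
  moreover have "ball (chart_map c p) (r/2) \<subseteq> chart_image c"
    using r by (auto simp: subset_iff)
  ultimately have "chart_cutoff A c (ball (chart_map c p) (r/2)) \<rho>"
    unfolding chart_cutoff_def using c K K0 by blast
  then show ?thesis using that r(1) by simp
qed

lemma chart_cutoffD:
  assumes "chart_cutoff A c W \<rho>"
  shows "c \<in> A" "open W" "W \<subseteq> chart_image c" "\<rho> \<in> smooth_funs A" "u \<in> W \<Longrightarrow> \<rho> (chart_inv c u) = 1"
    "q \<notin> chart_dom c \<Longrightarrow> \<rho> q = 0" "p \<in> chart_dom c \<Longrightarrow> chart_map c p \<in> W \<Longrightarrow> \<rho> p = 1"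
proof -
  show "c \<in> A" "open W" "W \<subseteq> chart_image c" "\<rho> \<in> smooth_funs A" "u \<in> W \<Longrightarrow> \<rho> (chart_inv c u) = 1"
    using assms unfolding chart_cutoff_def by blast+
  show "q \<notin> chart_dom c \<Longrightarrow> \<rho> q = 0"
    using assms unfolding chart_cutoff_def by (meson subsetD)
  show "p \<in> chart_dom c \<Longrightarrow> chart_map c p \<in> W \<Longrightarrow> \<rho> p = 1"
    using assms chart_inv_map unfolding chart_cutoff_def by metis
qed

lemma cutoff_smooth_funs:
  assumes "chart_cutoff A c W \<rho>" "smooth_on (chart_image c) h"
  shows "(\<lambda>q. \<rho> q * h (chart_map c q)) \<in> smooth_funs A"
proof -
  note c = chart_cutoffD(1)[OF assms(1)]
  obtain K where K: "closed K" "K \<subseteq> chart_dom c" "\<And>q. q \<notin> K \<Longrightarrow> \<rho> q = 0"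
    using assms(1) unfolding chart_cutoff_def by blast
  have "smooth_on (chart_image c) (\<lambda>u. \<rho> (chart_inv c u) * h u)"
    by (intro smooth_on_mult open_image c fun_smooth chart_cutoffD(4)[OF assms(1)] assms(2))
  then have "smooth_on (chart_image c) (\<lambda>u. \<rho> (chart_inv c u) * h (chart_map c (chart_inv c u)))"
    by (subst smooth_on_cong[OF open_image[OF c], where g = "\<lambda>u. \<rho> (chart_inv c u) * h u"]) (use c in auto)
  then show ?thesis
    by (intro smooth_funs_extend_zero[OF c K(1,2)]) (simp_all add: K(3))
qed

lemma cutoff_vector_fields:
  assumes "chart_cutoff A c W \<rho>" "smooth_on (chart_image c) w"
  shows "(\<lambda>q. \<rho> q *\<^sub>R from_chart A c q (w (chart_map c q))) \<in> vector_fields A"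
proof -
  note c = chart_cutoffD(1)[OF assms(1)]
  obtain K where K: "closed K" "K \<subseteq> chart_dom c" "\<And>q. q \<notin> K \<Longrightarrow> \<rho> q = 0"
    using assms(1) unfolding chart_cutoff_def by blast
  have "smooth_on (chart_image c) (\<lambda>u. \<rho> (chart_inv c u) *\<^sub>R w u)"
    by (intro smooth_on_scaleR open_image c fun_smooth chart_cutoffD(4)[OF assms(1)] assms(2))
  then have "smooth_on (chart_image c) (vf_rep A c (\<lambda>q. \<rho> q *\<^sub>R from_chart A c q (w (chart_map c q))))"
    by (subst smooth_on_cong[OF open_image[OF c], where g = "\<lambda>u. \<rho> (chart_inv c u) *\<^sub>R w u"])
      (use c in \<open>auto simp: vf_rep_at linear_cmul[OF linear_to_chart]\<close>)
  then show ?thesis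
    by (intro vector_fields_extend_zero[OF c K(1,2)]) (simp_all add: K(3))
qed

lemma chart_frame_vf: "chart_cutoff A c W \<rho> \<Longrightarrow> chart_frame A c \<rho> v \<in> vector_fields A"
  unfolding chart_frame_def
  using cutoff_vector_fields[OF _ smooth_on_const[OF open_image]] chart_cutoffD(1) by blast

lemma vf_rep_chart_frame:
  assumes "chart_cutoff A c W \<rho>" "u \<in> W" shows "vf_rep A c (chart_frame A c \<rho> v) u = v"
proof -
  have "u \<in> chart_image c" using chart_cutoffD(3)[OF assms(1)] assms(2) by blast
  then show ?thesis
    using chart_cutoffD(5)[OF assms] chart_cutoffD(1)[OF assms(1)]
    by (simp add: vf_rep_def chart_frame_def)
qed

lemma vector_field_through: "\<exists>X\<in>vector_fields A. X p = v"
proof -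
  obtain W \<rho> where W: "chart_cutoff A (chart_at A p) W \<rho>" "chart_map (chart_at A p) p \<in> W"
    using chart_cutoff_exists chart_at by metis
  have "chart_frame A (chart_at A p) \<rho> v p = v"
    using chart_cutoffD(7)[OF W(1) chart_at(2) W(2)] by (simp add: chart_frame_def)
  then show ?thesis using chart_frame_vf[OF W(1)] by blast
qed

definition frame_coeff :: "('m, 'e) chart \<Rightarrow> ('m \<Rightarrow> real) \<Rightarrow> ('m \<Rightarrow> 'e) \<Rightarrow> 'e \<Rightarrow> 'm \<Rightarrow> real" where
  "frame_coeff c \<rho> X b = (\<lambda>q. \<rho> q * (vf_rep A c X (chart_map c q) \<bullet> b))"

lemma frame_coeff_smooth:
  "chart_cutoff A c W \<rho> \<Longrightarrow> X \<in> vector_fields A \<Longrightarrow> frame_coeff c \<rho> X b \<in> smooth_funs A"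
  unfolding frame_coeff_def
  by (rule cutoff_smooth_funs, assumption) (intro smooth_on_inner_left open_image vf_smooth; auto dest: chart_cutoffD(1))

text \<open>The identity \<open>\<rho>\<^sup>2 X = \<Sum> X\<^sub>b E\<^sub>b\<close> of global fields carries local expansions in a frame to the whole
  manifold, so that tensorial operators can be evaluated without any separate locality argument.\<close>

lemma frame_expansion:
  assumes "chart_cutoff A c W \<rho>"
  shows "(\<lambda>q. (\<rho> q * \<rho> q) *\<^sub>R X q) = (\<Sum>b\<in>Basis. (\<lambda>q. frame_coeff c \<rho> X b q *\<^sub>R chart_frame A c \<rho> b q))"
proof
  fix q
  show "(\<rho> q * \<rho> q) *\<^sub>R X q = (\<Sum>b\<in>Basis. (\<lambda>q. frame_coeff c \<rho> X b q *\<^sub>R chart_frame A c \<rho> b q)) q"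
  proof (cases "q \<in> chart_dom c")
    case True
    note c = chart_cutoffD(1)[OF assms]
    have "X q = from_chart A c q (vf_rep A c X (chart_map c q))" using c True by (simp add: from_chart_vf_rep)
    also have "\<dots> = (\<Sum>b\<in>Basis. (vf_rep A c X (chart_map c q) \<bullet> b) *\<^sub>R from_chart A c q b)"
      by (rule linear_basis_expansion[OF linear_from_chart[OF c True]])
    finally show ?thesis
      by (simp add: fun_sum_apply frame_coeff_def chart_frame_def scaleR_sum_right mult_ac)
  next
    case False
    then show ?thesis using chart_cutoffD(6)[OF assms] by (simp add: fun_sum_apply chart_frame_def)
  qed
qed

lemma tensorial_sum:
  assumes "tensorial A Q" "\<And>i. i \<in> I \<Longrightarrow> X i \<in> vector_fields A"
  shows "Q (\<Sum>i\<in>I. X i) = (\<Sum>i\<in>I. Q (X i))"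
  using assms(2)
proof (induction I rule: infinite_finite_induct)
  case (insert i I)
  then have "Q (X i + sum X I) = Q (X i) + Q (sum X I)"
    using assms(1) vf_sum[of I X] unfolding tensorial_def by blast
  moreover have "Q (sum X I) = (\<Sum>i\<in>I. Q (X i))" using insert by blast
  ultimately show ?case by (simp only: sum.insert[OF insert(1,2)])
qed (use assms(1) vf_zero smooth_funs_const[of 0] in \<open>force simp: tensorial_def zero_fun_def\<close>)+

lemma tensorial_add: "tensorial A Q \<Longrightarrow> X \<in> vector_fields A \<Longrightarrow> Y \<in> vector_fields A \<Longrightarrow> Q (X + Y) = Q X + Q Y"
  by (simp add: tensorial_def)

lemma tensorial_cmul: "tensorial A Q \<Longrightarrow> X \<in> vector_fields A \<Longrightarrow> Q (a *\<^sub>R X) = (\<lambda>p. a *\<^sub>R Q X p)"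
  unfolding tensorial_def using smooth_funs_const[of a] by (simp add: scaleR_fun_def)

lemma tensorial_minus: "tensorial A Q \<Longrightarrow> X \<in> vector_fields A \<Longrightarrow> Q (- X) = - Q X"
  using tensorial_cmul[of Q X "-1"] by (simp add: fun_eq_iff)

lemma tensorial_diff:
  assumes "tensorial A Q" "X \<in> vector_fields A" "Y \<in> vector_fields A"
  shows "Q (X - Y) = Q X - Q Y"
proof -
  have "Q (X + - Y) = Q X + Q (- Y)"
    using assms vf_minus[of Y] unfolding tensorial_def by blast
  then show ?thesis unfolding tensorial_minus[OF assms(1,3)] by simp
qed

lemma tensorial_scale: "tensorial A Q \<Longrightarrow> X \<in> vector_fields A \<Longrightarrow> Q (a *\<^sub>R X) = a *\<^sub>R Q X"
  using tensorial_cmul by (simp add: scaleR_fun_def)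

text \<open>Over \<open>W\<close> the factor \<open>\<rho>\<^sup>2\<close> is 1, so
  \<open>frame_expansion\<close> computes \<open>Q X\<close> at \<open>p\<close> from the
  coordinates of \<open>X\<close> at \<open>p\<close>.\<close>

lemma tensorial_expansion:
  fixes Q :: "('m \<Rightarrow> 'e) \<Rightarrow> 'm \<Rightarrow> 'f::real_vector"
  assumes Q: "tensorial A Q" and W: "chart_cutoff A c W \<rho>" and p: "p \<in> chart_dom c" "chart_map c p \<in> W"
    and X: "X \<in> vector_fields A"
  shows "Q X p = (\<Sum>b\<in>Basis. (vf_rep A c X (chart_map c p) \<bullet> b) *\<^sub>R Q (chart_frame A c \<rho> b) p)"
proof -
  have 1: "\<rho> p = 1" using chart_cutoffD(7)[OF W p] .
  have "Q X p = (\<rho> p * \<rho> p) *\<^sub>R Q X p" by (simp add: 1)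
  also have "\<dots> = Q (\<lambda>q. (\<rho> q * \<rho> q) *\<^sub>R X q) p"
    using Q X smooth_funs_mult chart_cutoffD(4)[OF W] by (simp add: tensorial_def)
  also have "\<dots> = (\<Sum>b\<in>Basis. Q (\<lambda>q. frame_coeff c \<rho> X b q *\<^sub>R chart_frame A c \<rho> b q) p)"
    unfolding frame_expansion[OF W]
    by (subst tensorial_sum[OF Q]) (auto simp: fun_sum_apply intro!: vf_scale frame_coeff_smooth chart_frame_vf W X)
  also have "\<dots> = (\<Sum>b\<in>Basis. frame_coeff c \<rho> X b p *\<^sub>R Q (chart_frame A c \<rho> b) p)"
    using Q frame_coeff_smooth[OF W X] chart_frame_vf[OF W] by (simp add: tensorial_def)
  finally show ?thesis by (simp add: frame_coeff_def 1)
qed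

lemma tensorial_pointwise:
  assumes "tensorial A Q" "X \<in> vector_fields A" "Y \<in> vector_fields A" "X p = Y p"
  shows "Q X p = Q Y p"
proof -
  obtain W \<rho> where W: "chart_cutoff A (chart_at A p) W \<rho>" "chart_map (chart_at A p) p \<in> W"
    using chart_cutoff_exists chart_at by metis
  show ?thesis
    using assms by (simp add: tensorial_expansion[OF assms(1) W(1) chart_at(2) W(2)])
qed

lemma endo_eqI: "(\<And>X. X \<in> vector_fields A \<Longrightarrow> blinfun_apply F (X p) = blinfun_apply G (X p)) \<Longrightarrow> F = G"
  using vector_field_through by (metis blinfun_eqI)

lemma induced_endo_unique:
  assumes "\<And>X. X \<in> vector_fields A \<Longrightarrow> blinfun_apply F (X p) = Q X p"
  shows "induced_endo A Q p = F"
  unfolding induced_endo_def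
proof (rule the_equality)
  show "\<forall>Y\<in>vector_fields A. blinfun_apply F (Y p) = Q Y p" using assms by blast
  show "G = F" if "\<forall>Y\<in>vector_fields A. blinfun_apply G (Y p) = Q Y p" for G
  proof (rule endo_eqI)
    show "blinfun_apply G (X p) = blinfun_apply F (X p)" if "X \<in> vector_fields A" for X
      using that \<open>\<forall>Y\<in>vector_fields A. blinfun_apply G (Y p) = Q Y p\<close> assms[OF that] by simp
  qed
qed

lemma induced_endo_apply:
  assumes "tensorial A Q" "X \<in> vector_fields A"
  shows "blinfun_apply (induced_endo A Q p) (X p) = Q X p"
proof -
  obtain W \<rho> where W: "chart_cutoff A (chart_at A p) W \<rho>" "chart_map (chart_at A p) p \<in> W"
    using chart_cutoff_exists chart_at by metis
  define F where "F = (\<Sum>b\<in>Basis. blinfun_scaleR_left (Q (chart_frame A (chart_at A p) \<rho> b) p) o\<^sub>L blinfun_inner_left b)"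
  have F: "blinfun_apply F (X p) = Q X p" if "X \<in> vector_fields A" for X
    using tensorial_expansion[OF assms(1) W(1) chart_at(2) W(2) that]
    by (simp add: F_def blinfun.sum_left blinfun_inner_left.rep_eq inner_commute)
  have "induced_endo A Q p = F" by (rule induced_endo_unique, rule F)
  then show ?thesis using F assms(2) by simp
qed

text \<open>The value of the endomorphism on constant coordinates \<open>v\<close> is the value of
  \<open>Q\<close> on the smooth frame field belonging to \<open>v\<close>.\<close>

lemma induced_endo_fields:
  assumes "tensorial A Q" "\<And>X. X \<in> vector_fields A \<Longrightarrow> Q X \<in> vector_fields A"
  shows "induced_endo A Q \<in> endo_fields A"
proof (rule endo_fieldsI)
  fix p
  let ?c = "chart_at A p"
  obtain W \<rho> where W: "chart_cutoff A ?c W \<rho>" "chart_map ?c p \<in> W"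
    using chart_cutoff_exists chart_at by metis
  note D = chart_cutoffD[OF W(1)]
  have "smooth_on W (\<lambda>u. endo_rep A ?c (induced_endo A Q) u v)" for v
  proof -
    have "smooth_on W (vf_rep A ?c (Q (chart_frame A ?c \<rho> v)))"
      using smooth_on_subset[OF vf_smooth[OF assms(2)[OF chart_frame_vf[OF W(1)]] chart_at(1)] D(3)] .
    moreover have "endo_rep A ?c (induced_endo A Q) u v = vf_rep A ?c (Q (chart_frame A ?c \<rho> v)) u" if "u \<in> W" for u
      using D(5)[OF that] induced_endo_apply[OF assms(1) chart_frame_vf[OF W(1), of v], of "chart_inv ?c u"]
      by (simp add: endo_rep_def vf_rep_def chart_frame_def)
    ultimately show ?thesis using smooth_on_cong[OF D(2)] by (metis (no_types, lifting))
  qed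
  then show "\<exists>c W. c \<in> A \<and> open W \<and> p \<in> chart_dom c \<and> chart_map c p \<in> W \<and> (\<forall>v. smooth_on W (\<lambda>u. endo_rep A c (induced_endo A Q) u v))"
    using chart_at W(2) D(2) by blast
qed

section \<open>Directional derivatives and the Jacobi bracket\<close>

lemma dir_deriv_chart:
  assumes f: "f \<in> smooth_funs A" and c: "c \<in> A" "p \<in> chart_dom c"
  shows "dir_deriv A X f p = frechet_derivative (\<lambda>u. f (chart_inv c u)) (at (chart_map c p)) (vf_rep A c X (chart_map c p))"
proof -
  let ?d = "chart_at A p"
  have fc: "((\<lambda>u. f (chart_inv c u)) has_derivative frechet_derivative (\<lambda>u. f (chart_inv c u)) (at (chart_map c p))) (at (chart_map c p))"
    using smooth_on_has_derivative[OF fun_smooth[OF f c(1)]] c(2) by blast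
  have "((\<lambda>u. f (chart_inv c (chart_map c (chart_inv ?d u)))) has_derivative
      (\<lambda>v. frechet_derivative (\<lambda>u. f (chart_inv c u)) (at (chart_map c p)) (coord_change ?d c p v))) (at (chart_map ?d p))"
    by (rule has_derivative_compose[OF coord_change_has_derivative, of ?d c p "\<lambda>u. f (chart_inv c u)"])
      (use c chart_at[of p] fc in auto)
  then have "((\<lambda>u. f (chart_inv ?d u)) has_derivative
      (\<lambda>v. frechet_derivative (\<lambda>u. f (chart_inv c u)) (at (chart_map c p)) (coord_change ?d c p v))) (at (chart_map ?d p))"
    by (rule has_derivative_transform_within_open[OF _ open_chart_map_image[OF chart_at(1)[of p] open_dom[OF c(1)]]])
      (use c chart_at[of p] in auto)
  from frechet_derivative_at[OF this, THEN fun_cong, of "X p", symmetric] show ?thesis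
    using c chart_at[of p] by (simp add: Let_def dir_deriv_def comp_def vf_rep_at to_chart_def)
qed

lemma dir_deriv_chart_inv:
  assumes f: "f \<in> smooth_funs A" and c: "c \<in> A" "u \<in> chart_image c"
  shows "dir_deriv A X f (chart_inv c u) = frechet_derivative (\<lambda>u. f (chart_inv c u)) (at u) (vf_rep A c X u)"
  using dir_deriv_chart[OF f c(1), of "chart_inv c u" X] c by simp

lemma dir_deriv_smooth:
  assumes f: "f \<in> smooth_funs A" and X: "X \<in> vector_fields A"
  shows "dir_deriv A X f \<in> smooth_funs A"
proof -
  have "smooth_on (chart_image c) (\<lambda>u. dir_deriv A X f (chart_inv c u))" if "c \<in> A" for c
    by (subst smooth_on_cong[OF open_image[OF that] dir_deriv_chart_inv[OF f that]])
      (auto intro!: smooth_on_deriv_apply open_image fun_smooth vf_smooth f X that)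
  then show ?thesis by (simp add: smooth_funs_def comp_def)
qed

lemma frechet_derivative_locally_const:
  assumes "open W" "u \<in> W" "\<And>x. x \<in> W \<Longrightarrow> f x = a" shows "frechet_derivative f (at u) v = 0"
proof -
  have "(f has_derivative (\<lambda>_. 0)) (at u)"
    by (rule has_derivative_transform_within_open[OF has_derivative_const assms(1,2)]) (simp add: assms(3))
  then show ?thesis using frechet_derivative_at by metis
qed

lemma dir_deriv_const [simp]: "dir_deriv A X (\<lambda>_. a) p = 0"
  unfolding dir_deriv_def Let_def by (rule frechet_derivative_locally_const[OF open_UNIV]) auto

lemma dir_deriv_diff:
  assumes "f \<in> smooth_funs A" "g \<in> smooth_funs A"
  shows "dir_deriv A X (\<lambda>p. f p - g p) p = dir_deriv A X f p - dir_deriv A X g p"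
proof -
  let ?c = "chart_at A p"
  have "chart_map ?c p \<in> chart_image ?c" using chart_at by blast
  then have "((\<lambda>u. f (chart_inv ?c u) - g (chart_inv ?c u)) has_derivative
     (\<lambda>v. frechet_derivative (\<lambda>u. f (chart_inv ?c u)) (at (chart_map ?c p)) v -
        frechet_derivative (\<lambda>u. g (chart_inv ?c u)) (at (chart_map ?c p)) v)) (at (chart_map ?c p))"
    by (intro has_derivative_diff smooth_on_has_derivative[OF fun_smooth] assms chart_at)
  from frechet_derivative_at[OF this, THEN fun_cong, of "X p", symmetric] show ?thesis
    by (simp add: Let_def dir_deriv_def comp_def)
qed

lemma linear_dir_deriv:
  assumes "f \<in> smooth_funs A"
  shows "dir_deriv A (X + Y) f p = dir_deriv A X f p + dir_deriv A Y f p"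
    "dir_deriv A (X - Y) f p = dir_deriv A X f p - dir_deriv A Y f p"
    "dir_deriv A (\<lambda>p. h p *\<^sub>R X p) f p = h p * dir_deriv A X f p"
proof -
  have "linear (frechet_derivative (f \<circ> chart_inv (chart_at A p)) (at (chart_map (chart_at A p) p)))"
    using smooth_on_linear_deriv[OF fun_smooth[OF assms chart_at(1)]] chart_at by (auto simp: comp_def)
  then show "dir_deriv A (X + Y) f p = dir_deriv A X f p + dir_deriv A Y f p"
    "dir_deriv A (X - Y) f p = dir_deriv A X f p - dir_deriv A Y f p"
    "dir_deriv A (\<lambda>p. h p *\<^sub>R X p) f p = h p * dir_deriv A X f p"
    by (simp_all add: Let_def dir_deriv_def linear_add linear_diff linear_cmul)
qed

text \<open>The cut-off coordinate functions are global smooth functions whose differentials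
  separate tangent vectors. Identities between vector fields can thus be checked on functions,
  where the Jacobi bracket is a commutator.\<close>

lemma smooth_funs_separate:
  assumes c: "c \<in> A" "p \<in> chart_dom c"
    and eq: "\<And>f. f \<in> smooth_funs A \<Longrightarrow> frechet_derivative (\<lambda>u. f (chart_inv c u)) (at (chart_map c p)) v =
      frechet_derivative (\<lambda>u. f (chart_inv c u)) (at (chart_map c p)) w"
  shows "v = w"
proof (rule euclidean_eqI)
  fix b :: 'e assume "b \<in> Basis"
  obtain W \<rho> where W: "chart_cutoff A c W \<rho>" "chart_map c p \<in> W"
    using chart_cutoff_exists[OF c] by metis
  note D = chart_cutoffD[OF W(1)]
  let ?f = "\<lambda>q. \<rho> q * (chart_map c q \<bullet> b)"
  have f: "?f \<in> smooth_funs A"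
    by (rule cutoff_smooth_funs[OF W(1)]) (intro smooth_on_linear bounded_linear_inner_left open_image c)
  have "((\<lambda>u. ?f (chart_inv c u)) has_derivative (\<lambda>v. v \<bullet> b)) (at (chart_map c p))"
    by (rule has_derivative_transform_within_open[OF bounded_linear_imp_has_derivative[OF bounded_linear_inner_left] D(2) W(2)])
      (use D(3,5) in \<open>auto simp: subset_iff\<close>)
  from frechet_derivative_at[OF this] eq[OF f] show "v \<bullet> b = w \<bullet> b" by metis
qed

lemma dir_deriv_separate:
  assumes "\<And>f. f \<in> smooth_funs A \<Longrightarrow> dir_deriv A X f p = dir_deriv A Y f p"
  shows "X p = Y p"
  by (rule smooth_funs_separate[OF chart_at(1) chart_at(2)]) (use assms in \<open>simp add: Let_def dir_deriv_def comp_def\<close>)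

text \<open>By symmetry of second derivatives the second order terms of \<open>XYf - YXf\<close> cancel, in every chart.\<close>

lemma dir_deriv_commutator_chart:
  assumes f: "f \<in> smooth_funs A" and X: "X \<in> vector_fields A" and Y: "Y \<in> vector_fields A"
    and c: "c \<in> A" and u: "u \<in> chart_image c"
  shows "dir_deriv A X (dir_deriv A Y f) (chart_inv c u) - dir_deriv A Y (dir_deriv A X f) (chart_inv c u) =
    frechet_derivative (\<lambda>u. f (chart_inv c u)) (at u)
      (frechet_derivative (vf_rep A c Y) (at u) (vf_rep A c X u) - frechet_derivative (vf_rep A c X) (at u) (vf_rep A c Y u))"
proof -
  let ?g = "\<lambda>u. f (chart_inv c u)"
  have sg: "smooth_on (chart_image c) ?g" using fun_smooth[OF f c] .
  have *: "dir_deriv A X (dir_deriv A Y f) (chart_inv c u) =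
      frechet_derivative (\<lambda>x. frechet_derivative ?g (at x) (vf_rep A c Y u)) (at u) (vf_rep A c X u) +
      frechet_derivative ?g (at u) (frechet_derivative (vf_rep A c Y) (at u) (vf_rep A c X u))"
    if Y: "Y \<in> vector_fields A" for X Y
  proof -
    have "((\<lambda>x. frechet_derivative ?g (at x) (vf_rep A c Y x)) has_derivative
       (\<lambda>k. frechet_derivative (\<lambda>x. frechet_derivative ?g (at x) (vf_rep A c Y u)) (at u) k +
          frechet_derivative ?g (at u) (frechet_derivative (vf_rep A c Y) (at u) k))) (at u)"
      by (rule has_derivative_linear_family[OF open_image[OF c] u])
        (use smooth_on_linear_deriv[OF sg] smooth_on_deriv[OF sg] smooth_on_has_derivative[OF vf_smooth[OF Y c] u] in auto)
    then have "((\<lambda>x. dir_deriv A Y f (chart_inv c x)) has_derivative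
       (\<lambda>k. frechet_derivative (\<lambda>x. frechet_derivative ?g (at x) (vf_rep A c Y u)) (at u) k +
          frechet_derivative ?g (at u) (frechet_derivative (vf_rep A c Y) (at u) k))) (at u)"
      by (rule has_derivative_transform_within_open[OF _ open_image[OF c] u])
        (simp add: dir_deriv_chart_inv[OF f c])
    from frechet_derivative_at[OF this, symmetric] show ?thesis
      by (simp add: dir_deriv_chart_inv[OF dir_deriv_smooth[OF f Y] c u])
  qed
  have "linear (frechet_derivative ?g (at u))" using smooth_on_linear_deriv[OF sg u] .
  then show ?thesis
    unfolding *[OF X] *[OF Y]
    using second_derivative_symmetric_real[OF sg open_image[OF c] u] by (simp add: linear_diff)
qed

lemma dir_deriv_jacobi_bracket:
  assumes "f \<in> smooth_funs A" "X \<in> vector_fields A" "Y \<in> vector_fields A"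
  shows "dir_deriv A (jacobi_bracket A X Y) f p = dir_deriv A X (dir_deriv A Y f) p - dir_deriv A Y (dir_deriv A X f) p"
proof -
  let ?c = "chart_at A p"
  have u: "chart_map ?c p \<in> chart_image ?c" using chart_at by blast
  show ?thesis
    using dir_deriv_commutator_chart[OF assms chart_at(1) u] chart_at[of p]
    by (simp add: Let_def dir_deriv_def[of A "jacobi_bracket A X Y"] jacobi_bracket_def comp_def Let_def)
qed

text \<open>The bracket is defined through the preferred chart of each point. That the same
  formula holds in every chart follows from its action on functions, which does not refer to a
  chart.\<close>

lemma vf_rep_jacobi_bracket:
  assumes X: "X \<in> vector_fields A" and Y: "Y \<in> vector_fields A" and c: "c \<in> A" and u: "u \<in> chart_image c"
  shows "vf_rep A c (jacobi_bracket A X Y) u =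
    frechet_derivative (vf_rep A c Y) (at u) (vf_rep A c X u) - frechet_derivative (vf_rep A c X) (at u) (vf_rep A c Y u)"
proof (rule smooth_funs_separate[OF c chart_inv_dom[OF u]])
  fix f assume f: "f \<in> smooth_funs A"
  show "frechet_derivative (\<lambda>u. f (chart_inv c u)) (at (chart_map c (chart_inv c u))) (vf_rep A c (jacobi_bracket A X Y) u) =
    frechet_derivative (\<lambda>u. f (chart_inv c u)) (at (chart_map c (chart_inv c u)))
     (frechet_derivative (vf_rep A c Y) (at u) (vf_rep A c X u) - frechet_derivative (vf_rep A c X) (at u) (vf_rep A c Y u))"
    using dir_deriv_commutator_chart[OF f X Y c u] dir_deriv_jacobi_bracket[OF f X Y]
      dir_deriv_chart_inv[OF f c u, of "jacobi_bracket A X Y"] u by simp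
qed

lemma jacobi_bracket_vf:
  assumes X: "X \<in> vector_fields A" and Y: "Y \<in> vector_fields A"
  shows "jacobi_bracket A X Y \<in> vector_fields A"
  by (rule vector_fields_by_rep[OF _ vf_rep_jacobi_bracket[OF X Y]])
    (intro smooth_on_diff smooth_on_deriv_apply open_image vf_smooth X Y)

lemma jacobi_bracket_skew: "jacobi_bracket A X Y = - jacobi_bracket A Y X"
  by (simp add: jacobi_bracket_def fun_eq_iff Let_def)

lemma frechet_derivative_vf_rep_add:
  assumes X: "X \<in> vector_fields A" and Y: "Y \<in> vector_fields A" and c: "c \<in> A" and u: "u \<in> chart_image c"
  shows "frechet_derivative (vf_rep A c (X + Y)) (at u) k =
    frechet_derivative (vf_rep A c X) (at u) k + frechet_derivative (vf_rep A c Y) (at u) k"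
proof -
  have "((\<lambda>u. vf_rep A c X u + vf_rep A c Y u) has_derivative
      (\<lambda>k. frechet_derivative (vf_rep A c X) (at u) k + frechet_derivative (vf_rep A c Y) (at u) k)) (at u)"
    by (intro has_derivative_add smooth_on_has_derivative[OF vf_smooth] X Y c u)
  then have "(vf_rep A c (X + Y) has_derivative
      (\<lambda>k. frechet_derivative (vf_rep A c X) (at u) k + frechet_derivative (vf_rep A c Y) (at u) k)) (at u)"
    by (rule has_derivative_transform_within_open[OF _ open_image[OF c] u]) (simp add: vf_rep_add c)
  from frechet_derivative_at[OF this] show ?thesis by metis
qed

lemma frechet_derivative_vf_rep_scale:
  assumes f: "f \<in> smooth_funs A" and X: "X \<in> vector_fields A" and c: "c \<in> A" and u: "u \<in> chart_image c"
  shows "frechet_derivative (vf_rep A c (\<lambda>p. f p *\<^sub>R X p)) (at u) k =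
    frechet_derivative (\<lambda>u. f (chart_inv c u)) (at u) k *\<^sub>R vf_rep A c X u
    + f (chart_inv c u) *\<^sub>R frechet_derivative (vf_rep A c X) (at u) k"
proof -
  have "((\<lambda>u. f (chart_inv c u) *\<^sub>R vf_rep A c X u) has_derivative
      (\<lambda>k. f (chart_inv c u) *\<^sub>R frechet_derivative (vf_rep A c X) (at u) k +
        frechet_derivative (\<lambda>u. f (chart_inv c u)) (at u) k *\<^sub>R vf_rep A c X u)) (at u)"
    by (intro has_derivative_scaleR smooth_on_has_derivative[OF vf_smooth] smooth_on_has_derivative[OF fun_smooth] f X c u)
  then have "(vf_rep A c (\<lambda>p. f p *\<^sub>R X p) has_derivative
      (\<lambda>k. f (chart_inv c u) *\<^sub>R frechet_derivative (vf_rep A c X) (at u) k +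
        frechet_derivative (\<lambda>u. f (chart_inv c u)) (at u) k *\<^sub>R vf_rep A c X u)) (at u)"
    by (rule has_derivative_transform_within_open[OF _ open_image[OF c] u]) (simp add: vf_rep_scaleR c)
  from frechet_derivative_at[OF this, symmetric] show ?thesis by simp
qed

lemma linear_frechet_derivative_vf_rep:
  "X \<in> vector_fields A \<Longrightarrow> linear (frechet_derivative (vf_rep A (chart_at A p) X) (at (chart_map (chart_at A p) p)))"
  using smooth_on_linear_deriv[OF vf_smooth[OF _ chart_at(1)]] chart_at by blast

lemma chart_at_image: "chart_map (chart_at A p) p \<in> chart_image (chart_at A p)"
  using chart_at by blast

lemma jacobi_bracket_add_right:
  assumes X: "X \<in> vector_fields A" and Y: "Y \<in> vector_fields A" and Y': "Y' \<in> vector_fields A"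
  shows "jacobi_bracket A X (Y + Y') = jacobi_bracket A X Y + jacobi_bracket A X Y'"
  by (rule ext) (simp add: jacobi_bracket_def Let_def frechet_derivative_vf_rep_add[OF Y Y' chart_at(1) chart_at_image]
      linear_add[OF linear_frechet_derivative_vf_rep[OF X]])

lemma jacobi_bracket_scale_right:
  assumes f: "f \<in> smooth_funs A" and X: "X \<in> vector_fields A" and Y: "Y \<in> vector_fields A"
  shows "jacobi_bracket A X (\<lambda>p. f p *\<^sub>R Y p) p = f p *\<^sub>R jacobi_bracket A X Y p + dir_deriv A X f p *\<^sub>R Y p"
  by (simp add: jacobi_bracket_def dir_deriv_def comp_def Let_def chart_at
      frechet_derivative_vf_rep_scale[OF f Y chart_at(1) chart_at_image]
      linear_cmul[OF linear_frechet_derivative_vf_rep[OF X]] algebra_simps)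

lemma jacobi_bracket_add_left:
  assumes "X \<in> vector_fields A" "X' \<in> vector_fields A" "Y \<in> vector_fields A"
  shows "jacobi_bracket A (X + X') Y = jacobi_bracket A X Y + jacobi_bracket A X' Y"
  using assms jacobi_bracket_add_right jacobi_bracket_skew by (metis minus_add_distrib)

lemma jacobi_bracket_scale_left:
  assumes f: "f \<in> smooth_funs A" and X: "X \<in> vector_fields A" and Y: "Y \<in> vector_fields A"
  shows "jacobi_bracket A (\<lambda>p. f p *\<^sub>R X p) Y p = f p *\<^sub>R jacobi_bracket A X Y p - dir_deriv A Y f p *\<^sub>R X p"
  using jacobi_bracket_scale_right[OF f Y X, of p] jacobi_bracket_skew[of "\<lambda>p. f p *\<^sub>R X p" Y] jacobi_bracket_skew[of X Y]
  by (simp add: algebra_simps)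

text \<open>On functions the brackets become commutators of operators, for which the Jacobi
  identity is a cancellation of twelve terms.\<close>

lemma jacobi_bracket_jacobi:
  assumes X: "X \<in> vector_fields A" and Y: "Y \<in> vector_fields A" and Z: "Z \<in> vector_fields A"
  shows "jacobi_bracket A X (jacobi_bracket A Y Z) + jacobi_bracket A Y (jacobi_bracket A Z X)
    = - jacobi_bracket A Z (jacobi_bracket A X Y)"
proof
  fix p
  have br: "dir_deriv A (jacobi_bracket A X Y) f = (\<lambda>p. dir_deriv A X (dir_deriv A Y f) p - dir_deriv A Y (dir_deriv A X f) p)"
    if "f \<in> smooth_funs A" "X \<in> vector_fields A" "Y \<in> vector_fields A" for X Y f
    using dir_deriv_jacobi_bracket[OF that] by blast
  have nest: "dir_deriv A (jacobi_bracket A X (jacobi_bracket A Y Z)) f p =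
      dir_deriv A X (dir_deriv A Y (dir_deriv A Z f)) p - dir_deriv A X (dir_deriv A Z (dir_deriv A Y f)) p
      - (dir_deriv A Y (dir_deriv A Z (dir_deriv A X f)) p - dir_deriv A Z (dir_deriv A Y (dir_deriv A X f)) p)"
    if f: "f \<in> smooth_funs A" and v: "X \<in> vector_fields A" "Y \<in> vector_fields A" "Z \<in> vector_fields A" for X Y Z f
    using f v by (simp add: dir_deriv_jacobi_bracket jacobi_bracket_vf br[OF f v(2,3)] dir_deriv_diff dir_deriv_smooth)
  have "jacobi_bracket A X (jacobi_bracket A Y Z) p =
     (- jacobi_bracket A Z (jacobi_bracket A X Y) - jacobi_bracket A Y (jacobi_bracket A Z X)) p"
  proof (rule dir_deriv_separate)
    fix f assume f: "f \<in> smooth_funs A"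
    have "- jacobi_bracket A Z (jacobi_bracket A X Y) - jacobi_bracket A Y (jacobi_bracket A Z X) =
       0 - jacobi_bracket A Z (jacobi_bracket A X Y) - jacobi_bracket A Y (jacobi_bracket A Z X)" by simp
    then have "dir_deriv A (- jacobi_bracket A Z (jacobi_bracket A X Y) - jacobi_bracket A Y (jacobi_bracket A Z X)) f p =
       dir_deriv A (0 - jacobi_bracket A Z (jacobi_bracket A X Y)) f p - dir_deriv A (jacobi_bracket A Y (jacobi_bracket A Z X)) f p"
      by (simp only: linear_dir_deriv(2)[OF f])
    also have "\<dots> = dir_deriv A 0 f p - dir_deriv A (jacobi_bracket A Z (jacobi_bracket A X Y)) f p
       - dir_deriv A (jacobi_bracket A Y (jacobi_bracket A Z X)) f p"
      by (simp only: linear_dir_deriv(2)[OF f])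
    also have "dir_deriv A 0 f p = 0"
      using linear_dir_deriv(2)[OF f, of X X p] by (simp only: diff_self)
    finally show "dir_deriv A (jacobi_bracket A X (jacobi_bracket A Y Z)) f p =
      dir_deriv A (- jacobi_bracket A Z (jacobi_bracket A X Y) - jacobi_bracket A Y (jacobi_bracket A Z X)) f p"
      unfolding nest[OF f X Y Z] nest[OF f Y Z X] nest[OF f Z X Y] by linarith
  qed
  then show "(jacobi_bracket A X (jacobi_bracket A Y Z) + jacobi_bracket A Y (jacobi_bracket A Z X)) p
    = (- jacobi_bracket A Z (jacobi_bracket A X Y)) p"
    by (simp add: algebra_simps)
qed

end

section \<open>Torsion and curvature of an affine connection\<close>

lemma endo_app_apply: "endo_app E X p = blinfun_apply (E p) (X p)"
  by (simp add: endo_app_def)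

lemma endo_app_linear:
  "endo_app E (X + Y) = endo_app E X + endo_app E Y"
  "endo_app E (X - Y) = endo_app E X - endo_app E Y"
  "endo_app (E + F) X = endo_app E X + endo_app F X"
  "endo_app (E - F) X = endo_app E X - endo_app F X"
  "endo_app E (\<lambda>p. f p *\<^sub>R X p) = (\<lambda>p. f p *\<^sub>R endo_app E X p)"
  "endo_app (- E) X = - endo_app E X"
  "endo_app (\<lambda>p. f p *\<^sub>R E p) X = (\<lambda>p. f p *\<^sub>R endo_app E X p)"
  by (simp_all add: fun_eq_iff endo_app_def blinfun.bilinear_simps)

lemma (in smooth_manifold) endo_ext:
  assumes "\<And>Z. Z \<in> vector_fields A \<Longrightarrow> endo_app E Z p = endo_app F Z p" shows "E p = F p"
  by (rule endo_eqI) (use assms in \<open>simp add: endo_app_def\<close>)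

lemma (in smooth_manifold) vf_rep_endo_app:
  assumes "c \<in> A" "u \<in> chart_image c"
  shows "vf_rep A c (endo_app E X) u = endo_rep A c E u (vf_rep A c X u)"
  using assms by (simp add: vf_rep_def endo_rep_def endo_app_def Let_def)

lemma (in smooth_manifold) endo_app_vf:
  assumes E: "E \<in> endo_fields A" and X: "X \<in> vector_fields A"
  shows "endo_app E X \<in> vector_fields A"
proof (rule vector_fields_by_rep[OF _ vf_rep_endo_app])
  show "smooth_on (chart_image c) (\<lambda>u. endo_rep A c E u (vf_rep A c X u))" if "c \<in> A" for c
    by (rule smooth_on_linear_family) (auto intro!: open_image linear_endo_rep endo_smooth vf_smooth that E X)
qed

context affine_connection
begin

lemma D_zero_right: assumes "X \<in> vector_fields A" shows "D X 0 = 0"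
  using D_add_right[OF assms vf_zero vf_zero] by simp

lemma D_minus_right: assumes "X \<in> vector_fields A" "Y \<in> vector_fields A" shows "D X (- Y) = - D X Y"
  using D_add_right[OF assms(1) vf_minus[OF assms(2)] assms(2)] D_zero_right[OF assms(1)]
  by (simp add: eq_neg_iff_add_eq_0)

lemma D_diff_right:
  assumes "X \<in> vector_fields A" "Y \<in> vector_fields A" "Z \<in> vector_fields A"
  shows "D X (Y - Z) = D X Y - D X Z"
  using D_add_right[OF assms(1,2) vf_minus[OF assms(3)]] D_minus_right[OF assms(1,3)] by simp

lemma D_cmul_right: "X \<in> vector_fields A \<Longrightarrow> Y \<in> vector_fields A \<Longrightarrow> D X (a *\<^sub>R Y) = a *\<^sub>R D X Y"
  using D_leibniz[OF smooth_funs_const[of a], of X Y] by (simp add: scaleR_fun_def)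

lemma D_cmul_left: "X \<in> vector_fields A \<Longrightarrow> Y \<in> vector_fields A \<Longrightarrow> D (a *\<^sub>R X) Y = a *\<^sub>R D X Y"
  using D_mult_left[OF smooth_funs_const[of a], of X Y] by (simp add: scaleR_fun_def)

lemma D_minus_left: "X \<in> vector_fields A \<Longrightarrow> Y \<in> vector_fields A \<Longrightarrow> D (- X) Y = - D X Y"
  using D_cmul_left[of X Y "-1"] by simp

lemma D_diff_left:
  assumes "X \<in> vector_fields A" "Y \<in> vector_fields A" "Z \<in> vector_fields A"
  shows "D (X - Y) Z = D X Z - D Y Z"
  using D_add_left[OF assms(1) vf_minus[OF assms(2)] assms(3)] D_minus_left[OF assms(2,3)] by simp

lemma D_sum_right:
  assumes "X \<in> vector_fields A" "\<And>i. i \<in> I \<Longrightarrow> Y i \<in> vector_fields A"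
  shows "D X (\<Sum>i\<in>I. Y i) = (\<Sum>i\<in>I. D X (Y i))"
  using assms(2)
proof (induction I rule: infinite_finite_induct)
  case (insert i I)
  have "D X (Y i + sum Y I) = D X (Y i) + D X (sum Y I)"
    by (rule D_add_right) (use insert assms(1) vf_sum[of I Y] in auto)
  moreover have "D X (sum Y I) = (\<Sum>i\<in>I. D X (Y i))" using insert by blast
  ultimately show ?case by (simp only: sum.insert[OF insert(1,2)])
qed (simp_all add: D_zero_right[OF assms(1)])

lemma tensorial_D: "Y \<in> vector_fields A \<Longrightarrow> tensorial A (\<lambda>X. D X Y)"
  by (simp add: tensorial_def D_add_left D_mult_left)

lemmas vf_intros = vf_add vf_minus vf_diff vf_cmul vf_scale vf_zero D_closed jacobi_bracket_vf endo_app_vf dir_deriv_smooth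

lemma torsion_vf: "X \<in> vector_fields A \<Longrightarrow> Y \<in> vector_fields A \<Longrightarrow> torsion A D X Y \<in> vector_fields A"
  unfolding torsion_def by (intro vf_intros)

lemma torsion_skew: "torsion A D X Y = - torsion A D Y X"
  unfolding torsion_def by (subst jacobi_bracket_skew) simp

lemma tensorial_torsion:
  assumes Y: "Y \<in> vector_fields A" shows "tensorial A (\<lambda>X. torsion A D X Y)"
  unfolding tensorial_def
proof (intro conjI ballI)
  show "torsion A D (X + X') Y = torsion A D X Y + torsion A D X' Y"
    if "X \<in> vector_fields A" "X' \<in> vector_fields A" for X X'
    unfolding torsion_def using that Y by (simp add: D_add_left D_add_right jacobi_bracket_add_left algebra_simps)
  show "torsion A D (\<lambda>p. f p *\<^sub>R X p) Y = (\<lambda>p. f p *\<^sub>R torsion A D X Y p)"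
    if "f \<in> smooth_funs A" "X \<in> vector_fields A" for f X
    unfolding torsion_def fun_eq_iff
    using that Y by (simp add: D_mult_left D_leibniz jacobi_bracket_scale_left algebra_simps)
qed

lemma tensorial_torsion': "Y \<in> vector_fields A \<Longrightarrow> tensorial A (\<lambda>X. torsion A D Y X)"
  using tensorial_torsion[of Y] torsion_skew[of Y] by (auto simp: tensorial_def fun_eq_iff)

lemma curvature_op_vf:
  "X \<in> vector_fields A \<Longrightarrow> Y \<in> vector_fields A \<Longrightarrow> Z \<in> vector_fields A \<Longrightarrow> curvature_op A D X Y Z \<in> vector_fields A"
  unfolding curvature_op_def by (intro vf_intros)

text \<open>The terms without derivatives of \<open>Z\<close> combine to \<open>(XYf - YXf -
  [X,Y]f) Z = 0\<close>, and those with one derivative of \<open>f\<close> are symmetric in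
  \<open>X\<close> and \<open>Y\<close>.\<close>

lemma tensorial_curvature_op:
  assumes X: "X \<in> vector_fields A" and Y: "Y \<in> vector_fields A"
  shows "tensorial A (curvature_op A D X Y)"
  unfolding tensorial_def
proof (intro conjI ballI)
  show "curvature_op A D X Y (Z + Z') = curvature_op A D X Y Z + curvature_op A D X Y Z'"
    if "Z \<in> vector_fields A" "Z' \<in> vector_fields A" for Z Z'
    unfolding curvature_op_def using that X Y
    by (simp add: D_add_right vf_intros algebra_simps)
  show "curvature_op A D X Y (\<lambda>p. f p *\<^sub>R Z p) = (\<lambda>p. f p *\<^sub>R curvature_op A D X Y Z p)"
    if f: "f \<in> smooth_funs A" and Z: "Z \<in> vector_fields A" for f Z
  proof -
    have DD: "D X (D Y (\<lambda>p. f p *\<^sub>R Z p)) = (\<lambda>p. dir_deriv A X (dir_deriv A Y f) p *\<^sub>R Z p + dir_deriv A Y f p *\<^sub>R D X Z p)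
        + (\<lambda>p. dir_deriv A X f p *\<^sub>R D Y Z p + f p *\<^sub>R D X (D Y Z) p)"
      if X: "X \<in> vector_fields A" and Y: "Y \<in> vector_fields A" for X Y
    proof -
      have "D Y (\<lambda>p. f p *\<^sub>R Z p) = (\<lambda>p. dir_deriv A Y f p *\<^sub>R Z p) + (\<lambda>p. f p *\<^sub>R D Y Z p)"
        unfolding D_leibniz[OF f Y Z] by (simp add: fun_eq_iff)
      then have "D X (D Y (\<lambda>p. f p *\<^sub>R Z p)) = D X (\<lambda>p. dir_deriv A Y f p *\<^sub>R Z p) + D X (\<lambda>p. f p *\<^sub>R D Y Z p)"
        using D_add_right[OF X vf_scale[OF dir_deriv_smooth[OF f Y] Z] vf_scale[OF f D_closed[OF Y Z]]] by (simp only:)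
      then show ?thesis
        unfolding D_leibniz[OF dir_deriv_smooth[OF f Y] X Z] D_leibniz[OF f X D_closed[OF Y Z]] .
    qed
    show ?thesis
      unfolding curvature_op_def DD[OF X Y] DD[OF Y X] D_leibniz[OF f jacobi_bracket_vf[OF X Y] Z] fun_eq_iff
      by (simp add: dir_deriv_jacobi_bracket[OF f X Y] algebra_simps)
  qed
qed

lemma curvature_op_skew:
  "X \<in> vector_fields A \<Longrightarrow> Y \<in> vector_fields A \<Longrightarrow> Z \<in> vector_fields A \<Longrightarrow> curvature_op A D X Y Z = - curvature_op A D Y X Z"
  unfolding curvature_op_def
  by (subst jacobi_bracket_skew) (simp add: D_minus_left jacobi_bracket_vf)

lemma tensorial_curvature_op_left:
  assumes Y: "Y \<in> vector_fields A" and Z: "Z \<in> vector_fields A"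
  shows "tensorial A (\<lambda>X. curvature_op A D X Y Z)"
  unfolding tensorial_def
proof (intro conjI ballI)
  show "curvature_op A D (X + X') Y Z = curvature_op A D X Y Z + curvature_op A D X' Y Z"
    if "X \<in> vector_fields A" "X' \<in> vector_fields A" for X X'
    unfolding curvature_op_def using that Y Z
    by (simp add: D_add_left D_add_right jacobi_bracket_add_left vf_intros algebra_simps)
  show "curvature_op A D (\<lambda>p. f p *\<^sub>R X p) Y Z = (\<lambda>p. f p *\<^sub>R curvature_op A D X Y Z p)"
    if f: "f \<in> smooth_funs A" and X: "X \<in> vector_fields A" for f X
  proof -
    have "jacobi_bracket A (\<lambda>p. f p *\<^sub>R X p) Y = (\<lambda>p. f p *\<^sub>R jacobi_bracket A X Y p) - (\<lambda>p. dir_deriv A Y f p *\<^sub>R X p)"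
      by (simp add: fun_eq_iff jacobi_bracket_scale_left f X Y)
    then have "D (jacobi_bracket A (\<lambda>p. f p *\<^sub>R X p) Y) Z =
       (\<lambda>p. f p *\<^sub>R D (jacobi_bracket A X Y) Z p) - (\<lambda>p. dir_deriv A Y f p *\<^sub>R D X Z p)"
      using D_diff_left[OF vf_scale[OF f jacobi_bracket_vf[OF X Y]] vf_scale[OF dir_deriv_smooth[OF f Y] X] Z]
      by (simp only: D_mult_left[OF f jacobi_bracket_vf[OF X Y] Z] D_mult_left[OF dir_deriv_smooth[OF f Y] X Z])
    then show ?thesis
      unfolding curvature_op_def D_mult_left[OF f X Z] D_mult_left[OF f X D_closed[OF Y Z]] D_leibniz[OF f Y D_closed[OF X Z]]
      by (simp add: fun_eq_iff algebra_simps)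
  qed
qed

lemma tensorial_curvature_op_mid:
  assumes Y: "Y \<in> vector_fields A" and Z: "Z \<in> vector_fields A"
  shows "tensorial A (\<lambda>X. curvature_op A D Y X Z)"
proof -
  have "curvature_op A D Y X Z = - curvature_op A D X Y Z" if "X \<in> vector_fields A" for X
    using curvature_op_skew that Y Z by blast
  then show ?thesis
    using tensorial_curvature_op_left[OF Y Z] by (simp add: tensorial_def vf_intros fun_eq_iff)
qed

lemma curvature_apply:
  assumes "X \<in> vector_fields A" "Y \<in> vector_fields A" "Z \<in> vector_fields A"
  shows "blinfun_apply (curvature A D X Y p) (Z p) = curvature_op A D X Y Z p"
  unfolding curvature_def using induced_endo_apply[OF tensorial_curvature_op] assms by blast

lemma endo_app_curvature:
  "X \<in> vector_fields A \<Longrightarrow> Y \<in> vector_fields A \<Longrightarrow> Z \<in> vector_fields A \<Longrightarrow> endo_app (curvature A D X Y) Z = curvature_op A D X Y Z"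
  by (simp add: fun_eq_iff endo_app_apply curvature_apply)

lemma curvature_endo_fields: "X \<in> vector_fields A \<Longrightarrow> Y \<in> vector_fields A \<Longrightarrow> curvature A D X Y \<in> endo_fields A"
  unfolding curvature_def by (intro induced_endo_fields tensorial_curvature_op curvature_op_vf)

lemma tensorial_curvature:
  assumes Y: "Y \<in> vector_fields A"
  shows "tensorial A (\<lambda>X. curvature A D X Y)" "tensorial A (\<lambda>X. curvature A D Y X)"
proof -
  have "tensorial A Q" if Q: "\<And>Z. Z \<in> vector_fields A \<Longrightarrow> tensorial A (\<lambda>X. endo_app (Q X) Z)" for Q :: "('m \<Rightarrow> 'e) \<Rightarrow> 'm \<Rightarrow> 'e \<Rightarrow>\<^sub>L 'e"
    unfolding tensorial_def
  proof (intro conjI ballI ext)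
    show "Q (X + X') p = (Q X + Q X') p" if "X \<in> vector_fields A" "X' \<in> vector_fields A" for X X' p
    proof (rule endo_ext)
      fix Z assume "Z \<in> vector_fields A"
      then have "endo_app (Q (X + X')) Z = endo_app (Q X) Z + endo_app (Q X') Z"
        using Q that unfolding tensorial_def by blast
      then show "endo_app (Q (X + X')) Z p = endo_app (Q X + Q X') Z p"
        by (simp only: endo_app_linear)
    qed
    show "Q (\<lambda>p. f p *\<^sub>R X p) p = f p *\<^sub>R Q X p" if "f \<in> smooth_funs A" "X \<in> vector_fields A" for f X p
    proof -
      have "Q (\<lambda>p. f p *\<^sub>R X p) p = (\<lambda>p. f p *\<^sub>R Q X p) p"
      proof (rule endo_ext)
        fix Z assume "Z \<in> vector_fields A"
        then have "endo_app (Q (\<lambda>p. f p *\<^sub>R X p)) Z = (\<lambda>p. f p *\<^sub>R endo_app (Q X) Z p)"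
          using Q that unfolding tensorial_def by blast
        then show "endo_app (Q (\<lambda>p. f p *\<^sub>R X p)) Z p = endo_app (\<lambda>p. f p *\<^sub>R Q X p) Z p"
          by (simp only: endo_app_linear)
      qed
      then show ?thesis .
    qed
  qed note * = this
  have "tensorial A (\<lambda>X. endo_app (curvature A D X Y) Z)" "tensorial A (\<lambda>X. endo_app (curvature A D Y X) Z)"
    if Z: "Z \<in> vector_fields A" for Z
    using tensorial_curvature_op_left[OF Y Z] tensorial_curvature_op_mid[OF Y Z] Y Z
    by (simp_all add: tensorial_def endo_app_curvature vf_intros)
  then show "tensorial A (\<lambda>X. curvature A D X Y)" "tensorial A (\<lambda>X. curvature A D Y X)"
    by (auto intro: *)
qed

lemma curvature_skew:
  assumes "X \<in> vector_fields A" "Y \<in> vector_fields A" shows "curvature A D X Y = - curvature A D Y X"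
proof
  fix p show "curvature A D X Y p = (- curvature A D Y X) p"
  proof (rule endo_ext)
    fix Z assume Z: "Z \<in> vector_fields A"
    show "endo_app (curvature A D X Y) Z p = endo_app (- curvature A D Y X) Z p"
      unfolding endo_app_linear endo_app_curvature[OF assms Z] endo_app_curvature[OF assms(2,1) Z]
      by (subst curvature_op_skew[OF assms Z]) (rule refl)
  qed
qed

lemma tensorial_cov_deriv_endo:
  assumes X: "X \<in> vector_fields A" and E: "E \<in> endo_fields A"
  shows "tensorial A (\<lambda>Y. D X (endo_app E Y) - endo_app E (D X Y))"
  unfolding tensorial_def
proof (intro conjI ballI)
  show "D X (endo_app E (Y + Y')) - endo_app E (D X (Y + Y')) = D X (endo_app E Y) - endo_app E (D X Y) + (D X (endo_app E Y') - endo_app E (D X Y'))"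
    if "Y \<in> vector_fields A" "Y' \<in> vector_fields A" for Y Y'
    using that X E by (simp add: endo_app_linear D_add_right vf_intros algebra_simps)
  show "D X (endo_app E (\<lambda>p. f p *\<^sub>R Y p)) - endo_app E (D X (\<lambda>p. f p *\<^sub>R Y p)) =
      (\<lambda>p. f p *\<^sub>R (D X (endo_app E Y) - endo_app E (D X Y)) p)"
    if f: "f \<in> smooth_funs A" and Y: "Y \<in> vector_fields A" for f Y
    unfolding endo_app_linear D_leibniz[OF f X Y] D_leibniz[OF f X endo_app_vf[OF E Y]]
    by (simp add: fun_eq_iff endo_app_def blinfun.bilinear_simps algebra_simps)
qed

lemma cov_deriv_endo_apply:
  assumes "X \<in> vector_fields A" "E \<in> endo_fields A" "Y \<in> vector_fields A"
  shows "blinfun_apply (cov_deriv_endo A D X E p) (Y p) = D X (endo_app E Y) p - blinfun_apply (E p) (D X Y p)"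
  unfolding cov_deriv_endo_def
  using induced_endo_apply[OF tensorial_cov_deriv_endo[OF assms(1,2)] assms(3)] by (simp add: endo_app_apply)

lemma endo_app_cov_deriv_endo:
  assumes "X \<in> vector_fields A" "E \<in> endo_fields A" "Y \<in> vector_fields A"
  shows "endo_app (cov_deriv_endo A D X E) Y = D X (endo_app E Y) - endo_app E (D X Y)"
  by (simp add: fun_eq_iff cov_deriv_endo_apply[OF assms] endo_app_apply)

lemma cov_deriv_endo_fields:
  "X \<in> vector_fields A \<Longrightarrow> E \<in> endo_fields A \<Longrightarrow> cov_deriv_endo A D X E \<in> endo_fields A"
  unfolding cov_deriv_endo_def by (intro induced_endo_fields tensorial_cov_deriv_endo vf_intros)

section \<open>Connection coefficients in a chart\<close>

text \<open>The bilinear map \<open>\<Gamma>\<^sub>u(v,w)\<close> given by the Christoffel symbols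
  of the chart; it has this meaning where the cut-off function is 1.\<close>

definition christoffel :: "('m, 'e) chart \<Rightarrow> ('m \<Rightarrow> real) \<Rightarrow> 'e \<Rightarrow> 'e \<Rightarrow> 'e \<Rightarrow> 'e" where
  "christoffel c \<rho> u v w = (\<Sum>a\<in>Basis. \<Sum>b\<in>Basis. ((v \<bullet> a) * (w \<bullet> b)) *\<^sub>R
     vf_rep A c (D (chart_frame A c \<rho> a) (chart_frame A c \<rho> b)) u)"

lemma smooth_on_christoffel:
  assumes "chart_cutoff A c W \<rho>" shows "smooth_on W (\<lambda>u. christoffel c \<rho> u v w)"
  unfolding christoffel_def
  by (intro smooth_on_sum smooth_on_bounded_linear[OF bounded_linear_scaleR_right] chart_cutoffD(2)[OF assms]
      smooth_on_subset[OF vf_smooth[OF D_closed[OF chart_frame_vf[OF assms] chart_frame_vf[OF assms]]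
        chart_cutoffD(1)[OF assms]] chart_cutoffD(3)[OF assms]])

lemma bilinear_christoffel:
  "christoffel c \<rho> u (v + v') w = christoffel c \<rho> u v w + christoffel c \<rho> u v' w"
  "christoffel c \<rho> u v (w + w') = christoffel c \<rho> u v w + christoffel c \<rho> u v w'"
  "christoffel c \<rho> u (r *\<^sub>R v) w = r *\<^sub>R christoffel c \<rho> u v w"
  "christoffel c \<rho> u v (r *\<^sub>R w) = r *\<^sub>R christoffel c \<rho> u v w"
  by (simp_all add: christoffel_def inner_add_left algebra_simps sum.distrib scaleR_sum_right)

text \<open>The coordinate formula \<open>\<nabla>\<^sub>X Y = dY(X) + \<Gamma>(X,Y)\<close>. The
  derivative of \<open>\<rho>\<^sup>2\<close> vanishes over \<open>W\<close>, so \<open>Y\<close>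
  may be replaced by \<open>\<rho>\<^sup>2 Y\<close>, which is a combination of global frame
  fields, without changing \<open>\<nabla>\<^sub>X Y\<close> there. This is how locality follows
  from the Leibniz rule.\<close>

lemma vf_rep_D:
  assumes W: "chart_cutoff A c W \<rho>" and u: "u \<in> W" and X: "X \<in> vector_fields A" and Y: "Y \<in> vector_fields A"
  shows "vf_rep A c (D X Y) u =
    frechet_derivative (vf_rep A c Y) (at u) (vf_rep A c X u) + christoffel c \<rho> u (vf_rep A c X u) (vf_rep A c Y u)"
proof -
  note C = chart_cutoffD[OF W]
  let ?E = "chart_frame A c \<rho>"
  define q where "q = chart_inv c u"
  have ui: "u \<in> chart_image c" using C(3) u by blast
  then have q: "q \<in> chart_dom c" "chart_map c q = u" by (auto simp: q_def)
  note E = chart_frame_vf[OF W]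
  have r2: "(\<lambda>q. \<rho> q * \<rho> q) \<in> smooth_funs A" using C(4) smooth_funs_mult by blast
  \<comment> \<open>\<open>\<rho>\<^sup>2\<close> is constant near \<open>q\<close>.\<close>
  have "dir_deriv A X (\<lambda>q. \<rho> q * \<rho> q) q = 0"
    unfolding dir_deriv_chart[OF r2 C(1) q(1)]
    by (rule frechet_derivative_locally_const[OF C(2)]) (use u q C(5) in auto)
  then have "D X Y q = D X (\<lambda>q. (\<rho> q * \<rho> q) *\<^sub>R Y q) q"
    unfolding D_leibniz[OF r2 X Y] using C(7)[OF q(1)] q u by simp
  also have "\<dots> = (\<Sum>b\<in>Basis. D X (\<lambda>q. frame_coeff c \<rho> Y b q *\<^sub>R ?E b q) q)"
    unfolding frame_expansion[OF W]
    by (subst D_sum_right) (auto simp: fun_sum_apply intro!: vf_scale frame_coeff_smooth[OF W] X Y E)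
  also have "\<dots> = (\<Sum>b\<in>Basis. (frechet_derivative (vf_rep A c Y) (at u) (vf_rep A c X u) \<bullet> b) *\<^sub>R from_chart A c q b
      + (vf_rep A c Y u \<bullet> b) *\<^sub>R (\<Sum>a\<in>Basis. (vf_rep A c X u \<bullet> a) *\<^sub>R D (?E a) (?E b) q))"
  proof (rule sum.cong[OF refl])
    fix b :: 'e assume "b \<in> Basis"
    note f = frame_coeff_smooth[OF W Y, of b]
    have "((\<lambda>u. vf_rep A c Y u \<bullet> b) has_derivative (\<lambda>k. frechet_derivative (vf_rep A c Y) (at u) k \<bullet> b)) (at u)"
      by (intro has_derivative_inner_left smooth_on_has_derivative[OF vf_smooth[OF Y C(1)]] ui)
    then have "((\<lambda>u. frame_coeff c \<rho> Y b (chart_inv c u)) has_derivative (\<lambda>k. frechet_derivative (vf_rep A c Y) (at u) k \<bullet> b)) (at u)"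
      by (rule has_derivative_transform_within_open[OF _ C(2) u])
        (use C(3,5) in \<open>auto simp: frame_coeff_def subset_iff\<close>)
    from frechet_derivative_at[OF this, symmetric]
    have 1: "dir_deriv A X (frame_coeff c \<rho> Y b) q = frechet_derivative (vf_rep A c Y) (at u) (vf_rep A c X u) \<bullet> b"
      unfolding dir_deriv_chart[OF f C(1) q(1)] q(2) by simp
    have 2: "D X (?E b) q = (\<Sum>a\<in>Basis. (vf_rep A c X u \<bullet> a) *\<^sub>R D (?E a) (?E b) q)"
      using tensorial_expansion[OF tensorial_D[OF E] W q(1) _ X] q(2) u by simp
    have r1: "\<rho> q = 1" using C(7)[OF q(1)] q u by simp
    have 3: "frame_coeff c \<rho> Y b q = vf_rep A c Y u \<bullet> b" "?E b q = from_chart A c q b"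
      by (simp_all add: r1 frame_coeff_def q(2) chart_frame_def)
    show "D X (\<lambda>q. frame_coeff c \<rho> Y b q *\<^sub>R ?E b q) q =
      (frechet_derivative (vf_rep A c Y) (at u) (vf_rep A c X u) \<bullet> b) *\<^sub>R from_chart A c q b
      + (vf_rep A c Y u \<bullet> b) *\<^sub>R (\<Sum>a\<in>Basis. (vf_rep A c X u \<bullet> a) *\<^sub>R D (?E a) (?E b) q)"
      unfolding D_leibniz[OF f X E] 1 2 3 ..
  qed
  finally have *: "D X Y q = \<dots>" .
  note lin = linear_to_chart[OF C(1) q(1)]
  have "vf_rep A c (D X Y) u = to_chart A c q (D X Y q)" by (simp add: vf_rep_def q_def Let_def)
  also have "\<dots> = (\<Sum>b\<in>Basis. (frechet_derivative (vf_rep A c Y) (at u) (vf_rep A c X u) \<bullet> b) *\<^sub>R b)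
      + (\<Sum>b\<in>Basis. \<Sum>a\<in>Basis. ((vf_rep A c X u \<bullet> a) * (vf_rep A c Y u \<bullet> b)) *\<^sub>R to_chart A c q (D (?E a) (?E b) q))"
    unfolding * by (simp add: linear_sum[OF lin] linear_add[OF lin] linear_cmul[OF lin] C(1) q(1) sum.distrib scaleR_sum_right mult.commute)
  also have "(\<Sum>b\<in>Basis. \<Sum>a\<in>Basis. ((vf_rep A c X u \<bullet> a) * (vf_rep A c Y u \<bullet> b)) *\<^sub>R to_chart A c q (D (?E a) (?E b) q))
      = christoffel c \<rho> u (vf_rep A c X u) (vf_rep A c Y u)"
    unfolding christoffel_def by (subst sum.swap) (simp add: vf_rep_def q_def Let_def)
  finally show ?thesis by (simp add: euclidean_representation)
qed

lemma vf_rep_D_frame: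
  assumes W: "chart_cutoff A c W \<rho>" and u: "u \<in> W"
  shows "vf_rep A c (D (chart_frame A c \<rho> v) (chart_frame A c \<rho> w)) u = christoffel c \<rho> u v w"
proof -
  have "frechet_derivative (vf_rep A c (chart_frame A c \<rho> w)) (at u) k = 0" for k
    by (rule frechet_derivative_locally_const[OF chart_cutoffD(2)[OF W] u]) (rule vf_rep_chart_frame[OF W])
  then show ?thesis
    using vf_rep_D[OF W u chart_frame_vf[OF W] chart_frame_vf[OF W]] by (simp add: vf_rep_chart_frame[OF W u])
qed

end

section \<open>Bianchi identities for parallel torsion and curvature\<close>

locale parallel_connection = affine_connection A D
  for A :: "('m::{t2_space, second_countable_topology}, 'e::euclidean_space) chart set"
    and D :: "('m \<Rightarrow> 'e) \<Rightarrow> ('m \<Rightarrow> 'e) \<Rightarrow> 'm \<Rightarrow> 'e" +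
  assumes curvature_par: "curvature_parallel A D"
    and torsion_par: "torsion_parallel A D"
begin

lemma D_torsion:
  assumes "W \<in> vector_fields A" "X \<in> vector_fields A" "Y \<in> vector_fields A"
  shows "D W (torsion A D X Y) = torsion A D (D W X) Y + torsion A D X (D W Y)"
  using torsion_par assms unfolding torsion_parallel_def by (metis add.commute diff_eq_eq eq_iff_diff_eq_0)

lemma cov_deriv_curvature:
  assumes "W \<in> vector_fields A" "X \<in> vector_fields A" "Y \<in> vector_fields A"
  shows "cov_deriv_endo A D W (curvature A D X Y) = curvature A D (D W X) Y + curvature A D X (D W Y)"
  using curvature_par assms unfolding curvature_parallel_def by (metis add.commute diff_eq_eq eq_iff_diff_eq_0)

lemma D_curvature_op:
  assumes W: "W \<in> vector_fields A" and X: "X \<in> vector_fields A" and Y: "Y \<in> vector_fields A" and Z: "Z \<in> vector_fields A"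
  shows "D W (curvature_op A D X Y Z) = curvature_op A D (D W X) Y Z + curvature_op A D X (D W Y) Z + curvature_op A D X Y (D W Z)"
proof -
  have "endo_app (cov_deriv_endo A D W (curvature A D X Y)) Z = D W (endo_app (curvature A D X Y) Z) - endo_app (curvature A D X Y) (D W Z)"
    by (rule endo_app_cov_deriv_endo[OF W curvature_endo_fields[OF X Y] Z])
  then show ?thesis
    unfolding cov_deriv_curvature[OF W X Y] endo_app_linear
    using W X Y Z by (simp add: endo_app_curvature D_closed algebra_simps)
qed

lemmas torsion_diff_left = tensorial_diff[OF tensorial_torsion]
lemmas curvature_op_diff_left = tensorial_diff[OF tensorial_curvature_op_left]

text \<open>Apply \<open>\<nabla>\<^sub>X\<close> to \<open>\<nabla>\<^sub>Y Z - \<nabla>\<^sub>Z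
  Y = T(Y,Z) + [Y,Z]\<close>, expand \<open>\<nabla>\<^sub>X T(Y,Z)\<close> by \<open>\<nabla>T =
  0\<close>, and sum cyclically. The iterated brackets cancel by the Jacobi identity.\<close>

lemma first_bianchi:
  assumes X: "X \<in> vector_fields A" and Y: "Y \<in> vector_fields A" and Z: "Z \<in> vector_fields A"
  shows "curvature_op A D X Y Z + curvature_op A D Y Z X + curvature_op A D Z X Y =
    torsion A D (torsion A D X Y) Z + torsion A D (torsion A D Y Z) X + torsion A D (torsion A D Z X) Y"
proof -
  let ?T = "torsion A D" and ?J = "jacobi_bracket A"
  have *: "D X (D Y Z) - D X (D Z Y) - D (?J Y Z) X = ?T (D X Y) Z + ?T Y (D X Z) + ?T X (?J Y Z) + ?J X (?J Y Z)"
    if X: "X \<in> vector_fields A" and Y: "Y \<in> vector_fields A" and Z: "Z \<in> vector_fields A" for X Y Z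
  proof -
    have "D Y Z - D Z Y = ?T Y Z + ?J Y Z" by (simp add: torsion_def)
    then have "D X (D Y Z) - D X (D Z Y) = D X (?T Y Z) + D X (?J Y Z)"
      using X Y Z by (metis D_diff_right D_add_right D_closed torsion_vf jacobi_bracket_vf)
    then show ?thesis
      unfolding D_torsion[OF X Y Z] by (simp add: torsion_def[of A D X "?J Y Z"])
  qed
  have T: "?T (?T X Y) Z = ?T (D X Y) Z - ?T (D Y X) Z + ?T Z (?J X Y)"
    if X: "X \<in> vector_fields A" and Y: "Y \<in> vector_fields A" and Z: "Z \<in> vector_fields A" for X Y Z
  proof -
    have "?T (?T X Y) Z = ?T (D X Y) Z - ?T (D Y X) Z - ?T (?J X Y) Z"
      unfolding torsion_def[of A D X Y] using X Y Z by (simp add: torsion_diff_left vf_intros)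
    then show ?thesis using torsion_skew[of Z "?J X Y"] by simp
  qed
  have "curvature_op A D X Y Z + curvature_op A D Y Z X + curvature_op A D Z X Y =
     (D X (D Y Z) - D X (D Z Y) - D (?J Y Z) X) + (D Y (D Z X) - D Y (D X Z) - D (?J Z X) Y)
      + (D Z (D X Y) - D Z (D Y X) - D (?J X Y) Z)"
    by (simp add: curvature_op_def algebra_simps)
  also have "\<dots> = (?T (D X Y) Z + ?T Y (D X Z) + ?T X (?J Y Z)) + (?T (D Y Z) X + ?T Z (D Y X) + ?T Y (?J Z X))
      + (?T (D Z X) Y + ?T X (D Z Y) + ?T Z (?J X Y)) + (?J X (?J Y Z) + ?J Y (?J Z X) + ?J Z (?J X Y))"
    unfolding *[OF X Y Z] *[OF Y Z X] *[OF Z X Y] by (simp add: algebra_simps)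
  also have "?J X (?J Y Z) + ?J Y (?J Z X) + ?J Z (?J X Y) = 0"
    using jacobi_bracket_jacobi[OF X Y Z] by simp
  also have "?T Y (D X Z) = - ?T (D X Z) Y" by (rule torsion_skew)
  also have "?T Z (D Y X) = - ?T (D Y X) Z" by (rule torsion_skew)
  also have "?T X (D Z Y) = - ?T (D Z Y) X" by (rule torsion_skew)
  also have "?T (D X Y) Z + - ?T (D X Z) Y + ?T X (?J Y Z) + (?T (D Y Z) X + - ?T (D Y X) Z + ?T Y (?J Z X))
      + (?T (D Z X) Y + - ?T (D Z Y) X + ?T Z (?J X Y)) + 0 = ?T (?T X Y) Z + ?T (?T Y Z) X + ?T (?T Z X) Y"
    unfolding T[OF X Y Z] T[OF Y Z X] T[OF Z X Y] by (simp add: algebra_simps)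
  finally show ?thesis .
qed

text \<open>Expand \<open>\<nabla>\<^sub>X (R(Y,Z)V)\<close> by \<open>\<nabla>R = 0\<close> and
  sum cyclically. The third derivatives of \<open>V\<close> cancel as in the Jacobi identity for
  the operators \<open>\<nabla>\<^sub>X\<close>, \<open>\<nabla>\<^sub>Y\<close>,
  \<open>\<nabla>\<^sub>Z\<close>, and the iterated brackets of the fields cancel as well.\<close>

lemma second_bianchi:
  assumes X: "X \<in> vector_fields A" and Y: "Y \<in> vector_fields A" and Z: "Z \<in> vector_fields A" and V: "V \<in> vector_fields A"
  shows "curvature_op A D (torsion A D X Y) Z V + curvature_op A D (torsion A D Y Z) X V + curvature_op A D (torsion A D Z X) Y V = 0"
proof -
  let ?R = "curvature_op A D" and ?J = "jacobi_bracket A"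
  have *: "?R (D X Y) Z V + ?R Y (D X Z) V + ?R X (?J Y Z) V + D (?J X (?J Y Z)) V =
      D X (D Y (D Z V)) - D X (D Z (D Y V)) - D Y (D Z (D X V)) + D Z (D Y (D X V))"
    if X: "X \<in> vector_fields A" and Y: "Y \<in> vector_fields A" and Z: "Z \<in> vector_fields A" for X Y Z
  proof -
    have "?R (D X Y) Z V + ?R Y (D X Z) V = D X (?R Y Z V) - ?R Y Z (D X V)"
      unfolding D_curvature_op[OF X Y Z V] by simp
    also have "\<dots> = D X (D Y (D Z V)) - D X (D Z (D Y V)) - D X (D (?J Y Z) V) - D Y (D Z (D X V)) + D Z (D Y (D X V)) + D (?J Y Z) (D X V)"
      unfolding curvature_op_def using X Y Z V by (simp add: D_diff_right vf_intros)
    finally have 1: "?R (D X Y) Z V + ?R Y (D X Z) V = \<dots>" .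
    have 2: "?R X (?J Y Z) V = D X (D (?J Y Z) V) - D (?J Y Z) (D X V) - D (?J X (?J Y Z)) V"
      by (simp add: curvature_op_def)
    show ?thesis unfolding 1 2 by (simp add: algebra_simps)
  qed
  have T: "?R (torsion A D X Y) Z V = ?R (D X Y) Z V - ?R (D Y X) Z V - ?R (?J X Y) Z V"
    if X: "X \<in> vector_fields A" and Y: "Y \<in> vector_fields A" and Z: "Z \<in> vector_fields A" for X Y Z
    unfolding torsion_def using X Y Z V by (simp add: curvature_op_diff_left vf_intros)
  have sk: "?R (?J X Y) Z V = - ?R Z (?J X Y) V" "?R (D X Y) Z V = - ?R Z (D X Y) V"
    if X: "X \<in> vector_fields A" and Y: "Y \<in> vector_fields A" and Z: "Z \<in> vector_fields A" for X Y Z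
    using curvature_op_skew[OF jacobi_bracket_vf[OF X Y] Z V] curvature_op_skew[OF D_closed[OF X Y] Z V] by auto
  have J: "D (?J X (?J Y Z)) V + D (?J Y (?J Z X)) V + D (?J Z (?J X Y)) V = 0"
  proof -
    have "D (?J X (?J Y Z) + ?J Y (?J Z X)) V = D (- ?J Z (?J X Y)) V"
      by (simp only: jacobi_bracket_jacobi[OF X Y Z])
    then show ?thesis using X Y Z V by (simp add: D_add_left D_minus_left vf_intros)
  qed
  let ?L = "\<lambda>X Y Z. ?R (D X Y) Z V + ?R Y (D X Z) V + ?R X (?J Y Z) V + D (?J X (?J Y Z)) V"
  let ?U = "\<lambda>X Y Z. D X (D Y (D Z V)) - D X (D Z (D Y V)) - D Y (D Z (D X V)) + D Z (D Y (D X V))"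
  have "?R (torsion A D X Y) Z V + ?R (torsion A D Y Z) X V + ?R (torsion A D Z X) Y V =
     ?L X Y Z + ?L Y Z X + ?L Z X Y - (D (?J X (?J Y Z)) V + D (?J Y (?J Z X)) V + D (?J Z (?J X Y)) V)"
    unfolding T[OF X Y Z] T[OF Y Z X] T[OF Z X Y] sk(1)[OF X Y Z] sk(1)[OF Y Z X] sk(1)[OF Z X Y]
      sk(2)[OF Y X Z] sk(2)[OF Z Y X] sk(2)[OF X Z Y]
    by (simp add: algebra_simps)
  also have "\<dots> = ?U X Y Z + ?U Y Z X + ?U Z X Y - 0"
    by (simp only: *[OF X Y Z] *[OF Y Z X] *[OF Z X Y] J)
  also have "\<dots> = 0" by (simp add: algebra_simps)
  finally show ?thesis .
qed

end

section \<open>Parallel fields along curves\<close>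

lemma has_vector_derivative_linear_family:
  fixes L :: "real \<Rightarrow> 'a::euclidean_space \<Rightarrow> 'b::real_normed_vector"
  assumes N: "open N" "t \<in> N" and lin: "\<And>s. s \<in> N \<Longrightarrow> linear (L s)"
    and L: "\<And>v. ((\<lambda>s. L s v) has_vector_derivative L' v) (at t)"
    and w: "(w has_vector_derivative w') (at t)"
  shows "((\<lambda>s. L s (w s)) has_vector_derivative (L' (w t) + L t w')) (at t)"
proof -
  have exp: "L s v = (\<Sum>b\<in>Basis. (v \<bullet> b) *\<^sub>R L s b)" if "s \<in> N" for s v
    by (rule linear_basis_expansion[OF lin[OF that]])
  have wb: "((\<lambda>s. w s \<bullet> b) has_real_derivative (w' \<bullet> b)) (at t)" for b
    using bounded_linear.has_vector_derivative[OF bounded_linear_inner_left w]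
    by (simp add: has_real_derivative_iff_has_vector_derivative)
  have "((\<lambda>s. \<Sum>b\<in>Basis. (v \<bullet> b) *\<^sub>R L s b) has_vector_derivative (\<Sum>b\<in>Basis. (v \<bullet> b) *\<^sub>R L' b)) (at t)" for v
    by (intro has_vector_derivative_sum bounded_linear.has_vector_derivative[OF bounded_linear_scaleR_right] L)
  then have "((\<lambda>s. L s v) has_vector_derivative (\<Sum>b\<in>Basis. (v \<bullet> b) *\<^sub>R L' b)) (at t)" for v
    by (rule has_vector_derivative_transform_within_open[OF _ N]) (simp add: exp[symmetric])
  then have L'exp: "L' v = (\<Sum>b\<in>Basis. (v \<bullet> b) *\<^sub>R L' b)" for v
    using L vector_derivative_unique_at by blast
  have "((\<lambda>s. \<Sum>b\<in>Basis. (w s \<bullet> b) *\<^sub>R L s b) has_vector_derivative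
      (\<Sum>b\<in>Basis. (w t \<bullet> b) *\<^sub>R L' b + (w' \<bullet> b) *\<^sub>R L t b)) (at t)"
    by (intro has_vector_derivative_sum has_vector_derivative_scaleR wb L)
  then have "((\<lambda>s. L s (w s)) has_vector_derivative
      (\<Sum>b\<in>Basis. (w t \<bullet> b) *\<^sub>R L' b + (w' \<bullet> b) *\<^sub>R L t b)) (at t)"
    by (rule has_vector_derivative_transform_within_open[OF _ N]) (simp add: exp[symmetric])
  then show ?thesis
    by (simp add: sum.distrib L'exp[symmetric] exp[OF N(2), symmetric])
qed

text \<open>Gronwall's argument: \<open>f = \<bar>v\<bar>\<^sup>2\<close> satisfies
  \<open>\<bar>f'\<bar> \<le> 2 M f\<close>, so \<open>exp (-2Mt) f\<close> does not increase and
  \<open>exp (2Mt) f\<close> does not decrease.\<close>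

lemma linear_ode_zero:
  fixes v :: "real \<Rightarrow> 'a::euclidean_space" and G :: "real \<Rightarrow> 'a \<Rightarrow>\<^sub>L 'a"
  assumes v: "\<And>s. s \<in> {a<..<b} \<Longrightarrow> (v has_vector_derivative G s (v s)) (at s)"
    and M: "\<And>s. s \<in> {a<..<b} \<Longrightarrow> norm (G s) \<le> M"
    and t1: "t1 \<in> {a<..<b}" "v t1 = 0" and t: "t \<in> {a<..<b}"
  shows "v t = 0"
proof -
  define f where "f s = v s \<bullet> v s" for s
  have df: "(f has_real_derivative 2 * (v s \<bullet> G s (v s))) (at s)" if "s \<in> {a<..<b}" for s
  proof -
    have "((\<lambda>s. v s \<bullet> v s) has_vector_derivative (v s \<bullet> G s (v s) + G s (v s) \<bullet> v s)) (at s)"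
      by (rule bounded_bilinear.has_vector_derivative[OF bounded_bilinear_inner v[OF that] v[OF that]])
    then show ?thesis
      unfolding f_def by (simp add: has_real_derivative_iff_has_vector_derivative inner_commute)
  qed
  have bd: "\<bar>v s \<bullet> G s (v s)\<bar> \<le> M * f s" if "s \<in> {a<..<b}" for s
  proof -
    have "\<bar>v s \<bullet> G s (v s)\<bar> \<le> norm (v s) * norm (G s (v s))" by (rule Cauchy_Schwarz_ineq2)
    also have "\<dots> \<le> norm (v s) * (norm (G s) * norm (v s))" by (intro mult_left_mono norm_blinfun) auto
    also have "\<dots> \<le> norm (v s) * (M * norm (v s))" by (intro mult_left_mono mult_right_mono M that) auto
    also have "\<dots> = M * f s" by (simp add: f_def power2_norm_eq_inner[symmetric] power2_eq_square)
    finally show ?thesis .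
  qed
  have "f t \<le> 0"
  proof (cases "t1 \<le> t")
    case True
    have "exp (- 2 * M * t) * f t \<le> exp (- 2 * M * t1) * f t1"
    proof (rule DERIV_nonpos_imp_nonincreasing[OF True])
      fix s assume "t1 \<le> s" "s \<le> t"
      then have s: "s \<in> {a<..<b}" using t1 t by auto
      have "((\<lambda>s. exp (- 2 * M * s) * f s) has_real_derivative
          exp (- 2 * M * s) * (2 * (v s \<bullet> G s (v s)) - 2 * M * f s)) (at s)"
        by (rule derivative_eq_intros df[OF s] refl)+ (simp add: algebra_simps)
      moreover have "2 * (v s \<bullet> G s (v s)) - 2 * M * f s \<le> 0" using bd[OF s] by linarith
      ultimately show "\<exists>y. ((\<lambda>s. exp (- 2 * M * s) * f s) has_real_derivative y) (at s) \<and> y \<le> 0"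
        using mult_nonneg_nonpos[OF exp_ge_zero[of "- 2 * M * s"]] by blast
    qed
    then show ?thesis using t1(2) by (simp add: f_def mult_le_0_iff)
  next
    case False
    then have "t \<le> t1" by simp
    have "exp (2 * M * t) * f t \<le> exp (2 * M * t1) * f t1"
    proof (rule DERIV_nonneg_imp_nondecreasing[OF \<open>t \<le> t1\<close>])
      fix s assume "t \<le> s" "s \<le> t1"
      then have s: "s \<in> {a<..<b}" using t1 t by auto
      have "((\<lambda>s. exp (2 * M * s) * f s) has_real_derivative
          exp (2 * M * s) * (2 * (v s \<bullet> G s (v s)) + 2 * M * f s)) (at s)"
        by (rule derivative_eq_intros df[OF s] refl)+ (simp add: algebra_simps)
      moreover have "2 * (v s \<bullet> G s (v s)) + 2 * M * f s \<ge> 0" using bd[OF s] by linarith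
      ultimately show "\<exists>y. ((\<lambda>s. exp (2 * M * s) * f s) has_real_derivative y) (at s) \<and> y \<ge> 0"
        using mult_nonneg_nonneg[OF exp_ge_zero[of "2 * M * s"]] by blast
    qed
    then show ?thesis using t1(2) by (simp add: f_def mult_le_0_iff)
  qed
  then show ?thesis by (metis f_def inner_eq_zero_iff inner_ge_zero order_antisym)
qed

context affine_connection
begin

text \<open>The connection as an operator-valued form: a field with coordinates \<open>v\<close>
  along a curve with coordinates \<open>x\<close> is parallel iff \<open>v' = - conn_form x x'
  v\<close>.\<close>

definition conn_form :: "('m, 'e) chart \<Rightarrow> ('m \<Rightarrow> real) \<Rightarrow> 'e \<Rightarrow> 'e \<Rightarrow> 'e \<Rightarrow>\<^sub>L 'e" where
  "conn_form c \<rho> u a = Blinfun (christoffel c \<rho> u a)"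

lemma conn_form_apply [simp]: "blinfun_apply (conn_form c \<rho> u a) v = christoffel c \<rho> u a v"
proof -
  have "linear (christoffel c \<rho> u a)" by (intro linearI bilinear_christoffel)
  then show ?thesis unfolding conn_form_def
    by (simp add: bounded_linear_Blinfun_apply linear_conv_bounded_linear)
qed

lemma linear_conn_form: "linear (conn_form c \<rho> u)"
  by (intro linearI blinfun_eqI) (simp_all add: blinfun.bilinear_simps bilinear_christoffel)

lemma smooth_on_conn_form: "chart_cutoff A c W \<rho> \<Longrightarrow> smooth_on W (\<lambda>u. conn_form c \<rho> u a)"
  by (rule smooth_on_blinfunI) (auto intro: chart_cutoffD(2) smooth_on_christoffel)

lemma smooth_curve_chart_open:
  assumes "smooth_curve A S \<gamma>" "open S" "c \<in> A" "open W"
  shows "open {s \<in> S. \<gamma> s \<in> chart_dom c \<and> chart_map c (\<gamma> s) \<in> W}"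
proof -
  have "open (\<gamma> -` {p \<in> chart_dom c. chart_map c p \<in> W} \<inter> S)"
    using continuous_on_open_vimage[OF assms(2), THEN iffD1, rule_format, OF _ open_chart_preimage[OF assms(3,4)]]
      assms(1) by (simp add: smooth_curve_def)
  then show ?thesis by (rule back_subst[of "open"]) auto
qed

lemma smooth_curve_dom_open:
  assumes "smooth_curve A S \<gamma>" "open S" "c \<in> A" shows "open {s \<in> S. \<gamma> s \<in> chart_dom c}"
  using smooth_curve_chart_open[OF assms open_UNIV] by simp

lemma smooth_curve_derivative:
  assumes "smooth_curve A S \<gamma>" "c \<in> A" "t \<in> S" "\<gamma> t \<in> chart_dom c"
  shows "((\<lambda>s. chart_map c (\<gamma> s)) has_vector_derivative vector_derivative (\<lambda>s. chart_map c (\<gamma> s)) (at t)) (at t)"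
proof -
  have "smooth_on {s \<in> S. \<gamma> s \<in> chart_dom c} (\<lambda>s. chart_map c (\<gamma> s))"
    using assms by (simp add: smooth_curve_def comp_def)
  from smooth_on_has_derivative[OF this, of t]
  have "(\<lambda>s. chart_map c (\<gamma> s)) differentiable (at t)" using assms by (auto simp: differentiable_def)
  then show ?thesis by (simp add: vector_derivative_works)
qed

lemma to_chart_velocity:
  assumes \<gamma>: "smooth_curve A S \<gamma>" "open S" and c: "c \<in> A" and t: "t \<in> S" "\<gamma> t \<in> chart_dom c"
  shows "to_chart A c (\<gamma> t) (velocity A \<gamma> t) = vector_derivative (\<lambda>s. chart_map c (\<gamma> s)) (at t)"
proof -
  let ?d = "chart_at A (\<gamma> t)"
  note d = chart_at[of "\<gamma> t"]
  have "((\<lambda>s. chart_map ?d (\<gamma> s)) has_vector_derivative velocity A \<gamma> t) (at t)"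
    using smooth_curve_derivative[OF \<gamma>(1) d(1) t(1) d(2)] by (simp add: velocity_def comp_def)
  from has_derivative_compose[OF this[unfolded has_vector_derivative_def] coord_change_has_derivative[OF d(1) c d(2) t(2)]]
  have "((\<lambda>s. chart_map c (chart_inv ?d (chart_map ?d (\<gamma> s)))) has_vector_derivative
      coord_change ?d c (\<gamma> t) (velocity A \<gamma> t)) (at t)"
    using linear_coord_change[OF d(1) c d(2) t(2)] by (simp add: has_vector_derivative_def linear_cmul)
  then have "((\<lambda>s. chart_map c (\<gamma> s)) has_vector_derivative
      coord_change ?d c (\<gamma> t) (velocity A \<gamma> t)) (at t)"
    by (rule has_vector_derivative_transform_within_open[OF _ smooth_curve_dom_open[OF \<gamma> d(1)]])
      (use t d in auto)
  then show ?thesis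
    unfolding to_chart_def by (simp add: vector_derivative_at)
qed

text \<open>The covariant derivative along a curve is defined through some representation \<open>V
  = \<Sum> f\<^sub>i Y\<^sub>i\<close>. In a chart it becomes \<open>v' + \<Gamma>(x',v)\<close>
  for every such representation.\<close>

lemma cov_deriv_in_chart:
  assumes W: "chart_cutoff A c W \<rho>" and \<gamma>: "smooth_curve A S \<gamma>" "open S"
    and t: "t \<in> S" "\<gamma> t \<in> chart_dom c" "chart_map c (\<gamma> t) \<in> W"
    and cov: "has_cov_deriv_along A D \<gamma> V w t"
  shows "((\<lambda>s. to_chart A c (\<gamma> s) (V s)) has_vector_derivative
    to_chart A c (\<gamma> t) w - christoffel c \<rho> (chart_map c (\<gamma> t)) (vector_derivative (\<lambda>s. chart_map c (\<gamma> s)) (at t)) (to_chart A c (\<gamma> t) (V t))) (at t)"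
proof -
  note C = chart_cutoffD[OF W]
  let ?x = "\<lambda>s. chart_map c (\<gamma> s)"
  let ?x' = "vector_derivative ?x (at t)"
  let ?G = "christoffel c \<rho> (?x t)"
  obtain n :: nat and f f' Y X where X: "X \<in> vector_fields A" "X (\<gamma> t) = velocity A \<gamma> t"
    and Yf: "\<forall>i<n. Y i \<in> vector_fields A \<and> (f i has_real_derivative f' i) (at t)"
    and V: "\<forall>\<^sub>F s in nhds t. V s = (\<Sum>i<n. f i s *\<^sub>R Y i (\<gamma> s))"
    and w: "w = (\<Sum>i<n. f' i *\<^sub>R Y i (\<gamma> t) + f i t *\<^sub>R D X (Y i) (\<gamma> t))"
    using cov unfolding has_cov_deriv_along_def by (elim exE conjE) (rule that; assumption)
  have Y: "Y i \<in> vector_fields A" and f: "(f i has_real_derivative f' i) (at t)" if "i < n" for i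
    using Yf that by auto
  obtain N1 where N1: "open N1" "t \<in> N1" "\<And>s. s \<in> N1 \<Longrightarrow> V s = (\<Sum>i<n. f i s *\<^sub>R Y i (\<gamma> s))"
    using V unfolding eventually_nhds by blast
  define N where "N = N1 \<inter> {s \<in> S. \<gamma> s \<in> chart_dom c}"
  have N: "open N" "t \<in> N" using N1 smooth_curve_dom_open[OF \<gamma> C(1)] t by (auto simp: N_def)
  have xi: "?x t \<in> chart_image c" using t by blast
  have rep: "to_chart A c (\<gamma> s) (\<Sum>i<n. r i *\<^sub>R Z i (\<gamma> s)) = (\<Sum>i<n. r i *\<^sub>R vf_rep A c (Z i) (?x s))"
    if "\<gamma> s \<in> chart_dom c" for s r Z
    using linear_to_chart[OF C(1) that] by (simp add: linear_sum linear_cmul vf_rep_at C(1) that)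
  have dY: "((\<lambda>s. vf_rep A c (Y i) (?x s)) has_vector_derivative frechet_derivative (vf_rep A c (Y i)) (at (?x t)) ?x') (at t)"
    if "i < n" for i
  proof -
    have sm: "smooth_on (chart_image c) (vf_rep A c (Y i))" using vf_smooth[OF Y[OF that] C(1)] .
    have "((\<lambda>s. vf_rep A c (Y i) (?x s)) has_derivative (\<lambda>k. frechet_derivative (vf_rep A c (Y i)) (at (?x t)) (k *\<^sub>R ?x'))) (at t)"
      by (rule has_derivative_compose[OF smooth_curve_derivative[OF \<gamma>(1) C(1) t(1,2), unfolded has_vector_derivative_def]
            smooth_on_has_derivative[OF sm xi]])
    then show ?thesis
      using smooth_on_linear_deriv[OF sm xi] by (simp add: has_vector_derivative_def linear_cmul)
  qed
  have "((\<lambda>s. \<Sum>i<n. f i s *\<^sub>R vf_rep A c (Y i) (?x s)) has_vector_derivative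
     (\<Sum>i<n. f i t *\<^sub>R frechet_derivative (vf_rep A c (Y i)) (at (?x t)) ?x' + f' i *\<^sub>R vf_rep A c (Y i) (?x t))) (at t)"
    by (intro has_vector_derivative_sum has_vector_derivative_scaleR f dY) auto
  then have dv: "((\<lambda>s. to_chart A c (\<gamma> s) (V s)) has_vector_derivative
     (\<Sum>i<n. f i t *\<^sub>R frechet_derivative (vf_rep A c (Y i)) (at (?x t)) ?x' + f' i *\<^sub>R vf_rep A c (Y i) (?x t))) (at t)"
    by (rule has_vector_derivative_transform_within_open[OF _ N]) (auto simp: N_def N1(3) intro!: rep[symmetric])
  have X': "vf_rep A c X (?x t) = ?x'"
    using to_chart_velocity[OF \<gamma> C(1) t(1,2)] by (simp add: vf_rep_at C(1) t(2) X(2))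
  have "to_chart A c (\<gamma> t) w = (\<Sum>i<n. f' i *\<^sub>R vf_rep A c (Y i) (?x t)) + (\<Sum>i<n. f i t *\<^sub>R vf_rep A c (D X (Y i)) (?x t))"
    unfolding w sum.distrib linear_add[OF linear_to_chart[OF C(1) t(2)]]
      rep[OF t(2), of f' Y] rep[OF t(2), of "\<lambda>i. f i t" "\<lambda>i. D X (Y i)"] ..
  also have "(\<Sum>i<n. f i t *\<^sub>R vf_rep A c (D X (Y i)) (?x t)) =
      (\<Sum>i<n. f i t *\<^sub>R (frechet_derivative (vf_rep A c (Y i)) (at (?x t)) ?x' + ?G ?x' (vf_rep A c (Y i) (?x t))))"
    by (intro sum.cong refl) (simp add: vf_rep_D[OF W t(3) X(1) Y] X')
  also have "\<dots> = (\<Sum>i<n. f i t *\<^sub>R frechet_derivative (vf_rep A c (Y i)) (at (?x t)) ?x') + ?G ?x' (\<Sum>i<n. f i t *\<^sub>R vf_rep A c (Y i) (?x t))"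
    unfolding conn_form_apply[symmetric] by (simp add: blinfun.sum_right blinfun.bilinear_simps sum.distrib algebra_simps)
  also have "(\<Sum>i<n. f i t *\<^sub>R vf_rep A c (Y i) (?x t)) = to_chart A c (\<gamma> t) (V t)"
    using N1(3)[OF N1(2)] rep[OF t(2), of "\<lambda>i. f i t" Y] by simp
  finally show ?thesis using dv by (simp add: sum.distrib add.commute)
qed

text \<open>Conversely, the coordinates of \<open>V\<close> and the frame fields of the chart form
  a representation of \<open>V\<close> near \<open>t\<close>.\<close>

lemma cov_deriv_from_chart:
  assumes W: "chart_cutoff A c W \<rho>" and \<gamma>: "smooth_curve A S \<gamma>" "open S"
    and t: "t \<in> S" "\<gamma> t \<in> chart_dom c" "chart_map c (\<gamma> t) \<in> W"
    and v: "((\<lambda>s. to_chart A c (\<gamma> s) (V s)) has_vector_derivative v') (at t)"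
  shows "has_cov_deriv_along A D \<gamma> V (from_chart A c (\<gamma> t) (v' +
    christoffel c \<rho> (chart_map c (\<gamma> t)) (vector_derivative (\<lambda>s. chart_map c (\<gamma> s)) (at t)) (to_chart A c (\<gamma> t) (V t)))) t"
proof -
  note C = chart_cutoffD[OF W]
  let ?x = "\<lambda>s. chart_map c (\<gamma> s)" and ?v = "\<lambda>s. to_chart A c (\<gamma> s) (V s)"
  let ?x' = "vector_derivative ?x (at t)"
  let ?E = "chart_frame A c \<rho>"
  note E = chart_frame_vf[OF W]
  obtain h where h: "bij_betw h {..<DIM('e)} (Basis :: 'e set)"
    using ex_bij_betw_nat_finite[of "Basis :: 'e set"] by (auto simp: atLeast0LessThan)
  obtain X where X: "X \<in> vector_fields A" "X (\<gamma> t) = velocity A \<gamma> t" using vector_field_through by blast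
  have re: "(\<Sum>i<DIM('e). g (h i)) = (\<Sum>b\<in>Basis. g b)" for g :: "'e \<Rightarrow> 'e"
    by (rule sum.reindex_bij_betw[OF h])
  have Ev: "?E b (\<gamma> s) = from_chart A c (\<gamma> s) b" if "\<gamma> s \<in> chart_dom c" "?x s \<in> W" for b s
    using C(7)[OF that] by (simp add: chart_frame_def)
  have V: "V s = (\<Sum>i<DIM('e). (?v s \<bullet> h i) *\<^sub>R ?E (h i) (\<gamma> s))" if "\<gamma> s \<in> chart_dom c" "?x s \<in> W" for s
    unfolding Ev[OF that] re[of "\<lambda>b. (?v s \<bullet> b) *\<^sub>R from_chart A c (\<gamma> s) b"]
    using linear_basis_expansion[OF linear_from_chart[OF C(1) that(1)], of "?v s"]
    by (simp add: C(1) that(1))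
  have 1: "\<forall>\<^sub>F s in nhds t. V s = (\<Sum>i<DIM('e). (?v s \<bullet> h i) *\<^sub>R ?E (h i) (\<gamma> s))"
    unfolding eventually_nhds
    by (rule exI[of _ "{s \<in> S. \<gamma> s \<in> chart_dom c \<and> ?x s \<in> W}"])
      (use smooth_curve_chart_open[OF \<gamma> C(1,2)] t V in auto)
  have 2: "((\<lambda>s. ?v s \<bullet> b) has_real_derivative (v' \<bullet> b)) (at t)" for b
    using bounded_linear.has_vector_derivative[OF bounded_linear_inner_left v]
    by (simp add: has_real_derivative_iff_has_vector_derivative)
  have X': "vf_rep A c X (?x t) = ?x'"
    using to_chart_velocity[OF \<gamma> C(1) t(1,2)] by (simp add: vf_rep_at C(1) t(2) X(2))
  have G: "D X (?E b) (\<gamma> t) = from_chart A c (\<gamma> t) (christoffel c \<rho> (?x t) ?x' b)" for b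
  proof -
    have "frechet_derivative (vf_rep A c (?E b)) (at (?x t)) k = 0" for k
      by (rule frechet_derivative_locally_const[OF C(2) t(3)]) (rule vf_rep_chart_frame[OF W])
    then have "vf_rep A c (D X (?E b)) (?x t) = christoffel c \<rho> (?x t) ?x' b"
      by (simp add: vf_rep_D[OF W t(3) X(1) E] X' vf_rep_chart_frame[OF W t(3)])
    then show ?thesis using from_chart_vf_rep[OF C(1) t(2)] by metis
  qed
  have "from_chart A c (\<gamma> t) (v' + christoffel c \<rho> (?x t) ?x' (?v t)) =
      (\<Sum>i<DIM('e). (v' \<bullet> h i) *\<^sub>R ?E (h i) (\<gamma> t) + (?v t \<bullet> h i) *\<^sub>R D X (?E (h i)) (\<gamma> t))"
  proof -
    note lin = linear_from_chart[OF C(1) t(2)]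
    have "christoffel c \<rho> (?x t) ?x' (?v t) = (\<Sum>b\<in>Basis. (?v t \<bullet> b) *\<^sub>R christoffel c \<rho> (?x t) ?x' b)"
      by (rule linear_basis_expansion) (intro linearI bilinear_christoffel)
    then have "from_chart A c (\<gamma> t) (christoffel c \<rho> (?x t) ?x' (?v t)) = (\<Sum>b\<in>Basis. (?v t \<bullet> b) *\<^sub>R D X (?E b) (\<gamma> t))"
      by (simp only: linear_sum[OF lin] linear_cmul[OF lin] G)
    moreover have "from_chart A c (\<gamma> t) v' = (\<Sum>b\<in>Basis. (v' \<bullet> b) *\<^sub>R ?E b (\<gamma> t))"
      unfolding Ev[OF t(2,3)] by (rule linear_basis_expansion[OF lin])
    ultimately show ?thesis
      unfolding re[of "\<lambda>b. (v' \<bullet> b) *\<^sub>R ?E b (\<gamma> t) + (?v t \<bullet> b) *\<^sub>R D X (?E b) (\<gamma> t)"]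
      by (simp only: linear_add[OF lin] sum.distrib)
  qed
  then show ?thesis
    unfolding has_cov_deriv_along_def
    by (intro exI[of _ "DIM('e)"] exI[of _ "\<lambda>i s. ?v s \<bullet> h i"] exI[of _ "\<lambda>i. v' \<bullet> h i"]
        exI[of _ "\<lambda>i. ?E (h i)"] exI[of _ X] conjI allI impI X E 1 2)
qed

lemma parallel_iff_chart:
  assumes W: "chart_cutoff A c W \<rho>" and \<gamma>: "smooth_curve A S \<gamma>" "open S"
    and t: "t \<in> S" "\<gamma> t \<in> chart_dom c" "chart_map c (\<gamma> t) \<in> W"
  shows "has_cov_deriv_along A D \<gamma> V 0 t \<longleftrightarrow> ((\<lambda>s. to_chart A c (\<gamma> s) (V s)) has_vector_derivative
    - conn_form c \<rho> (chart_map c (\<gamma> t)) (vector_derivative (\<lambda>s. chart_map c (\<gamma> s)) (at t)) (to_chart A c (\<gamma> t) (V t))) (at t)"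
proof -
  note C = chart_cutoffD[OF W]
  have "to_chart A c (\<gamma> t) 0 = 0" "from_chart A c (\<gamma> t) 0 = 0"
    using linear_0[OF linear_to_chart[OF C(1) t(2)]] linear_0[OF linear_from_chart[OF C(1) t(2)]] .
  then show ?thesis
    using cov_deriv_in_chart[OF assms, of V 0] cov_deriv_from_chart[OF assms, of V
        "- conn_form c \<rho> (chart_map c (\<gamma> t)) (vector_derivative (\<lambda>s. chart_map c (\<gamma> s)) (at t)) (to_chart A c (\<gamma> t) (V t))"]
    by (auto simp: blinfun.bilinear_simps)
qed

lemma chart_cutoff_curve:
  obtains c W \<rho> where "chart_cutoff A c W \<rho>" "p \<in> chart_dom c" "chart_map c p \<in> W" "c = chart_at A p"
  using chart_cutoff_exists[OF chart_at] chart_at by metis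

lemma parallel_along_diff:
  assumes \<gamma>: "smooth_curve A S \<gamma>" "open S" and "parallel_along A D S \<gamma> U" "parallel_along A D S \<gamma> V"
  shows "parallel_along A D S \<gamma> (\<lambda>s. U s - V s)"
  unfolding parallel_along_def
proof
  fix t assume t: "t \<in> S"
  obtain c W \<rho> where c: "chart_cutoff A c W \<rho>" "\<gamma> t \<in> chart_dom c" "chart_map c (\<gamma> t) \<in> W"
    using chart_cutoff_curve by metis
  note C = chart_cutoffD[OF c(1)]
  let ?K = "conn_form c \<rho> (chart_map c (\<gamma> t)) (vector_derivative (\<lambda>s. chart_map c (\<gamma> s)) (at t))"
  have UV: "((\<lambda>s. to_chart A c (\<gamma> s) (U s)) has_vector_derivative - ?K (to_chart A c (\<gamma> t) (U t))) (at t)"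
    "((\<lambda>s. to_chart A c (\<gamma> s) (V s)) has_vector_derivative - ?K (to_chart A c (\<gamma> t) (V t))) (at t)"
    using assms(3,4) t unfolding parallel_along_def parallel_iff_chart[OF c(1) \<gamma> t c(2,3), symmetric] by auto
  have "((\<lambda>s. to_chart A c (\<gamma> s) (U s - V s)) has_vector_derivative
      - ?K (to_chart A c (\<gamma> t) (U t)) - - ?K (to_chart A c (\<gamma> t) (V t))) (at t)"
    by (rule has_vector_derivative_transform_within_open[OF has_vector_derivative_diff[OF UV] smooth_curve_dom_open[OF \<gamma> C(1)]])
      (use t c(2) C(1) in \<open>auto simp: linear_diff[OF linear_to_chart]\<close>)
  then show "has_cov_deriv_along A D \<gamma> (\<lambda>s. U s - V s) 0 t"
    unfolding parallel_iff_chart[OF c(1) \<gamma> t c(2,3)]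
    by (simp add: linear_diff[OF linear_to_chart[OF C(1) c(2)]] blinfun.bilinear_simps)
qed

text \<open>In a chart, parallel fields solve a linear differential equation whose coefficients
  are bounded on a compact neighbourhood of \<open>t0\<close>.\<close>

lemma parallel_along_zero_locally:
  assumes \<gamma>: "smooth_curve A S \<gamma>" "open S" and V: "parallel_along A D S \<gamma> V" and t0: "t0 \<in> S"
  shows "\<exists>N. open N \<and> t0 \<in> N \<and> (\<forall>t1\<in>N. \<forall>t\<in>N. V t1 = 0 \<longrightarrow> V t = 0)"
proof -
  obtain c W \<rho> where c: "chart_cutoff A c W \<rho>" "\<gamma> t0 \<in> chart_dom c" "chart_map c (\<gamma> t0) \<in> W"
    using chart_cutoff_curve by metis
  note C = chart_cutoffD[OF c(1)]
  define N where "N = {s \<in> S. \<gamma> s \<in> chart_dom c \<and> chart_map c (\<gamma> s) \<in> W}"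
  let ?x = "\<lambda>s. chart_map c (\<gamma> s)"
  define G where "G s = - conn_form c \<rho> (?x s) (vector_derivative ?x (at s))" for s
  have N: "open N" "t0 \<in> N" using smooth_curve_chart_open[OF \<gamma> C(1,2)] t0 c by (auto simp: N_def)
  have x: "smooth_on N ?x"
    by (rule smooth_on_subset[of "{s \<in> S. \<gamma> s \<in> chart_dom c}"])
      (use \<gamma>(1) C(1) in \<open>auto simp: smooth_curve_def comp_def N_def\<close>)
  have "frechet_derivative ?x (at s) 1 = vector_derivative ?x (at s)" if "s \<in> N" for s
  proof -
    have "(?x has_derivative (\<lambda>k. k *\<^sub>R vector_derivative ?x (at s))) (at s)"
      using smooth_curve_derivative[OF \<gamma>(1) C(1), of s] that by (auto simp: N_def has_vector_derivative_def)
    from frechet_derivative_at[OF this, symmetric] show ?thesis by simp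
  qed
  then have x': "smooth_on N (\<lambda>s. vector_derivative ?x (at s))"
    by (subst smooth_on_cong[OF N(1), where g = "\<lambda>s. frechet_derivative ?x (at s) 1"]) (auto intro: smooth_on_deriv x)
  have "smooth_on N (\<lambda>s. conn_form c \<rho> (?x s) (vector_derivative ?x (at s)))"
  proof (rule smooth_on_linear_family[OF N(1) linear_conn_form _ x'])
    show "smooth_on N (\<lambda>s. conn_form c \<rho> (?x s) b)" for b
      by (rule smooth_on_compose[OF N(1) C(2) _ x smooth_on_conn_form[OF c(1)]]) (auto simp: N_def)
  qed
  then have contG: "continuous_on N G" unfolding G_def
    by (intro continuous_intros smooth_on_continuous)
  obtain e where e: "e > 0" "cball t0 e \<subseteq> N" using N open_contains_cball by blast
  have "compact (G ` cball t0 e)"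
    using continuous_on_subset[OF contG e(2)] by (intro compact_continuous_image) auto
  then obtain M where M: "\<And>s. s \<in> cball t0 e \<Longrightarrow> norm (G s) \<le> M"
    by (metis compact_imp_bounded bounded_iff imageI)
  have sub: "{t0 - e<..<t0 + e} \<subseteq> cball t0 e" by (auto simp: dist_real_def)
  have "V t = 0" if "t1 \<in> {t0 - e<..<t0 + e}" "t \<in> {t0 - e<..<t0 + e}" "V t1 = 0" for t1 t
  proof -
    have tN: "t \<in> N" "t1 \<in> N" using that sub e by blast+
    have "to_chart A c (\<gamma> t) (V t) = 0"
    proof (rule linear_ode_zero[where v = "\<lambda>s. to_chart A c (\<gamma> s) (V s)" and G = G and M = M and a = "t0 - e" and b = "t0 + e" and ?t1.0 = t1])
      fix s assume s: "s \<in> {t0 - e<..<t0 + e}"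
      then have sN: "s \<in> N" using sub e by blast
      then have sS: "s \<in> S" "\<gamma> s \<in> chart_dom c" "?x s \<in> W" by (auto simp: N_def)
      show "((\<lambda>s. to_chart A c (\<gamma> s) (V s)) has_vector_derivative blinfun_apply (G s) (to_chart A c (\<gamma> s) (V s))) (at s)"
        using V[unfolded parallel_along_def, rule_format, OF sS(1)]
        unfolding parallel_iff_chart[OF c(1) \<gamma> sS] G_def by (simp only: blinfun.minus_left)
      show "norm (G s) \<le> M" using M s sub by blast
    next
      show "to_chart A c (\<gamma> t1) (V t1) = 0"
        using tN(2) that(3) by (simp add: N_def linear_0[OF linear_to_chart[OF C(1)]])
    qed (use that in auto)
    then have "from_chart A c (\<gamma> t) (to_chart A c (\<gamma> t) (V t)) = 0"
      using tN by (simp add: N_def linear_0[OF linear_from_chart[OF C(1)]])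
    then show ?thesis using tN C(1) by (simp add: N_def)
  qed
  then have "\<forall>t1\<in>{t0 - e<..<t0 + e}. \<forall>t\<in>{t0 - e<..<t0 + e}. V t1 = 0 \<longrightarrow> V t = 0" by blast
  moreover have "t0 \<in> {t0 - e<..<t0 + e}" using e(1) by simp
  ultimately show ?thesis using open_greaterThanLessThan[of "t0 - e" "t0 + e"] by (intro exI conjI)
qed

lemma parallel_along_zero:
  assumes \<gamma>: "smooth_curve A S \<gamma>" "open S" and V: "parallel_along A D S \<gamma> V" and S: "{0..1} \<subseteq> S"
    and ab: "a \<in> {0..1}" "b \<in> {0..1}" "V a = 0"
  shows "V b = 0"
proof (rule connected_induction_simple[of "{0..1::real}" a b "\<lambda>t. V t = 0"])
  fix t :: real assume t: "t \<in> {0..1}"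
  obtain N where N: "open N" "t \<in> N" "\<forall>t1\<in>N. \<forall>t\<in>N. V t1 = 0 \<longrightarrow> V t = 0"
    using parallel_along_zero_locally[OF \<gamma> V subsetD[OF S t]] by auto
  then show "\<exists>T. openin (top_of_set {0..1}) T \<and> t \<in> T \<and> (\<forall>x\<in>T. \<forall>y\<in>T. V x = 0 \<longrightarrow> V y = 0)"
    using t by (intro exI[of _ "{0..1} \<inter> N"]) (auto simp: openin_open)
qed (use ab in auto)

lemma parallel_along_unique:
  assumes \<gamma>: "smooth_curve A S \<gamma>" "open S" and S: "{0..1} \<subseteq> S"
    and U: "parallel_along A D S \<gamma> U" and V: "parallel_along A D S \<gamma> V"
    and ab: "a \<in> {0..1}" "b \<in> {0..1}" "U a = V a"
  shows "U b = V b"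
  using parallel_along_zero[OF \<gamma> parallel_along_diff[OF \<gamma> U V] S ab(1,2)] ab(3) by simp

lemma is_transport_alongD:
  assumes "is_transport_along A D S \<gamma> L" "smooth_curve A S \<gamma>" "open S" "{0..1} \<subseteq> S" "parallel_along A D S \<gamma> V"
  shows "V 1 = L (V 0)"
proof -
  obtain U where U: "parallel_along A D S \<gamma> U" "U 0 = V 0" "U 1 = L (V 0)"
    using assms(1) unfolding is_transport_along_def by blast
  then show ?thesis using parallel_along_unique[OF assms(2-4) assms(5) U(1), of 0 1] by simp
qed

section \<open>Parallel transport is invertible\<close>

lemma smooth_curve_reverse:
  assumes \<gamma>: "smooth_curve A S \<gamma>" "open S"
  shows "smooth_curve A {t. 1 - t \<in> S} (\<lambda>t. \<gamma> (1 - t))"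
  unfolding smooth_curve_def
proof (intro conjI ballI)
  show "continuous_on {t. 1 - t \<in> S} (\<lambda>t. \<gamma> (1 - t))"
  proof (rule continuous_on_compose2[of S \<gamma>])
    show "continuous_on S \<gamma>" using \<gamma>(1) by (simp add: smooth_curve_def)
    show "continuous_on {t. 1 - t \<in> S} (\<lambda>t. 1 - t)" by (intro continuous_intros)
  qed auto
next
  fix c assume c: "c \<in> A"
  have op: "open {t \<in> S. \<gamma> t \<in> chart_dom c}" by (rule smooth_curve_dom_open[OF \<gamma> c])
  have "open ((\<lambda>t. 1 - t) -` {t \<in> S. \<gamma> t \<in> chart_dom c})"
    by (intro open_vimage[OF op] continuous_intros)
  then have op': "open {t \<in> {t. 1 - t \<in> S}. \<gamma> (1 - t) \<in> chart_dom c}" by (rule back_subst[of "open"]) auto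
  have "smooth_on {t \<in> {t. 1 - t \<in> S}. \<gamma> (1 - t) \<in> chart_dom c} (\<lambda>t. (chart_map c \<circ> \<gamma>) (1 - t))"
    by (rule smooth_on_compose[OF op' op, where g = "chart_map c \<circ> \<gamma>" and f = "\<lambda>t. 1 - t"])
      (use \<gamma>(1) c smooth_on_diff[OF op' smooth_on_const[OF op'] smooth_on_id[OF op'], of 1] in \<open>auto simp: smooth_curve_def\<close>)
  then show "smooth_on {t \<in> {t. 1 - t \<in> S}. \<gamma> (1 - t) \<in> chart_dom c} (chart_map c \<circ> (\<lambda>t. \<gamma> (1 - t)))"
    by (simp add: comp_def)
qed

lemma has_vector_derivative_reverse:
  fixes f :: "real \<Rightarrow> 'b::real_normed_vector"
  assumes "(f has_vector_derivative d) (at (1 - t))"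
  shows "((\<lambda>t. f (1 - t)) has_vector_derivative - d) (at t)"
proof -
  have "((\<lambda>t. 1 - t) has_vector_derivative - 1) (at t)"
    by (auto intro!: derivative_eq_intros simp: has_real_derivative_iff_has_vector_derivative[symmetric])
  from vector_diff_chain_at[OF this assms] show ?thesis by (simp add: comp_def)
qed

lemma parallel_along_reverse:
  assumes \<gamma>: "smooth_curve A S \<gamma>" "open S" and V: "parallel_along A D S \<gamma> V"
  shows "parallel_along A D {t. 1 - t \<in> S} (\<lambda>t. \<gamma> (1 - t)) (\<lambda>t. V (1 - t))"
  unfolding parallel_along_def
proof
  fix t assume t: "t \<in> {t. 1 - t \<in> S}"
  then have t': "1 - t \<in> S" by simp
  obtain c W \<rho> where c: "chart_cutoff A c W \<rho>" "\<gamma> (1 - t) \<in> chart_dom c" "chart_map c (\<gamma> (1 - t)) \<in> W"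
    using chart_cutoff_curve by metis
  note C = chart_cutoffD[OF c(1)]
  let ?x = "\<lambda>s. chart_map c (\<gamma> s)"
  have "open ((\<lambda>t. 1 - t) -` S)" by (intro open_vimage[OF \<gamma>(2)] continuous_intros)
  then have op: "open {t. 1 - t \<in> S}" by (rule back_subst[of "open"]) auto
  have x': "vector_derivative (\<lambda>s. ?x (1 - s)) (at t) = - vector_derivative ?x (at (1 - t))"
    by (rule vector_derivative_at[OF has_vector_derivative_reverse[OF smooth_curve_derivative[OF \<gamma>(1) C(1) t' c(2)]]])
  have "((\<lambda>s. to_chart A c (\<gamma> s) (V s)) has_vector_derivative
    - conn_form c \<rho> (?x (1 - t)) (vector_derivative ?x (at (1 - t))) (to_chart A c (\<gamma> (1 - t)) (V (1 - t)))) (at (1 - t))"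
    using V t' parallel_iff_chart[OF c(1) \<gamma> t' c(2,3)] by (auto simp: parallel_along_def)
  from has_vector_derivative_reverse[OF this]
  show "has_cov_deriv_along A D (\<lambda>t. \<gamma> (1 - t)) (\<lambda>t. V (1 - t)) 0 t"
    by (subst parallel_iff_chart[OF c(1) smooth_curve_reverse[OF \<gamma>] op t c(2,3)])
      (simp add: x' linear_neg[OF linear_conn_form] blinfun.bilinear_simps del: conn_form_apply)
qed

text \<open>By uniqueness of parallel fields transport is injective, hence invertible in finite
  dimension, and reversing the parallel fields shows that the inverse belongs to the reversed
  curve.\<close>

lemma transport_inverse:
  assumes L: "is_transport_along A D S \<gamma> L" and \<gamma>: "smooth_curve A S \<gamma>" "open S" "{0..1} \<subseteq> S"
  obtains K where "is_transport_along A D {t. 1 - t \<in> S} (\<lambda>t. \<gamma> (1 - t)) K" "K o\<^sub>L L = id_blinfun" "L o\<^sub>L K = id_blinfun"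
proof -
  have lin: "linear (blinfun_apply L)" by (simp add: bounded_linear.linear blinfun.bounded_linear_right)
  have "v = 0" if "L v = 0" for v
  proof -
    obtain V where V: "parallel_along A D S \<gamma> V" "V 0 = v" "V 1 = L v"
      using L unfolding is_transport_along_def by blast
    then show ?thesis using parallel_along_zero[OF \<gamma>(1,2) V(1) \<gamma>(3), of 1 0] that by simp
  qed
  then have "inj (blinfun_apply L)" using linear_injective_0[OF lin] by blast
  then obtain k where k: "linear k" "\<And>x. k (L x) = x" "\<And>x. L (k x) = x"
    using linear_injective_isomorphism[OF lin] by blast
  define K where "K = Blinfun k"
  have K: "blinfun_apply K x = k x" for x
    using k(1) by (simp add: K_def bounded_linear_Blinfun_apply linear_conv_bounded_linear)
  have "is_transport_along A D {t. 1 - t \<in> S} (\<lambda>t. \<gamma> (1 - t)) K"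
    unfolding is_transport_along_def
  proof
    fix v
    obtain V where V: "parallel_along A D S \<gamma> V" "V 0 = k v" "V 1 = L (k v)"
      using L unfolding is_transport_along_def by blast
    then show "\<exists>V. parallel_along A D {t. 1 - t \<in> S} (\<lambda>t. \<gamma> (1 - t)) V \<and> V 0 = v \<and> V 1 = K v"
      using parallel_along_reverse[OF \<gamma>(1,2) V(1)] by (intro exI[of _ "\<lambda>t. V (1 - t)"]) (simp add: K k)
  qed
  moreover have "K o\<^sub>L L = id_blinfun" "L o\<^sub>L K = id_blinfun"
    by (rule blinfun_eqI, simp add: K k)+
  ultimately show ?thesis using that by blast
qed

lemma parallel_transport_trans:
  assumes "parallel_transport A D q r K" "parallel_transport A D p q L"
  shows "parallel_transport A D p r (K o\<^sub>L L)"
  using assms(1)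
proof induction
  case const
  have "id_blinfun o\<^sub>L L = L" by (rule blinfun_eqI) simp
  then show ?case using assms(2) by simp
next
  case (concat q' M S \<gamma> r K)
  have "(K o\<^sub>L M) o\<^sub>L L = K o\<^sub>L (M o\<^sub>L L)" by (rule blinfun_eqI) simp
  then show ?case using parallel_transport.concat[OF concat.IH concat.hyps(2-7)] by simp
qed

lemma parallel_transport_single:
  assumes "open S" "{0..1} \<subseteq> S" "smooth_curve A S \<gamma>" "is_transport_along A D S \<gamma> K"
  shows "parallel_transport A D (\<gamma> 0) (\<gamma> 1) K"
proof -
  have "K o\<^sub>L id_blinfun = K" by (rule blinfun_eqI) simp
  then show ?thesis
    using parallel_transport.concat[OF parallel_transport.const assms(1-3) refl refl assms(4)] by simp
qed

lemma parallel_transport_inverse: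
  assumes "parallel_transport A D p q L"
  shows "\<exists>K. parallel_transport A D q p K \<and> K o\<^sub>L L = id_blinfun \<and> L o\<^sub>L K = id_blinfun"
  using assms
proof induction
  case const
  have "id_blinfun o\<^sub>L id_blinfun = (id_blinfun :: 'e \<Rightarrow>\<^sub>L 'e)" by (rule blinfun_eqI) simp
  then show ?case using parallel_transport.const by blast
next
  case (concat q L S \<gamma> r K)
  obtain L' where L': "parallel_transport A D q p L'" "L' o\<^sub>L L = id_blinfun" "L o\<^sub>L L' = id_blinfun"
    using concat.IH by blast
  obtain K' where K': "is_transport_along A D {t. 1 - t \<in> S} (\<lambda>t. \<gamma> (1 - t)) K'" "K' o\<^sub>L K = id_blinfun" "K o\<^sub>L K' = id_blinfun"
    using transport_inverse[OF concat.hyps(7,4,2,3)] by blast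
  have "open ((\<lambda>t. 1 - t) -` S)" by (intro open_vimage[OF concat.hyps(2)] continuous_intros)
  then have op: "open {t. 1 - t \<in> S}" by (rule back_subst[of "open"]) auto
  have "parallel_transport A D r q K'"
    using parallel_transport_single[OF op _ smooth_curve_reverse[OF concat.hyps(4,2)] K'(1)] concat.hyps(3,5,6) by force
  then have "parallel_transport A D r p (L' o\<^sub>L K')" using parallel_transport_trans L'(1) by blast
  moreover have "blinfun_apply L' (L x) = x" "blinfun_apply L (L' x) = x"
      "blinfun_apply K' (K x) = x" "blinfun_apply K (K' x) = x" for x
    using L'(2,3) K'(2,3) by (metis blinfun_apply_blinfun_compose blinfun_apply_id_blinfun id_apply)+
  then have "(L' o\<^sub>L K') o\<^sub>L (K o\<^sub>L L) = id_blinfun" "(K o\<^sub>L L) o\<^sub>L (L' o\<^sub>L K') = id_blinfun"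
    by (auto intro!: blinfun_eqI)
  ultimately show ?case by blast
qed

end

section \<open>Linear differential equations with a parameter\<close>

lemma blinfun_compose_assoc: "(x o\<^sub>L y) o\<^sub>L z = x o\<^sub>L (y o\<^sub>L z)"
  by (rule blinfun_eqI) simp

lemma blinfun_compose_id [simp]: "id_blinfun o\<^sub>L x = x" "x o\<^sub>L id_blinfun = x"
  by (rule blinfun_eqI, simp)+

text \<open>This is \<open>\<integral> F(\<sigma>,t) d\<sigma>\<close> from 0 to \<open>s\<close>,
  after the substitution \<open>\<sigma> = r s\<close>. Over the fixed interval, one formula
  covers both signs of \<open>s\<close>, and continuity in \<open>(s,t)\<close> and
  differentiability in \<open>t\<close> are those of integrals that depend on parameters.\<close>

definition int_from_0 :: "(real \<Rightarrow> real \<Rightarrow> 'b::banach) \<Rightarrow> real \<Rightarrow> real \<Rightarrow> 'b" where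
  "int_from_0 F s t = integral (cbox 0 1) (\<lambda>r. s *\<^sub>R F (r * s) t)"

lemma continuous_on_UNIV_pair:
  fixes F :: "'c::topological_space \<Rightarrow> 'd::topological_space \<Rightarrow> 'b::topological_space"
  assumes "continuous_on UNIV (\<lambda>(s, t). F s t)" "continuous_on S f" "continuous_on S g"
  shows "continuous_on S (\<lambda>x. F (f x) (g x))"
  using continuous_on_compose2[OF assms(1) continuous_on_Pair[OF assms(2,3)]] by simp

lemma int_from_0_continuous:
  assumes "continuous_on UNIV (\<lambda>(s, t). F s t)"
  shows "continuous_on UNIV (\<lambda>(s, t). int_from_0 F s t)"
proof -
  have "continuous_on (UNIV \<times> cbox 0 1) (\<lambda>(x, r). fst x *\<^sub>R F (r * fst x) (snd x))"
    unfolding split_beta by (intro continuous_intros continuous_on_UNIV_pair[OF assms])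
  from integral_continuous_on_param[OF this] show ?thesis
    by (simp add: int_from_0_def split_beta)
qed

lemma int_from_0_derivative:
  fixes F :: "real \<Rightarrow> real \<Rightarrow> 'b::banach"
  assumes "continuous_on UNIV (\<lambda>s. F s t)"
  shows "((\<lambda>s. int_from_0 F s t) has_vector_derivative F s t) (at s)"
proof -
  define M where "M = \<bar>s\<bar> + 1"
  obtain g where g: "\<And>x. x \<in> {-M..M} \<Longrightarrow> (g has_vector_derivative F x t) (at x within {-M..M})"
    using antiderivative_continuous[OF continuous_on_subset[OF assms]] by blast
  have eq: "int_from_0 F x t = g x - g 0" if "x \<in> {-M<..<M}" for x
  proof -
    have "((\<lambda>r. g (r * x)) has_vector_derivative x *\<^sub>R F (r * x) t) (at r within {0..1})" if r: "r \<in> {0..1}" for r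
    proof -
      have sub: "(\<lambda>r. r * x) ` {0..1} \<subseteq> {-M..M}"
      proof
        fix y assume "y \<in> (\<lambda>r. r * x) ` {0..1}"
        then obtain q where q: "0 \<le> q" "q \<le> 1" "y = q * x" by auto
        have "\<bar>y\<bar> \<le> 1 * \<bar>x\<bar>" unfolding q(3) abs_mult using q by (intro mult_right_mono) auto
        then show "y \<in> {-M..M}" using \<open>x \<in> {-M<..<M}\<close> by auto
      qed
      have 1: "((\<lambda>r. r * x) has_vector_derivative x) (at r within {0..1})"
        by (auto intro!: derivative_eq_intros simp: has_real_derivative_iff_has_vector_derivative[symmetric])
      have 2: "(g has_vector_derivative F (r * x) t) (at (r * x) within (\<lambda>r. r * x) ` {0..1})"
        using sub r by (intro has_vector_derivative_within_subset[OF g sub]) (simp add: image_subset_iff)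
      show ?thesis using vector_diff_chain_within[OF 1 2] by (simp add: comp_def)
    qed
    from fundamental_theorem_of_calculus[OF _ this]
    have "((\<lambda>r. x *\<^sub>R F (r * x) t) has_integral g x - g 0) (cbox 0 1)" by simp
    then show ?thesis unfolding int_from_0_def by (rule integral_unique)
  qed
  have "(g has_vector_derivative F s t) (at s within {-M<..<M})"
    by (rule has_vector_derivative_within_subset[OF g]) (auto simp: M_def)
  moreover have "at s within {-M<..<M} = at s" by (rule at_within_open) (auto simp: M_def)
  ultimately have "(g has_vector_derivative F s t) (at s)" by simp
  then have "((\<lambda>x. g x - g 0) has_vector_derivative F s t) (at s)"
    by (auto intro!: derivative_eq_intros)
  then show ?thesis
    by (rule has_vector_derivative_transform_within_open[of _ _ _ "{-M<..<M}"]) (auto simp: eq M_def)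
qed

lemma int_from_0_param_derivative:
  fixes F :: "real \<Rightarrow> real \<Rightarrow> 'b::banach"
  assumes F: "continuous_on UNIV (\<lambda>(s, t). F s t)" and F': "continuous_on UNIV (\<lambda>(s, t). F' s t)"
    and d: "\<And>s t. (F s has_vector_derivative F' s t) (at t)"
  shows "(int_from_0 F s has_vector_derivative int_from_0 F' s t) (at t)"
proof -
  have "((\<lambda>t. integral (cbox 0 1) (\<lambda>r. s *\<^sub>R F (r * s) t)) has_vector_derivative
      integral (cbox 0 1) (\<lambda>r. s *\<^sub>R F' (r * s) t)) (at t within UNIV)"
  proof (rule leibniz_rule_vector_derivative)
    show "((\<lambda>t. s *\<^sub>R F (r * s) t) has_vector_derivative s *\<^sub>R F' (r * s) t) (at t within UNIV)" for t r
      using bounded_linear.has_vector_derivative[OF bounded_linear_scaleR_right d] by simp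
    show "(\<lambda>r. s *\<^sub>R F (r * s) t) integrable_on cbox 0 1" for t
      by (intro integrable_continuous continuous_intros continuous_on_UNIV_pair[OF F])
    show "continuous_on (UNIV \<times> cbox 0 1) (\<lambda>(t, r). s *\<^sub>R F' (r * s) t)"
      unfolding split_beta by (intro continuous_intros continuous_on_UNIV_pair[OF F'])
  qed auto
  then show ?thesis by (simp add: int_from_0_def[abs_def])
qed

lemma int_from_0_0 [simp]: "int_from_0 F 0 t = 0"
  by (simp add: int_from_0_def)

subsection \<open>Existence\<close>

text \<open>Picard iteration: the \<open>n\<close>-th increment is bounded by \<open>(M \<bar>s\<bar>)\<^sup>n / n!\<close>.\<close>

lemma linear_ode_solution:
  fixes mult :: "'b::banach \<Rightarrow> 'b \<Rightarrow> 'b" and a :: "real \<Rightarrow> real \<Rightarrow> 'b"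
  assumes mult: "bounded_bilinear mult" and nm: "\<And>x y. norm (mult x y) \<le> norm x * norm y"
    and a: "continuous_on UNIV (\<lambda>(s, t). a s t)" and M: "\<And>s t. norm (a s t) \<le> M"
  obtains \<Phi> where "continuous_on UNIV (\<lambda>(s, t). \<Phi> s t)" "\<And>t. \<Phi> 0 t = x0"
    "\<And>s t. ((\<lambda>s. \<Phi> s t) has_vector_derivative mult (a s t) (\<Phi> s t)) (at s)"
proof -
  interpret bounded_bilinear mult by (rule mult)
  have M0: "M \<ge> 0" using M[of 0 0] norm_ge_zero order_trans by blast
  define P where "P = rec_nat (\<lambda>s t. x0) (\<lambda>n p. int_from_0 (\<lambda>s t. mult (a s t) (p s t)))"
  have P0: "P 0 = (\<lambda>s t. x0)" and PS: "P (Suc n) = int_from_0 (\<lambda>s t. mult (a s t) (P n s t))" for n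
    by (simp_all add: P_def)
  have contP: "continuous_on UNIV (\<lambda>(s, t). P n s t)" for n
  proof (induction n)
    case (Suc n)
    show ?case unfolding PS
      by (rule int_from_0_continuous) (use continuous_on[OF a Suc] in \<open>simp add: split_beta\<close>)
  qed (simp add: P0 split_beta)
  have bP: "norm (P n s t) \<le> norm x0 * ((M * \<bar>s\<bar>) ^ n / fact n)" for n s t
  proof (induction n arbitrary: s)
    case (Suc n)
    let ?c = "norm x0 * ((M * \<bar>s\<bar>) ^ Suc n / fact n)"
    have bound: "norm (s *\<^sub>R mult (a (r * s) t) (P n (r * s) t)) \<le> ?c * r ^ n" if "r \<in> cbox 0 1" for r
    proof -
      have "norm (s *\<^sub>R mult (a (r * s) t) (P n (r * s) t)) \<le> \<bar>s\<bar> * (norm (a (r * s) t) * norm (P n (r * s) t))"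
        by (simp add: nm mult_left_mono)
      also have "\<dots> \<le> \<bar>s\<bar> * (M * (norm x0 * ((M * \<bar>r * s\<bar>) ^ n / fact n)))"
        by (intro mult_left_mono mult_mono M Suc) (auto simp: M0)
      also have "\<dots> = ?c * r ^ n"
        using that by (simp add: abs_mult power_mult_distrib field_simps)
      finally show ?thesis .
    qed
    have "norm (P (Suc n) s t) \<le> integral (cbox 0 1) (\<lambda>r. ?c * r ^ n)"
      unfolding PS int_from_0_def
      by (rule integral_norm_bound_integral)
        (intro integrable_continuous continuous_intros continuous_on continuous_on_UNIV_pair[OF a] continuous_on_UNIV_pair[OF contP] | rule bound, assumption)+
    also have "integral (cbox 0 1) (\<lambda>r. ?c * r ^ n) = ?c * (1 / real (Suc n))"
    proof -
      have "((\<lambda>r. r ^ n) has_integral 1 / real (Suc n)) {0..1::real}"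
      proof -
        have "((\<lambda>r. r ^ Suc n / real (Suc n)) has_vector_derivative r ^ n) (at r within {0..1})" for r :: real
          unfolding has_real_derivative_iff_has_vector_derivative[symmetric]
          by (rule derivative_eq_intros refl | simp del: of_nat_Suc)+
        from fundamental_theorem_of_calculus[OF _ this] show ?thesis by simp
      qed
      then have "((\<lambda>r. ?c * r ^ n) has_integral ?c * (1 / real (Suc n))) (cbox 0 1 :: real set)"
        unfolding cbox_interval by (rule has_integral_mult_right)
      then show ?thesis by (rule integral_unique)
    qed
    also have "\<dots> = norm x0 * ((M * \<bar>s\<bar>) ^ Suc n / fact (Suc n))"
      unfolding fact_Suc by (simp del: of_nat_Suc power_Suc add: mult.commute)
    finally show ?case .
  qed (simp add: P0)
  have summ: "summable (\<lambda>n. norm x0 * ((M * K) ^ n / fact n))" for K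
    using summable_mult[OF summable_exp[of "M * K"], of "norm x0"] by (simp add: field_simps)
  have bPK: "norm (P n s t) \<le> norm x0 * ((M * K) ^ n / fact n)" if "\<bar>s\<bar> \<le> K" for n s t K
  proof -
    have "(M * \<bar>s\<bar>) ^ n \<le> (M * K) ^ n" using that M0 by (intro power_mono mult_left_mono) auto
    then show ?thesis
      by (intro order_trans[OF bP] mult_left_mono divide_right_mono) auto
  qed
  have sP: "summable (\<lambda>n. P n s t)" for s t
    by (rule summable_comparison_test'[OF summ[of "\<bar>s\<bar>"], of 0]) (use bPK in auto)
  define \<Phi> where "\<Phi> s t = (\<Sum>n. P n s t)" for s t
  have cont: "continuous_on UNIV (\<lambda>(s, t). \<Phi> s t)"
  proof -
    have "continuous (at z) (\<lambda>(s, t). \<Phi> s t)" for z :: "real \<times> real"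
    proof -
      define K where "K = \<bar>fst z\<bar> + 1"
      let ?B = "{-K<..<K} \<times> (UNIV :: real set)"
      have "uniform_limit ?B (\<lambda>n z. \<Sum>i<n. P i (fst z) (snd z)) (\<lambda>z. \<Sum>i. P i (fst z) (snd z)) sequentially"
        by (rule Weierstrass_m_test[OF _ summ[of K]], rule bPK) auto
      moreover have "\<forall>\<^sub>F n in sequentially. continuous_on ?B (\<lambda>z. \<Sum>i<n. P i (fst z) (snd z))"
        by (intro always_eventually allI continuous_on_sum)
          (auto intro!: continuous_on_UNIV_pair[OF contP] continuous_intros)
      ultimately have "continuous_on ?B (\<lambda>z. \<Phi> (fst z) (snd z))"
        unfolding \<Phi>_def by (intro uniform_limit_theorem[of _ "\<lambda>n z. \<Sum>i<n. P i (fst z) (snd z)" sequentially]) simp_all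
      moreover have "open ?B" "z \<in> ?B" by (auto simp: open_Times K_def mem_Times_iff)
      ultimately have "continuous (at z) (\<lambda>z. \<Phi> (fst z) (snd z))"
        using continuous_on_eq_continuous_at by blast
      then show ?thesis by (simp add: case_prod_unfold)
    qed
    then show ?thesis by (simp add: continuous_at_imp_continuous_on)
  qed
  have eq: "\<Phi> s t = x0 + int_from_0 (\<lambda>s t. mult (a s t) (\<Phi> s t)) s t" for s t
  proof -
    let ?f = "\<lambda>n r. s *\<^sub>R mult (a (r * s) t) (P n (r * s) t)"
    let ?K = "\<bar>s\<bar>"
    have rs: "\<bar>r * s\<bar> \<le> ?K" if "r \<in> cbox 0 1" for r
      using that by (auto simp: abs_mult intro!: mult_left_le_one_le)
    have u: "uniform_limit (cbox 0 1) (\<lambda>n r. \<Sum>i<n. ?f i r) (\<lambda>r. \<Sum>i. ?f i r) sequentially"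
    proof (rule Weierstrass_m_test)
      fix n r assume r: "r \<in> cbox (0::real) 1"
      have "norm (?f n r) \<le> \<bar>s\<bar> * (norm (a (r * s) t) * norm (P n (r * s) t))"
        by (simp add: nm mult_left_mono)
      also have "\<dots> \<le> \<bar>s\<bar> * (M * (norm x0 * ((M * ?K) ^ n / fact n)))"
        using M0 by (intro mult_left_mono mult_mono M bPK[OF rs[OF r]]) auto
      finally show "norm (?f n r) \<le> (\<bar>s\<bar> * M) * (norm x0 * ((M * ?K) ^ n / fact n))" by simp
    qed (rule summable_mult[OF summ])
    have sf: "(\<Sum>i. ?f i r) = s *\<^sub>R mult (a (r * s) t) (\<Phi> (r * s) t)" for r
    proof -
      have bl: "bounded_linear (\<lambda>x. s *\<^sub>R mult (a (r * s) t) x)"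
        using bounded_linear_compose[OF bounded_linear_scaleR_right bounded_linear_right] .
      show ?thesis unfolding \<Phi>_def by (rule bounded_linear.suminf[OF bl sP, symmetric])
    qed
    have cf: "continuous_on (cbox 0 1) (\<lambda>r. ?f n r)" for n
      by (intro continuous_intros continuous_on continuous_on_UNIV_pair[OF a] continuous_on_UNIV_pair[OF contP])
    have cs: "continuous_on (cbox 0 1) (\<lambda>r. \<Sum>i<n. ?f i r)" for n
      by (intro continuous_on_sum cf)
    obtain I J where IJ: "\<And>n. ((\<lambda>r. \<Sum>i<n. ?f i r) has_integral I n) (cbox 0 1)"
      "((\<lambda>r. \<Sum>i. ?f i r) has_integral J) (cbox 0 1)" "(I \<longlongrightarrow> J) sequentially"
      by (rule uniform_limit_integral_cbox[OF u cs sequentially_bot], rule that)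
    have "I n = (\<Sum>i<n. P (Suc i) s t)" for n
    proof -
      have "((\<lambda>r. \<Sum>i<n. ?f i r) has_integral (\<Sum>i<n. P (Suc i) s t)) (cbox 0 1)"
        unfolding PS int_from_0_def
        by (intro has_integral_sum integrable_integral integrable_continuous cf) auto
      then show ?thesis using IJ(1) has_integral_unique by blast
    qed
    then have "I = (\<lambda>n. \<Sum>i<n. P (Suc i) s t)" by (rule ext)
    then have "(\<lambda>i. P (Suc i) s t) sums J" using IJ(3) by (simp only: sums_def)
    then have "(\<Sum>i. P (Suc i) s t) = J" by (simp add: sums_iff)
    also have "J = int_from_0 (\<lambda>s t. mult (a s t) (\<Phi> s t)) s t"
      using IJ(2) unfolding sf int_from_0_def by (rule integral_unique[symmetric])
    finally show ?thesis
      unfolding suminf_split_head[OF sP] by (simp add: P0 \<Phi>_def[of s t] algebra_simps)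
  qed
  have "((\<lambda>s. \<Phi> s t) has_vector_derivative mult (a s t) (\<Phi> s t)) (at s)" for s t
  proof -
    have "((\<lambda>s. int_from_0 (\<lambda>s t. mult (a s t) (\<Phi> s t)) s t) has_vector_derivative mult (a s t) (\<Phi> s t)) (at s)"
      by (rule int_from_0_derivative)
        (intro continuous_on continuous_on_UNIV_pair[OF a] continuous_on_UNIV_pair[OF cont] continuous_intros)
    then have "((\<lambda>s. x0 + int_from_0 (\<lambda>s t. mult (a s t) (\<Phi> s t)) s t) has_vector_derivative mult (a s t) (\<Phi> s t)) (at s)"
      by (auto intro!: derivative_eq_intros)
    then show ?thesis
      by (rule has_vector_derivative_transform_within_open[of _ _ _ UNIV]) (auto simp: eq[symmetric])
  qed
  moreover have "\<Phi> 0 t = x0" for t using eq[of 0 t] by simp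
  ultimately show ?thesis using that cont by blast
qed

text \<open>The inverse of the solution is obtained as solution \<open>\<Psi>\<close> of the
  adjoint equation, because then \<open>\<Psi> \<Phi>\<close> has derivative 0. In this way it
  inherits continuity in both variables.\<close>

lemma solution_operator_exists:
  fixes a :: "real \<Rightarrow> real \<Rightarrow> 'e::euclidean_space \<Rightarrow>\<^sub>L 'e"
  assumes a: "continuous_on UNIV (\<lambda>(s, t). a s t)" and M: "\<And>s t. norm (a s t) \<le> M"
  obtains \<Phi> \<Psi> where "continuous_on UNIV (\<lambda>(s, t). \<Phi> s t)" "continuous_on UNIV (\<lambda>(s, t). \<Psi> s t)"
    "\<And>t. \<Phi> 0 t = id_blinfun" "\<And>t. \<Psi> 0 t = id_blinfun"
    "\<And>s t. ((\<lambda>s. \<Phi> s t) has_vector_derivative a s t o\<^sub>L \<Phi> s t) (at s)"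
    "\<And>s t. ((\<lambda>s. \<Psi> s t) has_vector_derivative - (\<Psi> s t o\<^sub>L a s t)) (at s)"
    "\<And>s t. \<Psi> s t o\<^sub>L \<Phi> s t = id_blinfun" "\<And>s t. \<Phi> s t o\<^sub>L \<Psi> s t = id_blinfun"
proof -
  interpret c: bounded_bilinear "(o\<^sub>L) :: ('e \<Rightarrow>\<^sub>L 'e) \<Rightarrow> ('e \<Rightarrow>\<^sub>L 'e) \<Rightarrow> ('e \<Rightarrow>\<^sub>L 'e)"
    by (rule bounded_bilinear_blinfun_compose)
  obtain \<Phi> where \<Phi>: "continuous_on UNIV (\<lambda>(s, t). \<Phi> s t)" "\<And>t. \<Phi> 0 t = id_blinfun"
    "\<And>s t. ((\<lambda>s. \<Phi> s t) has_vector_derivative a s t o\<^sub>L \<Phi> s t) (at s)"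
    using linear_ode_solution[OF bounded_bilinear_blinfun_compose norm_blinfun_compose a M] by blast
  have a': "continuous_on UNIV (\<lambda>(s, t). - a s t)" using continuous_on_minus[OF a] by (simp add: split_beta)
  have "bounded_bilinear (\<lambda>x y :: 'e \<Rightarrow>\<^sub>L 'e. y o\<^sub>L x)"
    using bounded_bilinear.flip[OF bounded_bilinear_blinfun_compose] by simp
  from linear_ode_solution[OF this _ a', of M id_blinfun]
  obtain \<Psi> where \<Psi>: "continuous_on UNIV (\<lambda>(s, t). \<Psi> s t)" "\<And>t. \<Psi> 0 t = id_blinfun"
    "\<And>s t. ((\<lambda>s. \<Psi> s t) has_vector_derivative \<Psi> s t o\<^sub>L (- a s t)) (at s)"
    using M by (metis norm_blinfun_compose mult.commute norm_minus_cancel)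
  have "\<Psi> s t o\<^sub>L \<Phi> s t = id_blinfun" for s t
  proof -
    note assoc = blinfun_compose_assoc
    have "((\<lambda>s. \<Psi> s t o\<^sub>L \<Phi> s t) has_vector_derivative
        (\<Psi> s t o\<^sub>L (a s t o\<^sub>L \<Phi> s t)) + ((\<Psi> s t o\<^sub>L - a s t) o\<^sub>L \<Phi> s t)) (at s)" for s
      by (rule c.has_vector_derivative[OF \<Psi>(3) \<Phi>(3)])
    then have "((\<lambda>s. \<Psi> s t o\<^sub>L \<Phi> s t) has_vector_derivative 0) (at s)" for s
      by (simp add: c.minus_left c.minus_right assoc)
    from has_vector_derivative_zero_constant[OF convex_UNIV this] obtain k where
      "\<And>s. \<Psi> s t o\<^sub>L \<Phi> s t = k" by auto
    then have "\<Psi> s t o\<^sub>L \<Phi> s t = \<Psi> 0 t o\<^sub>L \<Phi> 0 t" by simp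
    then show ?thesis by (simp add: \<Phi>(2) \<Psi>(2) blinfun_eqI)
  qed
  moreover have "\<Phi> s t o\<^sub>L \<Psi> s t = id_blinfun" for s t
  proof -
    have "blinfun_apply (\<Psi> s t) \<circ> blinfun_apply (\<Phi> s t) = id"
      by (rule ext) (simp add: calculation blinfun_apply_blinfun_compose[symmetric] del: blinfun_apply_blinfun_compose)
    then have "blinfun_apply (\<Phi> s t) \<circ> blinfun_apply (\<Psi> s t) = id"
      using linear_inverse_left bounded_linear.linear blinfun.bounded_linear_right by metis
    then show ?thesis by (intro blinfun_eqI) (simp add: fun_eq_iff)
  qed
  ultimately show ?thesis using that \<Phi> \<Psi> by (simp add: c.minus_right)
qed

subsection \<open>Smooth dependence on the parameter\<close>

text \<open>Regularity in the parameter \<open>t\<close> with joint continuity in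
  \<open>(s,t)\<close>, a class that is stable under integration in \<open>s\<close>.\<close>

primrec param_Ck :: "nat \<Rightarrow> (real \<Rightarrow> real \<Rightarrow> 'b::real_normed_vector) \<Rightarrow> bool" where
  "param_Ck 0 F \<longleftrightarrow> continuous_on UNIV (\<lambda>(s, t). F s t)"
| "param_Ck (Suc k) F \<longleftrightarrow> continuous_on UNIV (\<lambda>(s, t). F s t) \<and>
     (\<exists>F'. (\<forall>s t. (F s has_vector_derivative F' s t) (at t)) \<and> param_Ck k F')"

lemma param_Ck_continuous: "param_Ck k F \<Longrightarrow> continuous_on UNIV (\<lambda>(s, t). F s t)"
  by (cases k) auto

lemma param_Ck_Suc_imp: "param_Ck (Suc k) F \<Longrightarrow> param_Ck k F"
proof (induction k arbitrary: F)
  case (Suc k)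
  then obtain F' where F': "\<forall>s t. (F s has_vector_derivative F' s t) (at t)" "param_Ck (Suc k) F'" by auto
  then have "param_Ck k F'" using Suc.IH by blast
  then show ?case using F'(1) Suc.prems by auto
qed simp

lemma param_Ck_add: "param_Ck k F \<Longrightarrow> param_Ck k G \<Longrightarrow> param_Ck k (\<lambda>s t. F s t + G s t)"
proof (induction k arbitrary: F G)
  case 0
  then show ?case using continuous_on_add[of UNIV "\<lambda>(s, t). F s t" "\<lambda>(s, t). G s t"] by (simp add: split_beta)
next
  case (Suc k)
  then obtain F' G' where 1: "\<forall>s t. (F s has_vector_derivative F' s t) (at t)" "param_Ck k F'"
    "\<forall>s t. (G s has_vector_derivative G' s t) (at t)" "param_Ck k G'" by auto
  have "continuous_on UNIV (\<lambda>(s, t). F s t + G s t)"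
    using Suc.prems continuous_on_add[of UNIV "\<lambda>(s, t). F s t" "\<lambda>(s, t). G s t"] by (simp add: split_beta)
  moreover have "((\<lambda>t. F s t + G s t) has_vector_derivative F' s t + G' s t) (at t)" for s t
    using 1 by (auto intro!: has_vector_derivative_add)
  ultimately show ?case using Suc.IH[OF 1(2,4)] unfolding param_Ck.simps
    by (intro conjI exI[of _ "\<lambda>s t. F' s t + G' s t"] allI)
qed

lemma param_Ck_bilinear:
  assumes "bounded_bilinear h"
  shows "param_Ck k F \<Longrightarrow> param_Ck k G \<Longrightarrow> param_Ck k (\<lambda>s t. h (F s t) (G s t))"
proof (induction k arbitrary: F G)
  case 0
  then show ?case using bounded_bilinear.continuous_on[OF assms, of UNIV "\<lambda>(s, t). F s t" "\<lambda>(s, t). G s t"] by (simp add: split_beta)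
next
  case (Suc k)
  then obtain F' G' where 1: "\<forall>s t. (F s has_vector_derivative F' s t) (at t)" "param_Ck k F'"
    "\<forall>s t. (G s has_vector_derivative G' s t) (at t)" "param_Ck k G'" by auto
  have "continuous_on UNIV (\<lambda>(s, t). h (F s t) (G s t))"
    using Suc.prems bounded_bilinear.continuous_on[OF assms, of UNIV "\<lambda>(s, t). F s t" "\<lambda>(s, t). G s t"] by (simp add: split_beta)
  moreover have "((\<lambda>t. h (F s t) (G s t)) has_vector_derivative h (F s t) (G' s t) + h (F' s t) (G s t)) (at t)" for s t
    using 1 by (auto intro!: bounded_bilinear.has_vector_derivative[OF assms])
  moreover have "param_Ck k (\<lambda>s t. h (F s t) (G' s t) + h (F' s t) (G s t))"
    by (intro param_Ck_add Suc.IH param_Ck_Suc_imp[OF Suc.prems(1)] param_Ck_Suc_imp[OF Suc.prems(2)] 1)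
  ultimately show ?case unfolding param_Ck.simps
    by (intro conjI exI[of _ "\<lambda>s t. h (F s t) (G' s t) + h (F' s t) (G s t)"] allI)
qed

lemma param_Ck_linear:
  assumes "bounded_linear h"
  shows "param_Ck k F \<Longrightarrow> param_Ck k (\<lambda>s t. h (F s t))"
proof (induction k arbitrary: F)
  case 0
  then show ?case using bounded_linear.continuous_on[OF assms, of UNIV "\<lambda>(s, t). F s t"] by (simp add: split_beta)
next
  case (Suc k)
  then obtain F' where 1: "\<forall>s t. (F s has_vector_derivative F' s t) (at t)" "param_Ck k F'" by auto
  have "continuous_on UNIV (\<lambda>(s, t). h (F s t))"
    using Suc.prems bounded_linear.continuous_on[OF assms, of UNIV "\<lambda>(s, t). F s t"] by (simp add: split_beta)
  moreover have "((\<lambda>t. h (F s t)) has_vector_derivative h (F' s t)) (at t)" for s t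
    using 1 by (auto intro!: bounded_linear.has_vector_derivative[OF assms])
  ultimately show ?case using Suc.IH[OF 1(2)] unfolding param_Ck.simps
    by (intro conjI exI[of _ "\<lambda>s t. h (F' s t)"] allI)
qed

lemma param_Ck_int_from_0: "param_Ck k F \<Longrightarrow> param_Ck k (int_from_0 F)"
proof (induction k arbitrary: F)
  case 0
  then show ?case using int_from_0_continuous by auto
next
  case (Suc k)
  then obtain F' where 1: "\<forall>s t. (F s has_vector_derivative F' s t) (at t)" "param_Ck k F'" by auto
  have "(int_from_0 F s has_vector_derivative int_from_0 F' s t) (at t)" for s t
    using int_from_0_param_derivative[OF param_Ck_continuous[OF Suc.prems] param_Ck_continuous[OF 1(2)]] 1(1) by blast
  then show ?case
    using Suc.IH[OF 1(2)] int_from_0_continuous[OF param_Ck_continuous[OF Suc.prems]] by auto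
qed

lemma param_Ck_smooth: "(\<And>k. param_Ck k F) \<Longrightarrow> smooth_on UNIV (F s)"
proof -
  assume *: "\<And>k. param_Ck k F"
  have "Ck_on k UNIV (F s)" if "param_Ck k F" for k and F :: "real \<Rightarrow> real \<Rightarrow> 'a"
    using that
  proof (induction k arbitrary: F)
    case 0
    then show ?case using continuous_on_UNIV_pair[of F UNIV "\<lambda>_. s" "\<lambda>t. t"] by simp
  next
    case (Suc k)
    then obtain F' where 1: "\<forall>s t. (F s has_vector_derivative F' s t) (at t)" "param_Ck k F'" by auto
    show ?case by (rule smooth_on_real_SucI[OF _ _ Suc.IH[OF 1(2)]]) (use 1 in auto)
  qed
  then show ?thesis using * by (simp add: smooth_on_def)
qed

lemma has_vector_derivative_caratheodory:
  fixes f g :: "real \<Rightarrow> 'b::real_normed_vector"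
  assumes "\<And>x. f x - f t = (x - t) *\<^sub>R g x" "isCont g t"
  shows "(f has_vector_derivative g t) (at t)"
proof -
  have "((\<lambda>h. norm (g (t + h) - g t)) \<longlongrightarrow> norm (g t - g t)) (at 0)"
    using assms(2) by (intro tendsto_intros) (simp add: isCont_iff)
  then have "((\<lambda>h. norm (g (t + h) - g t)) \<longlongrightarrow> 0) (at 0)" by simp
  then have "((\<lambda>h. norm (f (t + h) - f t - h *\<^sub>R g t) / norm h) \<longlongrightarrow> 0) (at 0)"
    by (rule Lim_transform_eventually)
      (auto simp: assms(1) eventually_at scaleR_diff_right[symmetric] intro!: exI[of _ 1])
  then show ?thesis
    by (simp add: has_vector_derivative_def has_derivative_at bounded_linear_scaleR_left)
qed

context
  fixes a a' :: "real \<Rightarrow> real \<Rightarrow> 'e::euclidean_space \<Rightarrow>\<^sub>L 'e" and \<Phi> \<Psi> :: "real \<Rightarrow> real \<Rightarrow> 'e \<Rightarrow>\<^sub>L 'e"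
  assumes a: "continuous_on UNIV (\<lambda>(s, t). a s t)" and a': "continuous_on UNIV (\<lambda>(s, t). a' s t)"
    and da: "\<And>s t. (a s has_vector_derivative a' s t) (at t)"
    and c\<Phi>: "continuous_on UNIV (\<lambda>(s, t). \<Phi> s t)" and c\<Psi>: "continuous_on UNIV (\<lambda>(s, t). \<Psi> s t)"
    and init: "\<And>t. \<Phi> 0 t = id_blinfun" "\<And>t. \<Psi> 0 t = id_blinfun"
    and d\<Phi>: "\<And>s t. ((\<lambda>s. \<Phi> s t) has_vector_derivative a s t o\<^sub>L \<Phi> s t) (at s)"
    and d\<Psi>: "\<And>s t. ((\<lambda>s. \<Psi> s t) has_vector_derivative - (\<Psi> s t o\<^sub>L a s t)) (at s)"
    and inv: "\<And>s t. \<Psi> s t o\<^sub>L \<Phi> s t = id_blinfun" "\<And>s t. \<Phi> s t o\<^sub>L \<Psi> s t = id_blinfun"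
begin

interpretation c: bounded_bilinear "(o\<^sub>L) :: ('e \<Rightarrow>\<^sub>L 'e) \<Rightarrow> ('e \<Rightarrow>\<^sub>L 'e) \<Rightarrow> ('e \<Rightarrow>\<^sub>L 'e)"
  by (rule bounded_bilinear_blinfun_compose)

definition param_variation :: "real \<Rightarrow> real \<Rightarrow> 'e \<Rightarrow>\<^sub>L 'e" where
  "param_variation = int_from_0 (\<lambda>s t. \<Psi> s t o\<^sub>L (a' s t o\<^sub>L \<Phi> s t))"

text \<open>Variation of constants: \<open>\<Phi>(s,\<tau>) - \<Phi>(s,t) = (\<tau> - t) \<Phi>(s,t) \<integral> \<Psi>(\<sigma>,t) B(\<sigma>,\<tau>) \<Phi>(\<sigma>,\<tau>) d\<sigma>\<close>, where \<open>B\<close> is the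
  difference quotient of \<open>a\<close> in its parameter, made continuous at \<open>\<tau> = t\<close> by Hadamard's formula.\<close>

lemma solution_param_difference:
  obtains \<kappa> where "\<And>\<tau>. \<Phi> s \<tau> - \<Phi> s t = (\<tau> - t) *\<^sub>R (\<Phi> s t o\<^sub>L \<kappa> \<tau>)" "isCont \<kappa> t" "\<kappa> t = param_variation s t"
proof -
  define B where "B s \<tau> = integral (cbox 0 1) (\<lambda>\<theta>. a' s (t + \<theta> * (\<tau> - t)))" for s \<tau>
  have aB: "a s \<tau> - a s t = (\<tau> - t) *\<^sub>R B s \<tau>" for s \<tau>
  proof -
    have "((\<lambda>\<theta>. a s (t + \<theta> * (\<tau> - t))) has_vector_derivative (\<tau> - t) *\<^sub>R a' s (t + \<theta> * (\<tau> - t))) (at \<theta> within {0..1})" for \<theta>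
    proof -
      have "((\<lambda>\<theta>. t + \<theta> * (\<tau> - t)) has_vector_derivative (\<tau> - t)) (at \<theta>)"
        by (auto intro!: derivative_eq_intros simp: has_real_derivative_iff_has_vector_derivative[symmetric])
      from vector_diff_chain_at[OF this da] show ?thesis
        by (simp add: comp_def has_vector_derivative_at_within)
    qed
    from fundamental_theorem_of_calculus[OF _ this]
    have "((\<lambda>\<theta>. (\<tau> - t) *\<^sub>R a' s (t + \<theta> * (\<tau> - t))) has_integral a s \<tau> - a s t) (cbox 0 1)" by simp
    moreover have "((\<lambda>\<theta>. (\<tau> - t) *\<^sub>R a' s (t + \<theta> * (\<tau> - t))) has_integral (\<tau> - t) *\<^sub>R B s \<tau>) (cbox 0 1)"
      unfolding B_def
      by (intro has_integral_cmul integrable_integral integrable_continuous continuous_on_UNIV_pair[OF a'] continuous_intros)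
    ultimately show ?thesis using has_integral_unique by blast
  qed
  have cB: "continuous_on UNIV (\<lambda>(s, \<tau>). B s \<tau>)"
  proof -
    have "continuous_on (UNIV \<times> cbox 0 1) (\<lambda>(x, \<theta>). a' (fst x) (t + \<theta> * (snd x - t)))"
      unfolding split_beta by (intro continuous_intros continuous_on_UNIV_pair[OF a'])
    from integral_continuous_on_param[OF this] show ?thesis by (simp add: B_def split_beta)
  qed
  have Btt: "B s t = a' s t" for s by (simp add: B_def)
  define F where "F s \<tau> = \<Psi> s t o\<^sub>L (B s \<tau> o\<^sub>L \<Phi> s \<tau>)" for s \<tau>
  have cF: "continuous_on UNIV (\<lambda>(s, \<tau>). F s \<tau>)"
    unfolding F_def split_beta
    by (intro c.continuous_on continuous_on_UNIV_pair[OF c\<Psi>] continuous_on_UNIV_pair[OF cB] continuous_on_UNIV_pair[OF c\<Phi>] continuous_intros)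
  define \<kappa> where "\<kappa> \<tau> = int_from_0 F s \<tau>" for \<tau>
  note assoc = blinfun_compose_assoc and idl = blinfun_compose_id
  \<comment> \<open>Both sides agree at \<open>s = 0\<close> and have the same derivative in
    \<open>s\<close>.\<close>
  have Y: "\<Psi> s t o\<^sub>L \<Phi> s \<tau> = id_blinfun + (\<tau> - t) *\<^sub>R int_from_0 F s \<tau>" for \<tau>
  proof -
    have "((\<lambda>s. (\<Psi> s t o\<^sub>L \<Phi> s \<tau>) - (\<tau> - t) *\<^sub>R int_from_0 F s \<tau>) has_vector_derivative
        ((\<Psi> s t o\<^sub>L (a s \<tau> o\<^sub>L \<Phi> s \<tau>)) + (- (\<Psi> s t o\<^sub>L a s t) o\<^sub>L \<Phi> s \<tau>)) - (\<tau> - t) *\<^sub>R F s \<tau>) (at s)" for s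
      by (intro has_vector_derivative_diff c.has_vector_derivative d\<Phi> d\<Psi>
          bounded_linear.has_vector_derivative[OF bounded_linear_scaleR_right] int_from_0_derivative
          continuous_on_UNIV_pair[OF cF] continuous_intros)
    moreover have "((\<Psi> s t o\<^sub>L (a s \<tau> o\<^sub>L \<Phi> s \<tau>)) + (- (\<Psi> s t o\<^sub>L a s t) o\<^sub>L \<Phi> s \<tau>)) - (\<tau> - t) *\<^sub>R F s \<tau> = 0" for s
    proof -
      have "(\<Psi> s t o\<^sub>L (a s \<tau> o\<^sub>L \<Phi> s \<tau>)) + (- (\<Psi> s t o\<^sub>L a s t) o\<^sub>L \<Phi> s \<tau>) = \<Psi> s t o\<^sub>L ((a s \<tau> - a s t) o\<^sub>L \<Phi> s \<tau>)"
        by (simp add: c.minus_left c.diff_left c.diff_right assoc)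
      then show ?thesis unfolding aB F_def by (simp add: c.scaleR_left c.scaleR_right)
    qed
    ultimately have "((\<lambda>s. (\<Psi> s t o\<^sub>L \<Phi> s \<tau>) - (\<tau> - t) *\<^sub>R int_from_0 F s \<tau>) has_vector_derivative 0) (at s)" for s
      by metis
    from has_vector_derivative_zero_constant[OF convex_UNIV this] obtain k where
      "\<And>s. (\<Psi> s t o\<^sub>L \<Phi> s \<tau>) - (\<tau> - t) *\<^sub>R int_from_0 F s \<tau> = k" by auto
    from this[of 0] this[of s] show ?thesis by (simp add: init idl algebra_simps)
  qed
  have "\<Phi> s \<tau> - \<Phi> s t = (\<tau> - t) *\<^sub>R (\<Phi> s t o\<^sub>L \<kappa> \<tau>)" for \<tau>
  proof -
    have "\<Phi> s \<tau> = \<Phi> s t o\<^sub>L (\<Psi> s t o\<^sub>L \<Phi> s \<tau>)" by (simp add: assoc[symmetric] inv idl)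
    then show ?thesis unfolding Y by (simp add: \<kappa>_def c.add_right c.scaleR_right idl)
  qed
  moreover have "isCont \<kappa> t"
    unfolding \<kappa>_def using continuous_on_UNIV_pair[OF int_from_0_continuous[OF cF], of UNIV "\<lambda>_. s" "\<lambda>\<tau>. \<tau>"]
    by (simp add: continuous_on_eq_continuous_at)
  moreover have "\<kappa> t = param_variation s t"
    by (simp add: \<kappa>_def param_variation_def int_from_0_def F_def Btt)
  ultimately show ?thesis using that by blast
qed

text \<open>Divided by \<open>\<tau> - t\<close>, the difference formula has a continuous right
  side. The formula for \<open>\<Psi>\<close> follows from that for \<open>\<Phi>\<close> by
  \<open>\<Psi>(\<tau>) - \<Psi>(t) = - \<Psi>(\<tau>) (\<Phi>(\<tau>) - \<Phi>(t))
  \<Psi>(t)\<close>.\<close>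

lemma solution_param_derivative:
  "(\<Phi> s has_vector_derivative \<Phi> s t o\<^sub>L param_variation s t) (at t)"
  "(\<Psi> s has_vector_derivative - (param_variation s t o\<^sub>L \<Psi> s t)) (at t)"
proof -
  obtain \<kappa> where \<kappa>: "\<And>\<tau>. \<Phi> s \<tau> - \<Phi> s t = (\<tau> - t) *\<^sub>R (\<Phi> s t o\<^sub>L \<kappa> \<tau>)" "isCont \<kappa> t" "\<kappa> t = param_variation s t"
    using solution_param_difference by blast
  note assoc = blinfun_compose_assoc and idl = blinfun_compose_id
  show "(\<Phi> s has_vector_derivative \<Phi> s t o\<^sub>L param_variation s t) (at t)"
    unfolding \<kappa>(3)[symmetric]
    by (rule has_vector_derivative_caratheodory[where g = "\<lambda>\<tau>. \<Phi> s t o\<^sub>L \<kappa> \<tau>", OF \<kappa>(1)])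
      (intro c.isCont continuous_const \<kappa>(2))
  have c\<Psi>s: "isCont (\<Psi> s) t"
    using continuous_on_UNIV_pair[OF c\<Psi>, of UNIV "\<lambda>_. s" "\<lambda>\<tau>. \<tau>"] by (simp add: continuous_on_eq_continuous_at)
  have diff: "\<Psi> s \<tau> - \<Psi> s t = (\<tau> - t) *\<^sub>R - (\<Psi> s \<tau> o\<^sub>L ((\<Phi> s t o\<^sub>L \<kappa> \<tau>) o\<^sub>L \<Psi> s t))" for \<tau>
  proof -
    have "\<Psi> s \<tau> - \<Psi> s t = - (\<Psi> s \<tau> o\<^sub>L ((\<Phi> s \<tau> - \<Phi> s t) o\<^sub>L \<Psi> s t))"
      by (simp add: c.diff_left c.diff_right inv idl assoc[symmetric])
    then show ?thesis unfolding \<kappa>(1) by (simp add: c.scaleR_left c.scaleR_right)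
  qed
  have "(\<Psi> s has_vector_derivative - (\<Psi> s t o\<^sub>L ((\<Phi> s t o\<^sub>L \<kappa> t) o\<^sub>L \<Psi> s t))) (at t)"
    by (rule has_vector_derivative_caratheodory[where g = "\<lambda>\<tau>. - (\<Psi> s \<tau> o\<^sub>L ((\<Phi> s t o\<^sub>L \<kappa> \<tau>) o\<^sub>L \<Psi> s t))", OF diff])
      (intro continuous_minus c.isCont continuous_const \<kappa>(2) c\<Psi>s)
  then show "(\<Psi> s has_vector_derivative - (param_variation s t o\<^sub>L \<Psi> s t)) (at t)"
    by (simp add: \<kappa>(3) assoc[symmetric] inv idl)
qed

text \<open>The derivatives in \<open>t\<close> are built from \<open>\<Phi>\<close>,
  \<open>\<Psi>\<close> and \<open>a'\<close> by products and integration, so each round of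
  differentiation raises the known regularity by one.\<close>

lemma solution_param_Ck:
  assumes "\<And>k. param_Ck k a'"
  shows "param_Ck k \<Phi>" "param_Ck k \<Psi>" "param_Ck k param_variation"
proof -
  have pv: "param_Ck k param_variation" if "param_Ck k \<Phi>" "param_Ck k \<Psi>" for k
    unfolding param_variation_def
    by (intro param_Ck_int_from_0 param_Ck_bilinear[OF bounded_bilinear_blinfun_compose] that assms)
  have "param_Ck k \<Phi> \<and> param_Ck k \<Psi>" for k
  proof (induction k)
    case (Suc k)
    then have k: "param_Ck k \<Phi>" "param_Ck k \<Psi>" by auto
    have "param_Ck k (\<lambda>s t. \<Phi> s t o\<^sub>L param_variation s t)" "param_Ck k (\<lambda>s t. - (param_variation s t o\<^sub>L \<Psi> s t))"
      by (intro param_Ck_linear[OF bounded_linear_minus[OF bounded_linear_ident]]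
          param_Ck_bilinear[OF bounded_bilinear_blinfun_compose] k pv[OF k])+
    then show ?case unfolding param_Ck.simps
      by (intro conjI c\<Phi> c\<Psi> exI[of _ "\<lambda>s t. \<Phi> s t o\<^sub>L param_variation s t"]
          exI[of _ "\<lambda>s t. - (param_variation s t o\<^sub>L \<Psi> s t)"] allI solution_param_derivative)
  qed (use c\<Phi> c\<Psi> in auto)
  then show "param_Ck k \<Phi>" "param_Ck k \<Psi>" "param_Ck k param_variation" using pv by auto
qed

end

section \<open>The holonomy algebra\<close>

lemma blinfun_compose_inverse_apply:
  "K o\<^sub>L L = id_blinfun \<Longrightarrow> blinfun_apply K (blinfun_apply L x) = x"
  by (metis blinfun_apply_blinfun_compose blinfun_apply_id_blinfun id_apply)

text \<open>If \<open>d \<notin> S\<close>, some linear functional vanishes on \<open>S\<close>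
  and is 1 at \<open>d\<close>. In finite dimension it is continuous, so it maps the curve to the
  constant 0 and the derivative of the curve to 1.\<close>

lemma derivative_in_subspace:
  fixes S :: "('e::euclidean_space \<Rightarrow>\<^sub>L 'e) set" and f :: "real \<Rightarrow> 'e \<Rightarrow>\<^sub>L 'e"
  assumes S: "subspace S" and f: "\<And>s. f s \<in> S" and d: "(f has_vector_derivative d) (at t)"
  shows "d \<in> S"
proof (rule ccontr)
  assume "d \<notin> S"
  obtain B where B: "B \<subseteq> S" "independent B" "S \<subseteq> span B"
    using basis_exists[of S] by metis
  then have "span B = S" using S span_minimal[of B S] by blast
  then have "d \<notin> span B" using \<open>d \<notin> S\<close> by simp
  then have "independent (insert d B)" using B(2) independent_insertI by blast
  from linear_independent_extend[OF this, of "\<lambda>x. if x = d then 1 else 0"]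
  obtain g :: "('e \<Rightarrow>\<^sub>L 'e) \<Rightarrow> real" where g: "linear g" "\<forall>x\<in>insert d B. g x = (if x = d then 1 else 0)" by blast
  have "g x = 0" if "x \<in> B" for x
  proof -
    have "x \<noteq> d" using that B(1) \<open>d \<notin> S\<close> by blast
    then show ?thesis using g(2) that by simp
  qed
  then have g0: "g x = 0" if "x \<in> S" for x
    using linear_eq_0_on_span[OF g(1)] that B(3) by blast
  let ?e = "\<lambda>i b. blinfun_scaleR_left i o\<^sub>L blinfun_inner_left b :: 'e \<Rightarrow>\<^sub>L 'e"
  have "x = (\<Sum>b\<in>Basis. \<Sum>i\<in>Basis. (x b \<bullet> i) *\<^sub>R ?e i b)" for x :: "'e \<Rightarrow>\<^sub>L 'e"
  proof (rule blinfun_eqI)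
    fix v
    have "(\<Sum>i\<in>Basis. (x b \<bullet> i) *\<^sub>R (v \<bullet> b) *\<^sub>R i) = (v \<bullet> b) *\<^sub>R x b" for b
      using euclidean_representation[of "(v \<bullet> b) *\<^sub>R x b"] by (simp add: mult.commute)
    then show "blinfun_apply x v = blinfun_apply (\<Sum>b\<in>Basis. \<Sum>i\<in>Basis. (x b \<bullet> i) *\<^sub>R ?e i b) v"
      using linear_basis_expansion[OF bounded_linear.linear[OF blinfun.bounded_linear_right], of x v]
      by (simp add: blinfun.sum_left blinfun.bilinear_simps blinfun_inner_left.rep_eq inner_commute)
  qed
  note xexp = this
  define k where "k i b = g (?e i b)" for i b
  have "g = (\<lambda>x. \<Sum>b\<in>Basis. \<Sum>i\<in>Basis. (x b \<bullet> i) *\<^sub>R k i b)"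
  proof
    fix x
    have "g x = g (\<Sum>b\<in>Basis. \<Sum>i\<in>Basis. (x b \<bullet> i) *\<^sub>R ?e i b)" by (rule arg_cong[OF xexp])
    also have "\<dots> = (\<Sum>b\<in>Basis. \<Sum>i\<in>Basis. (x b \<bullet> i) *\<^sub>R k i b)"
      by (simp only: linear_sum[OF g(1)] linear_cmul[OF g(1)] k_def)
    finally show "g x = \<dots>" .
  qed
  moreover have "bounded_linear (\<lambda>x :: 'e \<Rightarrow>\<^sub>L 'e. \<Sum>b\<in>Basis. \<Sum>i\<in>Basis. (x b \<bullet> i) *\<^sub>R k i b)"
    by (intro bounded_linear_sum bounded_linear_compose[OF bounded_linear_scaleR_left]
        bounded_linear_compose[OF bounded_linear_inner_left] blinfun.bounded_linear_left)
  ultimately have "bounded_linear g" by (simp only:)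
  from bounded_linear.has_vector_derivative[OF this d]
  have "((\<lambda>s. 0) has_vector_derivative g d) (at t)" by (simp add: g0[OF f])
  then have "g d = 0" by (metis has_vector_derivative_const vector_derivative_unique_at)
  then show False using g(2) by simp
qed

text \<open>Nothing is known about \<open>h\<close> except that its values are inverses. The
  identity \<open>h - 1 = - h (g - 1)\<close> first bounds \<open>h\<close> near 0, then shows its
  continuity, and after division by \<open>t\<close> gives the derivative.\<close>

lemma inverse_has_vector_derivative:
  fixes g h :: "real \<Rightarrow> 'e::real_normed_vector \<Rightarrow>\<^sub>L 'e"
  assumes g: "(g has_vector_derivative E) (at 0)" "g 0 = id_blinfun" and hg: "\<And>t. h t o\<^sub>L g t = id_blinfun"
  shows "(h has_vector_derivative - E) (at 0)"
proof -
  interpret c: bounded_bilinear "(o\<^sub>L) :: ('e \<Rightarrow>\<^sub>L 'e) \<Rightarrow> ('e \<Rightarrow>\<^sub>L 'e) \<Rightarrow> ('e \<Rightarrow>\<^sub>L 'e)"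
    by (rule bounded_bilinear_blinfun_compose)
  have h0: "h 0 = id_blinfun" using hg[of 0] g(2) by simp
  have diff: "h t - id_blinfun = - (h t o\<^sub>L (g t - id_blinfun))" for t
    by (simp add: c.diff_right hg)
  have gc: "(g \<longlongrightarrow> id_blinfun) (at 0)"
    using has_vector_derivative_continuous[OF g(1)] g(2) by (simp add: continuous_at)
  have ev: "\<forall>\<^sub>F t in at 0. norm (g t - id_blinfun) < 1/2"
    using gc unfolding tendsto_iff dist_norm by (metis half_gt_zero zero_less_one)
  have "\<forall>\<^sub>F t in at 0. norm (h t - id_blinfun) \<le> 2 * norm (g t - id_blinfun)"
    using ev
  proof eventually_elim
    fix t assume t: "norm (g t - id_blinfun) < 1/2"
    have le: "norm (h t - id_blinfun) \<le> norm (h t) * norm (g t - id_blinfun)"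
      unfolding diff by (simp add: norm_blinfun_compose)
    also have "\<dots> \<le> norm (h t) * (1/2)" using t by (intro mult_left_mono) auto
    finally have "norm (h t - id_blinfun) \<le> norm (h t) / 2" by simp
    moreover have "norm (h t) \<le> norm (h t - id_blinfun) + norm (id_blinfun :: 'e \<Rightarrow>\<^sub>L 'e)"
      using norm_triangle_ineq[of "h t - id_blinfun" id_blinfun] by simp
    ultimately have "norm (h t) \<le> 2" using norm_blinfun_id_le[where 'a='e] by linarith
    then have "norm (h t) * norm (g t - id_blinfun) \<le> 2 * norm (g t - id_blinfun)" by (intro mult_right_mono) auto
    then show "norm (h t - id_blinfun) \<le> 2 * norm (g t - id_blinfun)" using le by linarith
  qed
  moreover have "((\<lambda>t. 2 * norm (g t - id_blinfun)) \<longlongrightarrow> 0) (at 0)"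
  proof -
    have "((\<lambda>t. 2 * norm (g t - id_blinfun)) \<longlongrightarrow> 2 * norm (id_blinfun - id_blinfun :: 'e \<Rightarrow>\<^sub>L 'e)) (at 0)"
      by (intro tendsto_intros gc)
    then show ?thesis by simp
  qed
  ultimately have "((\<lambda>t. h t - id_blinfun) \<longlongrightarrow> 0) (at 0)"
    by (rule Lim_null_comparison)
  then have hc: "isCont h 0" unfolding continuous_at h0 by (simp add: LIM_zero_iff)
  define q where "q t = (if t = 0 then E else (1 / t) *\<^sub>R (g t - id_blinfun))" for t
  have "((\<lambda>t. norm (g (0 + t) - g 0 - t *\<^sub>R E) / norm t) \<longlongrightarrow> 0) (at 0)"
    using g(1) unfolding has_vector_derivative_def has_derivative_at by blast
  then have "((\<lambda>t. norm (q t - E)) \<longlongrightarrow> 0) (at 0)"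
  proof (rule Lim_transform_eventually)
    have "norm (g (0 + t) - g 0 - t *\<^sub>R E) / norm t = norm (q t - E)" if "t \<noteq> 0" for t
    proof -
      have "q t - E = (1 / t) *\<^sub>R (g (0 + t) - g 0 - t *\<^sub>R E)" using that by (simp add: q_def g(2) scaleR_diff_right)
      then show ?thesis by simp
    qed
    then show "\<forall>\<^sub>F t in at 0. norm (g (0 + t) - g 0 - t *\<^sub>R E) / norm t = norm (q t - E)"
      by (auto simp: eventually_at intro!: exI[of _ 1])
  qed
  then have qc: "isCont q 0" by (simp add: continuous_at q_def[of 0] tendsto_norm_zero_iff LIM_zero_iff)
  have "(h has_vector_derivative - (h 0 o\<^sub>L q 0)) (at 0)"
  proof (rule has_vector_derivative_caratheodory[where g = "\<lambda>t. - (h t o\<^sub>L q t)"])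
    show "h t - h 0 = (t - 0) *\<^sub>R - (h t o\<^sub>L q t)" for t
      unfolding h0 diff by (auto simp: q_def c.scaleR_right g(2))
    show "isCont (\<lambda>t. - (h t o\<^sub>L q t)) 0"
      by (intro continuous_minus c.isCont hc qc)
  qed
  then show ?thesis by (simp add: h0 q_def)
qed

context affine_connection
begin

lemma holonomy_group_id: "id_blinfun \<in> holonomy_group A D p"
  by (simp add: holonomy_group_def parallel_transport.const)

lemma holonomy_group_compose: "K \<in> holonomy_group A D p \<Longrightarrow> L \<in> holonomy_group A D p \<Longrightarrow> K o\<^sub>L L \<in> holonomy_group A D p"
  by (simp add: holonomy_group_def parallel_transport_trans)

lemma holonomy_algebraI:
  "smooth_on UNIV g \<Longrightarrow> g 0 = id_blinfun \<Longrightarrow> (\<And>t. g t \<in> holonomy_group A D p) \<Longrightarrow> (g has_vector_derivative B) (at 0)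
    \<Longrightarrow> B \<in> holonomy_algebra A D p"
  unfolding holonomy_algebra_def by blast

text \<open>Products of curves add their velocities, and the reparametrisation \<open>t \<mapsto>
  r t\<close> multiplies them by \<open>r\<close>.\<close>

lemma subspace_holonomy_algebra: "subspace (holonomy_algebra A D p)"
  unfolding subspace_def
proof (intro conjI ballI allI)
  show "0 \<in> holonomy_algebra A D p"
    by (rule holonomy_algebraI[of "\<lambda>_. id_blinfun"]) (auto intro: smooth_on_const holonomy_group_id)
next
  fix B C assume "B \<in> holonomy_algebra A D p" "C \<in> holonomy_algebra A D p"
  then obtain g h where g: "smooth_on UNIV g" "g 0 = id_blinfun" "\<And>t. g t \<in> holonomy_group A D p" "(g has_vector_derivative B) (at 0)"
    and h: "smooth_on UNIV h" "h 0 = id_blinfun" "\<And>t. h t \<in> holonomy_group A D p" "(h has_vector_derivative C) (at 0)"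
    unfolding holonomy_algebra_def by blast
  show "B + C \<in> holonomy_algebra A D p"
  proof (rule holonomy_algebraI[of "\<lambda>t. g t o\<^sub>L h t"])
    show "smooth_on UNIV (\<lambda>t. g t o\<^sub>L h t)"
      by (rule smooth_on_bilinear[OF bounded_bilinear_blinfun_compose open_UNIV g(1) h(1)])
    show "((\<lambda>t. g t o\<^sub>L h t) has_vector_derivative B + C) (at 0)"
      using bounded_bilinear.has_vector_derivative[OF bounded_bilinear_blinfun_compose g(4) h(4)]
      by (simp add: g(2) h(2) add.commute)
  qed (use g h holonomy_group_compose in auto)
next
  fix r B assume "B \<in> holonomy_algebra A D p"
  then obtain g where g: "smooth_on UNIV g" "g 0 = id_blinfun" "\<And>t. g t \<in> holonomy_group A D p" "(g has_vector_derivative B) (at 0)"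
    unfolding holonomy_algebra_def by blast
  have lin: "smooth_on UNIV (\<lambda>t::real. r * t)"
    by (intro smooth_on_mult smooth_on_const smooth_on_id open_UNIV)
  show "r *\<^sub>R B \<in> holonomy_algebra A D p"
  proof (rule holonomy_algebraI[of "\<lambda>t. g (r * t)"])
    show "smooth_on UNIV (\<lambda>t. g (r * t))"
      by (rule smooth_on_compose[OF open_UNIV open_UNIV _ lin g(1)]) simp
    have "((\<lambda>t. r * t) has_vector_derivative r) (at 0)"
      by (auto intro!: derivative_eq_intros simp: has_real_derivative_iff_has_vector_derivative[symmetric])
    from vector_diff_chain_at[OF this, of g B] g(4)
    show "((\<lambda>t. g (r * t)) has_vector_derivative r *\<^sub>R B) (at 0)" by (simp add: comp_def)
  qed (use g in auto)
qed

lemma holonomy_algebra_conjugate: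
  assumes L: "parallel_transport A D p q L" and K: "parallel_transport A D q p K" and KL: "K o\<^sub>L L = id_blinfun"
    and B: "B \<in> holonomy_algebra A D q"
  shows "K o\<^sub>L (B o\<^sub>L L) \<in> holonomy_algebra A D p"
proof -
  obtain g where g: "smooth_on UNIV g" "g 0 = id_blinfun" "\<And>t. g t \<in> holonomy_group A D q" "(g has_vector_derivative B) (at 0)"
    using B unfolding holonomy_algebra_def by blast
  note c = bounded_bilinear_blinfun_compose
  have bl: "bounded_linear (\<lambda>x. K o\<^sub>L (x o\<^sub>L L))"
    by (intro bounded_linear_compose[OF bounded_bilinear.bounded_linear_right[OF c] bounded_bilinear.bounded_linear_left[OF c]])
  show ?thesis
  proof (rule holonomy_algebraI[of "\<lambda>t. K o\<^sub>L (g t o\<^sub>L L)"])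
    show "smooth_on UNIV (\<lambda>t. K o\<^sub>L (g t o\<^sub>L L))" by (rule smooth_on_bounded_linear[OF bl open_UNIV g(1)])
    show "((\<lambda>t. K o\<^sub>L (g t o\<^sub>L L)) has_vector_derivative K o\<^sub>L (B o\<^sub>L L)) (at 0)"
      by (rule bounded_linear.has_vector_derivative[OF bl g(4)])
    show "K o\<^sub>L (g t o\<^sub>L L) \<in> holonomy_group A D p" for t
      using g(3)[of t] parallel_transport_trans[OF K parallel_transport_trans[OF _ L]] by (simp add: holonomy_group_def)
  qed (simp add: g(2) KL)
qed

text \<open>For a curve \<open>g\<close> in the group with velocity \<open>E\<close>, the curve
  \<open>g\<^sup>-\<^sup>1 F g\<close> lies in the holonomy algebra, and so does its derivative
  \<open>FE - EF\<close>.\<close>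

lemma holonomy_algebra_commutator:
  assumes E: "E \<in> holonomy_algebra A D p" and F: "F \<in> holonomy_algebra A D p"
  shows "(E o\<^sub>L F) - (F o\<^sub>L E) \<in> holonomy_algebra A D p"
proof -
  obtain g where g: "g 0 = id_blinfun" "\<And>t. g t \<in> holonomy_group A D p" "(g has_vector_derivative E) (at 0)"
    using E unfolding holonomy_algebra_def by blast
  have "\<exists>K. parallel_transport A D p p K \<and> K o\<^sub>L g t = id_blinfun \<and> g t o\<^sub>L K = id_blinfun" for t
    using parallel_transport_inverse[of p p "g t"] g(2) by (simp add: holonomy_group_def)
  then obtain h where h: "\<And>t. parallel_transport A D p p (h t)" "\<And>t. h t o\<^sub>L g t = id_blinfun" by metis
  have h0: "h 0 = id_blinfun" using h(2)[of 0] g(1) by simp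
  have hol: "h t o\<^sub>L (F o\<^sub>L g t) \<in> holonomy_algebra A D p" for t
    using holonomy_algebra_conjugate[OF _ h(1) h(2) F] g(2) by (simp add: holonomy_group_def)
  note c = bounded_bilinear_blinfun_compose
  have "((\<lambda>t. F o\<^sub>L g t) has_vector_derivative F o\<^sub>L E) (at 0)"
    by (rule bounded_linear.has_vector_derivative[OF bounded_bilinear.bounded_linear_right[OF c] g(3)])
  from bounded_bilinear.has_vector_derivative[OF c inverse_has_vector_derivative[OF g(3,1) h(2)] this]
  have "((\<lambda>t. h t o\<^sub>L (F o\<^sub>L g t)) has_vector_derivative (F o\<^sub>L E) - (E o\<^sub>L F)) (at 0)"
    by (simp add: h0 g(1) bounded_bilinear.minus_left[OF c])
  from derivative_in_subspace[OF subspace_holonomy_algebra hol this]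
  have "(F o\<^sub>L E) - (E o\<^sub>L F) \<in> holonomy_algebra A D p" .
  from subspace_neg[OF subspace_holonomy_algebra this] show ?thesis by simp
qed

section \<open>Transport along coordinate curves\<close>

definition chart_blinfun :: "('m, 'e) chart \<Rightarrow> 'm \<Rightarrow> 'e \<Rightarrow>\<^sub>L 'e" where
  "chart_blinfun c q = Blinfun (to_chart A c q)"

definition chart_blinfun_inv :: "('m, 'e) chart \<Rightarrow> 'm \<Rightarrow> 'e \<Rightarrow>\<^sub>L 'e" where
  "chart_blinfun_inv c q = Blinfun (from_chart A c q)"

lemma chart_blinfun_apply:
  assumes "c \<in> A" "q \<in> chart_dom c"
  shows "blinfun_apply (chart_blinfun c q) v = to_chart A c q v" "blinfun_apply (chart_blinfun_inv c q) v = from_chart A c q v"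
  using linear_to_chart[OF assms] linear_from_chart[OF assms]
  by (simp_all add: chart_blinfun_def chart_blinfun_inv_def bounded_linear_Blinfun_apply linear_conv_bounded_linear)

lemma smooth_curve_from_chart:
  assumes c: "c \<in> A" and x: "smooth_on UNIV x" "\<And>s. x s \<in> chart_image c"
  shows "smooth_curve A UNIV (\<lambda>s. chart_inv c (x s))"
  unfolding smooth_curve_def
proof (intro conjI ballI)
  show "continuous_on UNIV (\<lambda>s. chart_inv c (x s))"
    by (rule continuous_on_compose2[OF continuous_on_chart_inv[OF c] smooth_on_continuous[OF x(1)]]) (use x in auto)
  fix d assume d: "d \<in> A"
  let ?O = "chart_map c ` (chart_dom c \<inter> chart_dom d)"
  have O: "open ?O" using open_chart_map_image[OF c open_dom[OF d]] .
  have "x s \<in> ?O \<longleftrightarrow> chart_inv c (x s) \<in> chart_dom d" for s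
  proof
    assume "x s \<in> ?O"
    then obtain q where "q \<in> chart_dom c" "q \<in> chart_dom d" "x s = chart_map c q" by blast
    then show "chart_inv c (x s) \<in> chart_dom d" using c by simp
  next
    assume "chart_inv c (x s) \<in> chart_dom d"
    then show "x s \<in> ?O"
      by (intro image_eqI[of _ _ "chart_inv c (x s)"]) (simp_all add: x(2))
  qed
  then have eq: "x -` ?O = {t \<in> UNIV. chart_inv c (x t) \<in> chart_dom d}" by auto
  have op: "open (x -` ?O)"
    using smooth_on_continuous[OF x(1)] O by (simp add: continuous_on_open_vimage)
  have "smooth_on (x -` ?O) (\<lambda>t. (chart_map d \<circ> chart_inv c) (x t))"
    by (rule smooth_on_compose[OF op O _ smooth_on_subset[OF x(1)] compatible[OF c d]]) auto
  then show "smooth_on {t \<in> UNIV. chart_inv c (x t) \<in> chart_dom d} (chart_map d \<circ> (\<lambda>s. chart_inv c (x s)))"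
    unfolding eq by (simp add: comp_def)
qed

text \<open>In a chart, transport along a curve is a value of the operator-valued solution
  \<open>U\<close>. A left inverse \<open>U'\<close> of this value gives the transport backwards,
  as transports are invertible.\<close>

lemma coordinate_curve_transport:
  assumes W: "chart_cutoff A c W \<rho>" and x: "smooth_on UNIV x" "\<And>s. x s \<in> W"
    and x': "\<And>s. (x has_vector_derivative x' s) (at s)"
    and U: "\<And>s. (U has_vector_derivative - (conn_form c \<rho> (x s) (x' s) o\<^sub>L U s)) (at s)" "U 0 = id_blinfun"
    and U': "U' o\<^sub>L U 1 = id_blinfun"
  shows "parallel_transport A D (chart_inv c (x 0)) (chart_inv c (x 1))
      (chart_blinfun_inv c (chart_inv c (x 1)) o\<^sub>L (U 1 o\<^sub>L chart_blinfun c (chart_inv c (x 0))))"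
    "parallel_transport A D (chart_inv c (x 1)) (chart_inv c (x 0))
      (chart_blinfun_inv c (chart_inv c (x 0)) o\<^sub>L (U' o\<^sub>L chart_blinfun c (chart_inv c (x 1))))"
proof -
  note C = chart_cutoffD[OF W]
  let ?\<gamma> = "\<lambda>s. chart_inv c (x s)"
  have xi: "x s \<in> chart_image c" for s using C(3) x(2) by blast
  then have dom: "?\<gamma> s \<in> chart_dom c" "chart_map c (?\<gamma> s) = x s" for s by auto
  note \<gamma> = smooth_curve_from_chart[OF C(1) x(1) xi]
  let ?P = "chart_blinfun_inv c (?\<gamma> 1) o\<^sub>L (U 1 o\<^sub>L chart_blinfun c (?\<gamma> 0))"
  let ?P' = "chart_blinfun_inv c (?\<gamma> 0) o\<^sub>L (U' o\<^sub>L chart_blinfun c (?\<gamma> 1))"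
  have "is_transport_along A D UNIV ?\<gamma> ?P"
    unfolding is_transport_along_def
  proof
    fix v
    define V where "V s = from_chart A c (?\<gamma> s) (U s (to_chart A c (?\<gamma> 0) v))" for s
    have "parallel_along A D UNIV ?\<gamma> V"
      unfolding parallel_along_def
    proof
      fix t :: real
      have "((\<lambda>s. U s (to_chart A c (?\<gamma> 0) v)) has_vector_derivative
          - (conn_form c \<rho> (x t) (x' t) o\<^sub>L U t) (to_chart A c (?\<gamma> 0) v)) (at t)"
        using bounded_linear.has_vector_derivative[OF blinfun.bounded_linear_left U(1)] by (simp add: blinfun.minus_left)
      moreover have "vector_derivative (\<lambda>s. chart_map c (?\<gamma> s)) (at t) = x' t"
        unfolding dom(2) by (rule vector_derivative_at[OF x'])
      ultimately show "has_cov_deriv_along A D ?\<gamma> V 0 t"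
        unfolding V_def by (subst parallel_iff_chart[OF W \<gamma> open_UNIV UNIV_I]) (simp_all add: C(1) dom x(2))
    qed
    moreover have "V 0 = v" "V 1 = ?P v"
      by (simp_all add: V_def U(2) C(1) dom chart_blinfun_apply)
    ultimately show "\<exists>V. parallel_along A D UNIV ?\<gamma> V \<and> V 0 = v \<and> V 1 = ?P v" by blast
  qed
  from parallel_transport_single[OF open_UNIV subset_UNIV \<gamma> this]
  show P: "parallel_transport A D (?\<gamma> 0) (?\<gamma> 1) ?P" .
  obtain K where K: "parallel_transport A D (?\<gamma> 1) (?\<gamma> 0) K" "?P o\<^sub>L K = id_blinfun"
    using parallel_transport_inverse[OF P] by blast
  have "?P' o\<^sub>L ?P = id_blinfun"
  proof (rule blinfun_eqI)
    fix v
    show "blinfun_apply (?P' o\<^sub>L ?P) v = blinfun_apply id_blinfun v"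
      by (simp add: chart_blinfun_apply C(1) dom blinfun_compose_inverse_apply[OF U'])
  qed
  then have "?P' = ?P' o\<^sub>L (?P o\<^sub>L K)" by (simp only: K(2) blinfun_compose_id)
  also have "\<dots> = (?P' o\<^sub>L ?P) o\<^sub>L K" by (simp only: blinfun_compose_assoc)
  also have "\<dots> = K" using \<open>?P' o\<^sub>L ?P = id_blinfun\<close> by (simp only: blinfun_compose_id)
  finally show "parallel_transport A D (?\<gamma> 1) (?\<gamma> 0) ?P'" using K(1) by (simp only:)
qed

end

section \<open>Curvature belongs to the holonomy algebra\<close>

text \<open>Parallelograms in coordinates. The sine has derivative 1 at 0 but keeps the points in
  a bounded box for all real \<open>s\<close> and \<open>t\<close>, so that the resulting curves
  of holonomies are defined and smooth on the whole real line.\<close>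

definition sin_grid :: "'e::real_vector \<Rightarrow> 'e \<Rightarrow> 'e \<Rightarrow> real \<Rightarrow> real \<Rightarrow> 'e" where
  "sin_grid u0 a b s t = u0 + sin s *\<^sub>R a + sin t *\<^sub>R b"

lemma sin_grid_swap: "sin_grid u0 b a t s = sin_grid u0 a b s t"
  by (simp add: sin_grid_def)

lemma sin_grid_0 [simp]: "sin_grid u0 a b 0 0 = u0"
  by (simp add: sin_grid_def)

text \<open>Differentiation shifts the phase by \<open>\<pi>/2\<close>; with the phase as a
  parameter, a single induction suffices.\<close>

lemma smooth_on_cos_shift: "smooth_on UNIV (\<lambda>t::real. cos (t + c))"
proof -
  have "Ck_on k UNIV (\<lambda>t::real. cos (t + c))" for k
  proof (induction k arbitrary: c)
    case (Suc k)
    have "((\<lambda>t. cos (t + c)) has_vector_derivative cos (t + (c + pi / 2))) (at t)" for t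
      unfolding has_real_derivative_iff_has_vector_derivative[symmetric]
      by (auto intro!: derivative_eq_intros simp: cos_add sin_add add.assoc[symmetric])
    from smooth_on_real_SucI[OF open_UNIV this Suc.IH] show ?case by simp
  qed (auto intro!: continuous_intros)
  then show ?thesis by (simp add: smooth_on_def)
qed

lemma smooth_on_cos: "smooth_on UNIV (cos :: real \<Rightarrow> real)"
  using smooth_on_cos_shift[of 0] by simp

lemma smooth_on_sin: "smooth_on UNIV (sin :: real \<Rightarrow> real)"
proof -
  have "(\<lambda>t::real. cos (t + - (pi / 2))) = sin" by (simp add: fun_eq_iff cos_diff)
  then show ?thesis using smooth_on_cos_shift[of "- (pi / 2)"] by (simp only:)
qed

lemma param_Ck_const_in_t: "continuous_on UNIV f \<Longrightarrow> param_Ck k (\<lambda>s t. f s)"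
proof (induction k arbitrary: f)
  case 0
  then show ?case using continuous_on_compose2[OF 0 continuous_on_fst[OF continuous_on_id]] by (simp add: split_beta)
next
  case (Suc k)
  have "continuous_on UNIV (\<lambda>(s::real, t::real). f s)"
    using continuous_on_compose2[OF Suc.prems continuous_on_fst[OF continuous_on_id]] by (simp add: split_beta)
  then show ?case using Suc.IH[of "\<lambda>_. 0"] unfolding param_Ck.simps
    by (intro conjI exI[of _ "\<lambda>s t. 0"]) auto
qed

lemma param_Ck_const_in_s: "smooth_on UNIV f \<Longrightarrow> param_Ck k (\<lambda>s t. f t)"
proof (induction k arbitrary: f)
  case 0
  from smooth_on_continuous[OF this] show ?case
    using continuous_on_compose2[OF _ continuous_on_snd[OF continuous_on_id]] by (auto simp: split_beta)
next
  case (Suc k)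
  have "continuous_on UNIV (\<lambda>(s::real, t). f t)"
    using continuous_on_compose2[OF smooth_on_continuous[OF Suc.prems] continuous_on_snd[OF continuous_on_id]] by (simp add: split_beta)
  moreover have "(f has_vector_derivative frechet_derivative f (at t) 1) (at t)" for t
  proof -
    note d = smooth_on_has_derivative[OF Suc.prems UNIV_I, of t]
    have "frechet_derivative f (at t) = (\<lambda>k. k *\<^sub>R frechet_derivative f (at t) 1)"
    proof
      fix k
      show "frechet_derivative f (at t) k = k *\<^sub>R frechet_derivative f (at t) 1"
        using linear_cmul[OF has_derivative_linear[OF d], of k 1] by (simp only: real_scaleR_def mult_1_right)
    qed
    then show ?thesis using d unfolding has_vector_derivative_def by metis
  qed
  ultimately show ?case using Suc.IH[OF smooth_on_deriv[OF Suc.prems, of 1]] unfolding param_Ck.simps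
    by (intro conjI exI[of _ "\<lambda>s t. frechet_derivative f (at t) 1"]) auto
qed

lemma sin_grid_derivative:
  assumes "smooth_on W h" "sin_grid u0 a b s t \<in> W"
  shows "((\<lambda>t. h (sin_grid u0 a b s t)) has_vector_derivative
    cos t *\<^sub>R frechet_derivative h (at (sin_grid u0 a b s t)) b) (at t)"
proof -
  have "((\<lambda>t. sin_grid u0 a b s t) has_derivative (\<lambda>k. k *\<^sub>R cos t *\<^sub>R b)) (at t)"
    unfolding sin_grid_def by (auto intro!: derivative_eq_intros)
  from has_derivative_compose[OF this smooth_on_has_derivative[OF assms]] show ?thesis
    using smooth_on_linear_deriv[OF assms] by (simp add: has_vector_derivative_def linear_cmul)
qed

lemma param_Ck_sin_grid:
  assumes W: "\<And>s t. sin_grid u0 a b s t \<in> W"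
  shows "smooth_on W h \<Longrightarrow> param_Ck k (\<lambda>s t. h (sin_grid u0 a b s t))"
proof (induction k arbitrary: h)
  case 0
  have "continuous_on UNIV (\<lambda>x. sin_grid u0 a b (fst x) (snd x))"
    unfolding sin_grid_def by (intro continuous_intros)
  from continuous_on_compose2[OF smooth_on_continuous[OF 0] this] show ?case
    using W by (auto simp: split_beta)
next
  case (Suc k)
  have "continuous_on UNIV (\<lambda>x. sin_grid u0 a b (fst x) (snd x))"
    unfolding sin_grid_def by (intro continuous_intros)
  from continuous_on_compose2[OF smooth_on_continuous[OF Suc.prems] this]
  have "continuous_on UNIV (\<lambda>(s, t). h (sin_grid u0 a b s t))" using W by (auto simp: split_beta)
  moreover have "param_Ck k (\<lambda>s t. cos t *\<^sub>R frechet_derivative h (at (sin_grid u0 a b s t)) b)"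
    by (intro param_Ck_bilinear[OF bounded_bilinear_scaleR] param_Ck_const_in_s smooth_on_cos Suc.IH smooth_on_deriv Suc.prems)
  ultimately show ?case using sin_grid_derivative[OF Suc.prems W] unfolding param_Ck.simps
    by (intro conjI exI[of _ "\<lambda>s t. cos t *\<^sub>R frechet_derivative h (at (sin_grid u0 a b s t)) b"] allI)
qed

lemma linear_ode_solution_smooth:
  fixes f :: "real \<Rightarrow> 'b::real_normed_vector"
  assumes "bounded_bilinear h" "smooth_on UNIV a" "\<And>t. (f has_vector_derivative h (a t) (f t)) (at t)"
  shows "smooth_on UNIV f"
proof -
  have "Ck_on k UNIV f" for k
  proof (induction k)
    case 0
    show ?case using assms(3) by (auto intro!: continuous_at_imp_continuous_on has_vector_derivative_continuous)
  next
    case (Suc k)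
    show ?case
      by (rule smooth_on_real_SucI[OF open_UNIV assms(3) Ck_on_bilinear[OF assms(1) open_UNIV _ Suc]])
        (use assms(2) in \<open>simp add: smooth_on_def\<close>)
  qed
  then show ?thesis by (simp add: smooth_on_def)
qed

context affine_connection
begin

text \<open>The coefficient of the equation of parallel transport along the curve \<open>s
  \<mapsto> sin_grid u0 a b s t\<close>, with \<open>t\<close> as a parameter.\<close>

definition leg_form :: "('m, 'e) chart \<Rightarrow> ('m \<Rightarrow> real) \<Rightarrow> 'e \<Rightarrow> 'e \<Rightarrow> 'e \<Rightarrow> real \<Rightarrow> real \<Rightarrow> 'e \<Rightarrow>\<^sub>L 'e" where
  "leg_form c \<rho> u0 a b s t = - (cos s *\<^sub>R conn_form c \<rho> (sin_grid u0 a b s t) a)"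

definition leg_form_deriv :: "('m, 'e) chart \<Rightarrow> ('m \<Rightarrow> real) \<Rightarrow> 'e \<Rightarrow> 'e \<Rightarrow> 'e \<Rightarrow> real \<Rightarrow> real \<Rightarrow> 'e \<Rightarrow>\<^sub>L 'e" where
  "leg_form_deriv c \<rho> u0 a b s t =
     - (cos s *\<^sub>R (cos t *\<^sub>R frechet_derivative (\<lambda>u. conn_form c \<rho> u a) (at (sin_grid u0 a b s t)) b))"

abbreviation grid_point :: "('m, 'e) chart \<Rightarrow> 'e \<Rightarrow> 'e \<Rightarrow> 'e \<Rightarrow> real \<Rightarrow> real \<Rightarrow> 'm" where
  "grid_point c u0 a b s t \<equiv> chart_inv c (sin_grid u0 a b s t)"

context
  fixes c W \<rho> u0 a b
  assumes W: "chart_cutoff A c W \<rho>"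
    and box: "\<And>x y. \<bar>x\<bar> \<le> 1 \<Longrightarrow> \<bar>y\<bar> \<le> 1 \<Longrightarrow> u0 + x *\<^sub>R a + y *\<^sub>R b \<in> W"
begin

lemma grid_in_W: "sin_grid u0 a b s t \<in> W"
  unfolding sin_grid_def by (rule box) auto

lemma param_Ck_leg_form: "param_Ck k (leg_form c \<rho> u0 a b)" "param_Ck k (leg_form_deriv c \<rho> u0 a b)"
proof -
  have m: "bounded_linear (uminus :: ('e \<Rightarrow>\<^sub>L 'e) \<Rightarrow> _)" by (rule bounded_linear_minus[OF bounded_linear_ident])
  have c: "continuous_on UNIV (cos :: real \<Rightarrow> real)" by (intro continuous_intros)
  have "param_Ck k (\<lambda>s t. - (cos s *\<^sub>R conn_form c \<rho> (sin_grid u0 a b s t) a))"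
    by (intro param_Ck_linear[OF m] param_Ck_bilinear[OF bounded_bilinear_scaleR] param_Ck_const_in_t c
        param_Ck_sin_grid[OF grid_in_W] smooth_on_conn_form[OF W])
  then show "param_Ck k (leg_form c \<rho> u0 a b)" by (simp add: leg_form_def[abs_def])
  have "param_Ck k (\<lambda>s t. - (cos s *\<^sub>R (cos t *\<^sub>R frechet_derivative (\<lambda>u. conn_form c \<rho> u a) (at (sin_grid u0 a b s t)) b)))"
    by (intro param_Ck_linear[OF m] param_Ck_bilinear[OF bounded_bilinear_scaleR] param_Ck_const_in_t c
        param_Ck_const_in_s smooth_on_cos param_Ck_sin_grid[OF grid_in_W, where h = "\<lambda>u. frechet_derivative (\<lambda>u. conn_form c \<rho> u a) (at u) b"]
        smooth_on_deriv smooth_on_conn_form[OF W])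
  then show "param_Ck k (leg_form_deriv c \<rho> u0 a b)" by (simp add: leg_form_deriv_def[abs_def])
qed

lemma leg_form_has_derivative: "(leg_form c \<rho> u0 a b s has_vector_derivative leg_form_deriv c \<rho> u0 a b s t) (at t)"
proof -
  have "((\<lambda>t. - (cos s *\<^sub>R conn_form c \<rho> (sin_grid u0 a b s t) a)) has_vector_derivative leg_form_deriv c \<rho> u0 a b s t) (at t)"
    unfolding leg_form_deriv_def
    by (intro has_vector_derivative_minus bounded_linear.has_vector_derivative[OF bounded_linear_scaleR_right]
        sin_grid_derivative[OF smooth_on_conn_form[OF W] grid_in_W])
  then show ?thesis by (simp add: leg_form_def[abs_def])
qed

lemma smooth_on_leg_form: "smooth_on UNIV (\<lambda>s. leg_form c \<rho> u0 a b s t)"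
proof -
  have g: "smooth_on UNIV (\<lambda>s. sin_grid u0 a b s t)"
    unfolding sin_grid_def
    by (intro smooth_on_add smooth_on_const smooth_on_bounded_linear[OF bounded_linear_scaleR_left] smooth_on_sin open_UNIV)
  have "smooth_on UNIV (\<lambda>s. conn_form c \<rho> (sin_grid u0 a b s t) a)"
    by (rule smooth_on_compose[OF open_UNIV chart_cutoffD(2)[OF W] _ g smooth_on_conn_form[OF W]]) (use grid_in_W in auto)
  then show ?thesis unfolding leg_form_def
    by (intro smooth_on_bounded_linear[OF bounded_linear_minus[OF bounded_linear_ident]] smooth_on_scaleR smooth_on_cos open_UNIV)
qed

lemma leg_form_bounded: "\<exists>M. \<forall>s t. norm (leg_form c \<rho> u0 a b s t) \<le> M"
proof -
  let ?K = "(\<lambda>z. u0 + fst z *\<^sub>R a + snd z *\<^sub>R b) ` ({-1..1} \<times> {-1..1})"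
  have K: "compact ?K"
    by (intro compact_continuous_image compact_Times compact_Icc continuous_intros)
  have "?K \<subseteq> W" using box by auto
  then have "compact ((\<lambda>u. conn_form c \<rho> u a) ` ?K)"
    by (intro compact_continuous_image[OF _ K] continuous_on_subset[OF smooth_on_continuous[OF smooth_on_conn_form[OF W]]])
  from compact_imp_bounded[OF this] obtain M where "\<forall>y\<in>(\<lambda>u. conn_form c \<rho> u a) ` ?K. norm y \<le> M"
    unfolding bounded_iff by blast
  then have M: "norm (conn_form c \<rho> u a) \<le> M" if "u \<in> ?K" for u using that by blast
  have "norm (leg_form c \<rho> u0 a b s t) \<le> M" for s t
  proof -
    have "(sin s, sin t) \<in> {-1..1} \<times> {-1..1}" by simp
    then have "sin_grid u0 a b s t \<in> ?K" unfolding sin_grid_def by force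
    from M[OF this] have M': "norm (conn_form c \<rho> (sin_grid u0 a b s t) a) \<le> M" .
    have "norm (leg_form c \<rho> u0 a b s t) = \<bar>cos s\<bar> * norm (conn_form c \<rho> (sin_grid u0 a b s t) a)"
      by (simp add: leg_form_def)
    also have "\<dots> \<le> 1 * M" using M' by (intro mult_mono) auto
    finally show ?thesis by simp
  qed
  then show ?thesis by blast
qed

text \<open>The curve \<open>\<sigma> \<mapsto> sin_grid u0 a b (\<sigma> s) t\<close> covers the
  part up to the parameter \<open>s\<close> in unit time.\<close>

lemma leg_transport:
  assumes U: "\<And>s. ((\<lambda>s. \<Phi> s t) has_vector_derivative leg_form c \<rho> u0 a b s t o\<^sub>L \<Phi> s t) (at s)" "\<Phi> 0 t = id_blinfun"
    and inv: "\<Psi> o\<^sub>L \<Phi> s t = id_blinfun"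
  shows "parallel_transport A D (grid_point c u0 a b 0 t) (grid_point c u0 a b s t)
      (chart_blinfun_inv c (grid_point c u0 a b s t) o\<^sub>L (\<Phi> s t o\<^sub>L chart_blinfun c (grid_point c u0 a b 0 t)))"
    "parallel_transport A D (grid_point c u0 a b s t) (grid_point c u0 a b 0 t)
      (chart_blinfun_inv c (grid_point c u0 a b 0 t) o\<^sub>L (\<Psi> o\<^sub>L chart_blinfun c (grid_point c u0 a b s t)))"
proof -
  let ?x = "\<lambda>\<sigma>. sin_grid u0 a b (\<sigma> * s) t"
  have lin: "smooth_on UNIV (\<lambda>\<sigma>. \<sigma> * s)" by (intro smooth_on_mult smooth_on_const smooth_on_id open_UNIV)
  have sx: "smooth_on UNIV ?x"
    unfolding sin_grid_def
    by (intro smooth_on_add smooth_on_const smooth_on_bounded_linear[OF bounded_linear_scaleR_left] open_UNIV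
        smooth_on_compose[OF open_UNIV open_UNIV _ lin smooth_on_sin]) auto
  have dx: "(?x has_vector_derivative (s * cos (\<sigma> * s)) *\<^sub>R a) (at \<sigma>)" for \<sigma>
    unfolding sin_grid_def has_vector_derivative_def
    by (auto intro!: derivative_eq_intros simp: algebra_simps)
  have dU: "((\<lambda>\<sigma>. \<Phi> (\<sigma> * s) t) has_vector_derivative - (conn_form c \<rho> (?x \<sigma>) ((s * cos (\<sigma> * s)) *\<^sub>R a) o\<^sub>L \<Phi> (\<sigma> * s) t)) (at \<sigma>)" for \<sigma>
  proof -
    have "((\<lambda>\<sigma>. \<sigma> * s) has_vector_derivative s) (at \<sigma>)"
      by (auto intro!: derivative_eq_intros simp: has_real_derivative_iff_has_vector_derivative[symmetric])
    from vector_diff_chain_at[OF this U(1)]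
    have "((\<lambda>\<sigma>. \<Phi> (\<sigma> * s) t) has_vector_derivative s *\<^sub>R (leg_form c \<rho> u0 a b (\<sigma> * s) t o\<^sub>L \<Phi> (\<sigma> * s) t)) (at \<sigma>)"
      by (simp add: comp_def)
    moreover have "s *\<^sub>R (leg_form c \<rho> u0 a b (\<sigma> * s) t o\<^sub>L \<Phi> (\<sigma> * s) t) =
        - (conn_form c \<rho> (?x \<sigma>) ((s * cos (\<sigma> * s)) *\<^sub>R a) o\<^sub>L \<Phi> (\<sigma> * s) t)"
      by (rule blinfun_eqI) (simp add: leg_form_def blinfun.bilinear_simps bilinear_christoffel)
    ultimately show ?thesis by simp
  qed
  show "parallel_transport A D (grid_point c u0 a b 0 t) (grid_point c u0 a b s t)
      (chart_blinfun_inv c (grid_point c u0 a b s t) o\<^sub>L (\<Phi> s t o\<^sub>L chart_blinfun c (grid_point c u0 a b 0 t)))"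
    using coordinate_curve_transport(1)[OF W sx grid_in_W dx dU, of \<Psi>] U(2) inv by simp
  show "parallel_transport A D (grid_point c u0 a b s t) (grid_point c u0 a b 0 t)
      (chart_blinfun_inv c (grid_point c u0 a b 0 t) o\<^sub>L (\<Psi> o\<^sub>L chart_blinfun c (grid_point c u0 a b s t)))"
    using coordinate_curve_transport(2)[OF W sx grid_in_W dx dU, of \<Psi>] U(2) inv by simp
qed

text \<open>\<open>V\<close> is the logarithmic derivative of the transport in the parameter
  \<open>t\<close>. Its derivative in \<open>s\<close> at the origin is a mixed term
  \<open>d\<Gamma>\<close> of the curvature.\<close>

lemma leg_solution:
  obtains \<Phi> \<Psi> V where "\<And>k. param_Ck k \<Phi>" "\<And>k. param_Ck k \<Psi>"
    "\<And>t. \<Phi> 0 t = id_blinfun" "\<And>t. \<Psi> 0 t = id_blinfun"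
    "\<And>s t. ((\<lambda>s. \<Phi> s t) has_vector_derivative leg_form c \<rho> u0 a b s t o\<^sub>L \<Phi> s t) (at s)"
    "\<And>s t. ((\<lambda>s. \<Psi> s t) has_vector_derivative - (\<Psi> s t o\<^sub>L leg_form c \<rho> u0 a b s t)) (at s)"
    "\<And>s t. \<Psi> s t o\<^sub>L \<Phi> s t = id_blinfun" "\<And>s t. \<Phi> s t o\<^sub>L \<Psi> s t = id_blinfun"
    "\<And>s t. (\<Psi> s has_vector_derivative - (V s t o\<^sub>L \<Psi> s t)) (at t)"
    "((\<lambda>s. V s 0) has_vector_derivative leg_form_deriv c \<rho> u0 a b 0 0) (at 0)"
proof -
  let ?a = "leg_form c \<rho> u0 a b" and ?a' = "leg_form_deriv c \<rho> u0 a b"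
  note ca = param_Ck_continuous[OF param_Ck_leg_form(1)[of 0]] and ca' = param_Ck_continuous[OF param_Ck_leg_form(2)[of 0]]
  obtain M where M: "\<And>s t. norm (?a s t) \<le> M" using leg_form_bounded by blast
  obtain \<Phi> \<Psi> where P: "continuous_on UNIV (\<lambda>(s, t). \<Phi> s t)" "continuous_on UNIV (\<lambda>(s, t). \<Psi> s t)"
    "\<And>t. \<Phi> 0 t = id_blinfun" "\<And>t. \<Psi> 0 t = id_blinfun"
    "\<And>s t. ((\<lambda>s. \<Phi> s t) has_vector_derivative ?a s t o\<^sub>L \<Phi> s t) (at s)"
    "\<And>s t. ((\<lambda>s. \<Psi> s t) has_vector_derivative - (\<Psi> s t o\<^sub>L ?a s t)) (at s)"
    "\<And>s t. \<Psi> s t o\<^sub>L \<Phi> s t = id_blinfun" "\<And>s t. \<Phi> s t o\<^sub>L \<Psi> s t = id_blinfun"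
    by (rule solution_operator_exists[OF ca M], rule that)
  note ass = ca ca' leg_form_has_derivative P
  define V where "V = param_variation ?a' \<Phi> \<Psi>"
  have "((\<lambda>s. V s 0) has_vector_derivative \<Psi> 0 0 o\<^sub>L (?a' 0 0 o\<^sub>L \<Phi> 0 0)) (at 0)"
    unfolding V_def param_variation_def[OF ass]
    by (rule int_from_0_derivative)
      (intro bounded_bilinear.continuous_on[OF bounded_bilinear_blinfun_compose]
        continuous_on_UNIV_pair[OF ca'] continuous_on_UNIV_pair[OF P(1)] continuous_on_UNIV_pair[OF P(2)] continuous_intros)
  then have "((\<lambda>s. V s 0) has_vector_derivative ?a' 0 0) (at 0)" by (simp add: P(3,4))
  moreover have "(\<Psi> s has_vector_derivative - (V s t o\<^sub>L \<Psi> s t)) (at t)" for s t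
    unfolding V_def by (rule solution_param_derivative(2)[OF ass])
  moreover have "param_Ck k \<Phi>" "param_Ck k \<Psi>" for k
    using solution_param_Ck(1,2)[OF ass param_Ck_leg_form(2)] by auto
  ultimately show ?thesis using that[of \<Phi> \<Psi> V] P(3-8) by blast
qed

end

text \<open>The holonomy of the loop around the parallelogram with corners \<open>(0,0)\<close>, \<open>(s,0)\<close>, \<open>(s,t)\<close>, \<open>(0,t)\<close> is
  differentiated first in \<open>t\<close>, which lands in the holonomy algebra, and then in \<open>s\<close>.\<close>

lemma curvature_form_in_holonomy_algebra:
  assumes W: "chart_cutoff A c W \<rho>" and c: "c = chart_at A p"
    and box: "\<And>x y. \<bar>x\<bar> \<le> 1 \<Longrightarrow> \<bar>y\<bar> \<le> 1 \<Longrightarrow> chart_map c p + x *\<^sub>R a + y *\<^sub>R b \<in> W"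
  defines "G \<equiv> conn_form c \<rho> (chart_map c p)"
    and "DG \<equiv> \<lambda>a b. frechet_derivative (\<lambda>u. conn_form c \<rho> u b) (at (chart_map c p)) a"
  shows "(DG a b - DG b a) + ((G a o\<^sub>L G b) - (G b o\<^sub>L G a)) \<in> holonomy_algebra A D p"
proof -
  let ?u = "chart_map c p"
  note C = chart_cutoffD[OF W]
  note comp = bounded_bilinear_blinfun_compose
  have p: "p \<in> chart_dom c" using chart_at c by simp
  have box': "?u + x *\<^sub>R b + y *\<^sub>R a \<in> W" if "\<bar>x\<bar> \<le> 1" "\<bar>y\<bar> \<le> 1" for x y
    using box[OF that(2,1)] by (simp add: algebra_simps)
  let ?L = "leg_form c \<rho> ?u"
  let ?q = "\<lambda>s t. grid_point c ?u a b s t"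
  obtain \<Phi> \<Psi> V where P: "\<And>k. param_Ck k \<Phi>" "\<And>k. param_Ck k \<Psi>"
    "\<And>t. \<Phi> 0 t = id_blinfun" "\<And>t. \<Psi> 0 t = id_blinfun"
    "\<And>s t. ((\<lambda>s. \<Phi> s t) has_vector_derivative ?L a b s t o\<^sub>L \<Phi> s t) (at s)"
    "\<And>s t. ((\<lambda>s. \<Psi> s t) has_vector_derivative - (\<Psi> s t o\<^sub>L ?L a b s t)) (at s)"
    "\<And>s t. \<Psi> s t o\<^sub>L \<Phi> s t = id_blinfun"
    "\<And>s t. (\<Psi> s has_vector_derivative - (V s t o\<^sub>L \<Psi> s t)) (at t)"
    "((\<lambda>s. V s 0) has_vector_derivative leg_form_deriv c \<rho> ?u a b 0 0) (at 0)"
    by (rule leg_solution[OF W box], assumption, assumption, rule that)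
  obtain \<Phi>2 \<Psi>2 where Q: "\<And>t. \<Phi>2 0 t = id_blinfun" "\<And>t. \<Psi>2 0 t = id_blinfun"
    "\<And>s t. ((\<lambda>s. \<Phi>2 s t) has_vector_derivative ?L b a s t o\<^sub>L \<Phi>2 s t) (at s)"
    "\<And>s t. ((\<lambda>s. \<Psi>2 s t) has_vector_derivative - (\<Psi>2 s t o\<^sub>L ?L b a s t)) (at s)"
    "\<And>s t. \<Psi>2 s t o\<^sub>L \<Phi>2 s t = id_blinfun"
    by (rule leg_solution[OF W box'], assumption, assumption, rule that)
  have qd: "?q s t \<in> chart_dom c" for s t
    using grid_in_W[OF W box] C(3) by (intro chart_inv_dom) blast
  have q0: "?q 0 0 = p" using p C(1) by simp
  have B0: "chart_blinfun c p = id_blinfun" "chart_blinfun_inv c p = id_blinfun"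
    by (rule blinfun_eqI, simp add: chart_blinfun_apply C(1) p, simp add: c)+
  let ?T = "\<lambda>s t. chart_blinfun c (?q s t)" and ?F = "\<lambda>s t. chart_blinfun_inv c (?q s t)"
  \<comment> \<open>The four sides in coordinates: \<open>\<Phi>\<close> and \<open>\<Psi>\<close>
    belong to the direction \<open>a\<close>, \<open>\<Phi>2\<close> and \<open>\<Psi>2\<close> to
    the direction \<open>b\<close>, where \<open>s\<close> and \<open>t\<close> exchange their
    roles.\<close>
  define g where "g s t = \<Psi>2 t 0 o\<^sub>L (\<Psi> s t o\<^sub>L (\<Phi>2 t s o\<^sub>L \<Phi> s 0))" for s t
  have hol: "g s t \<in> holonomy_group A D p" for s t
  proof -
    have leg1: "parallel_transport A D (?q 0 t) (?q s t) (?F s t o\<^sub>L (\<Phi> s t o\<^sub>L ?T 0 t))"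
      "parallel_transport A D (?q s t) (?q 0 t) (?F 0 t o\<^sub>L (\<Psi> s t o\<^sub>L ?T s t))" for s t
      by (rule leg_transport[OF W _ P(5) P(3) P(7)], rule box, assumption+)+
    let ?q2 = "\<lambda>s t. grid_point c ?u b a t s"
    have leg2': "parallel_transport A D (?q2 s 0) (?q2 s t) (chart_blinfun_inv c (?q2 s t) o\<^sub>L (\<Phi>2 t s o\<^sub>L chart_blinfun c (?q2 s 0)))"
      "parallel_transport A D (?q2 s t) (?q2 s 0) (chart_blinfun_inv c (?q2 s 0) o\<^sub>L (\<Psi>2 t s o\<^sub>L chart_blinfun c (?q2 s t)))" for s t
      by (rule leg_transport[OF W _ Q(3) Q(1) Q(5)], rule box', assumption+)+
    have q2: "?q2 s t = ?q s t" for s t by (simp only: sin_grid_swap)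
    note leg2 = leg2'[unfolded q2]
    have l1: "parallel_transport A D p (?q s 0) (?F s 0 o\<^sub>L (\<Phi> s 0 o\<^sub>L id_blinfun))"
      using leg1(1)[where s = s and t = 0] by (simp only: q0 B0)
    have l2: "parallel_transport A D (?q s 0) (?q s t) (?F s t o\<^sub>L (\<Phi>2 t s o\<^sub>L ?T s 0))"
      by (rule leg2(1))
    have l3: "parallel_transport A D (?q s t) (?q 0 t) (?F 0 t o\<^sub>L (\<Psi> s t o\<^sub>L ?T s t))"
      by (rule leg1(2))
    have l4: "parallel_transport A D (?q 0 t) p (id_blinfun o\<^sub>L (\<Psi>2 t 0 o\<^sub>L ?T 0 t))"
      using leg2(2)[where s = 0 and t = t] by (simp only: q0 B0)
    have "parallel_transport A D p p ((id_blinfun o\<^sub>L (\<Psi>2 t 0 o\<^sub>L ?T 0 t)) o\<^sub>L ((?F 0 t o\<^sub>L (\<Psi> s t o\<^sub>L ?T s t))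
        o\<^sub>L ((?F s t o\<^sub>L (\<Phi>2 t s o\<^sub>L ?T s 0)) o\<^sub>L (?F s 0 o\<^sub>L (\<Phi> s 0 o\<^sub>L id_blinfun)))))"
      by (rule parallel_transport_trans[OF l4 parallel_transport_trans[OF l3 parallel_transport_trans[OF l2 l1]]])
    also have "(id_blinfun o\<^sub>L (\<Psi>2 t 0 o\<^sub>L ?T 0 t)) o\<^sub>L ((?F 0 t o\<^sub>L (\<Psi> s t o\<^sub>L ?T s t))
        o\<^sub>L ((?F s t o\<^sub>L (\<Phi>2 t s o\<^sub>L ?T s 0)) o\<^sub>L (?F s 0 o\<^sub>L (\<Phi> s 0 o\<^sub>L id_blinfun)))) = g s t"
      by (rule blinfun_eqI) (simp add: g_def chart_blinfun_apply C(1) qd)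
    finally show ?thesis by (simp add: holonomy_group_def)
  qed
  have g0: "g s 0 = id_blinfun" for s by (simp add: g_def Q(1,2) P(7))
  have smooth: "smooth_on UNIV (g s)" for s
  proof -
    have "smooth_on UNIV (\<lambda>t. \<Phi>2 t s)"
      by (rule linear_ode_solution_smooth[OF comp smooth_on_leg_form[OF W box'] Q(3)])
    moreover have "smooth_on UNIV (\<lambda>t. \<Psi>2 t 0)"
    proof -
      have bil: "bounded_bilinear (\<lambda>x y :: 'e \<Rightarrow>\<^sub>L 'e. - y o\<^sub>L x)"
        using bounded_bilinear.comp[OF bounded_bilinear.flip[OF comp] bounded_linear_ident bounded_linear_minus[OF bounded_linear_ident]]
        by simp
      have d: "((\<lambda>t. \<Psi>2 t 0) has_vector_derivative (- \<Psi>2 t 0 o\<^sub>L ?L b a t 0)) (at t)" for t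
        using Q(4)[where s = t and t = 0] by (simp add: bounded_bilinear.minus_left[OF comp])
      show ?thesis by (rule linear_ode_solution_smooth[OF bil smooth_on_leg_form[OF W box'] d])
    qed
    moreover have "smooth_on UNIV (\<Psi> s)" by (rule param_Ck_smooth[OF P(2)])
    ultimately show ?thesis
      unfolding g_def by (intro smooth_on_bilinear[OF comp] smooth_on_const open_UNIV)
  qed
  \<comment> \<open>\<open>B s\<close> is the derivative of \<open>g s\<close> at \<open>t =
    0\<close>.\<close>
  define B where "B s = (\<Psi> s 0 o\<^sub>L (?L b a 0 s o\<^sub>L \<Phi> s 0)) - V s 0 - ?L b a 0 0" for s
  have "B s \<in> holonomy_algebra A D p" for s
  proof (rule holonomy_algebraI[OF smooth g0 hol])
    have "((\<lambda>t. \<Phi>2 t s o\<^sub>L \<Phi> s 0) has_vector_derivative ?L b a 0 s o\<^sub>L \<Phi> s 0) (at 0)"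
      using bounded_linear.has_vector_derivative[OF bounded_bilinear.bounded_linear_left[OF comp] Q(3)[of s 0]]
      by (simp add: Q(1))
    from bounded_bilinear.has_vector_derivative[OF comp P(8)[of s 0] this]
    have "((\<lambda>t. \<Psi> s t o\<^sub>L (\<Phi>2 t s o\<^sub>L \<Phi> s 0)) has_vector_derivative (\<Psi> s 0 o\<^sub>L (?L b a 0 s o\<^sub>L \<Phi> s 0)) - V s 0) (at 0)"
      by (simp add: Q(1) bounded_bilinear.minus_left[OF comp] blinfun_compose_assoc P(7))
    from bounded_bilinear.has_vector_derivative[OF comp Q(4)[of 0 0] this]
    show "(g s has_vector_derivative B s) (at 0)"
      by (simp add: g_def[abs_def] B_def Q(1,2) P(7) bounded_bilinear.minus_left[OF comp])
  qed
  moreover have "(B has_vector_derivative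
      (?L b a 0 0 o\<^sub>L ?L a b 0 0) + leg_form_deriv c \<rho> ?u b a 0 0 - (?L a b 0 0 o\<^sub>L ?L b a 0 0)
      - leg_form_deriv c \<rho> ?u a b 0 0) (at 0)"
  proof -
    have "((\<lambda>s. ?L b a 0 s o\<^sub>L \<Phi> s 0) has_vector_derivative (?L b a 0 0 o\<^sub>L ?L a b 0 0) + leg_form_deriv c \<rho> ?u b a 0 0) (at 0)"
      using bounded_bilinear.has_vector_derivative[OF comp leg_form_has_derivative[OF W box', of 0 0] P(5)[of 0 0]]
      by (simp add: P(3))
    from bounded_bilinear.has_vector_derivative[OF comp P(6)[of 0 0] this]
    have "((\<lambda>s. \<Psi> s 0 o\<^sub>L (?L b a 0 s o\<^sub>L \<Phi> s 0)) has_vector_derivative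
        (?L b a 0 0 o\<^sub>L ?L a b 0 0) + leg_form_deriv c \<rho> ?u b a 0 0 - (?L a b 0 0 o\<^sub>L ?L b a 0 0)) (at 0)"
      by (simp add: P(3,4) bounded_bilinear.minus_left[OF comp])
    from has_vector_derivative_diff[OF has_vector_derivative_diff[OF this P(9)] has_vector_derivative_const[of "?L b a 0 0"]]
    show ?thesis by (simp add: B_def[abs_def])
  qed
  ultimately have "(?L b a 0 0 o\<^sub>L ?L a b 0 0) + leg_form_deriv c \<rho> ?u b a 0 0 - (?L a b 0 0 o\<^sub>L ?L b a 0 0)
      - leg_form_deriv c \<rho> ?u a b 0 0 \<in> holonomy_algebra A D p"
    by (rule derivative_in_subspace[OF subspace_holonomy_algebra])
  from subspace_neg[OF subspace_holonomy_algebra this]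
  show ?thesis
    by (simp add: leg_form_def leg_form_deriv_def G_def DG_def algebra_simps
        bounded_bilinear.minus_left[OF comp] bounded_bilinear.minus_right[OF comp])
qed

lemma small_box:
  assumes "open W" "u \<in> (W :: 'e set)"
  obtains r where "r > 0" "\<And>x y. \<bar>x\<bar> \<le> 1 \<Longrightarrow> \<bar>y\<bar> \<le> 1 \<Longrightarrow> u + x *\<^sub>R (r *\<^sub>R a) + y *\<^sub>R (r *\<^sub>R b) \<in> W"
proof -
  obtain e where e: "e > 0" "ball u e \<subseteq> W" using assms openE by blast
  define N where "N = norm a + norm b + 1"
  have N: "N > 0" by (simp add: N_def add_nonneg_pos)
  define r where "r = e / (2 * N)"
  have r: "r > 0" using e N by (simp add: r_def)
  have "u + x *\<^sub>R (r *\<^sub>R a) + y *\<^sub>R (r *\<^sub>R b) \<in> W" if "\<bar>x\<bar> \<le> 1" "\<bar>y\<bar> \<le> 1" for x y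
  proof -
    have "norm (x *\<^sub>R (r *\<^sub>R a) + y *\<^sub>R (r *\<^sub>R b)) \<le> norm (x *\<^sub>R (r *\<^sub>R a)) + norm (y *\<^sub>R (r *\<^sub>R b))" by (rule norm_triangle_ineq)
    also have "\<dots> = \<bar>x\<bar> * (r * norm a) + \<bar>y\<bar> * (r * norm b)" using r by (simp add: abs_mult)
    also have "\<dots> \<le> 1 * (r * norm a) + 1 * (r * norm b)"
      using that r by (intro add_mono mult_right_mono) auto
    also have "\<dots> \<le> r * N" using r by (simp add: N_def algebra_simps)
    also have "\<dots> < e" using N e by (simp add: r_def)
    finally have "norm (x *\<^sub>R (r *\<^sub>R a) + y *\<^sub>R (r *\<^sub>R b)) < e" .
    then have "u + (x *\<^sub>R (r *\<^sub>R a) + y *\<^sub>R (r *\<^sub>R b)) \<in> ball u e"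
      by (metis add_diff_cancel_left' dist_commute dist_norm mem_ball)
    then show ?thesis using e(2) by (simp only: add.assoc subsetD)
  qed
  then show ?thesis using that r by blast
qed

text \<open>Coordinate fields have vanishing bracket over \<open>W\<close>, so the curvature on
  them is given by the curvature form \<open>d\<Gamma> + \<Gamma> \<and> \<Gamma>\<close> of the
  connection form.\<close>

lemma curvature_in_chart:
  assumes W: "chart_cutoff A c W \<rho>" and p: "c = chart_at A p" "chart_map c p \<in> W"
    and X: "X \<in> vector_fields A" and Y: "Y \<in> vector_fields A"
  defines "G \<equiv> conn_form c \<rho> (chart_map c p)"
    and "DG \<equiv> \<lambda>a b. frechet_derivative (\<lambda>u. conn_form c \<rho> u b) (at (chart_map c p)) a"
  shows "curvature A D X Y p = (DG (X p) (Y p) - DG (Y p) (X p)) + ((G (X p) o\<^sub>L G (Y p)) - (G (Y p) o\<^sub>L G (X p)))"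
proof -
  note C = chart_cutoffD[OF W]
  let ?E = "chart_frame A c \<rho>" and ?u = "chart_map c p"
  note E = chart_frame_vf[OF W]
  have pd: "p \<in> chart_dom c" using chart_at p(1) by simp
  have Ep: "?E v p = v" for v using C(7)[OF pd p(2)] p(1) by (simp add: chart_frame_def)
  have rep: "vf_rep A c Z ?u = Z p" for Z using p(1) by simp
  have ui: "?u \<in> chart_image c" using pd by blast
  have "curvature A D X Y p = curvature A D (?E (X p)) (?E (Y p)) p"
    using tensorial_pointwise[OF tensorial_curvature(1)[OF Y] X E, of p "X p"]
      tensorial_pointwise[OF tensorial_curvature(2)[OF E] Y E, of p "Y p" "X p"] by (simp add: Ep)
  moreover have "curvature A D (?E a) (?E b) p = (DG a b - DG b a) + ((G a o\<^sub>L G b) - (G b o\<^sub>L G a))" for a b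
  proof (rule blinfun_eqI)
    fix v
    have DE: "vf_rep A c (D (?E b) (?E v)) u = conn_form c \<rho> u b v" if "u \<in> W" for b u
      using vf_rep_D_frame[OF W that] by simp
    have D2: "D (?E a) (D (?E b) (?E v)) p = blinfun_apply (DG a b) v + G a (G b v)" for a b
    proof -
      have "((\<lambda>u. conn_form c \<rho> u b v) has_derivative (\<lambda>k. frechet_derivative (\<lambda>u. conn_form c \<rho> u b) (at ?u) k v)) (at ?u)"
        by (rule bounded_linear.has_derivative[OF blinfun.bounded_linear_left smooth_on_has_derivative[OF smooth_on_conn_form[OF W] p(2)]])
      then have "(vf_rep A c (D (?E b) (?E v)) has_derivative (\<lambda>k. frechet_derivative (\<lambda>u. conn_form c \<rho> u b) (at ?u) k v)) (at ?u)"
        by (rule has_derivative_transform_within_open[OF _ C(2) p(2)]) (rule DE[symmetric])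
      from frechet_derivative_at[OF this, THEN fun_cong, of a, symmetric]
      have "frechet_derivative (vf_rep A c (D (?E b) (?E v))) (at ?u) a = blinfun_apply (DG a b) v" by (simp add: DG_def)
      then show ?thesis
        using vf_rep_D[OF W p(2) E D_closed[OF E E], of a b v]
        unfolding rep[of "D (?E a) (D (?E b) (?E v))"] vf_rep_chart_frame[OF W p(2)] DE[OF p(2)] by (simp add: G_def)
    qed
    have "frechet_derivative (vf_rep A c (?E w)) (at ?u) k = 0" for w k
      by (rule frechet_derivative_locally_const[OF C(2) p(2)]) (rule vf_rep_chart_frame[OF W])
    then have "jacobi_bracket A (?E a) (?E b) p = 0"
      using vf_rep_jacobi_bracket[OF E E C(1) ui, of a b] rep[of "jacobi_bracket A (?E a) (?E b)"] by simp
    then have "D (jacobi_bracket A (?E a) (?E b)) (?E v) p = D 0 (?E v) p"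
      by (intro tensorial_pointwise[OF tensorial_D[OF E]] jacobi_bracket_vf E vf_zero) simp
    also have "D 0 (?E v) = 0" using D_cmul_left[OF vf_zero E, of 0 v] by simp
    finally have J: "D (jacobi_bracket A (?E a) (?E b)) (?E v) p = 0" by simp
    have "blinfun_apply (curvature A D (?E a) (?E b) p) v = curvature_op A D (?E a) (?E b) (?E v) p"
      using curvature_apply[OF E E E, of a b p v] by (simp add: Ep)
    also have "\<dots> = blinfun_apply (DG a b) v + G a (G b v) - (blinfun_apply (DG b a) v + G b (G a v))"
      by (simp add: curvature_op_def D2 J)
    finally show "blinfun_apply (curvature A D (?E a) (?E b) p) v =
        blinfun_apply ((DG a b - DG b a) + ((G a o\<^sub>L G b) - (G b o\<^sub>L G a))) v"
      by (simp add: blinfun.bilinear_simps)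
  qed
  ultimately show ?thesis by simp
qed

text \<open>Small multiples of \<open>X\<close> and \<open>Y\<close> span a parallelogram inside
  the chart; the factor disappears by bilinearity.\<close>

lemma curvature_in_holonomy_algebra:
  assumes X: "X \<in> vector_fields A" and Y: "Y \<in> vector_fields A"
  shows "curvature A D X Y p \<in> holonomy_algebra A D p"
proof -
  define c where "c = chart_at A p"
  obtain W \<rho> where W: "chart_cutoff A c W \<rho>" "chart_map c p \<in> W"
    using chart_cutoff_exists chart_at unfolding c_def by metis
  obtain r where r: "r > 0" "\<And>x y. \<bar>x\<bar> \<le> 1 \<Longrightarrow> \<bar>y\<bar> \<le> 1 \<Longrightarrow> chart_map c p + x *\<^sub>R (r *\<^sub>R X p) + y *\<^sub>R (r *\<^sub>R Y p) \<in> W"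
    using small_box[OF chart_cutoffD(2)[OF W(1)] W(2)] by blast
  have rX: "r *\<^sub>R X \<in> vector_fields A" "r *\<^sub>R Y \<in> vector_fields A" using X Y vf_cmul by auto
  have "curvature A D (r *\<^sub>R X) (r *\<^sub>R Y) p \<in> holonomy_algebra A D p"
    unfolding curvature_in_chart[OF W(1) c_def W(2) rX]
    using curvature_form_in_holonomy_algebra[OF W(1) c_def r(2)] by (simp add: scaleR_fun_def)
  moreover have "curvature A D (r *\<^sub>R X) (r *\<^sub>R Y) p = r *\<^sub>R r *\<^sub>R curvature A D X Y p"
    using tensorial_curvature(1)[OF rX(2)] tensorial_curvature(2)[OF X] X Y smooth_funs_const[of r]
    by (simp add: tensorial_def scaleR_fun_def)
  ultimately have "(1 / (r * r)) *\<^sub>R (r *\<^sub>R r *\<^sub>R curvature A D X Y p) \<in> holonomy_algebra A D p"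
    using subspace_scale[OF subspace_holonomy_algebra] by metis
  then show ?thesis using r(1) by simp
qed

lemma curvature_holonomy_fields:
  "X \<in> vector_fields A \<Longrightarrow> Y \<in> vector_fields A \<Longrightarrow> curvature A D X Y \<in> holonomy_fields A D"
  by (simp add: holonomy_fields_def curvature_endo_fields curvature_in_holonomy_algebra)

section \<open>The holonomy bundle is parallel\<close>

definition endo_chart :: "('m, 'e) chart \<Rightarrow> ('m \<Rightarrow> 'e \<Rightarrow>\<^sub>L 'e) \<Rightarrow> 'e \<Rightarrow> 'e \<Rightarrow>\<^sub>L 'e" where
  "endo_chart c E u = chart_blinfun c (chart_inv c u) o\<^sub>L (E (chart_inv c u) o\<^sub>L chart_blinfun_inv c (chart_inv c u))"

lemma endo_chart_apply:
  "c \<in> A \<Longrightarrow> u \<in> chart_image c \<Longrightarrow> blinfun_apply (endo_chart c E u) v = endo_rep A c E u v"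
  by (simp add: endo_chart_def endo_rep_def chart_blinfun_apply Let_def)

lemma smooth_on_endo_chart: "E \<in> endo_fields A \<Longrightarrow> c \<in> A \<Longrightarrow> smooth_on (chart_image c) (endo_chart c E)"
  by (rule smooth_on_blinfunI[OF open_image], assumption,
      subst smooth_on_cong[OF open_image, where g = "\<lambda>u. endo_rep A c E u v" for v])
    (auto simp: endo_chart_apply intro: endo_smooth)

text \<open>The coordinate formula \<open>\<nabla>\<^sub>X E = dE(X) + [\<Gamma>(X),
  E]\<close>.\<close>

lemma cov_deriv_endo_in_chart:
  assumes W: "chart_cutoff A c W \<rho>" and p: "c = chart_at A p" "chart_map c p \<in> W"
    and X: "X \<in> vector_fields A" and E: "E \<in> endo_fields A"
  defines "G \<equiv> conn_form c \<rho> (chart_map c p)"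
  shows "cov_deriv_endo A D X E p = frechet_derivative (endo_chart c E) (at (chart_map c p)) (X p) +
    ((G (X p) o\<^sub>L E p) - (E p o\<^sub>L G (X p)))"
proof (rule blinfun_eqI)
  fix v
  note C = chart_cutoffD[OF W]
  let ?E = "chart_frame A c \<rho>" and ?u = "chart_map c p"
  note Ev = chart_frame_vf[OF W]
  have pd: "p \<in> chart_dom c" using chart_at p(1) by simp
  have Ep: "?E v p = v" for v using C(7)[OF pd p(2)] p(1) by (simp add: chart_frame_def)
  have rep: "vf_rep A c Z ?u = Z p" for Z using p(1) by simp
  have ui: "?u \<in> chart_image c" using pd by blast
  have EE: "vf_rep A c (endo_app E (?E v)) u = endo_chart c E u v" if "u \<in> W" for u
    using that C(1,3) by (simp add: vf_rep_endo_app endo_chart_apply vf_rep_chart_frame[OF W that] subset_iff)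
  have "((\<lambda>u. endo_chart c E u v) has_derivative (\<lambda>k. frechet_derivative (endo_chart c E) (at ?u) k v)) (at ?u)"
    by (rule bounded_linear.has_derivative[OF blinfun.bounded_linear_left smooth_on_has_derivative[OF smooth_on_endo_chart[OF E C(1)] ui]])
  then have "(vf_rep A c (endo_app E (?E v)) has_derivative (\<lambda>k. frechet_derivative (endo_chart c E) (at ?u) k v)) (at ?u)"
    by (rule has_derivative_transform_within_open[OF _ C(2) p(2)]) (rule EE[symmetric])
  from frechet_derivative_at[OF this, THEN fun_cong, of "X p", symmetric]
  have d: "frechet_derivative (vf_rep A c (endo_app E (?E v))) (at ?u) (X p) = frechet_derivative (endo_chart c E) (at ?u) (X p) v" .
  have "D X (endo_app E (?E v)) p = frechet_derivative (endo_chart c E) (at ?u) (X p) v + G (X p) (E p v)"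
    using vf_rep_D[OF W p(2) X endo_app_vf[OF E Ev], of v] unfolding rep d by (simp add: G_def endo_app_apply Ep)
  moreover have "D X (?E v) p = G (X p) v"
  proof -
    have "frechet_derivative (vf_rep A c (?E v)) (at ?u) k = 0" for k
      by (rule frechet_derivative_locally_const[OF C(2) p(2)]) (rule vf_rep_chart_frame[OF W])
    then show ?thesis using vf_rep_D[OF W p(2) X Ev, of v] unfolding rep by (simp add: G_def Ep)
  qed
  ultimately show "blinfun_apply (cov_deriv_endo A D X E p) v =
     blinfun_apply (frechet_derivative (endo_chart c E) (at ?u) (X p) + ((G (X p) o\<^sub>L E p) - (E p o\<^sub>L G (X p)))) v"
    using cov_deriv_endo_apply[OF X E Ev, of p v] by (simp add: Ep blinfun.bilinear_simps)
qed

text \<open>Parallel transport along a curve of velocity \<open>X\<close> carries the values of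
  \<open>E\<close> back to \<open>p\<close>. This gives a curve in the holonomy algebra at
  \<open>p\<close>, whose derivative at 0 is the covariant derivative. The curve is a degenerate
  parallelogram, with second side 0.\<close>

lemma cov_deriv_in_holonomy_algebra:
  assumes X: "X \<in> vector_fields A" and E: "E \<in> holonomy_fields A D"
  shows "cov_deriv_endo A D X E p \<in> holonomy_algebra A D p"
proof -
  define c where "c = chart_at A p"
  have Ee: "E \<in> endo_fields A" and Eh: "\<And>q. E q \<in> holonomy_algebra A D q"
    using E by (auto simp: holonomy_fields_def)
  let ?u = "chart_map c p"
  obtain W \<rho> where W: "chart_cutoff A c W \<rho>" "?u \<in> W"
    using chart_cutoff_exists chart_at unfolding c_def by metis
  note C = chart_cutoffD[OF W(1)]
  note comp = bounded_bilinear_blinfun_compose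
  have p: "p \<in> chart_dom c" using chart_at c_def by simp
  obtain r where r: "r > 0" "\<And>x y. \<bar>x\<bar> \<le> 1 \<Longrightarrow> \<bar>y\<bar> \<le> 1 \<Longrightarrow> ?u + x *\<^sub>R (r *\<^sub>R X p) + y *\<^sub>R (r *\<^sub>R 0) \<in> W"
    using small_box[OF C(2) W(2), of "X p" 0] by blast
  define a where "a = r *\<^sub>R X p"
  have box: "?u + x *\<^sub>R a + y *\<^sub>R 0 \<in> W" if "\<bar>x\<bar> \<le> 1" "\<bar>y\<bar> \<le> 1" for x y
    using r(2)[OF that] by (simp add: a_def)
  let ?L = "leg_form c \<rho> ?u a 0"
  let ?q = "\<lambda>s. grid_point c ?u a 0 s 0"
  obtain \<Phi> \<Psi> where P: "\<And>t. \<Phi> 0 t = id_blinfun" "\<And>t. \<Psi> 0 t = id_blinfun"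
    "\<And>s t. ((\<lambda>s. \<Phi> s t) has_vector_derivative ?L s t o\<^sub>L \<Phi> s t) (at s)"
    "\<And>s t. ((\<lambda>s. \<Psi> s t) has_vector_derivative - (\<Psi> s t o\<^sub>L ?L s t)) (at s)"
    "\<And>s t. \<Psi> s t o\<^sub>L \<Phi> s t = id_blinfun"
    by (rule leg_solution[OF W(1) box], assumption, assumption, rule that)
  have qd: "?q s \<in> chart_dom c" for s
    using grid_in_W[OF W(1) box] C(3) by (intro chart_inv_dom) blast
  have q0: "?q 0 = p" using p C(1) by simp
  have B0: "chart_blinfun c p = id_blinfun" "chart_blinfun_inv c p = id_blinfun"
    by (rule blinfun_eqI, simp add: chart_blinfun_apply C(1) p, simp add: c_def)+
  let ?g = "\<lambda>s. sin_grid ?u a 0 s 0"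
  define f where "f s = \<Psi> s 0 o\<^sub>L (endo_chart c E (?g s) o\<^sub>L \<Phi> s 0)" for s
  have hol: "f s \<in> holonomy_algebra A D p" for s
  proof -
    let ?L = "chart_blinfun_inv c (?q s) o\<^sub>L (\<Phi> s 0 o\<^sub>L id_blinfun)" and ?K = "id_blinfun o\<^sub>L (\<Psi> s 0 o\<^sub>L chart_blinfun c (?q s))"
    have leg: "parallel_transport A D (?q 0) (?q s) (chart_blinfun_inv c (?q s) o\<^sub>L (\<Phi> s 0 o\<^sub>L chart_blinfun c (?q 0)))"
      "parallel_transport A D (?q s) (?q 0) (chart_blinfun_inv c (?q 0) o\<^sub>L (\<Psi> s 0 o\<^sub>L chart_blinfun c (?q s)))"
      by (rule leg_transport[OF W(1) _ P(3) P(1) P(5)], rule box, assumption+)+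
    have L: "parallel_transport A D p (?q s) ?L" using leg(1) by (simp only: q0 B0)
    have K: "parallel_transport A D (?q s) p ?K" using leg(2) by (simp only: q0 B0)
    have KL: "?K o\<^sub>L ?L = id_blinfun"
      by (rule blinfun_eqI) (simp add: chart_blinfun_apply C(1) qd blinfun_compose_inverse_apply[OF P(5)])
    have "?K o\<^sub>L (E (?q s) o\<^sub>L ?L) \<in> holonomy_algebra A D p"
      by (rule holonomy_algebra_conjugate[OF L K KL Eh])
    moreover have "?K o\<^sub>L (E (?q s) o\<^sub>L ?L) = f s"
      by (rule blinfun_eqI) (simp add: f_def endo_chart_def)
    ultimately show ?thesis by simp
  qed
  have ui: "?u \<in> chart_image c" using p by blast
  have dE: "((\<lambda>s. endo_chart c E (?g s)) has_vector_derivative frechet_derivative (endo_chart c E) (at ?u) a) (at 0)"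
  proof -
    note d = smooth_on_has_derivative[OF smooth_on_endo_chart[OF Ee C(1)] ui]
    have "(?g has_derivative (\<lambda>k. k *\<^sub>R a)) (at 0)"
      unfolding sin_grid_def by (auto intro!: derivative_eq_intros)
    from has_derivative_compose[OF this, of "endo_chart c E" "frechet_derivative (endo_chart c E) (at ?u)"] d show ?thesis
      using has_derivative_linear[OF d] by (simp add: has_vector_derivative_def linear_cmul)
  qed
  have "((\<lambda>s. endo_chart c E (?g s) o\<^sub>L \<Phi> s 0) has_vector_derivative
      (E p o\<^sub>L ?L 0 0) + frechet_derivative (endo_chart c E) (at ?u) a) (at 0)"
    using bounded_bilinear.has_vector_derivative[OF comp dE P(3)[of 0 0]]
    by (simp add: P(1) endo_chart_def p C(1) B0)
  from bounded_bilinear.has_vector_derivative[OF comp P(4)[of 0 0] this]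
  have "(f has_vector_derivative ((E p o\<^sub>L ?L 0 0) + frechet_derivative (endo_chart c E) (at ?u) a) + - (?L 0 0 o\<^sub>L E p)) (at 0)"
    by (simp add: f_def[abs_def] P(1,2) endo_chart_def p C(1) B0 bounded_bilinear.minus_left[OF comp])
  from derivative_in_subspace[OF subspace_holonomy_algebra hol this]
  have "((E p o\<^sub>L ?L 0 0) + frechet_derivative (endo_chart c E) (at ?u) a) + - (?L 0 0 o\<^sub>L E p) \<in> holonomy_algebra A D p" .
  moreover have "((E p o\<^sub>L ?L 0 0) + frechet_derivative (endo_chart c E) (at ?u) a) + - (?L 0 0 o\<^sub>L E p) = r *\<^sub>R cov_deriv_endo A D X E p"
  proof -
    have "frechet_derivative (endo_chart c E) (at ?u) a = r *\<^sub>R frechet_derivative (endo_chart c E) (at ?u) (X p)"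
      unfolding a_def by (rule linear_cmul[OF smooth_on_linear_deriv[OF smooth_on_endo_chart[OF Ee C(1)] ui]])
    moreover have "?L 0 0 = - (r *\<^sub>R conn_form c \<rho> ?u (X p))"
      unfolding leg_form_def a_def by (simp add: linear_cmul[OF linear_conn_form])
    ultimately show ?thesis
      unfolding cov_deriv_endo_in_chart[OF W(1) c_def W(2) X Ee]
      by (simp add: bounded_bilinear.minus_left[OF comp] bounded_bilinear.minus_right[OF comp]
          bounded_bilinear.scaleR_left[OF comp] bounded_bilinear.scaleR_right[OF comp] algebra_simps)
  qed
  ultimately have "(1 / r) *\<^sub>R (r *\<^sub>R cov_deriv_endo A D X E p) \<in> holonomy_algebra A D p"
    using subspace_scale[OF subspace_holonomy_algebra] by metis
  then show ?thesis using r(1) by simp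
qed

lemma cov_deriv_holonomy_fields:
  assumes "X \<in> vector_fields A" "E \<in> holonomy_fields A D"
  shows "cov_deriv_endo A D X E \<in> holonomy_fields A D"
  using assms cov_deriv_endo_fields cov_deriv_in_holonomy_algebra by (simp add: holonomy_fields_def)

end

section \<open>Parallel tensors are invariant under holonomy\<close>

context affine_connection
begin

definition ext_vf :: "'m \<Rightarrow> 'e \<Rightarrow> 'm \<Rightarrow> 'e" where
  "ext_vf q v = (SOME X. X \<in> vector_fields A \<and> X q = v)"

lemma ext_vf: "ext_vf q v \<in> vector_fields A" "ext_vf q v q = v"
proof -
  have "\<exists>X. X \<in> vector_fields A \<and> X q = v" using vector_field_through by blast
  from someI_ex[OF this] show "ext_vf q v \<in> vector_fields A" "ext_vf q v q = v"
    unfolding ext_vf_def by auto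
qed

text \<open>The torsion as a bilinear map on the tangent space at \<open>q\<close>. By
  tensoriality the choice of the extending fields does not matter.\<close>

definition torsion_at :: "'m \<Rightarrow> 'e \<Rightarrow> 'e \<Rightarrow> 'e" where
  "torsion_at q v w = torsion A D (ext_vf q v) (ext_vf q w) q"

definition curvature_at :: "'m \<Rightarrow> 'e \<Rightarrow> 'e \<Rightarrow> 'e \<Rightarrow> 'e" where
  "curvature_at q v w z = curvature_op A D (ext_vf q v) (ext_vf q w) (ext_vf q z) q"

lemma torsion_at:
  assumes X: "X \<in> vector_fields A" and Y: "Y \<in> vector_fields A"
  shows "torsion A D X Y q = torsion_at q (X q) (Y q)"
proof -
  have "torsion A D X Y q = torsion A D (ext_vf q (X q)) Y q"
    by (rule tensorial_pointwise[OF tensorial_torsion[OF Y] X ext_vf(1)]) (simp add: ext_vf(2))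
  also have "\<dots> = torsion A D (ext_vf q (X q)) (ext_vf q (Y q)) q"
    by (rule tensorial_pointwise[OF tensorial_torsion'[OF ext_vf(1)] Y ext_vf(1)]) (simp add: ext_vf(2))
  finally show ?thesis by (simp add: torsion_at_def)
qed

lemma curvature_at:
  assumes X: "X \<in> vector_fields A" and Y: "Y \<in> vector_fields A" and Z: "Z \<in> vector_fields A"
  shows "curvature_op A D X Y Z q = curvature_at q (X q) (Y q) (Z q)"
proof -
  have "curvature_op A D X Y Z q = curvature_op A D (ext_vf q (X q)) Y Z q"
    by (rule tensorial_pointwise[OF tensorial_curvature_op_left[OF Y Z] X ext_vf(1)]) (simp add: ext_vf(2))
  also have "\<dots> = curvature_op A D (ext_vf q (X q)) (ext_vf q (Y q)) Z q"
    by (rule tensorial_pointwise[OF tensorial_curvature_op_mid[OF ext_vf(1) Z] Y ext_vf(1)]) (simp add: ext_vf(2))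
  also have "\<dots> = curvature_op A D (ext_vf q (X q)) (ext_vf q (Y q)) (ext_vf q (Z q)) q"
    by (rule tensorial_pointwise[OF tensorial_curvature_op[OF ext_vf(1) ext_vf(1)] Z ext_vf(1)]) (simp add: ext_vf(2))
  finally show ?thesis by (simp add: curvature_at_def)
qed

lemma linear_by_fields:
  fixes f :: "'e \<Rightarrow> 'f::real_vector"
  assumes Q: "tensorial A Q" and f: "\<And>X. X \<in> vector_fields A \<Longrightarrow> Q X q = f (X q)"
  shows "linear f"
proof (rule linearI)
  fix v w r
  have "f (v + w) = Q (ext_vf q v + ext_vf q w) q" using f[OF vf_add[OF ext_vf(1) ext_vf(1)], of q v q w] by (simp add: ext_vf(2))
  also have "\<dots> = (Q (ext_vf q v) + Q (ext_vf q w)) q" using Q ext_vf(1) by (simp only: tensorial_def)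
  finally show "f (v + w) = f v + f w" using f[OF ext_vf(1), of q] by (simp add: ext_vf(2))
  have "f (r *\<^sub>R v) = Q (\<lambda>p. r *\<^sub>R ext_vf q v p) q"
    using f[OF vf_scale[OF smooth_funs_const ext_vf(1)], of r q v] by (simp add: ext_vf(2))
  also have "\<dots> = (\<lambda>p. r *\<^sub>R Q (ext_vf q v) p) q"
    using Q ext_vf(1) smooth_funs_const[of r] by (simp add: tensorial_def)
  finally show "f (r *\<^sub>R v) = r *\<^sub>R f v" using f[OF ext_vf(1), of q] by (simp add: ext_vf(2))
qed

lemma linear_torsion_at: "linear (\<lambda>v. torsion_at q v w)" "linear (torsion_at q w)"
proof -
  show "linear (\<lambda>v. torsion_at q v w)"
    by (rule linear_by_fields[OF tensorial_torsion[OF ext_vf(1)[of q w]], of q]) (simp add: torsion_at ext_vf)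
  show "linear (torsion_at q w)"
    by (rule linear_by_fields[OF tensorial_torsion'[OF ext_vf(1)[of q w]], of q]) (simp add: torsion_at ext_vf)
qed

lemma linear_curvature_at:
  "linear (\<lambda>v. curvature_at q v w z)" "linear (\<lambda>w. curvature_at q v w z)" "linear (curvature_at q v w)"
proof -
  show "linear (\<lambda>v. curvature_at q v w z)"
    by (rule linear_by_fields[OF tensorial_curvature_op_left[OF ext_vf(1)[of q w] ext_vf(1)[of q z]], of q]) (simp add: curvature_at ext_vf)
  show "linear (\<lambda>w. curvature_at q v w z)"
    by (rule linear_by_fields[OF tensorial_curvature_op_mid[OF ext_vf(1)[of q v] ext_vf(1)[of q z]], of q]) (simp add: curvature_at ext_vf)
  show "linear (curvature_at q v w)"
    by (rule linear_by_fields[OF tensorial_curvature_op[OF ext_vf(1)[of q v] ext_vf(1)[of q w]], of q]) (simp add: curvature_at ext_vf)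
qed

lemma linear_conjugate_chart:
  assumes "c \<in> A" "q \<in> chart_dom c" "linear f"
  shows "linear (\<lambda>v. to_chart A c q (f (from_chart A c q v)))"
  using linear_compose[OF linear_compose[OF linear_from_chart[OF assms(1,2)] assms(3)] linear_to_chart[OF assms(1,2)]]
  by (simp add: comp_def)

definition torsion_chart :: "('m, 'e) chart \<Rightarrow> 'e \<Rightarrow> 'e \<Rightarrow> 'e \<Rightarrow> 'e" where
  "torsion_chart c u v w = (let q = chart_inv c u in to_chart A c q (torsion_at q (from_chart A c q v) (from_chart A c q w)))"

definition curvature_chart :: "('m, 'e) chart \<Rightarrow> 'e \<Rightarrow> 'e \<Rightarrow> 'e \<Rightarrow> 'e \<Rightarrow> 'e" where
  "curvature_chart c u v w z = (let q = chart_inv c u in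
     to_chart A c q (curvature_at q (from_chart A c q v) (from_chart A c q w) (from_chart A c q z)))"

lemma vf_rep_torsion:
  assumes "c \<in> A" "u \<in> chart_image c" "X \<in> vector_fields A" "Y \<in> vector_fields A"
  shows "vf_rep A c (torsion A D X Y) u = torsion_chart c u (vf_rep A c X u) (vf_rep A c Y u)"
  using assms by (simp add: vf_rep_def torsion_chart_def Let_def torsion_at)

lemma vf_rep_curvature:
  assumes "c \<in> A" "u \<in> chart_image c" "X \<in> vector_fields A" "Y \<in> vector_fields A" "Z \<in> vector_fields A"
  shows "vf_rep A c (curvature_op A D X Y Z) u = curvature_chart c u (vf_rep A c X u) (vf_rep A c Y u) (vf_rep A c Z u)"
  using assms by (simp add: vf_rep_def curvature_chart_def Let_def curvature_at)

lemma linear_torsion_chart: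
  assumes "c \<in> A" "u \<in> chart_image c"
  shows "linear (\<lambda>v. torsion_chart c u v w)" "linear (torsion_chart c u v)"
  unfolding torsion_chart_def Let_def using assms
  by (auto intro!: linear_conjugate_chart linear_torsion_at)

lemma linear_curvature_chart:
  assumes "c \<in> A" "u \<in> chart_image c"
  shows "linear (\<lambda>v. curvature_chart c u v w z)" "linear (\<lambda>w. curvature_chart c u v w z)" "linear (curvature_chart c u v w)"
  unfolding curvature_chart_def Let_def using assms
  by (auto intro!: linear_conjugate_chart linear_curvature_at)

end

context parallel_connection
begin

text \<open>On fields with constant coordinates, \<open>\<nabla>T = 0\<close> expresses the
  derivative of the components of \<open>T\<close> by the connection form.\<close>

lemma torsion_chart_derivative:
  assumes W: "chart_cutoff A c W \<rho>" and u: "u \<in> W"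
  shows "((\<lambda>u. torsion_chart c u v w) has_derivative (\<lambda>a. torsion_chart c u (conn_form c \<rho> u a v) w
    + torsion_chart c u v (conn_form c \<rho> u a w) - conn_form c \<rho> u a (torsion_chart c u v w))) (at u)"
proof -
  note C = chart_cutoffD[OF W]
  let ?E = "chart_frame A c \<rho>"
  note E = chart_frame_vf[OF W]
  have ui: "y \<in> chart_image c" if "y \<in> W" for y using C(3) that by blast
  have rep: "vf_rep A c (torsion A D (?E v) (?E w)) y = torsion_chart c y v w" if "y \<in> W" for y v w
    by (simp add: vf_rep_torsion[OF C(1) ui[OF that] E E] vf_rep_chart_frame[OF W that])
  note T = torsion_vf[OF E[of v] E[of w]]
  have d: "((\<lambda>u. torsion_chart c u v w) has_derivative frechet_derivative (vf_rep A c (torsion A D (?E v) (?E w))) (at u)) (at u)"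
    by (rule has_derivative_transform_within_open[OF smooth_on_has_derivative[OF vf_smooth[OF T C(1)] ui[OF u]] C(2) u]) (rule rep)
  have "frechet_derivative (vf_rep A c (torsion A D (?E v) (?E w))) (at u) a =
      torsion_chart c u (conn_form c \<rho> u a v) w + torsion_chart c u v (conn_form c \<rho> u a w) - conn_form c \<rho> u a (torsion_chart c u v w)" for a
  proof -
    have "vf_rep A c (D (?E a) (torsion A D (?E v) (?E w))) u =
        vf_rep A c (torsion A D (D (?E a) (?E v)) (?E w) + torsion A D (?E v) (D (?E a) (?E w))) u"
      by (simp only: D_torsion[OF E E E])
    also have "\<dots> = torsion_chart c u (conn_form c \<rho> u a v) w + torsion_chart c u v (conn_form c \<rho> u a w)"
      by (simp add: vf_rep_add[OF C(1) ui[OF u]] vf_rep_torsion[OF C(1) ui[OF u]] D_closed E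
          vf_rep_chart_frame[OF W u] vf_rep_D_frame[OF W u])
    finally show ?thesis
      unfolding vf_rep_D[OF W u E T] rep[OF u] vf_rep_chart_frame[OF W u] conn_form_apply by (simp add: algebra_simps)
  qed
  then have "frechet_derivative (vf_rep A c (torsion A D (?E v) (?E w))) (at u) = (\<lambda>a. torsion_chart c u (conn_form c \<rho> u a v) w
    + torsion_chart c u v (conn_form c \<rho> u a w) - conn_form c \<rho> u a (torsion_chart c u v w))" by (rule ext)
  then show ?thesis using d by (simp only:)
qed

lemma curvature_chart_derivative:
  assumes W: "chart_cutoff A c W \<rho>" and u: "u \<in> W"
  shows "((\<lambda>u. curvature_chart c u v w z) has_derivative (\<lambda>a. curvature_chart c u (conn_form c \<rho> u a v) w z
    + curvature_chart c u v (conn_form c \<rho> u a w) z + curvature_chart c u v w (conn_form c \<rho> u a z)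
    - conn_form c \<rho> u a (curvature_chart c u v w z))) (at u)"
proof -
  note C = chart_cutoffD[OF W]
  let ?E = "chart_frame A c \<rho>"
  note E = chart_frame_vf[OF W]
  have ui: "y \<in> chart_image c" if "y \<in> W" for y using C(3) that by blast
  have rep: "vf_rep A c (curvature_op A D (?E v) (?E w) (?E z)) y = curvature_chart c y v w z" if "y \<in> W" for y v w z
    by (simp add: vf_rep_curvature[OF C(1) ui[OF that] E E E] vf_rep_chart_frame[OF W that])
  note T = curvature_op_vf[OF E[of v] E[of w] E[of z]]
  have d: "((\<lambda>u. curvature_chart c u v w z) has_derivative frechet_derivative (vf_rep A c (curvature_op A D (?E v) (?E w) (?E z))) (at u)) (at u)"
    by (rule has_derivative_transform_within_open[OF smooth_on_has_derivative[OF vf_smooth[OF T C(1)] ui[OF u]] C(2) u]) (rule rep)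
  have "frechet_derivative (vf_rep A c (curvature_op A D (?E v) (?E w) (?E z))) (at u) a =
      curvature_chart c u (conn_form c \<rho> u a v) w z + curvature_chart c u v (conn_form c \<rho> u a w) z
      + curvature_chart c u v w (conn_form c \<rho> u a z) - conn_form c \<rho> u a (curvature_chart c u v w z)" for a
  proof -
    have "vf_rep A c (D (?E a) (curvature_op A D (?E v) (?E w) (?E z))) u =
        vf_rep A c (curvature_op A D (D (?E a) (?E v)) (?E w) (?E z) + curvature_op A D (?E v) (D (?E a) (?E w)) (?E z)
          + curvature_op A D (?E v) (?E w) (D (?E a) (?E z))) u"
      by (simp only: D_curvature_op[OF E E E E])
    also have "\<dots> = curvature_chart c u (conn_form c \<rho> u a v) w z + curvature_chart c u v (conn_form c \<rho> u a w) z
        + curvature_chart c u v w (conn_form c \<rho> u a z)"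
      by (simp add: vf_rep_add[OF C(1) ui[OF u]] vf_rep_curvature[OF C(1) ui[OF u]] D_closed E
          vf_rep_chart_frame[OF W u] vf_rep_D_frame[OF W u])
    finally show ?thesis
      unfolding vf_rep_D[OF W u E T] rep[OF u] vf_rep_chart_frame[OF W u] conn_form_apply by (simp add: algebra_simps)
  qed
  then have "frechet_derivative (vf_rep A c (curvature_op A D (?E v) (?E w) (?E z))) (at u) =
    (\<lambda>a. curvature_chart c u (conn_form c \<rho> u a v) w z + curvature_chart c u v (conn_form c \<rho> u a w) z
      + curvature_chart c u v w (conn_form c \<rho> u a z) - conn_form c \<rho> u a (curvature_chart c u v w z))" by (rule ext)
  then show ?thesis using d by (simp only:)
qed

text \<open>When \<open>T(U,V)\<close> is differentiated in a chart, the terms with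
  \<open>U'\<close> and \<open>V'\<close> cancel against those that \<open>\<nabla>T = 0\<close>
  contributes in the arguments of \<open>T\<close>, and \<open>- \<Gamma>(x', T(U,V))\<close>
  remains.\<close>

lemma parallel_along_torsion:
  assumes \<gamma>: "smooth_curve A S \<gamma>" "open S" and U: "parallel_along A D S \<gamma> U" and V: "parallel_along A D S \<gamma> V"
  shows "parallel_along A D S \<gamma> (\<lambda>s. torsion_at (\<gamma> s) (U s) (V s))"
  unfolding parallel_along_def
proof
  fix t assume t: "t \<in> S"
  obtain c W \<rho> where c: "chart_cutoff A c W \<rho>" "\<gamma> t \<in> chart_dom c" "chart_map c (\<gamma> t) \<in> W"
    using chart_cutoff_curve by metis
  note C = chart_cutoffD[OF c(1)]
  let ?x = "\<lambda>s. chart_map c (\<gamma> s)"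
  let ?x' = "vector_derivative ?x (at t)"
  define K where "K = conn_form c \<rho> (?x t) ?x'"
  define u where "u s = to_chart A c (\<gamma> s) (U s)" for s
  define v where "v s = to_chart A c (\<gamma> s) (V s)" for s
  define N where "N = {s \<in> S. \<gamma> s \<in> chart_dom c \<and> ?x s \<in> W}"
  have N: "open N" "t \<in> N" using smooth_curve_chart_open[OF \<gamma> C(1,2)] t c by (auto simp: N_def)
  have xi: "?x s \<in> chart_image c" if "s \<in> N" for s using that by (auto simp: N_def)
  have iff: "((\<lambda>s. to_chart A c (\<gamma> s) (Y s)) has_vector_derivative - K (to_chart A c (\<gamma> t) (Y t))) (at t)"
    if "parallel_along A D S \<gamma> Y" for Y
    using that t unfolding parallel_along_def K_def
    by (simp only: parallel_iff_chart[OF c(1) \<gamma> t c(2,3), symmetric])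
  have du: "(u has_vector_derivative - K (u t)) (at t)" and dv: "(v has_vector_derivative - K (v t)) (at t)"
    using iff[OF U] iff[OF V] by (simp_all only: u_def[abs_def] v_def[abs_def])
  let ?T = "\<lambda>s. torsion_chart c (?x s)"
  have dT: "((\<lambda>s. ?T s a b) has_vector_derivative ?T t (K a) b + ?T t a (K b) - K (?T t a b)) (at t)" for a b
  proof -
    note d = torsion_chart_derivative[OF c(1,3), of a b]
    from has_derivative_compose[OF smooth_curve_derivative[OF \<gamma>(1) C(1) t c(2), unfolded has_vector_derivative_def] d]
    show ?thesis
      using linear_cmul[OF has_derivative_linear[OF d], of _ ?x'] by (simp add: has_vector_derivative_def K_def del: conn_form_apply)
  qed
  have d1: "((\<lambda>s. ?T s a (v s)) has_vector_derivative (?T t (K a) (v t) + ?T t a (K (v t)) - K (?T t a (v t))) + ?T t a (- K (v t))) (at t)" for a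
    by (rule has_vector_derivative_linear_family[OF N linear_torsion_chart(2)[OF C(1) xi] dT dv])
  have "((\<lambda>s. ?T s (u s) (v s)) has_vector_derivative
      ((?T t (K (u t)) (v t) + ?T t (u t) (K (v t)) - K (?T t (u t) (v t))) + ?T t (u t) (- K (v t))) + ?T t (- K (u t)) (v t)) (at t)"
    by (rule has_vector_derivative_linear_family[where L = "\<lambda>s a. ?T s a (v s)", OF N linear_torsion_chart(1)[OF C(1) xi] d1 du])
  then have "((\<lambda>s. ?T s (u s) (v s)) has_vector_derivative - K (?T t (u t) (v t))) (at t)"
    using linear_neg[OF linear_torsion_chart(1)[OF C(1) xi[OF N(2)]], of "K (u t)" "v t"]
      linear_neg[OF linear_torsion_chart(2)[OF C(1) xi[OF N(2)]], of "u t" "K (v t)"] by simp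
  moreover have eq: "?T s (u s) (v s) = to_chart A c (\<gamma> s) (torsion_at (\<gamma> s) (U s) (V s))" if "s \<in> N" for s
    using that C(1) by (simp add: Let_def torsion_chart_def u_def v_def N_def)
  ultimately have "((\<lambda>s. to_chart A c (\<gamma> s) (torsion_at (\<gamma> s) (U s) (V s))) has_vector_derivative
      - K (to_chart A c (\<gamma> t) (torsion_at (\<gamma> t) (U t) (V t)))) (at t)"
    by (intro has_vector_derivative_transform_within_open[OF _ N eq]) (simp_all add: eq[OF N(2)])
  then show "has_cov_deriv_along A D \<gamma> (\<lambda>s. torsion_at (\<gamma> s) (U s) (V s)) 0 t"
    unfolding parallel_iff_chart[OF c(1) \<gamma> t c(2,3)] K_def .
qed

lemma parallel_along_curvature:
  assumes \<gamma>: "smooth_curve A S \<gamma>" "open S" and U: "parallel_along A D S \<gamma> U" and V: "parallel_along A D S \<gamma> V"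
    and Z: "parallel_along A D S \<gamma> Z"
  shows "parallel_along A D S \<gamma> (\<lambda>s. curvature_at (\<gamma> s) (U s) (V s) (Z s))"
  unfolding parallel_along_def
proof
  fix t assume t: "t \<in> S"
  obtain c W \<rho> where c: "chart_cutoff A c W \<rho>" "\<gamma> t \<in> chart_dom c" "chart_map c (\<gamma> t) \<in> W"
    using chart_cutoff_curve by metis
  note C = chart_cutoffD[OF c(1)]
  let ?x = "\<lambda>s. chart_map c (\<gamma> s)"
  let ?x' = "vector_derivative ?x (at t)"
  define K where "K = conn_form c \<rho> (?x t) ?x'"
  define u where "u s = to_chart A c (\<gamma> s) (U s)" for s
  define v where "v s = to_chart A c (\<gamma> s) (V s)" for s
  define z where "z s = to_chart A c (\<gamma> s) (Z s)" for s
  define N where "N = {s \<in> S. \<gamma> s \<in> chart_dom c \<and> ?x s \<in> W}"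
  have N: "open N" "t \<in> N" using smooth_curve_chart_open[OF \<gamma> C(1,2)] t c by (auto simp: N_def)
  have xi: "?x s \<in> chart_image c" if "s \<in> N" for s using that by (auto simp: N_def)
  have iff: "((\<lambda>s. to_chart A c (\<gamma> s) (Y s)) has_vector_derivative - K (to_chart A c (\<gamma> t) (Y t))) (at t)"
    if "parallel_along A D S \<gamma> Y" for Y
    using that t unfolding parallel_along_def K_def
    by (simp only: parallel_iff_chart[OF c(1) \<gamma> t c(2,3), symmetric])
  have du: "(u has_vector_derivative - K (u t)) (at t)" and dv: "(v has_vector_derivative - K (v t)) (at t)"
    and dz: "(z has_vector_derivative - K (z t)) (at t)"
    using iff[OF U] iff[OF V] iff[OF Z] by (simp_all only: u_def[abs_def] v_def[abs_def] z_def[abs_def])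
  let ?R = "\<lambda>s. curvature_chart c (?x s)"
  have dR: "((\<lambda>s. ?R s a b e) has_vector_derivative ?R t (K a) b e + ?R t a (K b) e + ?R t a b (K e) - K (?R t a b e)) (at t)" for a b e
  proof -
    note d = curvature_chart_derivative[OF c(1,3), of a b e]
    from has_derivative_compose[OF smooth_curve_derivative[OF \<gamma>(1) C(1) t c(2), unfolded has_vector_derivative_def] d]
    show ?thesis
      using linear_cmul[OF has_derivative_linear[OF d], of _ ?x'] by (simp add: has_vector_derivative_def K_def del: conn_form_apply)
  qed
  have d1: "((\<lambda>s. ?R s a b (z s)) has_vector_derivative
      (?R t (K a) b (z t) + ?R t a (K b) (z t) + ?R t a b (K (z t)) - K (?R t a b (z t))) + ?R t a b (- K (z t))) (at t)" for a b
    by (rule has_vector_derivative_linear_family[OF N linear_curvature_chart(3)[OF C(1) xi] dR dz])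
  have d2: "((\<lambda>s. ?R s a (v s) (z s)) has_vector_derivative
      ((?R t (K a) (v t) (z t) + ?R t a (K (v t)) (z t) + ?R t a (v t) (K (z t)) - K (?R t a (v t) (z t))) + ?R t a (v t) (- K (z t)))
      + ?R t a (- K (v t)) (z t)) (at t)" for a
    by (rule has_vector_derivative_linear_family[where L = "\<lambda>s b. ?R s a b (z s)", OF N linear_curvature_chart(2)[OF C(1) xi] d1 dv])
  have "((\<lambda>s. ?R s (u s) (v s) (z s)) has_vector_derivative
      (((?R t (K (u t)) (v t) (z t) + ?R t (u t) (K (v t)) (z t) + ?R t (u t) (v t) (K (z t)) - K (?R t (u t) (v t) (z t)))
        + ?R t (u t) (v t) (- K (z t))) + ?R t (u t) (- K (v t)) (z t)) + ?R t (- K (u t)) (v t) (z t)) (at t)"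
    by (rule has_vector_derivative_linear_family[where L = "\<lambda>s a. ?R s a (v s) (z s)", OF N linear_curvature_chart(1)[OF C(1) xi] d2 du])
  then have "((\<lambda>s. ?R s (u s) (v s) (z s)) has_vector_derivative - K (?R t (u t) (v t) (z t))) (at t)"
    using linear_neg[OF linear_curvature_chart(1)[OF C(1) xi[OF N(2)]], of "K (u t)" "v t" "z t"]
      linear_neg[OF linear_curvature_chart(2)[OF C(1) xi[OF N(2)]], of "u t" "K (v t)" "z t"]
      linear_neg[OF linear_curvature_chart(3)[OF C(1) xi[OF N(2)]], of "u t" "v t" "K (z t)"] by simp
  moreover have eq: "?R s (u s) (v s) (z s) = to_chart A c (\<gamma> s) (curvature_at (\<gamma> s) (U s) (V s) (Z s))" if "s \<in> N" for s
    using that C(1) by (simp add: Let_def curvature_chart_def u_def v_def z_def N_def)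
  ultimately have "((\<lambda>s. to_chart A c (\<gamma> s) (curvature_at (\<gamma> s) (U s) (V s) (Z s))) has_vector_derivative
      - K (to_chart A c (\<gamma> t) (curvature_at (\<gamma> t) (U t) (V t) (Z t)))) (at t)"
    by (intro has_vector_derivative_transform_within_open[OF _ N eq]) (simp_all add: eq[OF N(2)])
  then show "has_cov_deriv_along A D \<gamma> (\<lambda>s. curvature_at (\<gamma> s) (U s) (V s) (Z s)) 0 t"
    unfolding parallel_iff_chart[OF c(1) \<gamma> t c(2,3)] K_def .
qed

lemma parallel_transport_torsion:
  assumes "parallel_transport A D p q L"
  shows "L (torsion_at p v w) = torsion_at q (L v) (L w)"
  using assms
proof (induction arbitrary: v w)
  case (concat q L S \<gamma> r K)
  note \<gamma> = concat.hyps(4) concat.hyps(2,3)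
  obtain U V where U: "parallel_along A D S \<gamma> U" "U 0 = L v" "U 1 = K (L v)"
    and V: "parallel_along A D S \<gamma> V" "V 0 = L w" "V 1 = K (L w)"
    using concat.hyps(7) unfolding is_transport_along_def by metis
  from is_transport_alongD[OF concat.hyps(7) \<gamma> parallel_along_torsion[OF \<gamma>(1,2) U(1) V(1)]]
  show ?case using concat.IH concat.hyps(5,6) by (simp add: U V)
qed simp

lemma parallel_transport_curvature:
  assumes "parallel_transport A D p q L"
  shows "L (curvature_at p v w z) = curvature_at q (L v) (L w) (L z)"
  using assms
proof (induction arbitrary: v w z)
  case (concat q L S \<gamma> r K)
  note \<gamma> = concat.hyps(4) concat.hyps(2,3)
  obtain U V Z where U: "parallel_along A D S \<gamma> U" "U 0 = L v" "U 1 = K (L v)"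
    and V: "parallel_along A D S \<gamma> V" "V 0 = L w" "V 1 = K (L w)"
    and Z: "parallel_along A D S \<gamma> Z" "Z 0 = L z" "Z 1 = K (L z)"
    using concat.hyps(7) unfolding is_transport_along_def by metis
  from is_transport_alongD[OF concat.hyps(7) \<gamma> parallel_along_curvature[OF \<gamma>(1,2) U(1) V(1) Z(1)]]
  show ?case using concat.IH concat.hyps(5,6) by (simp add: U V Z)
qed simp

text \<open>The derivative at the identity of the invariance of \<open>T\<close> under the holonomy group.\<close>

lemma holonomy_algebra_torsion:
  assumes B: "B \<in> holonomy_algebra A D p"
  shows "B (torsion_at p v w) = torsion_at p (B v) w + torsion_at p v (B w)"
proof -
  obtain g where g: "g 0 = id_blinfun" "\<And>t. g t \<in> holonomy_group A D p" "(g has_vector_derivative B) (at 0)"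
    using B unfolding holonomy_algebra_def by blast
  have inv: "g t (torsion_at p v w) = torsion_at p (g t v) (g t w)" for t
    using parallel_transport_torsion[of p p "g t"] g(2) by (simp add: holonomy_group_def)
  have gx: "((\<lambda>t. g t x) has_vector_derivative B x) (at 0)" for x
    by (rule bounded_linear.has_vector_derivative[OF blinfun.bounded_linear_left g(3)])
  have 1: "((\<lambda>t. torsion_at p a (g t w)) has_vector_derivative torsion_at p a (B w)) (at 0)" for a
    by (rule bounded_linear.has_vector_derivative[OF _ gx]) (simp add: linear_conv_bounded_linear[symmetric] linear_torsion_at)
  have "((\<lambda>t. torsion_at p (g t v) (g t w)) has_vector_derivative torsion_at p (g 0 v) (B w) + torsion_at p (B v) (g 0 w)) (at 0)"
    by (rule has_vector_derivative_linear_family[where L = "\<lambda>t a. torsion_at p a (g t w)", OF open_UNIV UNIV_I linear_torsion_at(1) 1 gx])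
  then have "((\<lambda>t. g t (torsion_at p v w)) has_vector_derivative torsion_at p v (B w) + torsion_at p (B v) w) (at 0)"
    by (simp add: inv g(1))
  from vector_derivative_unique_at[OF this gx] show ?thesis by (simp add: add.commute)
qed

lemma holonomy_algebra_curvature:
  assumes B: "B \<in> holonomy_algebra A D p"
  shows "B (curvature_at p v w z) = curvature_at p (B v) w z + curvature_at p v (B w) z + curvature_at p v w (B z)"
proof -
  obtain g where g: "g 0 = id_blinfun" "\<And>t. g t \<in> holonomy_group A D p" "(g has_vector_derivative B) (at 0)"
    using B unfolding holonomy_algebra_def by blast
  have inv: "g t (curvature_at p v w z) = curvature_at p (g t v) (g t w) (g t z)" for t
    using parallel_transport_curvature[of p p "g t"] g(2) by (simp add: holonomy_group_def)
  have gx: "((\<lambda>t. g t x) has_vector_derivative B x) (at 0)" for x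
    by (rule bounded_linear.has_vector_derivative[OF blinfun.bounded_linear_left g(3)])
  have 1: "((\<lambda>t. curvature_at p a b (g t z)) has_vector_derivative curvature_at p a b (B z)) (at 0)" for a b
    by (rule bounded_linear.has_vector_derivative[OF _ gx]) (simp add: linear_conv_bounded_linear[symmetric] linear_curvature_at)
  have 2: "((\<lambda>t. curvature_at p a (g t w) (g t z)) has_vector_derivative
      curvature_at p a (g 0 w) (B z) + curvature_at p a (B w) (g 0 z)) (at 0)" for a
    by (rule has_vector_derivative_linear_family[where L = "\<lambda>t b. curvature_at p a b (g t z)", OF open_UNIV UNIV_I linear_curvature_at(2) 1 gx])
  have "((\<lambda>t. curvature_at p (g t v) (g t w) (g t z)) has_vector_derivative
      (curvature_at p (g 0 v) (g 0 w) (B z) + curvature_at p (g 0 v) (B w) (g 0 z)) + curvature_at p (B v) (g 0 w) (g 0 z)) (at 0)"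
    by (rule has_vector_derivative_linear_family[where L = "\<lambda>t a. curvature_at p a (g t w) (g t z)", OF open_UNIV UNIV_I linear_curvature_at(1) 2 gx])
  then have "((\<lambda>t. g t (curvature_at p v w z)) has_vector_derivative
      (curvature_at p v w (B z) + curvature_at p v (B w) z) + curvature_at p (B v) w z) (at 0)"
    by (simp add: inv g(1))
  from vector_derivative_unique_at[OF this gx] show ?thesis by (simp add: algebra_simps)
qed

end

section \<open>The post-Lie algebra\<close>

lemma eq_neg_imp_zero: "x = - x \<Longrightarrow> x = (0 :: 'v::real_vector)"
  by (metis add.right_inverse scaleR_2 scaleR_eq_0_iff zero_neq_numeral)

lemma endo_app_endo_comp: "endo_app (endo_comp E F) X = endo_app E (endo_app F X)"
  by (simp add: endo_app_def endo_comp_def fun_eq_iff)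

lemma endo_app_minus_right: "endo_app E (- X) = - endo_app E X"
  by (simp add: endo_app_def fun_eq_iff blinfun.bilinear_simps)

lemma endo_app_cmul: "endo_app (a *\<^sub>R E) X = a *\<^sub>R endo_app E X" "endo_app E (a *\<^sub>R X) = a *\<^sub>R endo_app E X"
  by (simp_all add: endo_app_def fun_eq_iff scaleR_fun_def blinfun.bilinear_simps)

lemma endo_comp_cmul: "endo_comp (a *\<^sub>R E) F = a *\<^sub>R endo_comp E F" "endo_comp E (a *\<^sub>R F) = a *\<^sub>R endo_comp E F"
  by (auto simp: endo_comp_def fun_eq_iff scaleR_fun_def blinfun.bilinear_simps intro!: blinfun_eqI)

lemma endo_comp_linear:
  "endo_comp (E + E') F = endo_comp E F + endo_comp E' F"
  "endo_comp E (F + F') = endo_comp E F + endo_comp E F'"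
  by (auto simp: endo_comp_def fun_eq_iff blinfun.bilinear_simps intro!: blinfun_eqI)

context smooth_manifold
begin

lemma endo_field_eqI:
  assumes "\<And>Z. Z \<in> vector_fields A \<Longrightarrow> endo_app E Z = endo_app F Z" shows "E = F"
proof
  fix p show "E p = F p" by (rule endo_ext) (simp add: assms)
qed

lemma endo_fields_by_rep:
  assumes g: "\<And>c v. c \<in> A \<Longrightarrow> smooth_on (chart_image c) (g c v)"
    and eq: "\<And>c u v. c \<in> A \<Longrightarrow> u \<in> chart_image c \<Longrightarrow> endo_rep A c E u v = g c v u"
  shows "E \<in> endo_fields A"
proof (rule endo_fieldsI)
  fix p
  let ?c = "chart_at A p"
  have "smooth_on (chart_image ?c) (\<lambda>u. endo_rep A ?c E u v)" for v
    by (subst smooth_on_cong[OF open_image[OF chart_at(1)], where g = "g ?c v"]) (auto intro!: eq g chart_at)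
  then show "\<exists>c W. c \<in> A \<and> open W \<and> p \<in> chart_dom c \<and> chart_map c p \<in> W \<and> (\<forall>v. smooth_on W (\<lambda>u. endo_rep A c E u v))"
    using chart_at open_image by blast
qed

lemma endo_fields_comp:
  assumes "E \<in> endo_fields A" "F \<in> endo_fields A" shows "endo_comp E F \<in> endo_fields A"
proof (rule endo_fields_by_rep[where g = "\<lambda>c v u. endo_rep A c E u (endo_rep A c F u v)"])
  show "smooth_on (chart_image c) (\<lambda>u. endo_rep A c E u (endo_rep A c F u v))" if "c \<in> A" for c v
    by (rule smooth_on_linear_family) (use that in \<open>auto intro!: open_image linear_endo_rep endo_smooth assms\<close>)
qed (simp add: endo_rep_def endo_comp_def Let_def)

lemma subspace_endo_fields: "subspace (endo_fields A)"
  unfolding subspace_def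
proof (intro conjI ballI allI)
  show "0 \<in> endo_fields A"
    by (rule endo_fields_by_rep[where g = "\<lambda>c v u. 0"])
      (auto simp: endo_rep_def Let_def linear_0[OF linear_to_chart] intro!: smooth_on_const open_image)
  show "E + F \<in> endo_fields A" if "E \<in> endo_fields A" "F \<in> endo_fields A" for E F
    by (rule endo_fields_by_rep[where g = "\<lambda>c v u. endo_rep A c E u v + endo_rep A c F u v"])
      (use that in \<open>auto simp: endo_rep_def[of A _ "E + F"] endo_rep_def Let_def linear_add[OF linear_to_chart] blinfun.bilinear_simps
        intro!: smooth_on_add open_image endo_smooth[unfolded endo_rep_def Let_def]\<close>)
  show "a *\<^sub>R E \<in> endo_fields A" if "E \<in> endo_fields A" for a E
    by (rule endo_fields_by_rep[where g = "\<lambda>c v u. a *\<^sub>R endo_rep A c E u v"])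
      (use that in \<open>auto simp: endo_rep_def Let_def linear_cmul[OF linear_to_chart] blinfun.bilinear_simps scaleR_fun_def
        intro!: smooth_on_bounded_linear[OF bounded_linear_scaleR_right] open_image endo_smooth[unfolded endo_rep_def Let_def]\<close>)
qed

end

context affine_connection
begin

lemma subspace_holonomy_fields: "subspace (holonomy_fields A D)"
proof -
  have "(0 :: 'm \<Rightarrow> 'e \<Rightarrow>\<^sub>L 'e) p \<in> holonomy_algebra A D p" for p
    using subspace_0[OF subspace_holonomy_algebra] by simp
  then show ?thesis
    unfolding subspace_def holonomy_fields_def
    using subspace_0[OF subspace_endo_fields] subspace_add[OF subspace_endo_fields] subspace_scale[OF subspace_endo_fields]
      subspace_add[OF subspace_holonomy_algebra] subspace_scale[OF subspace_holonomy_algebra]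
    by (simp add: scaleR_fun_def)
qed

lemma holonomy_fields_commutator:
  assumes "E \<in> holonomy_fields A D" "F \<in> holonomy_fields A D"
  shows "endo_comp E F - endo_comp F E \<in> holonomy_fields A D"
  using assms subspace_diff[OF subspace_endo_fields endo_fields_comp endo_fields_comp] holonomy_algebra_commutator
  by (simp add: holonomy_fields_def endo_comp_def)

lemma holonomy_endo: "E \<in> holonomy_fields A D \<Longrightarrow> E \<in> endo_fields A"
  by (simp add: holonomy_fields_def)

end

context parallel_connection
begin

lemmas torsion_linear =
  tensorial_add[OF tensorial_torsion] tensorial_diff[OF tensorial_torsion] tensorial_minus[OF tensorial_torsion]
  tensorial_add[OF tensorial_torsion'] tensorial_diff[OF tensorial_torsion'] tensorial_minus[OF tensorial_torsion']

lemmas curvature_op_linear =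
  tensorial_add[OF tensorial_curvature_op_left] tensorial_diff[OF tensorial_curvature_op_left] tensorial_minus[OF tensorial_curvature_op_left]
  tensorial_add[OF tensorial_curvature_op_mid] tensorial_diff[OF tensorial_curvature_op_mid] tensorial_minus[OF tensorial_curvature_op_mid]
  tensorial_add[OF tensorial_curvature_op] tensorial_diff[OF tensorial_curvature_op] tensorial_minus[OF tensorial_curvature_op]

lemmas D_linear = D_add_left D_add_right D_diff_left D_diff_right D_minus_left D_minus_right

lemmas endo_linear = endo_app_linear(1-4,6) endo_app_minus_right endo_app_endo_comp endo_app_cov_deriv_endo endo_app_curvature

lemmas field_closed = vf_add vf_minus vf_diff vf_zero D_closed jacobi_bracket_vf endo_app_vf torsion_vf curvature_op_vf
  subspace_add[OF subspace_endo_fields] subspace_diff[OF subspace_endo_fields] subspace_neg[OF subspace_endo_fields]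
  endo_fields_comp curvature_endo_fields cov_deriv_endo_fields holonomy_endo

lemma holonomy_torsion:
  assumes "E \<in> holonomy_fields A D" "X \<in> vector_fields A" "Y \<in> vector_fields A"
  shows "endo_app E (torsion A D X Y) = torsion A D (endo_app E X) Y + torsion A D X (endo_app E Y)"
proof
  fix p
  have "E p \<in> holonomy_algebra A D p" using assms(1) by (simp add: holonomy_fields_def)
  from holonomy_algebra_torsion[OF this, of "X p" "Y p"]
  show "endo_app E (torsion A D X Y) p = (torsion A D (endo_app E X) Y + torsion A D X (endo_app E Y)) p"
    using assms by (simp add: torsion_at field_closed endo_app_apply)
qed

lemma holonomy_curvature:
  assumes "E \<in> holonomy_fields A D" "X \<in> vector_fields A" "Y \<in> vector_fields A" "Z \<in> vector_fields A"
  shows "endo_app E (curvature_op A D X Y Z) =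
    curvature_op A D (endo_app E X) Y Z + curvature_op A D X (endo_app E Y) Z + curvature_op A D X Y (endo_app E Z)"
proof
  fix p
  have "E p \<in> holonomy_algebra A D p" using assms(1) by (simp add: holonomy_fields_def)
  from holonomy_algebra_curvature[OF this, of "X p" "Y p" "Z p"]
  show "endo_app E (curvature_op A D X Y Z) p =
    (curvature_op A D (endo_app E X) Y Z + curvature_op A D X (endo_app E Y) Z + curvature_op A D X Y (endo_app E Z)) p"
    using assms by (simp add: curvature_at field_closed endo_app_apply)
qed

text \<open>In the cyclic sum all terms with \<open>E\<close>, \<open>F\<close>, \<open>G\<close>
  cancel once the derivation property of \<open>E\<close> on \<open>T\<close> is used; what is
  left is the first Bianchi identity.\<close>

lemma ext_bracket_jacobi_vector:
  assumes x: "x \<in> vector_fields A" and y: "y \<in> vector_fields A" and z: "z \<in> vector_fields A"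
    and E: "E \<in> holonomy_fields A D" and F: "F \<in> holonomy_fields A D" and G: "G \<in> holonomy_fields A D"
  shows "fst (ext_bracket A D (x, E) (ext_bracket A D (y, F) (z, G))) + fst (ext_bracket A D (y, F) (ext_bracket A D (z, G) (x, E)))
    + fst (ext_bracket A D (z, G) (ext_bracket A D (x, E) (y, F))) = 0"
proof -
  let ?T = "torsion A D" and ?R = "curvature_op A D"
  let ?S = "\<lambda>x y z E F G. ?R y z x - ?T (?T y z) x - ?T (endo_app F z) x + ?T (endo_app G y) x + ?T (endo_app E y) z - ?T (endo_app E z) y
      + endo_app E (endo_app F z) - endo_app E (endo_app G y) - endo_app F (endo_app G x) + endo_app G (endo_app F x)"
  have *: "fst (ext_bracket A D (x, E) (ext_bracket A D (y, F) (z, G))) = ?S x y z E F G"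
    if "x \<in> vector_fields A" "y \<in> vector_fields A" "z \<in> vector_fields A" "E \<in> holonomy_fields A D"
      "F \<in> holonomy_fields A D" "G \<in> holonomy_fields A D" for x y z E F G
  proof -
    have sk: "?T x (?T y z) = - ?T (?T y z) x" "?T x (endo_app F z) = - ?T (endo_app F z) x"
      "?T x (endo_app G y) = - ?T (endo_app G y) x" "?T y (endo_app E z) = - ?T (endo_app E z) y"
      by (rule torsion_skew)+
    show ?thesis
      using that by (simp add: ext_bracket_def torsion_linear endo_linear field_closed holonomy_torsion sk)
  qed
  have "?S x y z E F G + ?S y z x F G E + ?S z x y G E F =
      (?R x y z + ?R y z x + ?R z x y) - (?T (?T x y) z + ?T (?T y z) x + ?T (?T z x) y)"
    by (simp add: algebra_simps)
  also have "\<dots> = 0" by (simp only: first_bianchi[OF x y z] diff_self)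
  finally show ?thesis
    by (simp only: *[OF x y z E F G] *[OF y z x F G E] *[OF z x y G E F])
qed

text \<open>The same cancellation with the derivation property of \<open>E\<close> on
  \<open>R\<close> leaves the second Bianchi identity. Endomorphism fields are compared through
  their values on vector fields.\<close>

lemma ext_bracket_jacobi_endo:
  assumes x: "x \<in> vector_fields A" and y: "y \<in> vector_fields A" and z: "z \<in> vector_fields A"
    and E: "E \<in> holonomy_fields A D" and F: "F \<in> holonomy_fields A D" and G: "G \<in> holonomy_fields A D"
  shows "snd (ext_bracket A D (x, E) (ext_bracket A D (y, F) (z, G))) + snd (ext_bracket A D (y, F) (ext_bracket A D (z, G) (x, E)))
    + snd (ext_bracket A D (z, G) (ext_bracket A D (x, E) (y, F))) = 0"
proof (rule endo_field_eqI)
  fix v assume v: "v \<in> vector_fields A"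
  let ?T = "torsion A D" and ?R = "curvature_op A D"
  let ?S = "\<lambda>x y z E F G. ?R (?T y z) x v + ?R (endo_app F z) x v - ?R (endo_app G y) x v - ?R (endo_app E y) z v + ?R (endo_app E z) y v
      + endo_app E (endo_app F (endo_app G v)) - endo_app E (endo_app G (endo_app F v))
      - endo_app F (endo_app G (endo_app E v)) + endo_app G (endo_app F (endo_app E v))"
  have *: "endo_app (snd (ext_bracket A D (x, E) (ext_bracket A D (y, F) (z, G)))) v = ?S x y z E F G"
    if "x \<in> vector_fields A" "y \<in> vector_fields A" "z \<in> vector_fields A" "E \<in> holonomy_fields A D"
      "F \<in> holonomy_fields A D" "G \<in> holonomy_fields A D" for x y z E F G
  proof -
    have sk: "?R x (?T y z) v = - ?R (?T y z) x v" "?R x (endo_app F z) v = - ?R (endo_app F z) x v"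
      "?R x (endo_app G y) v = - ?R (endo_app G y) x v" "?R y (endo_app E z) v = - ?R (endo_app E z) y v"
      by (rule curvature_op_skew; use that v in \<open>simp add: field_closed\<close>)+
    show ?thesis
      using that v by (simp add: ext_bracket_def curvature_op_linear endo_linear field_closed holonomy_curvature sk)
  qed
  have "endo_app (snd (ext_bracket A D (x, E) (ext_bracket A D (y, F) (z, G))) + snd (ext_bracket A D (y, F) (ext_bracket A D (z, G) (x, E)))
    + snd (ext_bracket A D (z, G) (ext_bracket A D (x, E) (y, F)))) v = ?S x y z E F G + ?S y z x F G E + ?S z x y G E F"
    by (simp only: endo_app_linear *[OF x y z E F G] *[OF y z x F G E] *[OF z x y G E F])
  also have "\<dots> = ?R (?T x y) z v + ?R (?T y z) x v + ?R (?T z x) y v"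
    by (simp add: algebra_simps)
  also have "\<dots> = endo_app 0 v"
    by (simp only: second_bianchi[OF x y z v]) (simp add: endo_app_def fun_eq_iff)
  finally show "endo_app (snd (ext_bracket A D (x, E) (ext_bracket A D (y, F) (z, G))) + snd (ext_bracket A D (y, F) (ext_bracket A D (z, G) (x, E)))
    + snd (ext_bracket A D (z, G) (ext_bracket A D (x, E) (y, F)))) v = endo_app 0 v" .
qed

text \<open>The part \<open>\<nabla>\<^sub>x\<close> acts by derivations since \<open>T\<close>
  and \<open>R\<close> are parallel, and the part \<open>E\<close> since the holonomy algebra acts
  by derivations of \<open>T\<close> and \<open>R\<close>.\<close>

lemma ext_prod_derivation:
  assumes x: "x \<in> vector_fields A" and y: "y \<in> vector_fields A" and z: "z \<in> vector_fields A"
    and E: "E \<in> holonomy_fields A D" and F: "F \<in> holonomy_fields A D" and G: "G \<in> holonomy_fields A D"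
  shows "ext_prod A D (x, E) (ext_bracket A D (y, F) (z, G)) =
    ext_bracket A D (ext_prod A D (x, E) (y, F)) (z, G) + ext_bracket A D (y, F) (ext_prod A D (x, E) (z, G))"
proof (rule prod_eqI)
  show "fst (ext_prod A D (x, E) (ext_bracket A D (y, F) (z, G))) =
    fst (ext_bracket A D (ext_prod A D (x, E) (y, F)) (z, G) + ext_bracket A D (y, F) (ext_prod A D (x, E) (z, G)))"
    using assms
    by (simp add: ext_prod_def ext_bracket_def torsion_linear endo_linear field_closed holonomy_torsion D_linear D_torsion)
  show "snd (ext_prod A D (x, E) (ext_bracket A D (y, F) (z, G))) =
    snd (ext_bracket A D (ext_prod A D (x, E) (y, F)) (z, G) + ext_bracket A D (y, F) (ext_prod A D (x, E) (z, G)))"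
  proof (rule endo_field_eqI)
    fix v assume v: "v \<in> vector_fields A"
    show "endo_app (snd (ext_prod A D (x, E) (ext_bracket A D (y, F) (z, G)))) v =
      endo_app (snd (ext_bracket A D (ext_prod A D (x, E) (y, F)) (z, G) + ext_bracket A D (y, F) (ext_prod A D (x, E) (z, G)))) v"
      using assms v
      by (simp add: ext_prod_def ext_bracket_def curvature_op_linear endo_linear field_closed holonomy_curvature D_linear D_curvature_op)
  qed
qed

text \<open>By the definition of \<open>T\<close>, subtracting the covariant derivative along
  \<open>T(x,y)\<close> from \<open>R(x,y)\<close> leaves \<open>[\<nabla>\<^sub>x,
  \<nabla>\<^sub>y]\<close> minus the covariant derivative along \<open>\<nabla>\<^sub>x y -
  \<nabla>\<^sub>y x\<close>, and this is the difference of the two associators. The terms with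
  \<open>E\<close> or \<open>F\<close> agree by the Leibniz rule.\<close>

lemma ext_prod_bracket:
  assumes x: "x \<in> vector_fields A" and y: "y \<in> vector_fields A" and z: "z \<in> vector_fields A"
    and E: "E \<in> holonomy_fields A D" and F: "F \<in> holonomy_fields A D" and G: "G \<in> holonomy_fields A D"
  shows "ext_prod A D (ext_bracket A D (x, E) (y, F)) (z, G) =
    associator (ext_prod A D) (x, E) (y, F) (z, G) - associator (ext_prod A D) (y, F) (x, E) (z, G)"
proof (rule prod_eqI)
  have DT: "D (torsion A D x y) v = D (D x y) v - D (D y x) v - D (jacobi_bracket A x y) v" if "v \<in> vector_fields A" for v
    unfolding torsion_def using x y that by (simp add: D_linear field_closed)
  show "fst (ext_prod A D (ext_bracket A D (x, E) (y, F)) (z, G)) =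
    fst (associator (ext_prod A D) (x, E) (y, F) (z, G) - associator (ext_prod A D) (y, F) (x, E) (z, G))"
    using assms
    by (simp add: ext_prod_def ext_bracket_def associator_def endo_linear field_closed D_linear DT curvature_op_def)
  show "snd (ext_prod A D (ext_bracket A D (x, E) (y, F)) (z, G)) =
    snd (associator (ext_prod A D) (x, E) (y, F) (z, G) - associator (ext_prod A D) (y, F) (x, E) (z, G))"
  proof (rule endo_field_eqI)
    fix v assume v: "v \<in> vector_fields A"
    show "endo_app (snd (ext_prod A D (ext_bracket A D (x, E) (y, F)) (z, G))) v =
      endo_app (snd (associator (ext_prod A D) (x, E) (y, F) (z, G) - associator (ext_prod A D) (y, F) (x, E) (z, G))) v"
      using assms v
      by (simp add: ext_prod_def ext_bracket_def associator_def endo_linear field_closed D_linear DT curvature_op_def)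
  qed
qed

lemma cov_deriv_endo_linear:
  assumes X: "X \<in> vector_fields A" and E: "E \<in> endo_fields A"
  shows "X' \<in> vector_fields A \<Longrightarrow> cov_deriv_endo A D (X + X') E = cov_deriv_endo A D X E + cov_deriv_endo A D X' E"
    "F \<in> endo_fields A \<Longrightarrow> cov_deriv_endo A D X (E + F) = cov_deriv_endo A D X E + cov_deriv_endo A D X F"
    "cov_deriv_endo A D (a *\<^sub>R X) E = a *\<^sub>R cov_deriv_endo A D X E"
    "cov_deriv_endo A D X (a *\<^sub>R E) = a *\<^sub>R cov_deriv_endo A D X E"
proof -
  note s = subspace_scale[OF subspace_endo_fields, of _ a]
  show "X' \<in> vector_fields A \<Longrightarrow> cov_deriv_endo A D (X + X') E = cov_deriv_endo A D X E + cov_deriv_endo A D X' E"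
    by (rule endo_field_eqI) (use assms in \<open>simp add: endo_linear field_closed D_linear\<close>)
  show "F \<in> endo_fields A \<Longrightarrow> cov_deriv_endo A D X (E + F) = cov_deriv_endo A D X E + cov_deriv_endo A D X F"
    by (rule endo_field_eqI) (use assms in \<open>simp add: endo_linear field_closed D_linear\<close>)
  show "cov_deriv_endo A D (a *\<^sub>R X) E = a *\<^sub>R cov_deriv_endo A D X E"
    by (rule endo_field_eqI) (use assms in \<open>simp add: endo_linear endo_app_cmul field_closed vf_cmul D_cmul_left scaleR_diff_right\<close>)
  show "cov_deriv_endo A D X (a *\<^sub>R E) = a *\<^sub>R cov_deriv_endo A D X E"
    by (rule endo_field_eqI) (use assms in \<open>simp add: endo_linear endo_app_cmul field_closed s D_cmul_right scaleR_diff_right\<close>)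
qed

lemma ext_fields_iff: "(x, E) \<in> ext_fields A D \<longleftrightarrow> x \<in> vector_fields A \<and> E \<in> holonomy_fields A D"
  by (simp add: ext_fields_def)

lemma subspace_ext_fields: "subspace (ext_fields A D)"
  unfolding ext_fields_def by (rule subspace_Times[OF subspace_vector_fields subspace_holonomy_fields])

lemma bilinear_onI:
  assumes "\<And>x E y F. (x, E) \<in> V \<Longrightarrow> (y, F) \<in> V \<Longrightarrow> f (x, E) (y, F) \<in> V"
    and "\<And>x E y F z G. (x, E) \<in> V \<Longrightarrow> (y, F) \<in> V \<Longrightarrow> (z, G) \<in> V \<Longrightarrow>
      f (x + y, E + F) (z, G) = f (x, E) (z, G) + f (y, F) (z, G) \<and> f (z, G) (x + y, E + F) = f (z, G) (x, E) + f (z, G) (y, F)"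
    and "\<And>x E y F a. (x, E) \<in> V \<Longrightarrow> (y, F) \<in> V \<Longrightarrow>
      f (a *\<^sub>R x, a *\<^sub>R E) (y, F) = a *\<^sub>R f (x, E) (y, F) \<and> f (x, E) (a *\<^sub>R y, a *\<^sub>R F) = a *\<^sub>R f (x, E) (y, F)"
  shows "bilinear_on V f"
  unfolding bilinear_on_def using assms by (auto simp: split_paired_all)

lemma bilinear_ext_bracket: "bilinear_on (ext_fields A D) (ext_bracket A D)"
proof (rule bilinear_onI)
  note hf = subspace_add[OF subspace_holonomy_fields] subspace_diff[OF subspace_holonomy_fields]
  fix x E y F assume "(x, E) \<in> ext_fields A D" "(y, F) \<in> ext_fields A D"
  then have xy: "x \<in> vector_fields A" "E \<in> holonomy_fields A D" "y \<in> vector_fields A" "F \<in> holonomy_fields A D"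
    by (auto simp: ext_fields_iff)
  have "curvature A D x y + (endo_comp F E - endo_comp E F) \<in> holonomy_fields A D"
    using xy by (intro hf(1) curvature_holonomy_fields holonomy_fields_commutator)
  then show "ext_bracket A D (x, E) (y, F) \<in> ext_fields A D"
    using xy by (simp add: ext_bracket_def ext_fields_iff field_closed algebra_simps)
  note ts = tensorial_scale[OF tensorial_torsion] tensorial_scale[OF tensorial_torsion']
    tensorial_scale[OF tensorial_curvature(1)] tensorial_scale[OF tensorial_curvature(2)]
  show "ext_bracket A D (a *\<^sub>R x, a *\<^sub>R E) (y, F) = a *\<^sub>R ext_bracket A D (x, E) (y, F) \<and>
      ext_bracket A D (x, E) (a *\<^sub>R y, a *\<^sub>R F) = a *\<^sub>R ext_bracket A D (x, E) (y, F)" for a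
    using xy by (simp add: ext_bracket_def ts endo_app_cmul endo_comp_cmul scaleR_add_right scaleR_diff_right)
next
  fix x E y F z G assume "(x, E) \<in> ext_fields A D" "(y, F) \<in> ext_fields A D" "(z, G) \<in> ext_fields A D"
  then have xy: "x \<in> vector_fields A" "E \<in> holonomy_fields A D" "y \<in> vector_fields A" "F \<in> holonomy_fields A D"
    "z \<in> vector_fields A" "G \<in> holonomy_fields A D"
    by (auto simp: ext_fields_iff)
  note ta = tensorial_add[OF tensorial_curvature(1)] tensorial_add[OF tensorial_curvature(2)]
  show "ext_bracket A D (x + y, E + F) (z, G) = ext_bracket A D (x, E) (z, G) + ext_bracket A D (y, F) (z, G) \<and>
      ext_bracket A D (z, G) (x + y, E + F) = ext_bracket A D (z, G) (x, E) + ext_bracket A D (z, G) (y, F)"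
    using xy by (simp add: ext_bracket_def torsion_linear ta endo_app_linear(1,3) endo_comp_linear)
qed

lemma bilinear_ext_prod: "bilinear_on (ext_fields A D) (ext_prod A D)"
proof (rule bilinear_onI)
  fix x E y F assume "(x, E) \<in> ext_fields A D" "(y, F) \<in> ext_fields A D"
  then have xy: "x \<in> vector_fields A" "E \<in> holonomy_fields A D" "y \<in> vector_fields A" "F \<in> holonomy_fields A D"
    by (auto simp: ext_fields_iff)
  have "cov_deriv_endo A D x F + (endo_comp E F - endo_comp F E) \<in> holonomy_fields A D"
    using xy by (intro subspace_add[OF subspace_holonomy_fields] cov_deriv_holonomy_fields holonomy_fields_commutator)
  then show "ext_prod A D (x, E) (y, F) \<in> ext_fields A D"
    using xy by (simp add: ext_prod_def ext_fields_iff field_closed algebra_simps)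
  show "ext_prod A D (a *\<^sub>R x, a *\<^sub>R E) (y, F) = a *\<^sub>R ext_prod A D (x, E) (y, F) \<and>
      ext_prod A D (x, E) (a *\<^sub>R y, a *\<^sub>R F) = a *\<^sub>R ext_prod A D (x, E) (y, F)" for a
    using xy by (simp add: ext_prod_def D_cmul_left D_cmul_right holonomy_endo cov_deriv_endo_linear(3,4) endo_app_cmul endo_comp_cmul
        scaleR_add_right scaleR_diff_right)
next
  fix x E y F z G assume "(x, E) \<in> ext_fields A D" "(y, F) \<in> ext_fields A D" "(z, G) \<in> ext_fields A D"
  then have xy: "x \<in> vector_fields A" "E \<in> holonomy_fields A D" "y \<in> vector_fields A" "F \<in> holonomy_fields A D"
    "z \<in> vector_fields A" "G \<in> holonomy_fields A D"
    by (auto simp: ext_fields_iff)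
  show "ext_prod A D (x + y, E + F) (z, G) = ext_prod A D (x, E) (z, G) + ext_prod A D (y, F) (z, G) \<and>
      ext_prod A D (z, G) (x + y, E + F) = ext_prod A D (z, G) (x, E) + ext_prod A D (z, G) (y, F)"
    using xy by (simp add: ext_prod_def D_linear holonomy_endo cov_deriv_endo_linear(1,2) endo_app_linear(1,3) endo_comp_linear)
qed

lemma ext_bracket_alternating:
  assumes "x \<in> vector_fields A" shows "ext_bracket A D (x, E) (x, E) = 0"
proof -
  have "torsion A D x x = 0" by (rule eq_neg_imp_zero[OF torsion_skew])
  moreover have "curvature A D x x = 0" by (rule eq_neg_imp_zero[OF curvature_skew[OF assms assms]])
  ultimately show ?thesis by (simp add: ext_bracket_def zero_prod_def)
qed

lemma post_lie_algebra_ext_fields: "post_lie_algebra (ext_fields A D) (ext_bracket A D) (ext_prod A D)"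
proof
  fix X Y Z assume "X \<in> ext_fields A D" "Y \<in> ext_fields A D" "Z \<in> ext_fields A D"
  moreover obtain x E y F z G where [simp]: "X = (x, E)" "Y = (y, F)" "Z = (z, G)" by (metis surj_pair)
  ultimately have xyz: "x \<in> vector_fields A" "y \<in> vector_fields A" "z \<in> vector_fields A"
    "E \<in> holonomy_fields A D" "F \<in> holonomy_fields A D" "G \<in> holonomy_fields A D"
    by (auto simp: ext_fields_iff)
  show "ext_bracket A D X (ext_bracket A D Y Z) + ext_bracket A D Y (ext_bracket A D Z X) + ext_bracket A D Z (ext_bracket A D X Y) = 0"
    using ext_bracket_jacobi_vector[OF xyz] ext_bracket_jacobi_endo[OF xyz] by (intro prod_eqI) (simp_all only: fst_add snd_add fst_zero snd_zero \<open>X = _\<close> \<open>Y = _\<close> \<open>Z = _\<close>)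
  show "ext_prod A D X (ext_bracket A D Y Z) = ext_bracket A D (ext_prod A D X Y) Z + ext_bracket A D Y (ext_prod A D X Z)"
    using ext_prod_derivation[OF xyz] by simp
  show "ext_prod A D (ext_bracket A D X Y) Z = associator (ext_prod A D) X Y Z - associator (ext_prod A D) Y X Z"
    using ext_prod_bracket[OF xyz] by simp
next
  fix X assume "X \<in> ext_fields A D"
  then show "ext_bracket A D X X = 0" using ext_bracket_alternating by (cases X) (simp add: ext_fields_iff)
qed (rule subspace_ext_fields bilinear_ext_bracket bilinear_ext_prod)+

end

theorem theorem1p1:
  fixes A :: "('m::{t2_space, second_countable_topology}, 'e::euclidean_space) chart set"
    and D :: "('m \<Rightarrow> 'e) \<Rightarrow> ('m \<Rightarrow> 'e) \<Rightarrow> 'm \<Rightarrow> 'e"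
  assumes "affine_connection A D"
    and "connected (UNIV :: 'm set)"
    and "curvature_parallel A D"
    and "torsion_parallel A D"
  shows "post_lie_algebra (ext_fields A D) (ext_bracket A D) (ext_prod A D)"
proof -
  interpret affine_connection A D by (rule assms(1))
  interpret parallel_connection A D by standard (rule assms(3,4))+
  show ?thesis by (rule post_lie_algebra_ext_fields)
qed

end
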